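(* Let $\Bbbk$ be a field. There exists a twisted composition, i.e. dg functors $$M=M_{C,D,E}\colon\mathcal{C}oh_{\mathrm{dg}}(D,E)\,\widetilde\otimes\,\mathcal{C}oh_{\mathrm{dg}}(C,D)\to\mathcal{C}oh_{\mathrm{dg}}(C,E)$$ for all small dg categories $C,D,E$ over $\Bbbk$ (namely the one described in the context), which is associative in the following sense: for all small dg categories $A,B,C,D$ over $\Bbbk$, the two dg functors $$\big(\mathcal{C}oh_{\mathrm{dg}}(C,D)\widetilde\otimes\mathcal{C}oh_{\mathrm{dg}}(B,C)\big)\widetilde\otimes\mathcal{C}oh_{\mathrm{dg}}(A,B)\to\mathcal{C}oh_{\mathrm{dg}}(A,D)$$ given by $M_{A,B,D}\circ(M_{B,C,D}\widetilde\otimes\mathrm{id})$ and by $M_{A,C,D}\circ(\mathrm{id}\widetilde\otimes M_{A,B,C})\circ\alpha$ are equal, where $\alpha$ is the associativity map for the three dg categories $\mathcal{C}oh_{\mathrm{dg}}(C,D)$, $\mathcal{C}oh_{\mathrm{dg}}(B,C)$, $\mathcal{C}oh_{\mathrm{dg}}(A,B)$.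
   Context: $|x|$ denotes the degree of $x$. **Twisted tensor product.** For small dg categories $C,D$ over $\Bbbk$, $C\widetilde\otimes D$ is the dg category with objects $\mathrm{Ob}(C)\times\mathrm{Ob}(D)$. As a graded $\Bbbk$-linear category (composition $\star$) it is generated by $f\otimes\mathrm{id}_d$ ($f$ a morphism of $C$, $d\in D$), $\mathrm{id}_c\otimes g$ ($c\in C$, $g$ a morphism of $D$) and, for $n\ge1$, a morphism $f\colon c_0\to c_1$ of $C$ and a chain $d_0\xrightarrow{g_1}d_1\to\dots\xrightarrow{g_n}d_n$ in $D$, new morphisms $\varepsilon(f;g_1,\dots,g_n)\colon(c_0,d_0)\to(c_1,d_n)$ of degree $-n+|f|+\sum_j|g_j|$, subject to: (R1) $(\mathrm{id}_c\otimes g_1)\star(\mathrm{id}_c\otimes g_2)=\mathrm{id}_c\otimes(g_1g_2)$, $(f_1\otimes\mathrm{id}_d)\star(f_2\otimes\mathrm{id}_d)=(f_1f_2)\otimes\mathrm{id}_d$; (R2) $\varepsilon(f;g_1,\dots,g_n)$ is linear in each argument; (R3) for $n\ge1$, $\varepsilon(f;g_1,\dots,g_n)=0$ if $f$ or some $g_i$ is an identity morphism; (R4) $$\varepsilon(f_2f_1;g_1,\dots,g_N)=\sum_{0\le m\le N}(-1)^{|f_1|(\sum_{j=m+1}^N|g_j|+N-m)}\varepsilon(f_2;g_{m+1},\dots,g_N)\star\varepsilon(f_1;g_1,\dots,g_m),$$ where $\varepsilon(f;\varnothing)$ is read as $f\otimes\mathrm{id}$. The differential is the given one on $C\otimes\mathrm{id}_d$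 and $\mathrm{id}_c\otimes D$; for $n=1$ it is determined by $$-d\varepsilon(f;g)+\varepsilon(df;g)+(-1)^{|f|}\varepsilon(f;dg)=(-1)^{|f||g|}(\mathrm{id}_{c_1}\otimes g)\star(f\otimes\mathrm{id}_{d_0})-(f\otimes\mathrm{id}_{d_1})\star(\mathrm{id}_{c_0}\otimes g),$$ and for $n\ge2$ by $$\varepsilon(df;g_1,\dots,g_n)=d\varepsilon(f;g_1,\dots,g_n)-\sum_{j=1}^n(-1)^{|f|+|g_n|+\dots+|g_{j+1}|+n-j}\varepsilon(f;g_1,\dots,dg_j,\dots,g_n)+(-1)^{|f|+n-1}\Big[(-1)^{|f||g_n|+|f|}(\mathrm{id}_{c_1}\otimes g_n)\star\varepsilon(f;g_1,\dots,g_{n-1})$$ $$+(-1)^{|f|+\sum_{i=2}^n(|g_i|+1)+1}\varepsilon(f;g_2,\dots,g_n)\star(\mathrm{id}_{c_0}\otimes g_1)+\sum_{i=1}^{n-1}(-1)^{|f|+\sum_{j=i+1}^n(|g_j|+1)}\varepsilon(f;g_1,\dots,g_{i+1}g_i,\dots,g_n)\Big].$$ It is functorial in both arguments. **Associativity map.** $\alpha_{C,D,E}\colon(C\widetilde\otimes D)\widetilde\otimes E\to C\widetilde\otimes(D\widetilde\otimes E)$ is the dg functor, natural in $C,D,E$, that is the identity on objects and satisfies: $(f\otimes\mathrm{id}_Y)\otimes\mathrm{id}_Z\mapsto f\otimes(\mathrm{id}_Y\otimes\mathrm{id}_Z)$; $(\mathrm{id}_X\otimes g)\otimes\mathrm{id}_Z\mapsto\mathrm{id}_X\otimes(g\otimes\mathrm{id}_Z)$;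 $(\mathrm{id}_X\otimes\mathrm{id}_Y)\otimes h\mapsto\mathrm{id}_X\otimes(\mathrm{id}_Y\otimes h)$; $\varepsilon(f;g_1,\dots,g_k)\otimes\mathrm{id}_Z\mapsto\varepsilon(f;g_1\otimes\mathrm{id}_Z,\dots,g_k\otimes\mathrm{id}_Z)$; $\varepsilon(f\otimes\mathrm{id}_Y;h_1,\dots,h_N)\mapsto\varepsilon(f;\mathrm{id}_Y\otimes h_1,\dots,\mathrm{id}_Y\otimes h_N)$; $\varepsilon(\mathrm{id}_X\otimes g;h_1,\dots,h_N)\mapsto\mathrm{id}_X\otimes\varepsilon(g;h_1,\dots,h_N)$; and $\varepsilon(\varepsilon(f;g_1,\dots,g_k);h_1,\dots,h_N)$ is sent to $$\sum_{0\le i_1\le j_1\le i_2\le j_2\le\dots\le j_k\le N}(-1)^{\sum_{\ell=1}^k|g_\ell|\cdot\sum_{s\le i_\ell}(|h_s|-1)}\varepsilon\big(f;h_1,\dots,h_{i_1},\varepsilon(g_1;h_{i_1+1},\dots,h_{j_1}),h_{j_1+1},\dots,h_{i_2},\varepsilon(g_2;h_{i_2+1},\dots,h_{j_2}),h_{j_2+1},\dots\big),$$ where for $j_\ell=i_\ell$ the term $\varepsilon(g_\ell;h_{i_\ell+1},\dots,h_{j_\ell})$ is replaced by $g_\ell\otimes\mathrm{id}$, and a bare argument $h_s$ on the right means $\mathrm{id}_Y\otimes h_s$ for the corresponding object $Y$ of $D$. Here $f,g,h$ (with indices) are morphisms and $X,Y,Z$ objects of $C,D,E$ respectively. **Coherent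 natural transformations.** $\mathcal{C}oh_{\mathrm{dg}}(C,D)$ is the dg category whose objects are dg functors $C\to D$ and whose morphism complex from $F$ to $G$ is the complex of reduced Hochschild cochains (vanishing when an argument is an identity), the product over $n\ge0$ and $X_0,\dots,X_n\in C$ of $\underline{\mathrm{Hom}}_\Bbbk(C(X_{n-1},X_n)\otimes\dots\otimes C(X_0,X_1),D(F(X_0),G(X_n)))$. A cochain $\Psi$ with $n$ arguments and degree $|\Psi|_0$ as a linear map has total degree $|\Psi|=|\Psi|_0+n$. The differential is $\delta_{\mathrm{tot}}\Psi=(-1)^{|\Psi|_0}\delta\Psi+\delta_{\mathrm{dg}}\Psi$ with $$\delta_{\mathrm{dg}}(\Psi)(f_n,\dots,f_1)=d(\Psi(f_n,\dots,f_1))-\sum_{i=1}^n(-1)^{|\Psi|+|f_n|+\dots+|f_{i+1}|+n-i}\Psi(f_n,\dots,df_i,\dots,f_1),$$ $$(\delta\Psi)(f_n,\dots,f_1)=(-1)^{|\Psi||f_n|+|\Psi|}G(f_n)\circ\Psi(f_{n-1},\dots,f_1)+(-1)^{|\Psi|+1+\sum_{i=2}^n(|f_i|+1)}\Psi(f_n,\dots,f_2)\circ F(f_1)+\sum_{i=1}^{n-1}(-1)^{|\Psi|+\sum_{j=i+1}^n(|f_j|+1)}\Psi(f_n,\dots,f_{i+1}f_i,\dots,f_1)$$ (in the last formula $\Psi$ has $n-1$ arguments). The composition of $\Psi_1$ with $m$ arguments and $\Psi_2$ with $n$ arguments is $$(\Psi_2\circ_v\Psi_1)(f_{m+n},\dots,f_1)=(-1)^{(\sum_{i=m+1}^{m+n}|f_i|+n)|\Psi_1|}\Psi_2(f_{m+n},\dots,f_{m+1})\circ\Psi_1(f_m,\dots,f_1).$$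 **Twisted composition.** There is a natural bijection $\mathrm{Fun}_{\mathrm{dg}}(C\widetilde\otimes D,E)\cong\mathrm{Fun}_{\mathrm{dg}}(C,\mathcal{C}oh_{\mathrm{dg}}(D,E))$ on sets of dg functors. Let $e\colon\mathcal{C}oh_{\mathrm{dg}}(C,D)\widetilde\otimes C\to D$ be the dg functor corresponding to the identity of $\mathcal{C}oh_{\mathrm{dg}}(C,D)$: $(F,c)\mapsto F(c)$, $\Psi\otimes\mathrm{id}_c\mapsto\Psi_0(c)$, $\mathrm{id}_F\otimes f\mapsto F(f)$, $\varepsilon(\Psi;f_1,\dots,f_n)\mapsto\Psi_n(f_n\otimes\dots\otimes f_1)$, where $\Psi_n$ is the component of $\Psi$ with $n$ arguments. The twisted composition $M_{C,D,E}$ is the dg functor corresponding under this bijection to the composite $$(\mathcal{C}oh_{\mathrm{dg}}(D,E)\widetilde\otimes\mathcal{C}oh_{\mathrm{dg}}(C,D))\widetilde\otimes C\xrightarrow{\alpha}\mathcal{C}oh_{\mathrm{dg}}(D,E)\widetilde\otimes(\mathcal{C}oh_{\mathrm{dg}}(C,D)\widetilde\otimes C)\xrightarrow{\mathrm{id}\widetilde\otimes e}\mathcal{C}oh_{\mathrm{dg}}(D,E)\widetilde\otimes D\xrightarrow{e}E.$$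
   Formalization: Signs inconsistent in characteristic ≠ 2 are corrected: δ_tot = δ + δ_dg with the df_i-sum added; in dε(f;g_1,…,g_n), n≥1, the dg_j-sum changes sign and the bracket's factor (-1)^{|f|+n-1} is dropped; α's exponent becomes Σ(|g_ℓ|-1)Σ_{s>j_ℓ}(|h_s|-1). *)

theory Defs
  imports Main "HOL-Library.FuncSet"
begin

section \<open>Small dg categories and dg functors\<close>

text \<open>
  The ground field is a type \<open>'k\<close> of class \<open>field\<close>.  A complex of morphisms is
  given by its family of homogeneous components, so an arrow is always homogeneous and
  carries its source, target and degree; in particular every triple (source, target, degree)
  has its own zero arrow.  \<open>cmp C g f\<close> is \<open>g \<circ> f\<close>.  Differentials have degree \<open>+1\<close>
  and satisfy \<open>d(g \<circ> f) = dg \<circ> f + (-1)^|g| g \<circ> df\<close>.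
\<close>

record ('k, 'o, 'm) dgcat =
  Obj :: "'o set"
  Arr :: "'m set"
  dom :: "'m \<Rightarrow> 'o"
  cod :: "'m \<Rightarrow> 'o"
  deg :: "'m \<Rightarrow> int"
  idn :: "'o \<Rightarrow> 'm"
  cmp :: "'m \<Rightarrow> 'm \<Rightarrow> 'm"
  zer :: "'o \<Rightarrow> 'o \<Rightarrow> int \<Rightarrow> 'm"
  add :: "'m \<Rightarrow> 'm \<Rightarrow> 'm"
  scl :: "'k \<Rightarrow> 'm \<Rightarrow> 'm"
  dif :: "'m \<Rightarrow> 'm"

definition Hom :: "('k, 'o, 'm) dgcat \<Rightarrow> 'o \<Rightarrow> 'o \<Rightarrow> int \<Rightarrow> 'm set" where
  "Hom C x y n = {f \<in> Arr C. dom C f = x \<and> cod C f = y \<and> deg C f = n}"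

abbreviation sscl :: "('k::field, 'o, 'm) dgcat \<Rightarrow> int \<Rightarrow> 'm \<Rightarrow> 'm" where
  "sscl C n f \<equiv> scl C ((-1) powi n) f"

locale dg_category =
  fixes C :: "('k::field, 'o, 'm) dgcat"
  assumes dom_Obj: "f \<in> Arr C \<Longrightarrow> dom C f \<in> Obj C"
    and cod_Obj: "f \<in> Arr C \<Longrightarrow> cod C f \<in> Obj C"
    \<comment> \<open>every homogeneous component is a vector space\<close>
    and zer_Hom: "\<lbrakk>x \<in> Obj C; y \<in> Obj C\<rbrakk> \<Longrightarrow> zer C x y n \<in> Hom C x y n"
    and add_Hom: "\<lbrakk>f \<in> Hom C x y n; g \<in> Hom C x y n\<rbrakk> \<Longrightarrow> add C f g \<in> Hom C x y n"
    and scl_Hom: "f \<in> Hom C x y n \<Longrightarrow> scl C a f \<in> Hom C x y n"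
    and add_assoc: "\<lbrakk>f \<in> Hom C x y n; g \<in> Hom C x y n; h \<in> Hom C x y n\<rbrakk>
          \<Longrightarrow> add C (add C f g) h = add C f (add C g h)"
    and add_comm: "\<lbrakk>f \<in> Hom C x y n; g \<in> Hom C x y n\<rbrakk> \<Longrightarrow> add C f g = add C g f"
    and add_zer: "f \<in> Hom C x y n \<Longrightarrow> add C f (zer C x y n) = f"
    and add_neg: "f \<in> Hom C x y n \<Longrightarrow> add C f (scl C (-1) f) = zer C x y n"
    and scl_one: "f \<in> Arr C \<Longrightarrow> scl C 1 f = f"
    and scl_scl: "f \<in> Arr C \<Longrightarrow> scl C a (scl C b f) = scl C (a * b) f"
    and scl_add: "\<lbrakk>f \<in> Hom C x y n; g \<in> Hom C x y n\<rbrakk>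
          \<Longrightarrow> scl C a (add C f g) = add C (scl C a f) (scl C a g)"
    and add_scl: "f \<in> Arr C \<Longrightarrow> scl C (a + b) f = add C (scl C a f) (scl C b f)"
    \<comment> \<open>graded linear category\<close>
    and idn_Hom: "x \<in> Obj C \<Longrightarrow> idn C x \<in> Hom C x x 0"
    and cmp_Hom: "\<lbrakk>g \<in> Hom C y z m; f \<in> Hom C x y n\<rbrakk> \<Longrightarrow> cmp C g f \<in> Hom C x z (m + n)"
    and cmp_add_left: "\<lbrakk>g \<in> Hom C y z m; g' \<in> Hom C y z m; f \<in> Hom C x y n\<rbrakk>
          \<Longrightarrow> cmp C (add C g g') f = add C (cmp C g f) (cmp C g' f)"
    and cmp_add_right: "\<lbrakk>g \<in> Hom C y z m; f \<in> Hom C x y n; f' \<in> Hom C x y n\<rbrakk>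
          \<Longrightarrow> cmp C g (add C f f') = add C (cmp C g f) (cmp C g f')"
    and cmp_scl_left: "\<lbrakk>g \<in> Hom C y z m; f \<in> Hom C x y n\<rbrakk>
          \<Longrightarrow> cmp C (scl C a g) f = scl C a (cmp C g f)"
    and cmp_scl_right: "\<lbrakk>g \<in> Hom C y z m; f \<in> Hom C x y n\<rbrakk>
          \<Longrightarrow> cmp C g (scl C a f) = scl C a (cmp C g f)"
    and cmp_assoc: "\<lbrakk>h \<in> Hom C z w l; g \<in> Hom C y z m; f \<in> Hom C x y n\<rbrakk>
          \<Longrightarrow> cmp C (cmp C h g) f = cmp C h (cmp C g f)"
    and cmp_idn_left: "f \<in> Hom C x y n \<Longrightarrow> cmp C (idn C y) f = f"
    and cmp_idn_right: "f \<in> Hom C x y n \<Longrightarrow> cmp C f (idn C x) = f"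
    \<comment> \<open>differential\<close>
    and dif_Hom: "f \<in> Hom C x y n \<Longrightarrow> dif C f \<in> Hom C x y (n + 1)"
    and dif_add: "\<lbrakk>f \<in> Hom C x y n; g \<in> Hom C x y n\<rbrakk>
          \<Longrightarrow> dif C (add C f g) = add C (dif C f) (dif C g)"
    and dif_scl: "f \<in> Hom C x y n \<Longrightarrow> dif C (scl C a f) = scl C a (dif C f)"
    and dif_dif: "f \<in> Hom C x y n \<Longrightarrow> dif C (dif C f) = zer C x y (n + 2)"
    and dif_cmp: "\<lbrakk>g \<in> Hom C y z m; f \<in> Hom C x y n\<rbrakk>
          \<Longrightarrow> dif C (cmp C g f) = add C (cmp C (dif C g) f) (sscl C m (cmp C g (dif C f)))"

text \<open>
  Functors are required to be undefined outside the objects and arrows of the source, so that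
  equality of functors is equality of the records.
\<close>

record ('o, 'm, 'p, 'q) dgfun =
  fobj :: "'o \<Rightarrow> 'p"
  farr :: "'m \<Rightarrow> 'q"

locale dg_functor = source: dg_category C + target: dg_category D
  for C :: "('k::field, 'o, 'm) dgcat" and D :: "('k, 'p, 'q) dgcat" +
  fixes F :: "('o, 'm, 'p, 'q) dgfun"
  assumes fobj_Obj: "fobj F \<in> Obj C \<rightarrow>\<^sub>E Obj D"
    and farr_ext: "farr F \<in> extensional (Arr C)"
    and farr_Hom: "f \<in> Hom C x y n \<Longrightarrow> farr F f \<in> Hom D (fobj F x) (fobj F y) n"
    and farr_add: "\<lbrakk>f \<in> Hom C x y n; g \<in> Hom C x y n\<rbrakk>
          \<Longrightarrow> farr F (add C f g) = add D (farr F f) (farr F g)"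
    and farr_scl: "f \<in> Arr C \<Longrightarrow> farr F (scl C a f) = scl D a (farr F f)"
    and farr_idn: "x \<in> Obj C \<Longrightarrow> farr F (idn C x) = idn D (fobj F x)"
    and farr_cmp: "\<lbrakk>g \<in> Hom C y z m; f \<in> Hom C x y n\<rbrakk>
          \<Longrightarrow> farr F (cmp C g f) = cmp D (farr F g) (farr F f)"
    and farr_dif: "f \<in> Arr C \<Longrightarrow> farr F (dif C f) = dif D (farr F f)"

definition fun_id :: "('k, 'o, 'm) dgcat \<Rightarrow> ('o, 'm, 'o, 'm) dgfun" where
  "fun_id C = \<lparr>fobj = (\<lambda>x\<in>Obj C. x), farr = (\<lambda>f\<in>Arr C. f)\<rparr>"

text \<open>\<open>fun_comp C G F\<close> is \<open>G \<circ> F\<close>, where \<open>C\<close> is the source of \<open>F\<close>.\<close>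

definition fun_comp :: "('k, 'o, 'm) dgcat \<Rightarrow> ('p, 'q, 'r, 's) dgfun \<Rightarrow> ('o, 'm, 'p, 'q) dgfun
    \<Rightarrow> ('o, 'm, 'r, 's) dgfun" where
  "fun_comp C G F =
     \<lparr>fobj = compose (Obj C) (fobj G) (fobj F), farr = compose (Arr C) (farr G) (farr F)\<rparr>"

definition dsum :: "('k, 'o, 'm) dgcat \<Rightarrow> 'o \<Rightarrow> 'o \<Rightarrow> int \<Rightarrow> 'm list \<Rightarrow> 'm" where
  "dsum C x y n fs = foldr (add C) fs (zer C x y n)"

section \<open>Chains of arrows\<close>

text \<open>
  A chain \<open>x = x\<^sub>0 \<rightarrow> x\<^sub>1 \<rightarrow> \<dots> \<rightarrow> x\<^sub>n\<close> with arrows \<open>f\<^sub>1, \<dots>, f\<^sub>n\<close> is the pair of its initial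
  object \<open>x\<close> and the list \<open>[f\<^sub>1, \<dots>, f\<^sub>n]\<close>, which is empty for \<open>n = 0\<close>.
\<close>

fun is_path :: "('k, 'o, 'm) dgcat \<Rightarrow> 'o \<Rightarrow> 'm list \<Rightarrow> bool" where
  "is_path C x [] \<longleftrightarrow> x \<in> Obj C"
| "is_path C x (f # fs) \<longleftrightarrow> f \<in> Arr C \<and> dom C f = x \<and> is_path C (cod C f) fs"

fun path_end :: "('k, 'o, 'm) dgcat \<Rightarrow> 'o \<Rightarrow> 'm list \<Rightarrow> 'o" where
  "path_end C x [] = x"
| "path_end C x (f # fs) = path_end C (cod C f) fs"

text \<open>
  The shifted degree \<open>|f\<^sub>1| + \<dots> + |f\<^sub>n| - n\<close>.  In signs it also stands for
  \<open>|f\<^sub>1| + \<dots> + |f\<^sub>n| + n\<close>, which has the same parity.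
\<close>

definition shdeg :: "('k, 'o, 'm) dgcat \<Rightarrow> 'm list \<Rightarrow> int" where
  "shdeg C fs = (\<Sum>f\<leftarrow>fs. deg C f - 1)"

text \<open>With 0-based \<open>i\<close>: replaces the two neighbours \<open>fs ! i\<close> and \<open>fs ! (i + 1)\<close> by their
  composite.\<close>

definition merge_at :: "('k, 'o, 'm) dgcat \<Rightarrow> 'm list \<Rightarrow> nat \<Rightarrow> 'm list" where
  "merge_at C fs i = take i fs @ cmp C (fs ! (i + 1)) (fs ! i) # drop (i + 2) fs"

section \<open>The twisted tensor product\<close>

text \<open>
  Sign conventions.  Write \<open>s\<close> for the shift, so that \<open>s f\<close> has degree \<open>|f| - 1\<close>.  The
  relation for \<open>\<epsilon>(f\<^sub>2 f\<^sub>1; \<dots>)\<close> below and the composition of cochains carry the Koszul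
  signs for moving \<open>f\<^sub>1\<close> (or a cochain) past \<open>s g\<^sub>N, \<dots>, s g\<^sub>m\<^sub>+\<^sub>1\<close>.  The other signs are
  chosen compatibly with this, which deviates in three places from the formulas of the source
  (there is no difference in characteristic 2):
  \<^item> The total differential of cochains is \<open>\<delta> + \<delta>\<^sub>d\<^sub>g\<close>, not \<open>(-1)^|\<Psi>|\<^sub>0 \<delta> + \<delta>\<^sub>d\<^sub>g\<close>, and the
    sum over the \<open>d f\<^sub>i\<close> in \<open>\<delta>\<^sub>d\<^sub>g\<close> is added, not subtracted.  With the bar differential
    \<open>b (s f) = - s (d f)\<close>, \<open>b (s f\<^sub>2, s f\<^sub>1) = (-1)^|f\<^sub>2| s (f\<^sub>2 f\<^sub>1)\<close> the result is
    \<open>d \<circ> \<Psi> - (-1)^|\<Psi>| \<Psi> \<circ> b + G \<union> \<Psi> - (-1)^|\<Psi>| \<Psi> \<union> F\<close> for \<open>\<Psi>\<close> from \<open>F\<close> to \<open>G\<close>.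
    With the source's signs the square of the differential of a 0-cochain contains
    \<open>- 2 d\<Psi> \<circ> F(f)\<close>.
  \<^item> Correspondingly, in the differential of \<open>\<epsilon>(f; g\<^sub>1, \<dots>, g\<^sub>n)\<close> the sum over the \<open>d g\<^sub>j\<close> has
    the opposite sign and the bracket has no factor \<open>(-1)^(|f| + n - 1)\<close>.  With the source's
    signs \<open>d d \<epsilon>(f; g)\<close> contains \<open>2 (df \<otimes> id) \<star> (id \<otimes> g)\<close>.
  \<^item> In the associativity map \<open>s g\<^sub>l\<close> is moved past the \<open>s h\<^sub>s\<close> with \<open>s > j\<^sub>l\<close>, whereas the
    source has \<open>|g\<^sub>l|\<close> and \<open>s \<le> i\<^sub>l\<close>.  Expanding \<open>\<epsilon>(\<epsilon>(f\<^sub>2 f\<^sub>1; g); h)\<close> in two ways shows that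
    the coefficients of \<open>\<epsilon>(f; g, h)\<close> and \<open>\<epsilon>(f; h, g)\<close> are forced to be
    \<open>(-1)^((|g|-1)(|h|-1))\<close> and \<open>1\<close>.
\<close>

text \<open>
  Formal expressions in the generators.  \<open>Eps f d [g\<^sub>1, \<dots>, g\<^sub>n]\<close> is \<open>\<epsilon>(f; g\<^sub>1, \<dots>, g\<^sub>n)\<close>
  for a chain starting at \<open>d\<close>; for \<open>n = 0\<close> it is \<open>f \<otimes> id\<^sub>d\<close>.  \<open>Rgt c g\<close> is \<open>id\<^sub>c \<otimes> g\<close>.
\<close>

datatype ('k, 'c, 'f, 'd, 'g) tw_term =
    Eps 'f 'd "'g list"
  | Rgt 'c 'g
  | Idn "'c \<times> 'd"
  | Cmp "('k, 'c, 'f, 'd, 'g) tw_term" "('k, 'c, 'f, 'd, 'g) tw_term"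
  | Zer "'c \<times> 'd" "'c \<times> 'd" int
  | Add "('k, 'c, 'f, 'd, 'g) tw_term" "('k, 'c, 'f, 'd, 'g) tw_term"
  | Scl 'k "('k, 'c, 'f, 'd, 'g) tw_term"

definition tsum :: "'c \<times> 'd \<Rightarrow> 'c \<times> 'd \<Rightarrow> int \<Rightarrow> ('k, 'c, 'f, 'd, 'g) tw_term list
    \<Rightarrow> ('k, 'c, 'f, 'd, 'g) tw_term" where
  "tsum x y n ts = foldr Add ts (Zer x y n)"

context
  fixes C :: "('k::field, 'c, 'f) dgcat" and D :: "('k, 'd, 'g) dgcat"
begin

primrec tdom :: "('k, 'c, 'f, 'd, 'g) tw_term \<Rightarrow> 'c \<times> 'd" where
  "tdom (Eps f d gs) = (dom C f, d)"
| "tdom (Rgt c g) = (c, dom D g)"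
| "tdom (Idn x) = x"
| "tdom (Cmp s t) = tdom t"
| "tdom (Zer x y n) = x"
| "tdom (Add s t) = tdom s"
| "tdom (Scl a t) = tdom t"

primrec tcod :: "('k, 'c, 'f, 'd, 'g) tw_term \<Rightarrow> 'c \<times> 'd" where
  "tcod (Eps f d gs) = (cod C f, path_end D d gs)"
| "tcod (Rgt c g) = (c, cod D g)"
| "tcod (Idn x) = x"
| "tcod (Cmp s t) = tcod s"
| "tcod (Zer x y n) = y"
| "tcod (Add s t) = tcod s"
| "tcod (Scl a t) = tcod t"

primrec tdeg :: "('k, 'c, 'f, 'd, 'g) tw_term \<Rightarrow> int" where
  "tdeg (Eps f d gs) = deg C f + shdeg D gs"
| "tdeg (Rgt c g) = deg D g"
| "tdeg (Idn x) = 0"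
| "tdeg (Cmp s t) = tdeg s + tdeg t"
| "tdeg (Zer x y n) = n"
| "tdeg (Add s t) = tdeg s"
| "tdeg (Scl a t) = tdeg t"

primrec wf_term :: "('k, 'c, 'f, 'd, 'g) tw_term \<Rightarrow> bool" where
  "wf_term (Eps f d gs) \<longleftrightarrow> f \<in> Arr C \<and> is_path D d gs"
| "wf_term (Rgt c g) \<longleftrightarrow> c \<in> Obj C \<and> g \<in> Arr D"
| "wf_term (Idn x) \<longleftrightarrow> x \<in> Obj C \<times> Obj D"
| "wf_term (Cmp s t) \<longleftrightarrow> wf_term s \<and> wf_term t \<and> tdom s = tcod t"
| "wf_term (Zer x y n) \<longleftrightarrow> x \<in> Obj C \<times> Obj D \<and> y \<in> Obj C \<times> Obj D"
| "wf_term (Add s t) \<longleftrightarrow> wf_term s \<and> wf_term t \<and> tdom s = tdom t \<and> tcod s = tcod t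
     \<and> tdeg s = tdeg t"
| "wf_term (Scl a t) \<longleftrightarrow> wf_term t"

text \<open>
  The relations: the least congruence making the expressions into a graded linear category
  (first two blocks) in which the defining relations of the twisted tensor product hold.  Since
  \<open>f \<mapsto> f \<otimes> id\<^sub>d\<close> and \<open>g \<mapsto> id\<^sub>c \<otimes> g\<close> are meant to be linear functors, they are linear and
  \<open>id\<^sub>c \<otimes> id\<^sub>d\<close>, read either way, is the identity of \<open>(c, d)\<close>.
\<close>

inductive_set tw_rel :: "(('k, 'c, 'f, 'd, 'g) tw_term \<times> ('k, 'c, 'f, 'd, 'g) tw_term) set" where
    refl: "wf_term t \<Longrightarrow> (t, t) \<in> tw_rel"
  | sym: "(s, t) \<in> tw_rel \<Longrightarrow> (t, s) \<in> tw_rel"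
  | trans: "\<lbrakk>(s, t) \<in> tw_rel; (t, u) \<in> tw_rel\<rbrakk> \<Longrightarrow> (s, u) \<in> tw_rel"
  | Cmp_cong: "\<lbrakk>(s, s') \<in> tw_rel; (t, t') \<in> tw_rel; wf_term (Cmp s t)\<rbrakk>
      \<Longrightarrow> (Cmp s t, Cmp s' t') \<in> tw_rel"
  | Add_cong: "\<lbrakk>(s, s') \<in> tw_rel; (t, t') \<in> tw_rel; wf_term (Add s t)\<rbrakk>
      \<Longrightarrow> (Add s t, Add s' t') \<in> tw_rel"
  | Scl_cong: "(t, t') \<in> tw_rel \<Longrightarrow> (Scl a t, Scl a t') \<in> tw_rel"

  | Add_assoc: "wf_term (Add (Add s t) u) \<Longrightarrow> (Add (Add s t) u, Add s (Add t u)) \<in> tw_rel"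
  | Add_comm: "wf_term (Add s t) \<Longrightarrow> (Add s t, Add t s) \<in> tw_rel"
  | Add_Zer: "wf_term t \<Longrightarrow> (Add t (Zer (tdom t) (tcod t) (tdeg t)), t) \<in> tw_rel"
  | Add_neg: "wf_term t \<Longrightarrow> (Add t (Scl (-1) t), Zer (tdom t) (tcod t) (tdeg t)) \<in> tw_rel"
  | Scl_one: "wf_term t \<Longrightarrow> (Scl 1 t, t) \<in> tw_rel"
  | Scl_Scl: "wf_term t \<Longrightarrow> (Scl a (Scl b t), Scl (a * b) t) \<in> tw_rel"
  | Scl_Add: "wf_term (Add s t) \<Longrightarrow> (Scl a (Add s t), Add (Scl a s) (Scl a t)) \<in> tw_rel"
  | Add_Scl: "wf_term t \<Longrightarrow> (Scl (a + b) t, Add (Scl a t) (Scl b t)) \<in> tw_rel"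
  | Cmp_Add_left: "\<lbrakk>wf_term (Add s s'); wf_term (Cmp s t)\<rbrakk>
      \<Longrightarrow> (Cmp (Add s s') t, Add (Cmp s t) (Cmp s' t)) \<in> tw_rel"
  | Cmp_Add_right: "\<lbrakk>wf_term (Add t t'); wf_term (Cmp s t)\<rbrakk>
      \<Longrightarrow> (Cmp s (Add t t'), Add (Cmp s t) (Cmp s t')) \<in> tw_rel"
  | Cmp_Scl_left: "wf_term (Cmp s t) \<Longrightarrow> (Cmp (Scl a s) t, Scl a (Cmp s t)) \<in> tw_rel"
  | Cmp_Scl_right: "wf_term (Cmp s t) \<Longrightarrow> (Cmp s (Scl a t), Scl a (Cmp s t)) \<in> tw_rel"
  | Cmp_assoc: "\<lbrakk>wf_term (Cmp s t); wf_term (Cmp t u)\<rbrakk>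
      \<Longrightarrow> (Cmp (Cmp s t) u, Cmp s (Cmp t u)) \<in> tw_rel"
  | Cmp_Idn_left: "wf_term t \<Longrightarrow> (Cmp (Idn (tcod t)) t, t) \<in> tw_rel"
  | Cmp_Idn_right: "wf_term t \<Longrightarrow> (Cmp t (Idn (tdom t)), t) \<in> tw_rel"

  | Left_idn: "\<lbrakk>c \<in> Obj C; d \<in> Obj D\<rbrakk> \<Longrightarrow> (Eps (idn C c) d [], Idn (c, d)) \<in> tw_rel"
  | Right_idn: "\<lbrakk>c \<in> Obj C; d \<in> Obj D\<rbrakk> \<Longrightarrow> (Rgt c (idn D d), Idn (c, d)) \<in> tw_rel"
  | Right_add: "\<lbrakk>c \<in> Obj C; g \<in> Hom D d d' q; g' \<in> Hom D d d' q\<rbrakk>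
      \<Longrightarrow> (Rgt c (add D g g'), Add (Rgt c g) (Rgt c g')) \<in> tw_rel"
  | Right_scl: "\<lbrakk>c \<in> Obj C; g \<in> Arr D\<rbrakk> \<Longrightarrow> (Rgt c (scl D a g), Scl a (Rgt c g)) \<in> tw_rel"

  | R1_right: "\<lbrakk>c \<in> Obj C; g\<^sub>1 \<in> Arr D; g\<^sub>2 \<in> Arr D; dom D g\<^sub>1 = cod D g\<^sub>2\<rbrakk>
      \<Longrightarrow> (Cmp (Rgt c g\<^sub>1) (Rgt c g\<^sub>2), Rgt c (cmp D g\<^sub>1 g\<^sub>2)) \<in> tw_rel"
  | R1_left: "\<lbrakk>f\<^sub>1 \<in> Arr C; f\<^sub>2 \<in> Arr C; dom C f\<^sub>1 = cod C f\<^sub>2; d \<in> Obj D\<rbrakk>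
      \<Longrightarrow> (Cmp (Eps f\<^sub>1 d []) (Eps f\<^sub>2 d []), Eps (cmp C f\<^sub>1 f\<^sub>2) d []) \<in> tw_rel"
  | R2_add_left: "\<lbrakk>f \<in> Hom C c c' p; f' \<in> Hom C c c' p; is_path D d gs\<rbrakk>
      \<Longrightarrow> (Eps (add C f f') d gs, Add (Eps f d gs) (Eps f' d gs)) \<in> tw_rel"
  | R2_scl_left: "\<lbrakk>f \<in> Arr C; is_path D d gs\<rbrakk>
      \<Longrightarrow> (Eps (scl C a f) d gs, Scl a (Eps f d gs)) \<in> tw_rel"
  | R2_add_right: "\<lbrakk>f \<in> Arr C; g \<in> Hom D y y' q; g' \<in> Hom D y y' q; is_path D d (gs @ g # hs)\<rbrakk>
      \<Longrightarrow> (Eps f d (gs @ add D g g' # hs),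
           Add (Eps f d (gs @ g # hs)) (Eps f d (gs @ g' # hs))) \<in> tw_rel"
  | R2_scl_right: "\<lbrakk>f \<in> Arr C; is_path D d (gs @ g # hs)\<rbrakk>
      \<Longrightarrow> (Eps f d (gs @ scl D a g # hs), Scl a (Eps f d (gs @ g # hs))) \<in> tw_rel"
  | R3_left: "\<lbrakk>c \<in> Obj C; is_path D d gs; gs \<noteq> []\<rbrakk>
      \<Longrightarrow> (Eps (idn C c) d gs, Zer (c, d) (c, path_end D d gs) (shdeg D gs)) \<in> tw_rel"
  | R3_right: "\<lbrakk>f \<in> Arr C; y \<in> Obj D; is_path D d gs; idn D y \<in> set gs\<rbrakk>
      \<Longrightarrow> (Eps f d gs,
           Zer (dom C f, d) (cod C f, path_end D d gs) (deg C f + shdeg D gs)) \<in> tw_rel"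
  | R4: "\<lbrakk>f\<^sub>1 \<in> Arr C; f\<^sub>2 \<in> Arr C; dom C f\<^sub>2 = cod C f\<^sub>1; is_path D d gs; gs \<noteq> []\<rbrakk>
      \<Longrightarrow> (Eps (cmp C f\<^sub>2 f\<^sub>1) d gs,
           tsum (dom C f\<^sub>1, d) (cod C f\<^sub>2, path_end D d gs) (deg C f\<^sub>2 + deg C f\<^sub>1 + shdeg D gs)
             (map (\<lambda>m. Scl ((-1) powi (deg C f\<^sub>1 * shdeg D (drop m gs)))
                         (Cmp (Eps f\<^sub>2 (path_end D d (take m gs)) (drop m gs))
                              (Eps f\<^sub>1 d (take m gs))))
                  [0..<Suc (length gs)])) \<in> tw_rel"

text \<open>
  The differential on expressions.  On \<open>\<epsilon>(f; g\<^sub>1, \<dots>, g\<^sub>n)\<close> one formula serves all \<open>n \<ge> 0\<close>: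
  for \<open>n = 1\<close> it reads
  \<open>d\<epsilon>(f;g) = \<epsilon>(df;g) - (-1)^|f| \<epsilon>(f;dg) - (-1)^|f| ((-1)^(|f||g|) (id \<otimes> g) \<star> (f \<otimes> id)
     - (f \<otimes> id) \<star> (id \<otimes> g))\<close>,
  and for \<open>n = 0\<close> it is \<open>df \<otimes> id\<^sub>d\<close>.  Every exponent has an additional \<open>1\<close> because the terms
  have been moved to the side of \<open>\<epsilon>(df; g\<^sub>1, \<dots>, g\<^sub>n)\<close>.  Indices are 0-based: \<open>gs ! i\<close> is
  \<open>g\<^sub>i\<^sub>+\<^sub>1\<close>.
\<close>

primrec tdif :: "('k, 'c, 'f, 'd, 'g) tw_term \<Rightarrow> ('k, 'c, 'f, 'd, 'g) tw_term" where
  "tdif (Eps f d gs) =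
     tsum (dom C f, d) (cod C f, path_end D d gs) (deg C f + shdeg D gs + 1)
      ([Eps (dif C f) d gs]
       @ map (\<lambda>i. Scl ((-1) powi (1 + deg C f + shdeg D (drop (i + 1) gs)))
                     (Eps f d (gs[i := dif D (gs ! i)]))) [0..<length gs]
       @ (if gs = [] then [] else
           [Scl ((-1) powi (1 + deg C f * deg D (last gs) + deg C f))
              (Cmp (Rgt (cod C f) (last gs)) (Eps f d (butlast gs))),
            Scl ((-1) powi (1 + deg C f + shdeg D (tl gs) + 1))
              (Cmp (Eps f (cod D (hd gs)) (tl gs)) (Rgt (dom C f) (hd gs)))])
       @ map (\<lambda>i. Scl ((-1) powi (1 + deg C f + shdeg D (drop (i + 1) gs)))
                     (Eps f d (merge_at D gs i))) [0..<length gs - 1])"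
| "tdif (Rgt c g) = Rgt c (dif D g)"
| "tdif (Idn x) = Zer x x 1"
| "tdif (Cmp s t) = Add (Cmp (tdif s) t) (Scl ((-1) powi (tdeg s)) (Cmp s (tdif t)))"
| "tdif (Zer x y n) = Zer x y (n + 1)"
| "tdif (Add s t) = Add (tdif s) (tdif t)"
| "tdif (Scl a t) = Scl a (tdif t)"

definition cls :: "('k, 'c, 'f, 'd, 'g) tw_term \<Rightarrow> ('k, 'c, 'f, 'd, 'g) tw_term set" where
  "cls t = tw_rel `` {t}"

end

definition rep :: "('k, 'c, 'f, 'd, 'g) tw_term set \<Rightarrow> ('k, 'c, 'f, 'd, 'g) tw_term" where
  "rep X = (SOME t. t \<in> X)"

definition tens :: "('k::field, 'c, 'f) dgcat \<Rightarrow> ('k, 'd, 'g) dgcat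
    \<Rightarrow> ('k, 'c \<times> 'd, ('k, 'c, 'f, 'd, 'g) tw_term set) dgcat" where
  "tens C D =
     \<lparr>Obj = Obj C \<times> Obj D,
      Arr = {t. wf_term C D t} // tw_rel C D,
      dom = (\<lambda>X. tdom C D (rep X)),
      cod = (\<lambda>X. tcod C D (rep X)),
      deg = (\<lambda>X. tdeg C D (rep X)),
      idn = (\<lambda>x. cls C D (Idn x)),
      cmp = (\<lambda>X Y. cls C D (Cmp (rep X) (rep Y))),
      zer = (\<lambda>x y n. cls C D (Zer x y n)),
      add = (\<lambda>X Y. cls C D (Add (rep X) (rep Y))),
      scl = (\<lambda>a X. cls C D (Scl a (rep X))),
      dif = (\<lambda>X. cls C D (tdif C D (rep X)))\<rparr>"

text \<open>
  The generators as arrows: \<open>eps C D f d [g\<^sub>1, \<dots>, g\<^sub>n]\<close> is \<open>\<epsilon>(f; g\<^sub>1, \<dots>, g\<^sub>n)\<close>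
  (\<open>f \<otimes> id\<^sub>d\<close> for \<open>n = 0\<close>) and \<open>rgt C D c g\<close> is \<open>id\<^sub>c \<otimes> g\<close>.
\<close>

definition eps :: "('k::field, 'c, 'f) dgcat \<Rightarrow> ('k, 'd, 'g) dgcat \<Rightarrow> 'f \<Rightarrow> 'd \<Rightarrow> 'g list
    \<Rightarrow> ('k, 'c, 'f, 'd, 'g) tw_term set" where
  "eps C D f d gs = cls C D (Eps f d gs)"

definition rgt :: "('k::field, 'c, 'f) dgcat \<Rightarrow> ('k, 'd, 'g) dgcat \<Rightarrow> 'c \<Rightarrow> 'g
    \<Rightarrow> ('k, 'c, 'f, 'd, 'g) tw_term set" where
  "rgt C D c g = cls C D (Rgt c g)"

text \<open>\<open>F \<otimes> G\<close> for dg functors \<open>F : C \<rightarrow> C'\<close> and \<open>G : D \<rightarrow> D'\<close>.\<close>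

definition tens_fun :: "('k::field, 'c, 'f) dgcat \<Rightarrow> ('k, 'd, 'g) dgcat
    \<Rightarrow> ('k, 'c2, 'f2) dgcat \<Rightarrow> ('k, 'd2, 'g2) dgcat
    \<Rightarrow> ('c, 'f, 'c2, 'f2) dgfun \<Rightarrow> ('d, 'g, 'd2, 'g2) dgfun
    \<Rightarrow> ('c \<times> 'd, ('k, 'c, 'f, 'd, 'g) tw_term set,
        'c2 \<times> 'd2, ('k, 'c2, 'f2, 'd2, 'g2) tw_term set) dgfun" where
  "tens_fun C D C' D' F G = (THE H.
     dg_functor (tens C D) (tens C' D') H \<and>
     (\<forall>c\<in>Obj C. \<forall>d\<in>Obj D. fobj H (c, d) = (fobj F c, fobj G d)) \<and>
     (\<forall>f\<in>Arr C. \<forall>d gs. is_path D d gs \<longrightarrow>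
        farr H (eps C D f d gs) = eps C' D' (farr F f) (fobj G d) (map (farr G) gs)) \<and>
     (\<forall>c\<in>Obj C. \<forall>g\<in>Arr D. farr H (rgt C D c g) = rgt C' D' (fobj F c) (farr G g)))"

section \<open>The associativity map\<close>

text \<open>
  The summands of the image of \<open>\<epsilon>(\<epsilon>(f; g\<^sub>1, \<dots>, g\<^sub>k); h\<^sub>1, \<dots>, h\<^sub>N)\<close>: \<open>brace_args D E y z gs hs\<close>
  lists, over all \<open>0 \<le> i\<^sub>1 \<le> j\<^sub>1 \<le> \<dots> \<le> i\<^sub>k \<le> j\<^sub>k \<le> N\<close>, the exponent of the sign together with
  the arguments \<open>h\<^sub>1, \<dots>, h\<^sub>i, \<epsilon>(g\<^sub>1; \<dots>), \<dots>\<close>, where the \<open>g\<close>s start at the object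
  \<open>y\<close> of \<open>D\<close> and the \<open>h\<close>s at the object \<open>z\<close> of \<open>E\<close>.  The recursion chooses \<open>i = i\<^sub>1\<close> and
  \<open>j = j\<^sub>1\<close>.
\<close>

fun brace_args :: "('k::field, 'd, 'g) dgcat \<Rightarrow> ('k, 'e, 'h) dgcat \<Rightarrow> 'd \<Rightarrow> 'e \<Rightarrow> 'g list \<Rightarrow> 'h list
    \<Rightarrow> (int \<times> ('k, 'd, 'g, 'e, 'h) tw_term set list) list" where
  "brace_args D E y z [] hs = [(0, map (rgt D E y) hs)]"
| "brace_args D E y z (g # gs) hs =
     [((deg D g - 1) * shdeg E (drop j hs) + n,
       map (rgt D E y) (take i hs)
         @ eps D E g (path_end E z (take i hs)) (drop i (take j hs)) # args).
      i \<leftarrow> [0..<Suc (length hs)], j \<leftarrow> [i..<Suc (length hs)],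
      (n, args) \<leftarrow> brace_args D E (cod D g) (path_end E z (take j hs)) gs (drop j hs)]"

text \<open>
  For \<open>k = 0\<close> or \<open>N = 0\<close> the brace formula gives the values prescribed on
  \<open>(f \<otimes> id) \<otimes> id\<close>, \<open>\<epsilon>(f; g\<^sub>1, \<dots>, g\<^sub>k) \<otimes> id\<close> and \<open>\<epsilon>(f \<otimes> id; h\<^sub>1, \<dots>, h\<^sub>N)\<close>, so it is imposed
  for all \<open>k, N \<ge> 0\<close>; likewise the clause for \<open>id \<otimes> g\<close> includes \<open>N = 0\<close>.
\<close>

definition assoc_map :: "('k::field, 'c, 'f) dgcat \<Rightarrow> ('k, 'd, 'g) dgcat \<Rightarrow> ('k, 'e, 'h) dgcat
    \<Rightarrow> (('c \<times> 'd) \<times> 'e,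
        ('k, 'c \<times> 'd, ('k, 'c, 'f, 'd, 'g) tw_term set, 'e, 'h) tw_term set,
        'c \<times> ('d \<times> 'e),
        ('k, 'c, 'f, 'd \<times> 'e, ('k, 'd, 'g, 'e, 'h) tw_term set) tw_term set) dgfun" where
  "assoc_map C D E = (THE H.
     dg_functor (tens (tens C D) E) (tens C (tens D E)) H \<and>
     (\<forall>x\<in>Obj C. \<forall>y\<in>Obj D. \<forall>z\<in>Obj E. fobj H ((x, y), z) = (x, (y, z))) \<and>
     (\<forall>x\<in>Obj C. \<forall>y\<in>Obj D. \<forall>h\<in>Arr E.
        farr H (rgt (tens C D) E (x, y) h) = rgt C (tens D E) x (rgt D E y h)) \<and>
     (\<forall>x\<in>Obj C. \<forall>g\<in>Arr D. \<forall>z hs. is_path E z hs \<longrightarrow>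
        farr H (eps (tens C D) E (rgt C D x g) z hs) = rgt C (tens D E) x (eps D E g z hs)) \<and>
     (\<forall>f\<in>Arr C. \<forall>y gs z hs. is_path D y gs \<and> is_path E z hs \<longrightarrow>
        farr H (eps (tens C D) E (eps C D f y gs) z hs) =
          dsum (tens C (tens D E)) (dom C f, (y, z)) (cod C f, (path_end D y gs, path_end E z hs))
            (deg C f + shdeg D gs + shdeg E hs)
            (map (\<lambda>(n, args). sscl (tens C (tens D E)) n (eps C (tens D E) f (y, z) args))
                 (brace_args D E y z gs hs))))"

section \<open>Coherent natural transformations\<close>

text \<open>
  A homogeneous element of total degree \<open>p\<close> of the complex of cochains from \<open>F\<close> to \<open>G\<close> is a
  family \<open>\<Psi>\<^sub>n\<close>, \<open>n \<ge> 0\<close>, of maps on composable chains, with \<open>\<Psi>\<^sub>n\<close> of degree \<open>p - n\<close> as a linear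
  map.  The value \<open>\<Psi>\<^sub>n(f\<^sub>n, \<dots>, f\<^sub>1)\<close> is written \<open>cval \<Psi> x [f\<^sub>1, \<dots>, f\<^sub>n]\<close> with \<open>x\<close> the source of
  \<open>f\<^sub>1\<close>, and \<open>\<Psi>\<^sub>0\<close> at \<open>x\<close> is \<open>cval \<Psi> x []\<close>.  Linear maps on the tensor product are rendered as
  maps that are linear in each homogeneous argument.
\<close>

datatype ('o, 'm, 'p, 'q) cochain =
  Cochain (csrc: "('o, 'm, 'p, 'q) dgfun") (ctgt: "('o, 'm, 'p, 'q) dgfun") (cdeg: int)
    (cval: "'o \<Rightarrow> 'm list \<Rightarrow> 'q")

definition on_paths :: "('k, 'o, 'm) dgcat \<Rightarrow> ('o \<Rightarrow> 'm list \<Rightarrow> 'q) \<Rightarrow> 'o \<Rightarrow> 'm list \<Rightarrow> 'q" where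
  "on_paths C \<phi> = (\<lambda>x fs. if is_path C x fs then \<phi> x fs else undefined)"

definition is_cochain :: "('k::field, 'o, 'm) dgcat \<Rightarrow> ('k, 'p, 'q) dgcat
    \<Rightarrow> ('o, 'm, 'p, 'q) cochain \<Rightarrow> bool" where
  "is_cochain C D \<Psi> \<longleftrightarrow>
     dg_functor C D (csrc \<Psi>) \<and> dg_functor C D (ctgt \<Psi>) \<and>
     (\<forall>x fs. \<not> is_path C x fs \<longrightarrow> cval \<Psi> x fs = undefined) \<and>
     (\<forall>x fs. is_path C x fs \<longrightarrow> cval \<Psi> x fs
        \<in> Hom D (fobj (csrc \<Psi>) x) (fobj (ctgt \<Psi>) (path_end C x fs)) (cdeg \<Psi> + shdeg C fs)) \<and>
     (\<forall>x fs gs f f' y z n. is_path C x (fs @ f # gs) \<and> f \<in> Hom C y z n \<and> f' \<in> Hom C y z n \<longrightarrow>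
        cval \<Psi> x (fs @ add C f f' # gs)
          = add D (cval \<Psi> x (fs @ f # gs)) (cval \<Psi> x (fs @ f' # gs))) \<and>
     (\<forall>x fs gs f a. is_path C x (fs @ f # gs) \<longrightarrow>
        cval \<Psi> x (fs @ scl C a f # gs) = scl D a (cval \<Psi> x (fs @ f # gs))) \<and>
     (\<forall>x fs. is_path C x fs \<and> (\<exists>y\<in>Obj C. idn C y \<in> set fs) \<longrightarrow> cval \<Psi> x fs
        = zer D (fobj (csrc \<Psi>) x) (fobj (ctgt \<Psi>) (path_end C x fs)) (cdeg \<Psi> + shdeg C fs))"

definition coh_delta_dg :: "('k::field, 'o, 'm) dgcat \<Rightarrow> ('k, 'p, 'q) dgcat
    \<Rightarrow> ('o, 'm, 'p, 'q) cochain \<Rightarrow> 'o \<Rightarrow> 'm list \<Rightarrow> 'q" where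
  "coh_delta_dg C D \<Psi> x fs =
     dsum D (fobj (csrc \<Psi>) x) (fobj (ctgt \<Psi>) (path_end C x fs)) (cdeg \<Psi> + shdeg C fs + 1)
       ([dif D (cval \<Psi> x fs)]
        @ map (\<lambda>i. sscl D (cdeg \<Psi> + shdeg C (drop (i + 1) fs))
                     (cval \<Psi> x (fs[i := dif C (fs ! i)]))) [0..<length fs])"

definition coh_delta :: "('k::field, 'o, 'm) dgcat \<Rightarrow> ('k, 'p, 'q) dgcat
    \<Rightarrow> ('o, 'm, 'p, 'q) cochain \<Rightarrow> 'o \<Rightarrow> 'm list \<Rightarrow> 'q" where
  "coh_delta C D \<Psi> x fs =
     dsum D (fobj (csrc \<Psi>) x) (fobj (ctgt \<Psi>) (path_end C x fs)) (cdeg \<Psi> + shdeg C fs + 1)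
       ((if fs = [] then [] else
           [sscl D (cdeg \<Psi> * deg C (last fs) + cdeg \<Psi>)
              (cmp D (farr (ctgt \<Psi>) (last fs)) (cval \<Psi> x (butlast fs))),
            sscl D (cdeg \<Psi> + 1 + shdeg C (tl fs))
              (cmp D (cval \<Psi> (cod C (hd fs)) (tl fs)) (farr (csrc \<Psi>) (hd fs)))])
        @ map (\<lambda>i. sscl D (cdeg \<Psi> + shdeg C (drop (i + 1) fs))
                     (cval \<Psi> x (merge_at C fs i))) [0..<length fs - 1])"

definition Coh :: "('k::field, 'o, 'm) dgcat \<Rightarrow> ('k, 'p, 'q) dgcat
    \<Rightarrow> ('k, ('o, 'm, 'p, 'q) dgfun, ('o, 'm, 'p, 'q) cochain) dgcat" where
  "Coh C D =
     \<lparr>Obj = {F. dg_functor C D F},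
      Arr = {\<Psi>. is_cochain C D \<Psi>},
      dom = csrc,
      cod = ctgt,
      deg = cdeg,
      idn = (\<lambda>F. Cochain F F 0 (on_paths C (\<lambda>x fs.
              if fs = [] then idn D (fobj F x)
              else zer D (fobj F x) (fobj F (path_end C x fs)) (shdeg C fs)))),
      cmp = (\<lambda>\<Psi>\<^sub>2 \<Psi>\<^sub>1. Cochain (csrc \<Psi>\<^sub>1) (ctgt \<Psi>\<^sub>2) (cdeg \<Psi>\<^sub>2 + cdeg \<Psi>\<^sub>1) (on_paths C (\<lambda>x fs.
              dsum D (fobj (csrc \<Psi>\<^sub>1) x) (fobj (ctgt \<Psi>\<^sub>2) (path_end C x fs))
                (cdeg \<Psi>\<^sub>2 + cdeg \<Psi>\<^sub>1 + shdeg C fs)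
                (map (\<lambda>m. sscl D (shdeg C (drop m fs) * cdeg \<Psi>\<^sub>1)
                       (cmp D (cval \<Psi>\<^sub>2 (path_end C x (take m fs)) (drop m fs))
                              (cval \<Psi>\<^sub>1 x (take m fs))))
                   [0..<Suc (length fs)])))),
      zer = (\<lambda>F G p. Cochain F G p (on_paths C (\<lambda>x fs.
              zer D (fobj F x) (fobj G (path_end C x fs)) (p + shdeg C fs)))),
      add = (\<lambda>\<Psi> \<Psi>'. Cochain (csrc \<Psi>) (ctgt \<Psi>) (cdeg \<Psi>) (on_paths C (\<lambda>x fs.
              add D (cval \<Psi> x fs) (cval \<Psi>' x fs)))),
      scl = (\<lambda>a \<Psi>. Cochain (csrc \<Psi>) (ctgt \<Psi>) (cdeg \<Psi>) (on_paths C (\<lambda>x fs.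
              scl D a (cval \<Psi> x fs)))),
      dif = (\<lambda>\<Psi>. Cochain (csrc \<Psi>) (ctgt \<Psi>) (cdeg \<Psi> + 1) (on_paths C (\<lambda>x fs.
              add D (coh_delta C D \<Psi> x fs) (coh_delta_dg C D \<Psi> x fs))))\<rparr>"

section \<open>The twisted composition\<close>

definition eval_fun :: "('k::field, 'o, 'm) dgcat \<Rightarrow> ('k, 'p, 'q) dgcat
    \<Rightarrow> (('o, 'm, 'p, 'q) dgfun \<times> 'o,
        ('k, ('o, 'm, 'p, 'q) dgfun, ('o, 'm, 'p, 'q) cochain, 'o, 'm) tw_term set,
        'p, 'q) dgfun" where
  "eval_fun C D = (THE H.
     dg_functor (tens (Coh C D) C) D H \<and>
     (\<forall>F\<in>Obj (Coh C D). \<forall>c\<in>Obj C. fobj H (F, c) = fobj F c) \<and>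
     (\<forall>\<Psi>\<in>Arr (Coh C D). \<forall>c fs. is_path C c fs \<longrightarrow>
        farr H (eps (Coh C D) C \<Psi> c fs) = cval \<Psi> c fs) \<and>
     (\<forall>F\<in>Obj (Coh C D). \<forall>f\<in>Arr C. farr H (rgt (Coh C D) C F f) = farr F f))"

text \<open>
  The bijection from dg functors \<open>C \<otimes> D \<rightarrow> E\<close> to dg functors \<open>C \<rightarrow> Coh D E\<close>; it is the
  transposition \<open>K \<mapsto> K'\<close> determined by \<open>K = eval_fun D E \<circ> (K' \<otimes> id)\<close>.
\<close>

definition transpose_obj :: "('k::field, 'c, 'f) dgcat \<Rightarrow> ('k, 'd, 'g) dgcat
    \<Rightarrow> ('c \<times> 'd, ('k, 'c, 'f, 'd, 'g) tw_term set, 'e, 'h) dgfun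
    \<Rightarrow> 'c \<Rightarrow> ('d, 'g, 'e, 'h) dgfun" where
  "transpose_obj C D K c =
     \<lparr>fobj = (\<lambda>d\<in>Obj D. fobj K (c, d)), farr = (\<lambda>g\<in>Arr D. farr K (rgt C D c g))\<rparr>"

definition transpose_fun :: "('k::field, 'c, 'f) dgcat \<Rightarrow> ('k, 'd, 'g) dgcat
    \<Rightarrow> ('c \<times> 'd, ('k, 'c, 'f, 'd, 'g) tw_term set, 'e, 'h) dgfun
    \<Rightarrow> ('c, 'f, ('d, 'g, 'e, 'h) dgfun, ('d, 'g, 'e, 'h) cochain) dgfun" where
  "transpose_fun C D K =
     \<lparr>fobj = (\<lambda>c\<in>Obj C. transpose_obj C D K c),
      farr = (\<lambda>f\<in>Arr C. Cochain (transpose_obj C D K (dom C f)) (transpose_obj C D K (cod C f))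
                (deg C f) (on_paths D (\<lambda>d gs. farr K (eps C D f d gs))))\<rparr>"

definition twisted_comp :: "('k::field, 'c, 'f) dgcat \<Rightarrow> ('k, 'd, 'g) dgcat \<Rightarrow> ('k, 'e, 'h) dgcat
    \<Rightarrow> (('d, 'g, 'e, 'h) dgfun \<times> ('c, 'f, 'd, 'g) dgfun,
        ('k, ('d, 'g, 'e, 'h) dgfun, ('d, 'g, 'e, 'h) cochain,
             ('c, 'f, 'd, 'g) dgfun, ('c, 'f, 'd, 'g) cochain) tw_term set,
        ('c, 'f, 'e, 'h) dgfun, ('c, 'f, 'e, 'h) cochain) dgfun" where
  "twisted_comp C D E =
     (let X = tens (Coh D E) (Coh C D)
      in transpose_fun X C
           (fun_comp (tens X C) (eval_fun D E)
             (fun_comp (tens X C)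
               (tens_fun (Coh D E) (tens (Coh C D) C) (Coh D E) D
                  (fun_id (Coh D E)) (eval_fun C D))
               (assoc_map (Coh D E) (Coh C D) C))))"

end

theory Submission
  imports Defs "HOL.Vector_Spaces" "HOL-Library.Poly_Mapping"
begin

text \<open>
  Every dg category acts faithfully, by left composition, on a quotient of the space spanned by its
  arrows, with the differential as a graded commutator.  A cochain thus becomes a function on chains
  of arrows with values in a ring, that is, a functional on a bar construction, and a dg functor
  becomes a Maurer-Cartan element; the composition of cochains is the cup product, and their
  differential is the commutator with these elements plus the transpose of the bar differential.

  The braces \<open>\<epsilon>(f; h, ..., h')\<close> assemble to a morphism of dg coalgebras from the tensor product of the
  bar constructions of \<open>C\<close> and \<open>D\<close> to the bar construction of the twisted tensor product of \<open>C\<close> and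
  \<open>D\<close>.  Its transpose sends cochains on the product to cochains on \<open>C\<close> with values in cochains on
  \<open>D\<close>; this is a dg functor, and it yields the associativity map from the universal property of the
  twisted tensor product.  On the values of cochains, the associativity of the twisted composition is
  then an identity between two iterated transposes of such morphisms, which follows by induction on
  the total length of the chains by comparing the first letters of the resulting words.
\<close>

section \<open>A faithful representation of a dg category in a ring\<close>

text \<open>Addition of arrows makes sense only inside one Hom space, while nearly every formula
  here is a long signed sum. In a ring, sums carry no typing conditions and sign bookkeeping is
  arithmetic; injectivity on each Hom space then brings an identity back. For the twisted tensor
  product such a ring exists before its differential is known to be well defined, so the
  differential can be studied inside it. No basis of the twisted tensor product is at hand: it is a
  quotient of expressions, and a functor out of it has to respect every relation. Hence
  \<open>eval_fun\<close>, \<open>tens_fun\<close> and \<open>assoc_map\<close>, which are specified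
  by values on generators, need existence as well as uniqueness. That the brace formula respects the
  relation for composites and the differential amounts to its transpose respecting composition and
  differential of cochains; in that form it is checked on chains, without touching the relations of
  the triple product. Cochains with values in cochains involve the operators of two categories at
  once. The passage between them rests on extending any additive function of arrows to an additive
  functional on operators.\<close>

definition sg :: "int => 'r::ring_1" where
  "sg n = (if even n then 1 else - 1)"

lemma sg_0 [simp]: "sg 0 = 1" and sg_1 [simp]: "sg 1 = - 1"
  by (simp_all add: sg_def)

lemma sg_add: "sg (m + n) = sg m * (sg n :: 'r::ring_1)"
  by (auto simp: sg_def)

lemma sg_diff: "sg (m - n) = sg m * (sg n :: 'r::ring_1)"
  by (auto simp: sg_def)

lemma sg_minus [simp]: "sg (- n) = (sg n :: 'r::ring_1)"
  by (auto simp: sg_def)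

lemma sg_sg [simp]: "sg n * sg n = (1 :: 'r::ring_1)"
  and sg_sg_left [simp]: "sg n * (sg n * x) = (x :: 'r)"
  by (auto simp: sg_def)

lemma sg_left_commute: "x * (sg n * y) = sg n * (x * (y :: 'r::ring_1))"
  by (auto simp: sg_def)

text \<open>Signs are defined as integer powers in the ground field, but computed with in rings
  without division; this is the bridge.\<close>

lemma powi_sg: "(- 1) powi n = (sg n :: 'k::field)"
  by (simp add: sg_def power_int_minus_left)

text \<open>Only additivity is built in. The type depends on the arrow type and the field but not on
  the category; scalars become the operators \<open>kap a\<close>, and linearity means commuting
  with these.\<close>

typedef (overloaded) ('m, 'k) endo = "{h :: ('m \<Rightarrow>\<^sub>0 'k::field) => ('m \<Rightarrow>\<^sub>0 'k). \<forall>p q. h (p + q) = h p + h q}"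
  by (rule exI[of _ "%p. p"]) simp

setup_lifting type_definition_endo

instantiation endo :: (type, field) ring_1
begin

lift_definition zero_endo :: "('a, 'b) endo" is "%p. 0" by simp
lift_definition one_endo :: "('a, 'b) endo" is "%p. p" by simp
lift_definition plus_endo :: "('a, 'b) endo => ('a, 'b) endo => ('a, 'b) endo"
  is "%g h p. g p + h p" by (simp add: ac_simps)
lift_definition minus_endo :: "('a, 'b) endo => ('a, 'b) endo => ('a, 'b) endo"
  is "%g h p. g p - h p" by simp
lift_definition uminus_endo :: "('a, 'b) endo => ('a, 'b) endo"
  is "%h p. - h p" by simp
lift_definition times_endo :: "('a, 'b) endo => ('a, 'b) endo => ('a, 'b) endo"
  is "%g h p. g (h p)" by simp

instance
proof
  show "(0 :: ('a, 'b) endo) \<noteq> 1"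
  proof transfer
    have "(0 :: 'a \<Rightarrow>\<^sub>0 'b) \<noteq> Poly_Mapping.single undefined 1"
      by (metis lookup_single_eq lookup_zero zero_neq_one)
    then show "(%p :: 'a \<Rightarrow>\<^sub>0 'b. 0) \<noteq> (%p. p)" by metis
  qed
qed (transfer; simp add: ac_simps fun_eq_iff)+

end

section \<open>Formal linear combinations of arrows\<close>

abbreviation "single \<equiv> Poly_Mapping.single"
abbreviation "lookup \<equiv> Poly_Mapping.lookup"
abbreviation "keys \<equiv> Poly_Mapping.keys"

definition pscale :: "'k::field => ('m \<Rightarrow>\<^sub>0 'k) => ('m \<Rightarrow>\<^sub>0 'k)" where
  "pscale a p = Poly_Mapping.map ((*) a) p"

lemma lookup_pscale [simp]: "lookup (pscale a p) m = a * lookup p m"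
  by (simp add: pscale_def Poly_Mapping.map.rep_eq when_def)

lemma vector_space_pscale: "vector_space (pscale :: 'k::field => ('m \<Rightarrow>\<^sub>0 'k) => _)"
  by unfold_locales (intro poly_mapping_eqI; simp add: lookup_add algebra_simps)+

text \<open>Presenting combinations by lists allows evaluation in a category by list recursion;
  independence of the presentation is proved afterwards.\<close>

definition plin :: "('k \<times> 'm) list => ('m \<Rightarrow>\<^sub>0 'k::field)" where
  "plin L = (\<Sum>(a, m)\<leftarrow>L. single m a)"

lemma plin_simps [simp]: "plin [] = 0" "plin ((a, m) # L) = single m a + plin L"
  "plin (L @ L') = plin L + plin L'"
  by (simp_all add: plin_def)

lemma ex_plin: "\<exists>L. plin L = (p :: 'm \<Rightarrow>\<^sub>0 'k::field)"
proof (induction "card (keys p)" arbitrary: p)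
  case 0
  then show ?case by (intro exI[of _ "[]"]) simp
next
  case (Suc n)
  then obtain m where m: "m \<in> keys p" by fastforce
  define q where "q = p - single m (lookup p m)"
  have "keys q = keys p - {m}"
    by (auto simp: q_def in_keys_iff lookup_minus lookup_single when_def split: if_splits)
  then have "n = card (keys q)"
    using Suc.hyps(2) m by simp
  then obtain L where "plin L = q" using Suc.hyps(1) by blast
  then show ?case
    by (intro exI[of _ "(lookup p m, m) # L"]) (simp add: q_def)
qed

lemma poly_mapping_induct [case_names single sum]:
  assumes "!!m a. P (single m a)" and "!!p q. P p ==> P q ==> P (p + q)"
  shows "P (p :: 'm \<Rightarrow>\<^sub>0 'k::field)"
proof -
  obtain L where "plin L = p" using ex_plin by blast
  moreover have "P (plin L)" for L
    using assms by (induction L) (auto, metis single_zero)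
  ultimately show ?thesis by blast
qed

text \<open>The map to be extended is typically composition with a fixed arrow, meaningful only on
  the composable arrows \<open>S\<close>; all others have to act by zero.\<close>

definition plift :: "'m set => ('m => 'm) => ('m \<Rightarrow>\<^sub>0 'k::field) => ('m \<Rightarrow>\<^sub>0 'k)" where
  "plift S h p = (\<Sum>m\<in>keys p.
     if m \<in> S then single (h m) (lookup p m) else 0)"

lemma plift_superset:
  assumes "finite A" "keys p \<subseteq> A"
  shows "plift S h p =
    (\<Sum>m\<in>A. if m \<in> S then single (h m) (lookup p m) else 0)"
  unfolding plift_def using assms
  by (intro sum.mono_neutral_left) (auto simp: in_keys_iff)

lemma plift_add: "plift S h (p + q) = plift S h p + plift S h q"
proof -
  let ?A = "keys p \<union> keys q"
  have *: "finite ?A" by simp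
  show ?thesis
    using keys_add[of p q]
    by (simp add: plift_superset[OF *] sum.distrib[symmetric] lookup_add single_add
        cong: if_cong, intro sum.cong) (auto simp: single_add)
qed

lemma plift_zero [simp]: "plift S h 0 = 0"
  by (simp add: plift_def)

lemma plift_single: "plift S h (single m a) =
    (if m \<in> S then single (h m) a else 0)"
  by (cases "a = 0") (auto simp: plift_def)

lemma plift_plin: "plift S h (plin L) = plin (map (map_prod id h) (filter (%(a, m). m \<in> S) L))"
  by (induction L) (auto simp: plift_add plift_single)

lemma plift_pscale: "plift S h (pscale a p) = pscale a (plift S h p)"
proof -
  interpret vector_space pscale by (rule vector_space_pscale)
  have single: "pscale a (single m b) = single m (a * b)" for m b
    by (auto intro!: poly_mapping_eqI simp: lookup_single when_def)
  show ?thesis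
    by (induction p rule: poly_mapping_induct)
      (auto simp: single plift_single plift_add scale_right_distrib)
qed

section \<open>Evaluation of formal combinations and its kernel\<close>

context dg_category
begin

lemma Hom_Arr: "f \<in> Hom C x y n ==> f \<in> Arr C"
  and Hom_dom: "f \<in> Hom C x y n ==> dom C f = x"
  and Hom_cod: "f \<in> Hom C x y n ==> cod C f = y"
  and Arr_Hom: "f \<in> Arr C ==> f \<in> Hom C (dom C f) (cod C f) (deg C f)"
  by (simp_all add: Hom_def)

lemma Hom_Obj: "f \<in> Hom C x y n ==> x \<in> Obj C" "f \<in> Hom C x y n ==> y \<in> Obj C"
  using dom_Obj cod_Obj by (auto simp: Hom_def)

lemma Hom_HomD: "f \<in> Hom C x y n ==> f \<in> Hom C x' y' n' ==> x' = x \<and> y' = y \<and> n' = n"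
  by (auto simp: Hom_def)

lemma zer_add: "f \<in> Hom C x y n ==> add C (zer C x y n) f = f"
  by (metis add_comm add_zer zer_Hom Hom_Obj)

lemma add_left_commute:
  "[|f \<in> Hom C x y n; g \<in> Hom C x y n; h \<in> Hom C x y n|] ==> add C f (add C g h) = add C g (add C f h)"
  using add_assoc[of f x y n g h] add_assoc[of g x y n f h] add_comm[of f x y n g] by simp

lemma zer_unique:
  assumes "f \<in> Hom C x y n" "add C f f = f"
  shows "f = zer C x y n"
proof -
  have "add C (add C f f) (scl C (-1) f) = add C f (add C f (scl C (-1) f))"
    using assms(1) by (intro add_assoc scl_Hom)
  then show ?thesis
    using assms by (simp add: add_neg add_zer)
qed

lemma scl_zero: "f \<in> Hom C x y n ==> scl C 0 f = zer C x y n"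
  by (rule zer_unique) (auto intro: scl_Hom simp: add_scl[symmetric] Hom_Arr)

lemma scl_zer: "x \<in> Obj C ==> y \<in> Obj C ==> scl C a (zer C x y n) = zer C x y n"
  by (rule zer_unique) (auto intro: scl_Hom zer_Hom simp: scl_add[OF zer_Hom zer_Hom, symmetric] add_zer[OF zer_Hom])

lemma dif_idn: assumes x: "x \<in> Obj C" shows "dif C (idn C x) = zer C x x 1"
proof (rule zer_unique)
  have i: "idn C x \<in> Hom C x x 0" by (rule idn_Hom[OF x])
  have d: "dif C (idn C x) \<in> Hom C x x 1" using dif_Hom[OF i] by simp
  show "dif C (idn C x) \<in> Hom C x x 1" by (rule d)
  show "add C (dif C (idn C x)) (dif C (idn C x)) = dif C (idn C x)"
    using dif_cmp[OF i i] by (simp add: cmp_idn_left[OF i] cmp_idn_left[OF d] cmp_idn_right[OF d]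
        scl_one[OF Hom_Arr[OF d]])
qed

text \<open>The component of a formal combination in one Hom space; entries elsewhere are skipped,
  since they cannot be added to those of this space.\<close>

definition evl :: "'o => 'o => int => ('k \<times> 'm) list => 'm" where
  "evl x y n L = foldr (%(a, m) acc. if m \<in> Hom C x y n then add C (scl C a m) acc else acc) L (zer C x y n)"

lemma evl_Hom: "x \<in> Obj C ==> y \<in> Obj C ==> evl x y n L \<in> Hom C x y n"
  by (induction L) (auto simp: evl_def intro!: zer_Hom add_Hom scl_Hom)

lemma evl_Cons: "evl x y n ((a, m) # L) =
    (if m \<in> Hom C x y n then add C (scl C a m) (evl x y n L) else evl x y n L)"
  by (simp add: evl_def)

lemma evl_Nil: "evl x y n [] = zer C x y n"
  by (simp add: evl_def)

lemma evl_append: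
  assumes [simp]: "x \<in> Obj C" "y \<in> Obj C"
  shows "evl x y n (L @ L') = add C (evl x y n L) (evl x y n L')"
  by (induction L) (auto simp: evl_Cons evl_Nil evl_Hom zer_add[OF evl_Hom]
      intro!: add_assoc[OF scl_Hom evl_Hom evl_Hom, symmetric])

text \<open>Commutativity moves all occurrences of \<open>m\<close> to the front, where their
  scalars add up to the coefficient of \<open>m\<close>.\<close>

lemma evl_collect:
  assumes [simp]: "x \<in> Obj C" "y \<in> Obj C" and m: "m \<in> Hom C x y n"
  shows "evl x y n L = add C (scl C (lookup (plin L) m) m)
           (evl x y n (filter (%(a, m'). m' \<noteq> m) L))"
proof (induction L)
  case Nil
  show ?case using m by (simp add: evl_Nil scl_zero zer_add zer_Hom)
next
  case (Cons am L)
  obtain a m' where am: "am = (a, m')" by force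
  let ?E = "evl x y n (filter (%(a, m'). m' \<noteq> m) L)"
  have E: "?E \<in> Hom C x y n" by (simp add: evl_Hom)
  have s: "scl C b m \<in> Hom C x y n" for b using m by (rule scl_Hom)
  show ?case
  proof (cases "m' = m")
    case True
    then show ?thesis using m E s by (simp add: am evl_Cons Cons lookup_add add_scl[OF Hom_Arr[OF m]]
          add_assoc[OF s s, OF E])
  next
    case False
    then show ?thesis using E s by (auto simp: am evl_Cons Cons lookup_add lookup_single when_def
          intro: add_left_commute scl_Hom)
  qed
qed

lemma plin_filter: "plin L = 0 ==> plin (filter (%(a, m'). m' \<noteq> m) L) = 0"
proof (rule poly_mapping_eqI)
  fix k assume "plin L = 0"
  then have "lookup (plin L) k = 0" by simp
  then show "lookup (plin (filter (%(a, m'). m' \<noteq> m) L)) k = lookup 0 k"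
  proof (cases "k = m")
    case True
    then show ?thesis by (induction L) (auto simp: lookup_add lookup_single when_def)
  next
    case False
    then have "lookup (plin (filter (%(a, m'). m' \<noteq> m) L)) k = lookup (plin L) k"
      by (induction L) (auto simp: lookup_add lookup_single when_def)
    then show ?thesis using \<open>lookup (plin L) k = 0\<close> by simp
  qed
qed

text \<open>Induction on the length: the arrow at the head of the list has total coefficient zero,
  so all its occurrences can be deleted at once.\<close>

lemma evl_zero:
  assumes [simp]: "x \<in> Obj C" "y \<in> Obj C" and "plin L = 0"
  shows "evl x y n L = zer C x y n"
  using assms(3)
proof (induction "length L" arbitrary: L rule: less_induct)
  case less
  show ?case
  proof (cases L)
    case Nil
    then show ?thesis by (simp add: evl_Nil)
  next
    case (Cons am L')
    obtain a m where am: "am = (a, m)" by force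
    show ?thesis
    proof (cases "m \<in> Hom C x y n")
      case True
      let ?L = "filter (%(a, m'). m' \<noteq> m) L"
      have "length ?L < length L" using Cons am by (simp add: le_imp_less_Suc)
      then have "evl x y n ?L = zer C x y n"
        using less.prems by (intro less.hyps) (auto intro: plin_filter)
      then show ?thesis using evl_collect[OF assms(1,2) True, of L] less.prems True
        by (simp add: scl_zero add_zer[OF zer_Hom])
    next
      case False
      then have "evl x y n L = evl x y n (filter (%(a, m'). m' \<noteq> m) L)"
      proof -
        have "evl x y n M = evl x y n (filter (%(a, m'). m' \<noteq> m) M)" for M
          using False by (induction M) (auto simp: evl_Cons)
        then show ?thesis .
      qed
      moreover have "length (filter (%(a, m'). m' \<noteq> m) L) < length L"
        using Cons am by (simp add: le_imp_less_Suc)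
      ultimately show ?thesis using less by (metis plin_filter)
    qed
  qed
qed

text \<open>The formal combinations that are zero in the category. One presenting list is enough,
  because by \<open>pkerD\<close> every other list has the same components.\<close>

definition pker :: "('m \<Rightarrow>\<^sub>0 'k) set" where
  "pker = {p. \<exists>L. plin L = p \<and> (\<forall>x\<in>Obj C. \<forall>y\<in>Obj C. \<forall>n. evl x y n L = zer C x y n)}"

lemma pkerI: "(!!x y n. x \<in> Obj C ==> y \<in> Obj C ==> evl x y n L = zer C x y n) ==> plin L \<in> pker"
  by (auto simp: pker_def)

lemma pkerD:
  assumes "plin L \<in> pker" and [simp]: "x \<in> Obj C" "y \<in> Obj C"
  shows "evl x y n L = zer C x y n"
proof -
  obtain M where M: "plin M = plin L" "evl x y n M = zer C x y n"
    using assms by (auto simp: pker_def)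
  \<comment> \<open>Appending the negative of the known presentation to \<open>L\<close> presents
    zero, where \<open>evl_zero\<close> applies.\<close>
  define N where "N = map (map_prod uminus id) M"
  have "plin N = - plin M"
    unfolding N_def by (induction M) (auto simp: single_uminus)
  moreover have "evl x y n (map (map_prod uminus id) M) = scl C (-1) (evl x y n M)"
    by (induction M) (auto simp: evl_Cons evl_Nil scl_zer scl_add[OF scl_Hom evl_Hom] scl_scl Hom_Arr)
  ultimately have "evl x y n (N @ L) = zer C x y n" and "evl x y n N = zer C x y n"
    using M by (auto intro!: evl_zero simp: N_def scl_zer)
  then show ?thesis
    by (simp add: evl_append zer_add evl_Hom)
qed

lemma pker_subspace: "module.subspace pscale pker"
proof -
  interpret vector_space "pscale :: 'k => ('m \<Rightarrow>\<^sub>0 'k) => _" by (rule vector_space_pscale)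
  show ?thesis
  proof (rule subspaceI)
    show "0 \<in> pker" using pkerI[of "[]"] by (simp add: evl_Nil)
  next
    fix p q assume "p \<in> pker" "q \<in> pker"
    moreover obtain L M where "p = plin L" "q = plin M" by (metis ex_plin)
    ultimately show "p + q \<in> pker"
      using pkerI[of "L @ M"] by (simp add: evl_append pkerD add_zer zer_Hom)
  next
    fix c p assume p: "p \<in> pker"
    obtain L where L: "p = plin L" by (metis ex_plin)
    have "pscale c (plin M) = plin (map (map_prod ((*) c) id) M)" for M :: "('k \<times> 'm) list"
      by (induction M) (auto intro!: poly_mapping_eqI simp: lookup_add lookup_single when_def algebra_simps)
    moreover have "evl x y n (map (map_prod ((*) c) id) M) = scl C c (evl x y n M)"
      if "x \<in> Obj C" "y \<in> Obj C" for x y n M using that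
      by (induction M) (auto simp: evl_Cons evl_Nil scl_zer scl_add[OF scl_Hom evl_Hom] scl_scl Hom_Arr)
    ultimately show "pscale c p \<in> pker"
      using p pkerI[of "map (map_prod ((*) c) id) L"] by (simp add: L pkerD scl_zer)
  qed
qed

text \<open>
  Modulo the kernel, formal combinations of arrows form the sum of all the spaces \<open>Hom x y n\<close>, on
  which arrows and the differential act.  A linear projection along the kernel makes this quotient
  a subspace, so that everything acts on one fixed type.
\<close>

definition pproj :: "('m \<Rightarrow>\<^sub>0 'k) => ('m \<Rightarrow>\<^sub>0 'k)" where
  "pproj = (SOME h. (\<forall>p q. h (p + q) = h p + h q) \<and> (\<forall>a p. h (pscale a p) = pscale a (h p)) \<and>
     (\<forall>p. h p = 0 \<longleftrightarrow> p \<in> pker) \<and> (\<forall>p. p - h p \<in> pker))"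

text \<open>Extend a basis of the kernel to a basis of the whole space, kill the former and fix the
  added vectors.\<close>

lemma pproj_ex: "\<exists>h :: ('m \<Rightarrow>\<^sub>0 'k) => ('m \<Rightarrow>\<^sub>0 'k).
   (\<forall>p q. h (p + q) = h p + h q) \<and> (\<forall>a p. h (pscale a p) = pscale a (h p)) \<and>
     (\<forall>p. h p = 0 \<longleftrightarrow> p \<in> pker) \<and> (\<forall>p. p - h p \<in> pker)"
proof -
  interpret vector_space "pscale :: 'k => ('m \<Rightarrow>\<^sub>0 'k) => _" by (rule vector_space_pscale)
  interpret vp: vector_space_pair "pscale :: 'k => ('m \<Rightarrow>\<^sub>0 'k) => _" "pscale :: 'k => ('m \<Rightarrow>\<^sub>0 'k) => _" ..
  obtain B where B: "B \<subseteq> pker" "independent B" "pker \<subseteq> span B"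
    by (rule maximal_independent_subset)
  define E where "E = extend_basis B"
  have E: "independent E" "span E = UNIV" "B \<subseteq> E"
    using B(2) by (auto simp: E_def independent_extend_basis extend_basis_superset)
  define h where "h = vp.construct E (%b. if b \<in> B then 0 else b)"
  have lin: "Vector_Spaces.linear pscale pscale h"
    unfolding h_def by (rule vp.linear_construct[OF E(1)])
  interpret h: Vector_Spaces.linear pscale pscale h by (rule lin)
  have hE: "h b = (if b \<in> B then 0 else b)" if "b \<in> E" for b
    unfolding h_def by (rule vp.construct_basis[OF E(1) that])
  have "h p = 0" if "p \<in> pker" for p
  proof (rule h.eq_0_on_span)
    show "p \<in> span B" using that B(3) by blast
    show "h b = 0" if "b \<in> B" for b using that hE E(3) by auto
  qed
  moreover have diff: "p - h p \<in> pker" for p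
  proof -
    have "p \<in> span E" by (simp add: E)
    then show ?thesis
    proof (induction rule: span_induct_alt)
      case base
      show ?case using subspace_0[OF pker_subspace] by simp
    next
      case (step c b q)
      have "pscale c b + q - h (pscale c b + q) = pscale c (b - h b) + (q - h q)"
        by (simp add: h.add h.scale scale_right_diff_distrib)
      moreover have "b - h b \<in> pker" using hE[OF step(1)] B(1) subspace_0[OF pker_subspace] by auto
      ultimately show ?case
        using step(2) subspace_add[OF pker_subspace] subspace_scale[OF pker_subspace] by metis
    qed
  qed
  ultimately have "h p = 0 \<longleftrightarrow> p \<in> pker" for p
    by (metis diff_zero)
  then show ?thesis
    using h.add h.scale diff by (intro exI[of _ h]) blast
qed

lemma pproj_add: "pproj (p + q) = pproj p + pproj q"
  and pproj_pscale: "pproj (pscale a p) = pscale a (pproj p)"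
  and pproj_0_iff: "pproj p = 0 \<longleftrightarrow> p \<in> pker"
  and pproj_pker: "p - pproj p \<in> pker"
  using someI_ex[OF pproj_ex] unfolding pproj_def[symmetric] by auto

lemma pproj_eqI: "p - q \<in> pker ==> pproj p = pproj q"
  by (metis diff_add_cancel pproj_0_iff pproj_add add_0)

lemma pproj_diff: "pproj (p - q) = pproj p - pproj q"
  by (metis diff_add_cancel add_diff_cancel_right' pproj_add)

lemma pproj_zero [simp]: "pproj 0 = 0"
  by (metis add_cancel_right_right pproj_add)

text \<open>The outer \<open>pproj\<close> makes values equal as soon as they agree modulo the
  kernel; that the argument matters only modulo the kernel needs \<open>hlin\<close>
  (\<open>pop_pproj\<close>).\<close>

definition pop :: "'m set => ('m => 'm) => ('m, 'k) endo" where
  "pop S h = Abs_endo (%p. pproj (plift S h p))"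

lemma Rep_pop: "Rep_endo (pop S h) p = pproj (plift S h p)"
  by (simp add: pop_def Abs_endo_inverse plift_add pproj_add)

lemma Rep_endo_zero: "Rep_endo (g :: ('m, 'k) endo) 0 = 0"
  using Rep_endo[of g] by (metis (mono_tags, lifting) add_cancel_right_right mem_Collect_eq)

lemma endo_ext:
  assumes "!!m. Rep_endo g (single m 1) = Rep_endo h (single m 1)"
    and "!!a p. Rep_endo g (pscale a p) = pscale a (Rep_endo g p)"
    and "!!a p. Rep_endo h (pscale a p) = pscale a (Rep_endo h p)"
  shows "g = (h :: ('m, 'k) endo)"
proof -
  have s1: "single m b = pscale b (single m 1)" for m :: 'm and b :: 'k
    by (auto intro!: poly_mapping_eqI simp: lookup_single when_def)
  have "Rep_endo g p = Rep_endo h p" for p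
  proof (induction p rule: poly_mapping_induct)
    case (single m b)
    show ?case by (simp only: s1[of m b] assms)
  next
    case (sum p q)
    then show ?case using Rep_endo[of g] Rep_endo[of h] by simp
  qed
  then show ?thesis by (metis Rep_endo_inject ext)
qed

text \<open>A homogeneous linear partial map, in the form that makes it act on the quotient.\<close>

definition hlin :: "'m set => ('m => 'm) => bool" where
  "hlin S h \<longleftrightarrow> (\<forall>x\<in>Obj C. \<forall>y\<in>Obj C. \<forall>n. (\<forall>m\<in>S. h m \<notin> Hom C x y n) \<or>
     (\<exists>x'\<in>Obj C. \<exists>y'\<in>Obj C. \<exists>n'. {m \<in> S. h m \<in> Hom C x y n} = Hom C x' y' n' \<and>
        (\<forall>f\<in>Hom C x' y' n'. \<forall>g\<in>Hom C x' y' n'. h (add C f g) = add C (h f) (h g)) \<and>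
        (\<forall>f\<in>Hom C x' y' n'. \<forall>a. h (scl C a f) = scl C a (h f))))"

text \<open>The component of the lifted combination in a Hom space is \<open>h\<close> applied to
  the component of \<open>p\<close> in the one Hom space that \<open>h\<close> sends there, or zero
  if there is none.\<close>

lemma plift_pker:
  assumes "hlin S h" "p \<in> pker"
  shows "plift S h p \<in> pker"
proof -
  obtain L where L: "p = plin L" by (metis ex_plin)
  let ?M = "%L. map (map_prod id h) (filter (%(a, m). m \<in> S) L)"
  have "plin (?M L) \<in> pker"
  proof (rule pkerI)
    fix x y n assume xy: "x \<in> Obj C" "y \<in> Obj C"
    have "(\<forall>m\<in>S. h m \<notin> Hom C x y n) \<or>
     (\<exists>x'\<in>Obj C. \<exists>y'\<in>Obj C. \<exists>n'. {m \<in> S. h m \<in> Hom C x y n} = Hom C x' y' n' \<and>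
        (\<forall>f\<in>Hom C x' y' n'. \<forall>g\<in>Hom C x' y' n'. h (add C f g) = add C (h f) (h g)) \<and>
        (\<forall>f\<in>Hom C x' y' n'. \<forall>a. h (scl C a f) = scl C a (h f)))" (is "?none \<or> ?some")
      using assms(1) xy unfolding hlin_def by blast
    then show "evl x y n (?M L) = zer C x y n"
    proof
      assume ?none
      then show ?thesis by (induction L) (auto simp: evl_Nil evl_Cons)
    next
      assume ?some
      then obtain x' y' n' where some: "x' \<in> Obj C" "y' \<in> Obj C"
        "{m \<in> S. h m \<in> Hom C x y n} = Hom C x' y' n'"
        "!!f g. f\<in>Hom C x' y' n' ==> g\<in>Hom C x' y' n' ==> h (add C f g) = add C (h f) (h g)"
        "!!f a. f\<in>Hom C x' y' n' ==> h (scl C a f) = scl C a (h f)"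
        by blast
      have iff: "m \<in> Hom C x' y' n' \<longleftrightarrow> m \<in> S \<and> h m \<in> Hom C x y n" for m
        using some(3) by auto
      have hH: "h m \<in> Hom C x y n" if "m \<in> Hom C x' y' n'" for m using that iff by blast
      have z: "h (zer C x' y' n') = zer C x y n"
      proof (rule zer_unique)
        have z': "zer C x' y' n' \<in> Hom C x' y' n'" by (rule zer_Hom[OF some(1,2)])
        show "h (zer C x' y' n') \<in> Hom C x y n" by (rule hH[OF z'])
        show "add C (h (zer C x' y' n')) (h (zer C x' y' n')) = h (zer C x' y' n')"
          using some(4)[OF z' z'] by (simp add: add_zer[OF z'])
      qed
      have "evl x y n (?M L) = h (evl x' y' n' L)"
      proof (induction L)
        case Nil
        show ?case by (simp add: evl_Nil z)
      next
        case (Cons am L)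
        obtain a m where am: "am = (a, m)" by force
        have "h (add C (scl C a m) (evl x' y' n' L)) = add C (scl C a (h m)) (h (evl x' y' n' L))"
          if "m \<in> Hom C x' y' n'"
          using some(4)[OF scl_Hom[OF that] evl_Hom[OF some(1,2)]] some(5)[OF that] by simp
        then show ?case using Cons by (auto simp: am evl_Cons iff)
      qed
      then show ?thesis using assms(2) some(1,2) by (simp add: L pkerD z)
    qed
  qed
  then show ?thesis by (simp add: L plift_plin)
qed

lemma pop_pproj: "hlin S h ==> Rep_endo (pop S h) (pproj p) = Rep_endo (pop S h) p"
proof -
  assume "hlin S h"
  then have "pproj (plift S h (p - pproj p)) = 0"
    using plift_pker pproj_pker pproj_0_iff by blast
  moreover have "plift S h p = plift S h (p - pproj p) + plift S h (pproj p)"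
    by (simp add: plift_add[symmetric])
  ultimately show ?thesis
    by (simp add: Rep_pop pproj_add)
qed

lemma pproj_single_add:
  assumes "f \<in> Hom C x y n" "g \<in> Hom C x y n"
  shows "pproj (single (add C f g) 1)
    = pproj (single f 1) + pproj (single g 1)"
proof -
  have "plin [(1, add C f g), (-1, f), (-1, g)] \<in> pker"
  proof (rule pkerI)
    fix x' y' n' assume xy: "x' \<in> Obj C" "y' \<in> Obj C"
    have n: "scl C (-1) f \<in> Hom C x y n" "scl C (-1) g \<in> Hom C x y n" and a: "add C f g \<in> Hom C x y n"
      using assms by (auto intro: scl_Hom add_Hom)
    have z: "zer C x y n \<in> Hom C x y n" using Hom_Obj[OF assms(1)] by (rule zer_Hom)
    have "add C (add C f g) (add C (scl C (-1) f) (scl C (-1) g))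
        = add C f (add C g (add C (scl C (-1) f) (scl C (-1) g)))"
      by (rule add_assoc[OF assms add_Hom[OF n]])
    also have "... = add C f (add C (scl C (-1) f) (add C g (scl C (-1) g)))"
      by (simp only: add_left_commute[OF assms(2) n])
    also have "... = zer C x y n"
      by (simp only: add_neg[OF assms(2)] add_zer[OF n(1)] add_neg[OF assms(1)])
    finally have sum: "add C (add C f g) (add C (scl C (-1) f) (scl C (-1) g)) = zer C x y n" .
    show "evl x' y' n' [(1, add C f g), (-1, f), (-1, g)] = zer C x' y' n'"
    proof (cases "x' = x \<and> y' = y \<and> n' = n")
      case True
      then show ?thesis
        using assms a by (simp add: evl_Cons evl_Nil scl_one[OF Hom_Arr[OF a]] add_zer[OF n(2)] sum)
    next
      case False
      then have "f \<notin> Hom C x' y' n'" "g \<notin> Hom C x' y' n'" "add C f g \<notin> Hom C x' y' n'"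
        using Hom_HomD[OF assms(1)] Hom_HomD[OF assms(2)] Hom_HomD[OF a] by blast+
      then show ?thesis by (simp add: evl_Cons evl_Nil)
    qed
  qed
  then have "pproj (plin [(1, add C f g), (-1, f), (-1, g)]) = 0"
    by (simp add: pproj_0_iff)
  moreover have "plin [(1, add C f g), (-1, f), (-1, g)] = single (add C f g) 1
     - (single f 1 + single g 1)"
    by (simp add: single_uminus)
  ultimately show ?thesis
    by (metis pproj_add pproj_diff right_minus_eq)
qed

lemma pproj_single_scl:
  assumes "f \<in> Hom C x y n"
  shows "pproj (single (scl C a f) 1) = pscale a (pproj (single f 1))"
proof -
  have "plin [(1, scl C a f), (- a, f)] \<in> pker"
  proof (rule pkerI)
    fix x' y' n' assume xy: "x' \<in> Obj C" "y' \<in> Obj C"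
    have n: "scl C b f \<in> Hom C x y n" for b
      using assms by (auto intro: scl_Hom)
    have "add C (scl C a f) (scl C (- a) f) = zer C x y n"
      using add_neg[OF n] by (simp add: scl_scl Hom_Arr[OF assms])
    then have sum: "add C (scl C a f) (scl C (- a) f) = zer C x y n" .
    show "evl x' y' n' [(1, scl C a f), (- a, f)] = zer C x' y' n'"
    proof (cases "x' = x \<and> y' = y \<and> n' = n")
      case True
      then show ?thesis
        using assms by (simp add: evl_Cons evl_Nil n scl_one[OF Hom_Arr[OF n]] add_zer[OF n] sum)
    next
      case False
      then have "f \<notin> Hom C x' y' n'" "scl C a f \<notin> Hom C x' y' n'"
        using Hom_HomD[OF assms(1)] Hom_HomD[OF n] by blast+
      then show ?thesis by (simp add: evl_Cons evl_Nil)
    qed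
  qed
  then have "pproj (plin [(1, scl C a f), (- a, f)]) = 0"
    by (simp add: pproj_0_iff)
  moreover have "plin [(1, scl C a f), (- a, f)] = single (scl C a f) 1
     - pscale a (single f 1)"
    by (auto intro!: poly_mapping_eqI simp: lookup_add lookup_minus lookup_single when_def)
  ultimately show ?thesis
    by (simp only: pproj_diff pproj_pscale right_minus_eq)
qed

lemma pproj_single_zer: "x \<in> Obj C ==> y \<in> Obj C ==> pproj (single (zer C x y n) 1) = 0"
  using pproj_single_add[OF zer_Hom zer_Hom, of x y n] by (simp add: add_zer[OF zer_Hom])

text \<open>The combination \<open>f\<close> minus \<open>g\<close> lies in the kernel, and its
  component in their common Hom space is the difference of the two arrows.\<close>

lemma pproj_single_inj:
  assumes "f \<in> Hom C x y n" "g \<in> Hom C x y n"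
    and "pproj (single f 1) = pproj (single g 1)"
  shows "f = g"
proof -
  have xy: "x \<in> Obj C" "y \<in> Obj C" using Hom_Obj assms(1) by auto
  have n: "scl C (-1) g \<in> Hom C x y n" using assms by (auto intro: scl_Hom)
  have "plin [(1, f), (-1, g)] \<in> pker"
    using assms(3) by (simp add: pproj_0_iff[symmetric] single_uminus pproj_diff)
  then have "evl x y n [(1, f), (-1, g)] = zer C x y n"
    using xy by (rule pkerD)
  then have *: "add C f (scl C (-1) g) = zer C x y n"
    using assms n xy by (simp add: evl_Cons evl_Nil scl_one Hom_Arr add_zer)
  have "f = add C f (add C (scl C (-1) g) g)"
    using assms n by (simp add: add_comm[OF n] add_neg add_zer)
  also have "... = add C (zer C x y n) g"
    using assms n by (simp add: add_assoc[symmetric] *)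
  finally show ?thesis
    using assms by (simp add: zer_add)
qed

end

section \<open>Arrows, the differential and scalars as operators\<close>

definition rho :: "('k::field, 'o, 'm) dgcat => 'm => ('m, 'k) endo" where
  "rho C f = dg_category.pop C {m \<in> Arr C. cod C m = dom C f} (cmp C f)"

definition prt :: "('k::field, 'o, 'm) dgcat => ('m, 'k) endo" where
  "prt C = dg_category.pop C (Arr C) (dif C)"

lift_definition kap :: "'k::field => ('m, 'k) endo" is pscale
  by (auto intro!: poly_mapping_eqI simp: lookup_add algebra_simps)

lemma kap_1 [simp]: "kap 1 = 1"
  by transfer (auto intro!: poly_mapping_eqI)

lemma kap_add: "kap (a + b) = kap a + kap b"
  by transfer (auto intro!: poly_mapping_eqI simp: lookup_add algebra_simps)

lemma kap_sg [simp]: "kap (sg n) = sg n"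
proof -
  have "kap (- 1) = - 1"
    by transfer (auto intro!: poly_mapping_eqI)
  then show ?thesis by (auto simp: sg_def)
qed

lemma kap_mult: "kap (a * b) = kap a * kap b"
  by transfer (auto intro!: poly_mapping_eqI simp: algebra_simps)

context dg_category
begin

text \<open>If the composite of \<open>f\<close> with \<open>g\<close> lies in
  \<open>Hom C x' z' n'\<close>, then \<open>z' = z\<close> and \<open>g\<close> lies in
  \<open>Hom C x' y (n' - m)\<close>; so the preimage of a Hom space is empty or a single Hom
  space.\<close>

lemma hlin_cmp:
  assumes f: "f \<in> Hom C y z m"
  shows "hlin {m \<in> Arr C. cod C m = dom C f} (cmp C f)"
  unfolding hlin_def
proof (intro ballI allI)
  fix x' z' n' assume xz: "x' \<in> Obj C" "z' \<in> Obj C"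
  let ?S = "{m \<in> Arr C. cod C m = dom C f}"
  have y: "dom C f = y" "y \<in> Obj C" using f Hom_Obj by (auto simp: Hom_def)
  have S: "cmp C f g \<in> Hom C (dom C g) z (m + deg C g)" if "g \<in> ?S" for g
    using that cmp_Hom[OF f] y by (auto dest: Arr_Hom)
  show "(\<forall>m\<in>?S. cmp C f m \<notin> Hom C x' z' n') \<or>
     (\<exists>x\<in>Obj C. \<exists>y\<in>Obj C. \<exists>n. {m \<in> ?S. cmp C f m \<in> Hom C x' z' n'} = Hom C x y n \<and>
        (\<forall>g\<in>Hom C x y n. \<forall>h\<in>Hom C x y n. cmp C f (add C g h) = add C (cmp C f g) (cmp C f h)) \<and>
        (\<forall>g\<in>Hom C x y n. \<forall>a. cmp C f (scl C a g) = scl C a (cmp C f g)))"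
  proof (cases "z' = z")
    case False
    have "cmp C f g \<notin> Hom C x' z' n'" if "g \<in> ?S" for g
      using False Hom_HomD[OF S[OF that]] by blast
    then show ?thesis by blast
  next
    case True
    have "{m \<in> ?S. cmp C f m \<in> Hom C x' z' n'} = Hom C x' y (n' - m)"
    proof (intro set_eqI iffI)
      fix g assume "g \<in> {m \<in> ?S. cmp C f m \<in> Hom C x' z' n'}"
      then have g: "g \<in> ?S" "cmp C f g \<in> Hom C x' z' n'" by auto
      show "g \<in> Hom C x' y (n' - m)"
        using g(1) Hom_HomD[OF S[OF g(1)] g(2)] y(1) by (simp add: Hom_def)
    next
      fix g assume g: "g \<in> Hom C x' y (n' - m)"
      show "g \<in> {m \<in> ?S. cmp C f m \<in> Hom C x' z' n'}"
        using cmp_Hom[OF f g] g y True by (simp add: Hom_def)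
    qed
    moreover have "\<forall>g\<in>Hom C x' y (n' - m). \<forall>h\<in>Hom C x' y (n' - m).
        cmp C f (add C g h) = add C (cmp C f g) (cmp C f h)"
      by (intro ballI cmp_add_right[OF f])
    moreover have "\<forall>g\<in>Hom C x' y (n' - m). \<forall>a. cmp C f (scl C a g) = scl C a (cmp C f g)"
      by (intro ballI allI cmp_scl_right[OF f])
    ultimately show ?thesis using xz(1) y(2) by blast
  qed
qed

lemma hlin_dif: "hlin (Arr C) (dif C)"
  unfolding hlin_def
proof (intro ballI allI disjI2)
  fix x y n assume xy: "x \<in> Obj C" "y \<in> Obj C"
  have "{m \<in> Arr C. dif C m \<in> Hom C x y n} = Hom C x y (n - 1)"
  proof (intro set_eqI iffI)
    fix g assume "g \<in> {m \<in> Arr C. dif C m \<in> Hom C x y n}"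
    then have g: "g \<in> Arr C" "dif C g \<in> Hom C x y n" by auto
    show "g \<in> Hom C x y (n - 1)"
      using g(1) Hom_HomD[OF dif_Hom[OF Arr_Hom[OF g(1)]] g(2)] by (simp add: Hom_def)
  next
    fix g assume g: "g \<in> Hom C x y (n - 1)"
    then show "g \<in> {m \<in> Arr C. dif C m \<in> Hom C x y n}"
      using dif_Hom[OF g] by (simp add: Hom_def)
  qed
  then show "\<exists>x'\<in>Obj C. \<exists>y'\<in>Obj C. \<exists>n'. {m \<in> Arr C. dif C m \<in> Hom C x y n} = Hom C x' y' n' \<and>
        (\<forall>f\<in>Hom C x' y' n'. \<forall>g\<in>Hom C x' y' n'. dif C (add C f g) = add C (dif C f) (dif C g)) \<and>
        (\<forall>f\<in>Hom C x' y' n'. \<forall>a. dif C (scl C a f) = scl C a (dif C f))"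
    using xy dif_add[of _ x y "n - 1"] dif_scl[of _ x y "n - 1"] by blast
qed

lemma Rep_pop_scale: "Rep_endo (pop S h) (pscale a p) = pscale a (Rep_endo (pop S h) p)"
  by (simp add: Rep_pop plift_pscale pproj_pscale)

lemma Rep_simps: "Rep_endo (g * h) p = Rep_endo g (Rep_endo h p)"
  "Rep_endo (g + h) p = Rep_endo g p + Rep_endo h p" "Rep_endo 0 p = 0"
  "Rep_endo (g - h) p = Rep_endo g p - Rep_endo h p" "Rep_endo (kap a) p = pscale a p"
  "Rep_endo (- g) p = - Rep_endo g p" "Rep_endo 1 p = p"
  by (transfer; simp)+

lemma Rep_sg: "Rep_endo (sg n) p = pscale (sg n) p"
  unfolding kap_sg[symmetric] by (rule Rep_simps)

lemma pscale_simps: "pscale a (p + q) = pscale a p + pscale a q" "pscale a (p - q) = pscale a p - pscale a q"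
  "pscale a (pscale b p) = pscale (a * b) p" "pscale a 0 = 0" "pscale a (- p) = - pscale a p"
  by (auto intro!: poly_mapping_eqI simp: lookup_add lookup_minus algebra_simps)

lemma Rep_rho_single: "Rep_endo (rho C f) (single m 1) =
    (if m \<in> Arr C \<and> cod C m = dom C f then pproj (single (cmp C f m) 1) else 0)"
  by (simp add: rho_def Rep_pop plift_single)

lemma Rep_prt_single: "Rep_endo (prt C) (single m 1) =
    (if m \<in> Arr C then pproj (single (dif C m) 1) else 0)"
  by (simp add: prt_def Rep_pop plift_single)

lemma Rep_rho_pproj: "f \<in> Arr C ==> Rep_endo (rho C f) (pproj p) = Rep_endo (rho C f) p"
  unfolding rho_def by (rule pop_pproj[OF hlin_cmp[OF Arr_Hom]])

lemma Rep_prt_pproj: "Rep_endo (prt C) (pproj p) = Rep_endo (prt C) p"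
  unfolding prt_def by (rule pop_pproj[OF hlin_dif])

lemma Rep_rho_scale: "Rep_endo (rho C f) (pscale a p) = pscale a (Rep_endo (rho C f) p)"
  and Rep_prt_scale: "Rep_endo (prt C) (pscale a p) = pscale a (Rep_endo (prt C) p)"
  by (simp_all add: rho_def prt_def Rep_pop_scale)

lemmas Rep_scale = Rep_rho_scale Rep_prt_scale Rep_simps Rep_sg pscale_simps mult.commute

lemma rho_add: "[|f \<in> Hom C x y n; g \<in> Hom C x y n|] ==> rho C (add C f g) = rho C f + rho C g"
proof (rule endo_ext)
  fix m assume fg: "f \<in> Hom C x y n" "g \<in> Hom C x y n"
  note d = Hom_dom[OF fg(1)] Hom_dom[OF fg(2)] Hom_dom[OF add_Hom[OF fg]]
  show "Rep_endo (rho C (add C f g)) (single m 1)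
    = Rep_endo (rho C f + rho C g) (single m 1)"
  proof (cases "m \<in> Arr C \<and> cod C m = x")
    case True
    then have m: "m \<in> Hom C (dom C m) x (deg C m)" by (auto dest: Arr_Hom)
    show ?thesis using True d pproj_single_add[OF cmp_Hom[OF fg(1) m] cmp_Hom[OF fg(2) m]]
      by (simp add: Rep_rho_single Rep_simps cmp_add_left[OF fg m])
  qed (auto simp: Rep_rho_single Rep_simps d)
qed (simp_all add: Rep_scale)

lemma rho_scl: "f \<in> Arr C ==> rho C (scl C a f) = kap a * rho C f"
proof (rule endo_ext)
  fix m assume "f \<in> Arr C"
  then have f: "f \<in> Hom C (dom C f) (cod C f) (deg C f)" by (rule Arr_Hom)
  note d = Hom_dom[OF scl_Hom[OF f], of a]
  show "Rep_endo (rho C (scl C a f)) (single m 1)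
    = Rep_endo (kap a * rho C f) (single m 1)"
  proof (cases "m \<in> Arr C \<and> cod C m = dom C f")
    case True
    then have m: "m \<in> Hom C (dom C m) (dom C f) (deg C m)" by (auto dest: Arr_Hom)
    show ?thesis using True d pproj_single_scl[OF cmp_Hom[OF f m]]
      by (simp add: Rep_rho_single Rep_simps cmp_scl_left[OF f m])
  qed (auto simp: Rep_rho_single Rep_simps d pscale_simps)
qed (simp_all add: Rep_scale)

lemma rho_cmp:
  assumes g: "g \<in> Hom C y z m" and f: "f \<in> Hom C x y n"
  shows "rho C (cmp C g f) = rho C g * rho C f"
proof (rule endo_ext)
  fix l
  show "Rep_endo (rho C (cmp C g f)) (single l 1)
    = Rep_endo (rho C g * rho C f) (single l 1)"
  proof (cases "l \<in> Arr C \<and> cod C l = x")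
    case True
    then have l: "l \<in> Hom C (dom C l) x (deg C l)" by (auto dest: Arr_Hom)
    have fl: "cmp C f l \<in> Hom C (dom C l) y (n + deg C l)" by (rule cmp_Hom[OF f l])
    show ?thesis
      using True Hom_dom[OF f] Hom_dom[OF g] Hom_dom[OF cmp_Hom[OF g f]] Hom_Arr[OF fl] Hom_cod[OF fl]
      by (simp add: Rep_rho_single Rep_simps Rep_rho_pproj[OF Hom_Arr[OF g]] cmp_assoc[OF g f l])
  next
    case False
    then show ?thesis using Hom_dom[OF f] Hom_dom[OF cmp_Hom[OF g f]]
      by (auto simp: Rep_rho_single Rep_simps Rep_endo_zero)
  qed
qed (simp_all add: Rep_scale)

text \<open>Both operators are evaluated at the identity of the source, which returns the classes of
  \<open>f\<close> and \<open>g\<close>.\<close>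

lemma rho_inj:
  assumes f: "f \<in> Hom C x y n" and g: "g \<in> Hom C x y n" and eq: "rho C f = rho C g"
  shows "f = g"
proof -
  have i: "idn C x \<in> Hom C x x 0" using idn_Hom Hom_Obj(1)[OF f] .
  have "pproj (single f 1) = Rep_endo (rho C f) (single (idn C x) 1)"
    using i by (simp add: Rep_rho_single Hom_dom[OF f] Hom_def cmp_idn_right[OF f])
  also have "... = pproj (single g 1)"
    using i by (simp add: eq Rep_rho_single Hom_dom[OF g] Hom_def cmp_idn_right[OF g])
  finally show ?thesis
    by (rule pproj_single_inj[OF f g])
qed

text \<open>The Leibniz rule, solved for the term in which \<open>f\<close> is differentiated. It
  replaces all later appeals to Leibniz by associativity of operators.\<close>

lemma rho_dif:
  assumes f: "f \<in> Hom C x y n"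
  shows "rho C (dif C f) = prt C * rho C f - sg n * (rho C f * prt C)"
proof (rule endo_ext)
  fix l
  show "Rep_endo (rho C (dif C f)) (single l 1)
    = Rep_endo (prt C * rho C f - sg n * (rho C f * prt C)) (single l 1)"
  proof (cases "l \<in> Arr C \<and> cod C l = x")
    case True
    then have l: "l \<in> Hom C (dom C l) x (deg C l)" by (auto dest: Arr_Hom)
    note dl = dif_Hom[OF l] and df = dif_Hom[OF f] and fl = cmp_Hom[OF f l]
    have fdl: "cmp C f (dif C l) \<in> Hom C (dom C l) y (n + deg C l + 1)"
      using cmp_Hom[OF f dl] by (simp add: add.assoc)
    have dfl: "cmp C (dif C f) l \<in> Hom C (dom C l) y (n + deg C l + 1)"
      using cmp_Hom[OF df l] by (simp add: ac_simps)
    have sfdl: "scl C (sg n) (cmp C f (dif C l)) \<in> Hom C (dom C l) y (n + deg C l + 1)"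
      using fdl by (rule scl_Hom)
    have "pproj (single (dif C (cmp C f l)) 1) = pproj (single (cmp C (dif C f) l) 1)
       + pscale (sg n) (pproj (single (cmp C f (dif C l)) 1))"
      unfolding dif_cmp[OF f l] powi_sg
      using pproj_single_add[OF dfl sfdl] pproj_single_scl[OF fdl] by simp
    then show ?thesis
      using True Hom_dom[OF f] Hom_dom[OF df] Hom_Arr[OF dl] Hom_cod[OF dl] Hom_Arr[OF fl]
      by (simp add: Rep_rho_single Rep_prt_single Rep_simps Rep_sg Rep_rho_pproj[OF Hom_Arr[OF f]] Rep_prt_pproj)
  next
    case False
    then have "\<not> (l \<in> Arr C \<and> cod C (dif C l) = x)"
      using Hom_cod[OF dif_Hom[OF Arr_Hom]] by auto
    then show ?thesis using False Hom_dom[OF f] Hom_dom[OF dif_Hom[OF f]]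
      by (auto simp: Rep_rho_single Rep_prt_single Rep_simps Rep_sg Rep_rho_pproj[OF Hom_Arr[OF f]] pscale_simps Rep_endo_zero)
  qed
qed (simp_all add: Rep_scale)

lemma prt_prt: "prt C * prt C = 0"
proof (rule endo_ext)
  fix l
  show "Rep_endo (prt C * prt C) (single l 1) = Rep_endo 0 (single l 1)"
    using dif_dif[OF Arr_Hom, of l] Hom_Arr[OF dif_Hom[OF Arr_Hom, of l]]
    by (auto simp: Rep_prt_single Rep_simps Rep_prt_pproj Rep_endo_zero intro!: pproj_single_zer dom_Obj cod_Obj)
qed (simp_all add: Rep_scale)

lemma kap_rho: "rho C f * kap a = kap a * rho C f"
  by (rule endo_ext) (simp_all add: Rep_scale)

lemma kap_prt: "prt C * kap a = kap a * prt C"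
  by (rule endo_ext) (simp_all add: Rep_scale)

lemma rho_zer: "x \<in> Obj C ==> y \<in> Obj C ==> rho C (zer C x y n) = 0"
  using rho_add[OF zer_Hom zer_Hom, of x y n] by (simp add: add_zer[OF zer_Hom])

lemma rho_sscl: "f \<in> Arr C ==> rho C (sscl C n f) = sg n * rho C f"
  by (simp add: rho_scl powi_sg)

lemma rho_idn_left: "f \<in> Hom C x y n ==> rho C (idn C y) * rho C f = rho C f"
  by (metis cmp_idn_left rho_cmp idn_Hom Hom_Obj(2))

lemma rho_idn_right: "f \<in> Hom C x y n ==> rho C f * rho C (idn C x) = rho C f"
  by (metis cmp_idn_right rho_cmp idn_Hom Hom_Obj(1))

end

context dg_category
begin

lemma evl_cong:
  assumes "plin L - plin M \<in> pker" and o: "x \<in> Obj C" "y \<in> Obj C"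
  shows "evl x y n L = evl x y n M"
proof -
  let ?N = "map (map_prod uminus id) M"
  have "plin ?N = - plin M" by (induction M) (auto simp: single_uminus)
  then have "plin (L @ ?N) = plin L - plin M" by (induction L) auto
  then have "evl x y n (L @ ?N) = zer C x y n" using pkerD[OF _ o, of "L @ ?N"] assms(1) by simp
  moreover have "evl x y n ?N = scl C (-1) (evl x y n M)"
    using o by (induction M) (auto simp: evl_Cons evl_Nil scl_zer scl_add[OF scl_Hom evl_Hom] scl_scl Hom_Arr)
  ultimately have *: "add C (evl x y n L) (scl C (-1) (evl x y n M)) = zer C x y n"
    by (simp add: evl_append o)
  note h = evl_Hom[OF o, of n L] evl_Hom[OF o, of n M] and s = scl_Hom[OF evl_Hom[OF o, of n M], of "-1"]
  have "evl x y n L = add C (evl x y n L) (add C (scl C (-1) (evl x y n M)) (evl x y n M))"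
    by (simp add: add_comm[OF s h(2)] add_neg[OF h(2)] add_zer[OF h(1)])
  also have "... = evl x y n M"
    by (simp add: add_assoc[OF h(1) s h(2), symmetric] * zer_add[OF h(2)])
  finally show ?thesis .
qed

text \<open>
  A formula that writes \<open>rho C f\<close> as a linear combination of operators \<open>rho C g\<close> therefore has an
  analogue for every additive function in place of \<open>rho C\<close>.
\<close>

lemma ex_additive_rho:
  fixes k :: "'m => 'r::ring_1"
  assumes o: "x \<in> Obj C" "y \<in> Obj C"
    and k: "!!f g. f \<in> Hom C x y n ==> g \<in> Hom C x y n ==> k (add C f g) = k f + k g"
  obtains L where "additive L" "!!f. f \<in> Hom C x y n ==> L (rho C f) = k f"
proof
  \<comment> \<open>Applied to the identity of \<open>x\<close>, the operator of an arrow returns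
    that arrow up to the kernel; \<open>P\<close> chooses a list presenting the result.\<close>
  define P where "P = (%a :: ('m, 'k) endo. SOME M. plin M = Rep_endo a (single (idn C x) 1))"
  have P: "plin (P a) = Rep_endo a (single (idn C x) 1)" for a
    unfolding P_def by (rule someI_ex[OF ex_plin])
  let ?L = "%a. k (evl x y n (P a))"
  have z: "0 \<in> pker" using pkerI[of "[]"] by (simp add: evl_Nil)
  show "additive ?L"
  proof
    fix a b
    have "plin (P (a + b)) - plin (P a @ P b) = 0" using P by (simp add: Rep_simps)
    then have "evl x y n (P (a + b)) = add C (evl x y n (P a)) (evl x y n (P b))"
      using evl_cong[OF _ o] evl_append[OF o] z by metis
    then show "?L (a + b) = ?L a + ?L b" by (simp add: k evl_Hom[OF o])
  qed
  fix f assume f: "f \<in> Hom C x y n"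
  have i: "idn C x \<in> Hom C x x 0" using idn_Hom o by simp
  have "plin (P (rho C f)) = pproj (plin [(1, f)])"
    using i by (simp add: P Rep_rho_single Hom_dom[OF f] Hom_def cmp_idn_right[OF f])
  moreover have "pproj p - p \<in> pker" for p
    using pproj_eqI[of p "pproj p"] pproj_pker[of p] by (simp add: pproj_0_iff[symmetric] pproj_diff)
  ultimately have "evl x y n (P (rho C f)) = evl x y n [(1, f)]"
    by (intro evl_cong o) simp
  then show "?L (rho C f) = k f"
    using f by (simp add: evl_Cons evl_Nil scl_one Hom_Arr add_zer)
qed

end

section \<open>Functions on chains of arrows\<close>

lemma shdeg_simps [simp]: "shdeg C [] = 0" "shdeg C (f # w) = deg C f - 1 + shdeg C w"
  "shdeg C (u @ v) = shdeg C u + shdeg C v"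
  by (simp_all add: shdeg_def)

lemma path_end_append [simp]: "path_end C x (u @ v) = path_end C (path_end C x u) v"
  by (induction u arbitrary: x) auto

text \<open>The deconcatenation coproduct: \<open>spl P w\<close> is the sum of \<open>P u v\<close> over all \<open>u @ v = w\<close>.\<close>

fun spl :: "('m list => 'm list => 'r::ring_1) => 'm list => 'r" where
  "spl P [] = P [] []"
| "spl P (f # w) = P [] (f # w) + spl (%u v. P (f # u) v) w"

text \<open>\<open>bb C \<psi>\<close> is \<open>\<psi> \<circ> b\<close> for the bar differential \<open>b\<close>, a coderivation for deconcatenation.\<close>

fun bb :: "('k, 'o, 'm) dgcat => ('m list => 'r::ring_1) => 'm list => 'r" where
  "bb C \<psi> [] = 0"
| "bb C \<psi> (f # w) = sg (shdeg C w) * \<psi> (dif C f # w)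
     + (case w of [] => 0 | g # v => sg (shdeg C w) * \<psi> (cmp C g f # v))
     + bb C (%u. \<psi> (f # u)) w"

text \<open>The convolution product for deconcatenation. \<open>\<Psi>\<close> takes the initial
  segment, and \<open>q\<close> stands for its degree: the sign moves it past the shifted letters
  consumed by \<open>\<Phi>\<close>.\<close>

definition cup :: "('k, 'o, 'm) dgcat => int => ('o => 'm list => 'r::ring_1) => ('o => 'm list => 'r)
    => 'o => 'm list => 'r" where
  "cup C q \<Phi> \<Psi> x w = spl (%u v. sg (shdeg C v * q) * (\<Phi> (path_end C x u) v * \<Psi> x u)) w"

lemma spl_add: "spl (%u v. P u v + Q u v) w = spl P w + spl Q w"
  by (induction w arbitrary: P Q) (simp_all add: ac_simps)

lemma spl_minus: "spl (%u v. - P u v) w = - spl P w"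
  by (induction w arbitrary: P) simp_all

lemma spl_diff: "spl (%u v. P u v - Q u v) w = spl P w - spl Q w"
  using spl_add[of P "%u v. - Q u v" w] by (simp add: spl_minus)

lemma spl_mult_left: "spl (%u v. c * P u v) w = c * spl P w"
  by (induction w arbitrary: P) (simp_all add: algebra_simps)

lemma spl_mult_right: "spl (%u v. P u v * c) w = spl P w * c"
  by (induction w arbitrary: P) (simp_all add: algebra_simps)

lemma spl_zero [simp]: "spl (%u v. 0) w = 0"
  by (induction w) simp_all

lemma spl_cong: "(!!u v. u @ v = w ==> P u v = Q u v) ==> spl P w = spl Q w"
proof (induction w arbitrary: P Q)
  case (Cons f w)
  have "spl (%u v. P (f # u) v) w = spl (%u v. Q (f # u) v) w"
    by (rule Cons.IH) (simp add: Cons.prems)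
  then show ?case by (simp add: Cons.prems)
qed simp

text \<open>Both sides sum over all ways of cutting \<open>w\<close> into three pieces.\<close>

lemma spl_coassoc: "spl (%u v. spl (%a b. P a b v) u) w = spl (%a r. spl (%b v. P a b v) r) w"
  by (induction w arbitrary: P) (simp_all add: spl_add ac_simps)

lemma spl_sum_list: "spl P w = (\<Sum>m\<leftarrow>[0..<Suc (length w)]. P (take m w) (drop m w))"
proof (induction w arbitrary: P)
  case (Cons f w)
  have "[0..<Suc (length (f # w))] = 0 # map Suc [0..<Suc (length w)]"
    by (simp add: map_Suc_upt upt_conv_Cons del: upt_Suc)
  then show ?case by (simp add: Cons o_def del: upt_Suc)
qed simp

lemma spl_last: "spl P (w @ [f]) = spl (%u v. P u (v @ [f])) w + P (w @ [f]) []"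
  by (induction w arbitrary: P) (simp_all add: ac_simps)

lemma bb_add: "bb C (%w. \<phi> w + \<psi> w) w = bb C \<phi> w + bb C \<psi> w"
  by (induction w arbitrary: \<phi> \<psi>) (auto simp: algebra_simps split: list.split)

lemma bb_minus: "bb C (%w. - \<phi> w) w = - bb C \<phi> w"
  by (induction w arbitrary: \<phi>) (auto simp: algebra_simps split: list.split)

lemma bb_diff: "bb C (%w. \<phi> w - \<psi> w) w = bb C \<phi> w - bb C \<psi> w"
  using bb_add[of C \<phi> "%w. - \<psi> w" w] by (simp add: bb_minus)

lemma bb_zero [simp]: "bb C (%w. 0) w = 0"
  by (induction w) (auto split: list.split)

lemma bb_mult_right: "bb C (%w. \<phi> w * c) w = bb C \<phi> w * c"
  by (induction w arbitrary: \<phi>) (auto simp: algebra_simps split: list.split)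

lemma bb_mult_left: "bb C (%w. c * \<phi> w) w = c * bb C \<phi> w"
proof (induction w arbitrary: \<phi>)
  case (Cons f w)
  show ?case
    by (auto simp: Cons sg_def algebra_simps split: list.split)
qed simp

text \<open>The coderivation property. The differential meets the later letters first, so acting on
  the initial piece costs the sign of the final piece. A product of the two letters on either side
  of a cut never occurs, since the cut is made after differentiating.\<close>

lemma bb_spl: "bb C (%w. spl P w) w =
    spl (%u v. sg (shdeg C v) * bb C (%u. P u v) u + bb C (P u) v) w"
proof (induction w arbitrary: P)
  case (Cons f w)
  let ?R = "%Q. spl (%u v. sg (shdeg C v) * bb C (%u. Q u v) u + bb C (Q u) v) w"
  have 1: "bb C (%u. spl (%u v. P (f # u) v) u) w = ?R (%u v. P (f # u) v)"
    by (rule Cons.IH)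
  have 2: "spl (%u v. sg (shdeg C v) * bb C (%u. P u v) (f # u) + bb C (P (f # u)) v) w
     = spl (%u v. sg (shdeg C v) * (sg (shdeg C u) * P (dif C f # u) v)) w
       + spl (%u v. case u of [] => 0 | g # u' => sg (shdeg C v) * (sg (shdeg C u) * P (cmp C g f # u') v)) w
       + ?R (%u v. P (f # u) v)"
    unfolding spl_add[symmetric]
    by (rule spl_cong) (auto simp: algebra_simps split: list.split)
  have 3: "spl (%u v. sg (shdeg C v) * (sg (shdeg C u) * P (dif C f # u) v)) w
      = sg (shdeg C w) * spl (%u v. P (dif C f # u) v) w"
    unfolding spl_mult_left[symmetric]
    by (rule spl_cong) (auto simp: sg_def)
  have 4: "spl (%u v. case u of [] => 0 | g # u' => sg (shdeg C v) * (sg (shdeg C u) * P (cmp C g f # u') v)) w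
      = (case w of [] => 0 | g # w' => sg (shdeg C w) * spl (%u v. P (cmp C g f # u) v) w')"
  proof (cases w)
    case (Cons g w')
    show ?thesis unfolding Cons spl_mult_left[symmetric] list.case spl.simps
      by (simp, rule spl_cong) (auto simp: sg_def)
  qed simp
  show ?case
    unfolding spl.simps(2) 2 3 4
    unfolding bb.simps spl.simps(2) bb_add 1
    by (auto simp: distrib_left split: list.split)
qed simp

text \<open>With \<open>additive_sg\<close> and \<open>additive_bb\<close>, this carries formulas
  proved for operators through an additive functional.\<close>

lemma additive_spl:
  fixes L :: "'r::ring_1 => 's::ring_1"
  assumes "additive L"
  shows "L (spl P w) = spl (%u v. L (P u v)) w"
  by (induction w arbitrary: P) (simp_all add: additive.add[OF assms])

lemma additive_sg:
  fixes L :: "'r::ring_1 => 's::ring_1"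
  assumes "additive L"
  shows "L (sg n * a) = sg n * L a"
  by (simp add: sg_def additive.minus[OF assms])

lemma additive_bb:
  fixes L :: "'r::ring_1 => 's::ring_1"
  assumes "additive L"
  shows "L (bb C \<psi> w) = bb C (%w. L (\<psi> w)) w"
  by (induction w arbitrary: \<psi>)
    (simp_all add: additive.add[OF assms] additive.zero[OF assms] additive_sg[OF assms] split: list.split)

section \<open>Multilinear and normalized functions on chains\<close>

context dg_category
begin

lemma is_path_append: "is_path C x (u @ v) \<longleftrightarrow> is_path C x u \<and> is_path C (path_end C x u) v"
proof (induction u arbitrary: x)
  case Nil
  have "is_path C x v ==> x \<in> Obj C" for x by (cases v) (auto simp: dom_Obj)
  then show ?case by auto
qed auto

lemma is_path_Obj: "is_path C x w ==> x \<in> Obj C" "is_path C x w ==> path_end C x w \<in> Obj C"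
proof -
  show "is_path C x w ==> x \<in> Obj C" by (cases w) (auto simp: dom_Obj)
  show "is_path C x w ==> path_end C x w \<in> Obj C" by (induction w arbitrary: x) auto
qed

lemma Arr_dif: "f \<in> Arr C ==> dif C f \<in> Arr C" "f \<in> Arr C ==> dom C (dif C f) = dom C f"
  "f \<in> Arr C ==> cod C (dif C f) = cod C f" "f \<in> Arr C ==> deg C (dif C f) = deg C f + 1"
  using dif_Hom[OF Arr_Hom] by (auto simp: Hom_def)

lemma Arr_cmp:
  assumes "f \<in> Arr C" "g \<in> Arr C" "dom C g = cod C f"
  shows "cmp C g f \<in> Arr C" "dom C (cmp C g f) = dom C f"
    "cod C (cmp C g f) = cod C g" "deg C (cmp C g f) = deg C g + deg C f"
  using cmp_Hom[of g "dom C g" "cod C g" "deg C g" f "dom C f" "deg C f"] assms by (auto simp: Hom_def)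

lemma Arr_scl: "f \<in> Arr C ==> scl C a f \<in> Arr C" "f \<in> Arr C ==> dom C (scl C a f) = dom C f"
  "f \<in> Arr C ==> cod C (scl C a f) = cod C f" "f \<in> Arr C ==> deg C (scl C a f) = deg C f"
  using scl_Hom[OF Arr_Hom] by (auto simp: Hom_def)

lemma Arr_add:
  assumes "f \<in> Arr C" "g \<in> Arr C" "dom C g = dom C f" "cod C g = cod C f" "deg C g = deg C f"
  shows "add C f g \<in> Arr C" "dom C (add C f g) = dom C f" "cod C (add C f g) = cod C f"
    "deg C (add C f g) = deg C f"
  using add_Hom[of f "dom C f" "cod C f" "deg C f" g] assms by (auto simp: Hom_def)

lemma Arr_idn: "x \<in> Obj C ==> idn C x \<in> Arr C" "x \<in> Obj C ==> dom C (idn C x) = x"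
  "x \<in> Obj C ==> cod C (idn C x) = x" "x \<in> Obj C ==> deg C (idn C x) = 0"
  using idn_Hom[of x] by (auto simp: Hom_def)

lemma Arr_zer: "x \<in> Obj C ==> y \<in> Obj C ==> zer C x y n \<in> Arr C"
  "x \<in> Obj C ==> y \<in> Obj C ==> dom C (zer C x y n) = x"
  "x \<in> Obj C ==> y \<in> Obj C ==> cod C (zer C x y n) = y"
  "x \<in> Obj C ==> y \<in> Obj C ==> deg C (zer C x y n) = n"
  using zer_Hom[of x y n] by (auto simp: Hom_def)

lemmas Arr_simps = Arr_dif Arr_cmp Arr_scl Arr_add Arr_idn Arr_zer dom_Obj cod_Obj

text \<open>The bar differential evaluates its function only at chains with the same ends and
  shifted degree larger by one. Signs depending on the shifted degree can therefore be pulled out of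
  it.\<close>

lemma bb_cong:
  assumes "is_path C x w"
    and "!!w'. is_path C x w' ==> path_end C x w' = path_end C x w ==> shdeg C w' = shdeg C w + 1
      ==> \<phi> w' = \<psi> w'"
  shows "bb C \<phi> w = bb C \<psi> w"
  using assms
proof (induction w arbitrary: x \<phi> \<psi>)
  case (Cons f w)
  have 1: "bb C (%u. \<phi> (f # u)) w = bb C (%u. \<psi> (f # u)) w"
  proof (rule Cons.IH)
    show "is_path C (cod C f) w" using Cons.prems(1) by simp
    show "\<phi> (f # w') = \<psi> (f # w')"
      if "is_path C (cod C f) w'" "path_end C (cod C f) w' = path_end C (cod C f) w"
        "shdeg C w' = shdeg C w + 1" for w'
      using that Cons.prems(1) by (intro Cons.prems(2)) auto
  qed
  have 2: "\<phi> (dif C f # w) = \<psi> (dif C f # w)"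
    using Cons.prems(1) by (intro Cons.prems(2)) (auto simp: Arr_simps)
  have 3: "\<phi> (cmp C g f # v) = \<psi> (cmp C g f # v)" if "w = g # v" for g v
    using Cons.prems(1) that by (intro Cons.prems(2)) (auto simp: Arr_simps)
  show ?case
    using 1 2 3 by (auto split: list.split)
qed simp

text \<open>Connects the recursion with the indexed sums in the differentials of cochains and of
  expressions.\<close>

lemma bb_sum_list:
  "bb C \<psi> w = (\<Sum>i\<leftarrow>[0..<length w]. sg (shdeg C (drop (i + 1) w)) * \<psi> (w[i := dif C (w ! i)]))
     + (\<Sum>i\<leftarrow>[0..<length w - 1]. sg (shdeg C (drop (i + 1) w)) * \<psi> (merge_at C w i))"
proof (induction w arbitrary: \<psi>)
  case (Cons f w)
  have "[0..<length (f # w)] = 0 # map Suc [0..<length w]"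
    by (simp add: map_Suc_upt upt_conv_Cons del: upt_Suc)
  moreover have "(\<Sum>i\<leftarrow>[0..<length (f # w) - 1]. sg (shdeg C (drop (i + 1) (f # w))) * \<psi> (merge_at C (f # w) i))
      = (case w of [] => 0 | g # v => sg (shdeg C w) * \<psi> (cmp C g f # v))
        + (\<Sum>i\<leftarrow>[0..<length w - 1]. sg (shdeg C (drop (i + 1) w)) * \<psi> (f # merge_at C w i))"
  proof (cases w)
    case (Cons g v)
    have "[0..<length (f # w) - 1] = 0 # map Suc [0..<length w - 1]"
      using Cons by (simp add: map_Suc_upt upt_conv_Cons del: upt_Suc)
    then show ?thesis by (simp add: Cons merge_at_def o_def del: upt_Suc)
  qed simp
  ultimately show ?case
    by (simp add: Cons o_def del: upt_Suc)
qed simp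

text \<open>Additivity and homogeneity in one condition. \<open>\<kappa>\<close> maps scalars into
  the value ring; for operators it is \<open>kap\<close>.\<close>

definition mlin :: "('k => 'r::ring_1) => 'o => ('m list => 'r) => bool" where
  "mlin \<kappa> x \<psi> \<longleftrightarrow> (\<forall>us f f' vs y z n a. is_path C x (us @ f # vs) --> f \<in> Hom C y z n --> f' \<in> Hom C y z n -->
     \<psi> (us @ add C (scl C a f) f' # vs) = \<kappa> a * \<psi> (us @ f # vs) + \<psi> (us @ f' # vs))"

definition nrm :: "'o => ('m list => 'r::ring_1) => bool" where
  "nrm x \<psi> \<longleftrightarrow> (\<forall>w. is_path C x w --> (\<exists>y\<in>Obj C. idn C y \<in> set w) --> \<psi> w = 0)"

lemma mlinD:
  "[|mlin \<kappa> x \<psi>; is_path C x (us @ f # vs); f \<in> Hom C y z n; f' \<in> Hom C y z n|]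
    ==> \<psi> (us @ add C (scl C a f) f' # vs) = \<kappa> a * \<psi> (us @ f # vs) + \<psi> (us @ f' # vs)"
  unfolding mlin_def by blast

lemma mlin_add:
  assumes "mlin \<kappa> x \<psi>" "\<kappa> 1 = 1" "is_path C x (us @ f # vs)" "f \<in> Hom C y z n" "f' \<in> Hom C y z n"
  shows "\<psi> (us @ add C f f' # vs) = \<psi> (us @ f # vs) + \<psi> (us @ f' # vs)"
  using mlinD[OF assms(1,3,4,5), of 1] assms(2,4) by (simp add: scl_one Hom_Arr)

lemma is_path_Hom:
  assumes "is_path C x (us @ f # vs)" "f \<in> Hom C y z n" "f' \<in> Hom C y z m"
  shows "is_path C x (us @ f' # vs)"
  using assms by (auto simp: is_path_append Hom_def)

lemma mlin_zer:
  assumes "mlin \<kappa> x \<psi>" "\<kappa> 1 = 1" "is_path C x (us @ zer C y z n # vs)" "y \<in> Obj C" "z \<in> Obj C"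
  shows "\<psi> (us @ zer C y z n # vs) = 0"
  using mlin_add[OF assms(1-3) zer_Hom zer_Hom] assms(4,5)
  by (metis add_cancel_left_left add_zer zer_Hom)

lemma mlin_scl:
  assumes "mlin \<kappa> x \<psi>" "\<kappa> 1 = 1" "is_path C x (us @ f # vs)" "f \<in> Arr C"
  shows "\<psi> (us @ scl C a f # vs) = \<kappa> a * \<psi> (us @ f # vs)"
proof -
  note f = Arr_Hom[OF assms(4)]
  have o: "dom C f \<in> Obj C" "cod C f \<in> Obj C" using assms(4) by (auto simp: Arr_simps)
  note z = zer_Hom[OF o, of "deg C f"]
  show ?thesis
    using mlinD[OF assms(1,3) f z, of a] mlin_zer[OF assms(1,2) is_path_Hom[OF assms(3) f z] o]
    by (simp add: add_zer[OF scl_Hom[OF f]])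
qed

lemma mlin_tail:
  assumes "mlin \<kappa> (dom C f) \<psi>" "f \<in> Arr C"
  shows "mlin \<kappa> (cod C f) (%u. \<psi> (f # u))"
  unfolding mlin_def
proof (intro allI impI)
  fix us g g' vs y z n a
  assume "is_path C (cod C f) (us @ g # vs)" "g \<in> Hom C y z n" "g' \<in> Hom C y z n"
  then show "\<psi> (f # us @ add C (scl C a g) g' # vs) = \<kappa> a * \<psi> (f # us @ g # vs) + \<psi> (f # us @ g' # vs)"
    using mlinD[OF assms(1), of "f # us" g vs y z n g' a] assms(2) by simp
qed

lemma nrmD: "nrm x \<psi> ==> is_path C x w ==> y \<in> Obj C ==> idn C y \<in> set w ==> \<psi> w = 0"
  unfolding nrm_def by blast

lemma nrm_tail:
  assumes "nrm (dom C f) \<psi>" "f \<in> Arr C"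
  shows "nrm (cod C f) (%u. \<psi> (f # u))"
  unfolding nrm_def
proof (intro allI impI)
  fix w assume "is_path C (cod C f) w" "\<exists>y\<in>Obj C. idn C y \<in> set w"
  then show "\<psi> (f # w) = 0"
    using nrmD[OF assms(1), of "f # w"] assms(2) by auto
qed

lemma shdeg_Hom: "f \<in> Hom C y z n ==> f' \<in> Hom C y z n ==> shdeg C (us @ f # vs) = shdeg C (us @ f' # vs)"
  by (simp add: Hom_def)

lemma lin_Hom: "f \<in> Hom C y z n ==> f' \<in> Hom C y z n ==> add C (scl C a f) f' \<in> Hom C y z n"
  by (intro add_Hom scl_Hom)

text \<open>Differentiating a letter and multiplying it with a neighbour are linear, so a
  combination in one letter stays a combination in one letter.\<close>

lemma bb_mlin:
  assumes "mlin \<kappa> x \<psi>"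
  shows "mlin \<kappa> x (bb C \<psi>)"
proof -
  have "bb C \<psi> (us @ add C (scl C a f) f' # vs) = \<kappa> a * bb C \<psi> (us @ f # vs) + bb C \<psi> (us @ f' # vs)"
    if "is_path C x (us @ f # vs)" "f \<in> Hom C y z n" "f' \<in> Hom C y z n" for us f f' vs y z n a
    using assms that(1)
  proof (induction us arbitrary: x \<psi>)
    case Nil
    let ?h = "add C (scl C a f) f'"
    note h = lin_Hom[OF that(2,3), of a]
    have fa: "f \<in> Arr C" "f' \<in> Arr C" using that by (auto simp: Hom_def)
    have d: "dif C ?h = add C (scl C a (dif C f)) (dif C f')"
      using that by (simp add: dif_add[OF scl_Hom] dif_scl)
    have 1: "\<psi> (dif C ?h # vs) = \<kappa> a * \<psi> (dif C f # vs) + \<psi> (dif C f' # vs)"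
      using mlinD[OF Nil(1) _ dif_Hom[OF that(2)] dif_Hom[OF that(3)], of "[]" vs a] Nil(2) fa
      by (simp add: d Arr_simps)
    have 2: "\<psi> (cmp C g ?h # v) = \<kappa> a * \<psi> (cmp C g f # v) + \<psi> (cmp C g f' # v)" if v: "vs = g # v" for g v
    proof -
      have g: "g \<in> Hom C z (cod C g) (deg C g)" using Nil(2) v \<open>f \<in> Hom C y z n\<close> by (auto simp: Hom_def)
      have c: "cmp C g ?h = add C (scl C a (cmp C g f)) (cmp C g f')"
        using \<open>f \<in> Hom C y z n\<close> \<open>f' \<in> Hom C y z n\<close>
        by (simp add: cmp_add_right[OF g scl_Hom] cmp_scl_right[OF g])
      show ?thesis
        using mlinD[OF Nil(1) _ cmp_Hom[OF g \<open>f \<in> Hom C y z n\<close>] cmp_Hom[OF g \<open>f' \<in> Hom C y z n\<close>], of "[]" v a] Nil(2) v fa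
        by (simp add: c Arr_simps)
    qed
    have 3: "bb C (%u. \<psi> (?h # u)) vs = bb C (%u. \<kappa> a * \<psi> (f # u) + \<psi> (f' # u)) vs"
    proof (rule bb_cong)
      show "is_path C (cod C f) vs" using Nil by simp
      show "\<psi> (?h # w') = \<kappa> a * \<psi> (f # w') + \<psi> (f' # w')" if "is_path C (cod C f) w'" for w'
        using mlinD[OF Nil(1), of "[]" f w'] that \<open>f \<in> Hom C y z n\<close> \<open>f' \<in> Hom C y z n\<close> Nil(2) by simp
    qed
    show ?case using 1 2 3 by (auto simp: bb_add bb_mult_left sg_def algebra_simps split: list.split)
  next
    case (Cons e us)
    let ?h = "add C (scl C a f) f'"
    have e: "e \<in> Arr C" "dom C e = x" "is_path C (cod C e) (us @ f # vs)" using Cons.prems by auto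
    have IH: "bb C (%u. \<psi> (e # u)) (us @ ?h # vs)
        = \<kappa> a * bb C (%u. \<psi> (e # u)) (us @ f # vs) + bb C (%u. \<psi> (e # u)) (us @ f' # vs)"
      using Cons.prems(1) e by (intro Cons.IH[OF mlin_tail]) auto
    have s: "shdeg C (us @ ?h # vs) = shdeg C (us @ f # vs)" "shdeg C (us @ f' # vs) = shdeg C (us @ f # vs)"
      using that lin_Hom shdeg_Hom by blast+
    have 1: "\<psi> (dif C e # us @ ?h # vs) = \<kappa> a * \<psi> (dif C e # us @ f # vs) + \<psi> (dif C e # us @ f' # vs)"
      using mlinD[OF Cons.prems(1), of "dif C e # us" f vs] e that by (simp add: Arr_simps)
    have 2: "(case us @ ?h # vs of [] => 0 | g # v => \<psi> (cmp C g e # v))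
      = \<kappa> a * (case us @ f # vs of [] => 0 | g # v => \<psi> (cmp C g e # v))
        + (case us @ f' # vs of [] => 0 | g # v => \<psi> (cmp C g e # v))"
    proof (cases us)
      case Nil
      have ee: "e \<in> Hom C x y (deg C e)" using e Nil that by (auto simp: Hom_def)
      have "cmp C ?h e = add C (scl C a (cmp C f e)) (cmp C f' e)"
        using that by (simp add: cmp_add_left[OF scl_Hom _ ee] cmp_scl_left[OF _ ee])
      then show ?thesis
        using mlinD[OF Cons.prems(1) _ cmp_Hom[OF that(2) ee] cmp_Hom[OF that(3) ee], of "[]" vs a] Nil e
        by (auto simp: Arr_simps)
    next
      case (Cons g us')
      show ?thesis using mlinD[OF Cons.prems(1), of "cmp C g e # us'" f vs y z n f' a] e that Cons
        using \<open>mlin \<kappa> x \<psi>\<close> mlinD[OF \<open>mlin \<kappa> x \<psi>\<close>, of "cmp C g e # us'" f vs y z n f' a] by (simp add: Arr_simps)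
    qed
    have c: "(case w of [] => 0 | g # v => sg n * F g v) = sg n * (case w of [] => 0 | g # v => F g v)"
      for w :: "'m list" and n and F :: "'m => 'm list => 'a" by (cases w) auto
    show ?case by (simp only: append_Cons bb.simps c s 1 2 IH) (simp add: sg_def algebra_simps)
  qed
  then show ?thesis unfolding mlin_def by blast
qed

lemma bb_sg_mult:
  assumes "is_path C x w"
  shows "bb C (%u. sg (shdeg C u * q) * \<psi> u) w = sg ((shdeg C w + 1) * q) * bb C \<psi> w"
  unfolding bb_mult_left[symmetric] using assms by (rule bb_cong) simp

text \<open>The square-zero law of the bar construction: twice the differential on one letter,
  Leibniz on a product of neighbours, associativity on three neighbours, while operations on
  disjoint letters anticommute. Multilinearity enters because Leibniz turns a letter into a
  sum.\<close>

lemma bb_bb: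
  assumes "mlin \<kappa> x \<psi>" "\<kappa> 1 = 1" "!!n. \<kappa> (sg n) = sg n" "is_path C x w"
  shows "bb C (bb C \<psi>) w = 0"
  using assms(1,4)
proof (induction w arbitrary: x \<psi>)
  case (Cons f w)
  have f: "f \<in> Arr C" "dom C f = x" "is_path C (cod C f) w" using Cons.prems by auto
  have IH: "bb C (bb C (%u. \<psi> (f # u))) w = 0"
    using Cons.prems(1) f by (intro Cons.IH[OF mlin_tail]) auto
  have ddf: "\<psi> (dif C (dif C f) # w) = 0"
    using mlin_zer[OF Cons.prems(1) assms(2), of "[]" "dom C f" "cod C f" "deg C f + 2" w]
      dif_dif[OF Arr_Hom[OF f(1)]] f by (auto simp: Arr_simps)
  have A: "bb C (%u. sg (shdeg C u) * \<psi> (dif C f # u)) w = - (sg (shdeg C w) * bb C (%u. \<psi> (dif C f # u)) w)"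
    using bb_sg_mult[OF f(3), of 1 "%u. \<psi> (dif C f # u)"] by (simp add: sg_add)
  show ?case
  proof (cases w)
    case Nil
    then show ?thesis using ddf by simp
  next
    case w: (Cons g v)
    have g: "g \<in> Arr C" "dom C g = cod C f" "is_path C (cod C g) v" using f(3) w by auto
    have ag: "f \<in> Hom C x (cod C f) (deg C f)" "g \<in> Hom C (cod C f) (cod C g) (deg C g)"
      using f g by (auto simp: Hom_def)
    note gdf = cmp_Hom[OF ag(2) dif_Hom[OF ag(1)]] and dgf = cmp_Hom[OF dif_Hom[OF ag(2)] ag(1)]
    \<comment> \<open>Leibniz for the product of the first two letters, distributed by linearity of
      \<open>\<psi>\<close> in that letter.\<close>
    have "\<psi> (dif C (cmp C g f) # v) = \<psi> (cmp C (dif C g) f # v) + sg (deg C g) * \<psi> (cmp C g (dif C f) # v)"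
    proof -
      have "is_path C x (cmp C (dif C g) f # v)" "is_path C x (cmp C g (dif C f) # v)"
        using f g by (auto simp: Arr_simps)
      moreover have "scl C (sg (deg C g)) (cmp C g (dif C f)) \<in> Hom C x (cod C g) (deg C g + 1 + deg C f)"
        using scl_Hom[OF gdf] by (simp add: ac_simps)
      ultimately show ?thesis using mlin_add[OF Cons.prems(1) assms(2), of "[]" "cmp C (dif C g) f" v]
          mlin_scl[OF Cons.prems(1) assms(2), of "[]" "cmp C g (dif C f)" v] dgf Hom_Arr[OF gdf]
        by (simp add: dif_cmp[OF ag(2,1)] powi_sg assms(3))
    qed
    note dgf' = this
    \<comment> \<open>Here the tail is differentiated and its new first letter is then multiplied
      into \<open>f\<close>; this letter is \<open>dif C g\<close>, the product of \<open>g\<close>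
      with its successor, or \<open>g\<close> itself.\<close>
    have B: "bb C (%u. case u of [] => 0 | g # v => sg (shdeg C u) * \<psi> (cmp C g f # v)) w
        = sg (shdeg C v) * (sg (deg C g + shdeg C v) * \<psi> (cmp C (dif C g) f # v))
         + (case v of [] => 0 | h # v' => sg (shdeg C v) * (sg (deg C h + deg C g - 1 + shdeg C v') * \<psi> (cmp C h (cmp C g f) # v')))
         - sg (deg C g - 1) * (sg (shdeg C v) * bb C (%u. \<psi> (cmp C g f # u)) v)"
    proof -
      have "bb C (%u. sg (shdeg C (g # u)) * \<psi> (cmp C g f # u)) v
          = bb C (%u. sg (deg C g - 1) * (sg (shdeg C u * 1) * \<psi> (cmp C g f # u))) v"
        by (simp add: sg_add mult.assoc)
      also have "... = - (sg (deg C g - 1) * (sg (shdeg C v) * bb C (%u. \<psi> (cmp C g f # u)) v))"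
        unfolding bb_mult_left bb_sg_mult[OF g(3)] by (simp add: sg_add)
      finally have 1: "bb C (%u. sg (shdeg C (g # u)) * \<psi> (cmp C g f # u)) v =
        - (sg (deg C g - 1) * (sg (shdeg C v) * bb C (%u. \<psi> (cmp C g f # u)) v))" .
      have 2: "cmp C (cmp C h g) f = cmp C h (cmp C g f)" "deg C (cmp C h g) = deg C h + deg C g"
        if "v = h # v'" for h v'
        using g(3) f(1) g(1,2) that cmp_assoc[OF _ ag(2,1), of h "cod C h" "deg C h"]
        by (auto simp: Arr_simps Hom_def)
      show ?thesis using 1 2 unfolding w by (auto simp: Arr_simps g split: list.split)
    qed
    have cw: "(case w of [] => 0 | g' # v' => F g' v') = F g v" for F :: "'m => 'm list => 'a"
      by (simp add: w)
    have C: "bb C (bb C \<psi>) (f # w) = sg (shdeg C w) * bb C \<psi> (dif C f # w)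
        + sg (shdeg C w) * bb C \<psi> (cmp C g f # v) + bb C (%u. bb C \<psi> (f # u)) w"
      unfolding bb.simps(2)[of C "bb C \<psi>" f w] cw ..
    have C1: "bb C \<psi> (dif C f # w) = sg (shdeg C w) * \<psi> (cmp C g (dif C f) # v)
        + bb C (%u. \<psi> (dif C f # u)) w"
      unfolding bb.simps(2)[of C \<psi> "dif C f" w] ddf cw by simp
    have C2: "bb C \<psi> (cmp C g f # v) = sg (shdeg C v) * \<psi> (dif C (cmp C g f) # v)
         + (case v of [] => 0 | h # v' => sg (shdeg C v) * \<psi> (cmp C h (cmp C g f) # v'))
         + bb C (%u. \<psi> (cmp C g f # u)) v"
      by (rule bb.simps(2))
    have "bb C (%u. bb C \<psi> (f # u)) w = bb C (%u. sg (shdeg C u) * \<psi> (dif C f # u)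
        + (case u of [] => 0 | g # v => sg (shdeg C u) * \<psi> (cmp C g f # v))
        + bb C (%u. \<psi> (f # u)) u) w"
      by (simp only: bb.simps(2)[of C \<psi> f])
    also have "... = - (sg (shdeg C w) * bb C (%u. \<psi> (dif C f # u)) w)
      + bb C (%u. case u of [] => 0 | g # v => sg (shdeg C u) * \<psi> (cmp C g f # v)) w"
      unfolding bb_add A IH by simp
    finally have C3: "bb C (%u. bb C \<psi> (f # u)) w = - (sg (shdeg C w) * bb C (%u. \<psi> (dif C f # u)) w)
      + bb C (%u. case u of [] => 0 | g # v => sg (shdeg C u) * \<psi> (cmp C g f # v)) w" .
    have sw: "shdeg C w = deg C g - 1 + shdeg C v" by (simp add: w)
    show ?thesis unfolding C C1 C2 C3 B dgf' sw
      by (auto simp: sg_def simp del: bb.simps split: list.split)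
  qed
qed simp

text \<open>Every term that still contains the identity vanishes. The two products with its
  neighbours have opposite signs and cancel; at an end of the chain only one of them exists and
  survives.\<close>

lemma bb_idn:
  assumes "mlin \<kappa> x \<psi>" "\<kappa> 1 = 1" "nrm x \<psi>" "y \<in> Obj C" "is_path C x (us @ idn C y # vs)"
  shows "bb C \<psi> (us @ idn C y # vs) =
    (if vs \<noteq> [] then sg (shdeg C vs) * \<psi> (us @ vs) else 0) - (if us \<noteq> [] then sg (shdeg C vs) * \<psi> (us @ vs) else 0)"
  using assms(1,3,5)
proof (induction us arbitrary: x \<psi>)
  case Nil
  have y: "x = y" "is_path C y vs" using Nil assms(4) by (auto simp: Arr_simps)
  have p: "is_path C x (dif C (idn C y) # vs)"
    using y assms(4) by (auto simp: Arr_simps)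
  have 1: "\<psi> (dif C (idn C y) # vs) = 0"
    using mlin_zer[OF Nil(1) assms(2), of "[]" y y 1 vs] p assms(4) by (simp add: dif_idn)
  have 2: "bb C (%u. \<psi> (idn C y # u)) vs = bb C (%u. 0) vs"
  proof (rule bb_cong)
    show "is_path C y vs" by (rule y)
    show "\<psi> (idn C y # w) = 0" if "is_path C y w" for w
      using nrmD[OF Nil(2), of "idn C y # w" y] that assms(4) y by (simp add: Arr_simps)
  qed
  have 3: "cmp C g (idn C y) = g" if "vs = g # v" for g v
    using y that cmp_idn_right[OF Arr_Hom[of g]] by auto
  show ?case
    using 1 2 3 by (auto split: list.split)
next
  case (Cons f us)
  have f: "f \<in> Arr C" "dom C f = x" "is_path C (cod C f) (us @ idn C y # vs)" using Cons.prems by auto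
  have IH: "bb C (%u. \<psi> (f # u)) (us @ idn C y # vs) =
    (if vs \<noteq> [] then sg (shdeg C vs) * \<psi> (f # us @ vs) else 0)
      - (if us \<noteq> [] then sg (shdeg C vs) * \<psi> (f # us @ vs) else 0)"
    using Cons.prems f by (intro Cons.IH[OF mlin_tail nrm_tail]) auto
  have 1: "\<psi> (dif C f # us @ idn C y # vs) = 0"
    by (rule nrmD[OF Cons.prems(2) _ assms(4)]) (use f in "auto simp: Arr_simps")
  show ?case
  proof (cases us)
    case Nil
    have "cod C f = y" using f Nil assms(4) by (auto simp: Arr_simps)
    then have "cmp C (idn C y) f = f" using f cmp_idn_left[OF Arr_Hom[of f]] by auto
    then show ?thesis using IH 1 Nil assms(4) by (simp add: Arr_simps sg_diff)
  next
    case (Cons g us')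
    have "\<psi> (cmp C g f # us' @ idn C y # vs) = 0"
      by (rule nrmD[OF Cons.prems(2) _ assms(4)]) (use f Cons in "auto simp: Arr_simps")
    then show ?thesis using IH 1 Cons by simp
  qed
qed

section \<open>The cup product and the bar differential\<close>

lemma cup_assoc: "cup C r (cup C q \<Phi> \<Psi>) \<Theta> x w = cup C (q + r) \<Phi> (cup C r \<Psi> \<Theta>) x w"
proof -
  have "cup C r (cup C q \<Phi> \<Psi>) \<Theta> x w = spl (%a r'. spl (%b v. sg (shdeg C r' * r) *
      (sg (shdeg C v * q) * (\<Phi> (path_end C x (a @ b)) v * \<Psi> (path_end C x a) b * \<Theta> x a))) r') w"
    by (simp add: cup_def spl_mult_left[symmetric] spl_mult_right[symmetric] mult.assoc)
  also have "... = spl (%a r'. spl (%b v. sg (shdeg C v * (q + r)) * (\<Phi> (path_end C x (a @ b)) v *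
      (sg (shdeg C b * r) * (\<Psi> (path_end C x a) b * \<Theta> x a)))) r') w"
    by (intro spl_cong) (auto simp: sg_def mult.assoc)
  also have "... = spl (%u v. spl (%a b. sg (shdeg C v * (q + r)) * (\<Phi> (path_end C x (a @ b)) v *
      (sg (shdeg C b * r) * (\<Psi> (path_end C x a) b * \<Theta> x a)))) u) w"
    by (rule spl_coassoc[symmetric])
  also have "... = cup C (q + r) \<Phi> (cup C r \<Psi> \<Theta>) x w"
    unfolding cup_def spl_mult_left[symmetric]
    by (intro spl_cong) simp
  finally show ?thesis .
qed

lemma cup_cong:
  assumes "is_path C x w"
    and "!!u v. u @ v = w ==> is_path C x u ==> is_path C (path_end C x u) v ==>
      \<Phi> (path_end C x u) v = \<Phi>' (path_end C x u) v"
    and "!!u v. u @ v = w ==> is_path C x u ==> \<Psi> x u = \<Psi>' x u"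
  shows "cup C q \<Phi> \<Psi> x w = cup C q \<Phi>' \<Psi>' x w"
  unfolding cup_def using assms by (intro spl_cong) (auto simp: is_path_append)

lemma cup_add_left: "cup C q (%x w. \<Phi> x w + \<Phi>' x w) \<Psi> x w = cup C q \<Phi> \<Psi> x w + cup C q \<Phi>' \<Psi> x w"
  and cup_add_right: "cup C q \<Phi> (%x w. \<Psi> x w + \<Psi>' x w) x w = cup C q \<Phi> \<Psi> x w + cup C q \<Phi> \<Psi>' x w"
  and cup_diff_left: "cup C q (%x w. \<Phi> x w - \<Phi>' x w) \<Psi> x w = cup C q \<Phi> \<Psi> x w - cup C q \<Phi>' \<Psi> x w"
  and cup_diff_right: "cup C q \<Phi> (%x w. \<Psi> x w - \<Psi>' x w) x w = cup C q \<Phi> \<Psi> x w - cup C q \<Phi> \<Psi>' x w"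
  by (simp_all add: cup_def distrib_left distrib_right left_diff_distrib right_diff_distrib spl_add spl_diff)

lemma cup_mult_left: "cup C q (%x w. c * \<Phi> x w) \<Psi> x w = c * cup C q \<Phi> \<Psi> x w"
proof -
  have "sg n * (c * \<Phi> y v * z) = c * (sg n * (\<Phi> y v * z))" for n y v z
    by (simp add: sg_def mult.assoc)
  then show ?thesis by (simp add: cup_def spl_mult_left)
qed

lemma cup_sg_right: "cup C q \<Phi> (%x w. sg n * \<Psi> x w) x w = sg n * cup C q \<Phi> \<Psi> x w"
  unfolding cup_def spl_mult_left[symmetric] by (rule spl_cong) (simp add: sg_def)

text \<open>In the second term \<open>\<Phi>\<close> sees a chain whose shifted degree has been
  raised by one, which changes the sign in the cup product by \<open>sg q\<close>.\<close>

lemma bb_cup: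
  assumes "is_path C x w"
  shows "bb C (cup C q \<Phi> \<Psi> x) w = cup C (q + 1) \<Phi> (%x. bb C (\<Psi> x)) x w + sg q * cup C q (%x. bb C (\<Phi> x)) \<Psi> x w"
proof -
  have "bb C (cup C q \<Phi> \<Psi> x) w = spl (%u v.
      sg (shdeg C v) * bb C (%u. sg (shdeg C v * q) * (\<Phi> (path_end C x u) v * \<Psi> x u)) u
      + bb C (%v. sg (shdeg C v * q) * (\<Phi> (path_end C x u) v * \<Psi> x u)) v) w"
    unfolding cup_def[abs_def] by (rule bb_spl)
  also have "... = spl (%u v. sg (shdeg C v * (q + 1)) * (\<Phi> (path_end C x u) v * bb C (\<Psi> x) u)
      + sg q * (sg (shdeg C v * q) * (bb C (\<Phi> (path_end C x u)) v * \<Psi> x u))) w"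
  proof (rule spl_cong)
    fix u v assume "u @ v = w"
    then have p: "is_path C x u" "is_path C (path_end C x u) v" using assms by (auto simp: is_path_append)
    have "bb C (%u. sg (shdeg C v * q) * (\<Phi> (path_end C x u) v * \<Psi> x u)) u
        = bb C (%u'. sg (shdeg C v * q) * (\<Phi> (path_end C x u) v * \<Psi> x u')) u"
      using p(1) by (rule bb_cong) simp
    then show "sg (shdeg C v) * bb C (%u. sg (shdeg C v * q) * (\<Phi> (path_end C x u) v * \<Psi> x u)) u
      + bb C (%v. sg (shdeg C v * q) * (\<Phi> (path_end C x u) v * \<Psi> x u)) v
      = sg (shdeg C v * (q + 1)) * (\<Phi> (path_end C x u) v * bb C (\<Psi> x) u)
      + sg q * (sg (shdeg C v * q) * (bb C (\<Phi> (path_end C x u)) v * \<Psi> x u))"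
      using bb_sg_mult[OF p(2), of q "%v. \<Phi> (path_end C x u) v * \<Psi> x u"]
      by (simp add: bb_mult_left bb_mult_right) (auto simp: sg_def)
  qed
  also have "... = cup C (q + 1) \<Phi> (%x. bb C (\<Psi> x)) x w + sg q * cup C q (%x. bb C (\<Phi> x)) \<Psi> x w"
    by (simp add: cup_def spl_add spl_mult_left)
  finally show ?thesis .
qed

end

section \<open>The dg category of coherent natural transformations\<close>

lemma spl_left_nil: "(!!f u v. P (f # u) v = 0) ==> spl P w = P [] w"
proof (cases w)
  case (Cons f v)
  assume "!!f u v. P (f # u) v = 0"
  then have "spl (%u v. P (f # u) v) v = spl (%u v. 0) v" by (intro spl_cong)
  then show ?thesis by (simp add: Cons)
qed simp

lemma spl_right_nil: "(!!f u v. P u (f # v) = 0) ==> spl P w = P w []"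
  by (induction w arbitrary: P) simp_all

lemma spl_insert: "spl P (us @ f # vs) = spl (%a b. P a (b @ f # vs)) us + spl (%a b. P (us @ f # a) b) vs"
  by (induction us arbitrary: P) (simp_all add: ac_simps)

lemma spl_short_right:
  assumes "!!u f g v. P u (f # g # v) = 0"
  shows "spl P w = P w [] + (if w = [] then 0 else P (butlast w) [last w])"
proof (cases w rule: rev_cases)
  case (snoc v f)
  have z: "P u (g # v @ [f]) = 0" for u g v by (cases v) (simp_all add: assms)
  have "spl (%u v. P u (v @ [f])) v = P v [f]"
    by (subst spl_right_nil) (simp_all add: z)
  then show ?thesis
    unfolding snoc spl_last by (simp add: add.commute)
qed simp

lemma spl_short_left:
  assumes "!!u f g v. P (f # g # u) v = 0"
  shows "spl P w = P [] w + (case w of [] => 0 | f # v => P [f] v)"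
proof (cases w)
  case (Cons f v)
  have "spl (%u v. P (f # u) v) v = P [f] v"
    by (rule spl_left_nil) (simp add: assms)
  then show ?thesis
    unfolding Cons by simp
qed simp

context dg_category
begin

lemma cup_mlin:
  assumes "!!y. mlin \<kappa> y (\<Phi> y)" "mlin \<kappa> x (\<Psi> x)" "!!y v a. \<Phi> y v * \<kappa> a = \<kappa> a * \<Phi> y v"
  shows "mlin \<kappa> x (cup C q \<Phi> \<Psi> x)"
  unfolding mlin_def
proof (intro allI impI)
  fix us f f' vs y z n a
  assume p: "is_path C x (us @ f # vs)" and f: "f \<in> Hom C y z n" "f' \<in> Hom C y z n"
  let ?h = "add C (scl C a f) f'"
  let ?A = "%h. spl (%u b. sg (shdeg C (b @ h # vs) * q) * (\<Phi> (path_end C x u) (b @ h # vs) * \<Psi> x u)) us"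
  let ?B = "%h. spl (%u v. sg (shdeg C v * q) * (\<Phi> (path_end C x (us @ h # u)) v * \<Psi> x (us @ h # u))) vs"
  note h = lin_Hom[OF f, of a]
  have "?A ?h = \<kappa> a * ?A f + ?A f'"
    unfolding spl_mult_left[symmetric] spl_add[symmetric]
  proof (rule spl_cong)
    fix u v assume "u @ v = us"
    then have "is_path C (path_end C x u) (v @ f # vs)" using p by (auto simp: is_path_append)
    then show "sg (shdeg C (v @ ?h # vs) * q) * (\<Phi> (path_end C x u) (v @ ?h # vs) * \<Psi> x u)
      = \<kappa> a * (sg (shdeg C (v @ f # vs) * q) * (\<Phi> (path_end C x u) (v @ f # vs) * \<Psi> x u))
      + sg (shdeg C (v @ f' # vs) * q) * (\<Phi> (path_end C x u) (v @ f' # vs) * \<Psi> x u)"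
      using mlinD[OF assms(1) _ f] shdeg_Hom[OF h f(1), of v vs] shdeg_Hom[OF f, of v vs]
      by (simp add: sg_def algebra_simps)
  qed
  moreover have "?B ?h = \<kappa> a * ?B f + ?B f'"
    unfolding spl_mult_left[symmetric] spl_add[symmetric]
  proof (rule spl_cong)
    fix u v assume uv: "u @ v = vs"
    then have "is_path C x (us @ f # u)" using p by (auto simp: is_path_append)
    note m = mlinD[OF assms(2) this f, of a]
    have e: "path_end C x (us @ ?h # u) = path_end C x (us @ f # u)"
      "path_end C x (us @ f' # u) = path_end C x (us @ f # u)"
      using h f by (auto simp: Hom_def)
    show "sg (shdeg C v * q) * (\<Phi> (path_end C x (us @ ?h # u)) v * \<Psi> x (us @ ?h # u))
      = \<kappa> a * (sg (shdeg C v * q) * (\<Phi> (path_end C x (us @ f # u)) v * \<Psi> x (us @ f # u)))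
      + sg (shdeg C v * q) * (\<Phi> (path_end C x (us @ f' # u)) v * \<Psi> x (us @ f' # u))"
      unfolding e m by (simp add: sg_def distrib_left mult.assoc[symmetric] assms(3))
  qed
  ultimately show "cup C q \<Phi> \<Psi> x (us @ ?h # vs)
    = \<kappa> a * cup C q \<Phi> \<Psi> x (us @ f # vs) + cup C q \<Phi> \<Psi> x (us @ f' # vs)"
    unfolding cup_def spl_insert by (simp only: distrib_left ac_simps)
qed

lemma cup_nrm:
  assumes "!!y. nrm y (\<Phi> y)" "nrm x (\<Psi> x)"
  shows "nrm x (cup C q \<Phi> \<Psi> x)"
  unfolding nrm_def
proof (intro allI impI)
  fix w assume p: "is_path C x w" and "\<exists>y\<in>Obj C. idn C y \<in> set w"
  then obtain y where y: "y \<in> Obj C" "idn C y \<in> set w" by blast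
  have "cup C q \<Phi> \<Psi> x w = spl (%u v. 0) w"
    unfolding cup_def
  proof (rule spl_cong)
    fix u v assume uv: "u @ v = w"
    then have "is_path C x u" "is_path C (path_end C x u) v" "idn C y \<in> set u \<or> idn C y \<in> set v"
      using p y by (auto simp: is_path_append)
    then show "sg (shdeg C v * q) * (\<Phi> (path_end C x u) v * \<Psi> x u) = 0"
      using nrmD[OF assms(1) _ y(1)] nrmD[OF assms(2) _ y(1)] by auto
  qed
  then show "cup C q \<Phi> \<Psi> x w = 0" by simp
qed

lemma mlin_cong:
  assumes "!!w. is_path C x w ==> \<phi> w = \<psi> w" "mlin \<kappa> x \<psi>"
  shows "mlin \<kappa> x \<phi>"
  unfolding mlin_def
proof (intro allI impI)
  fix us f f' vs y z n a
  assume p: "is_path C x (us @ f # vs)" and f: "f \<in> Hom C y z n" "f' \<in> Hom C y z n"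
  show "\<phi> (us @ add C (scl C a f) f' # vs) = \<kappa> a * \<phi> (us @ f # vs) + \<phi> (us @ f' # vs)"
    using mlinD[OF assms(2) p f] assms(1) p is_path_Hom[OF p f]
      is_path_Hom[OF p f(1) lin_Hom[OF f]] by simp
qed

lemma nrm_cong:
  assumes "!!w. is_path C x w ==> \<phi> w = \<psi> w" "nrm x \<psi>"
  shows "nrm x \<phi>"
  using assms unfolding nrm_def by simp

lemma mlin_comb:
  assumes "mlin \<kappa> x \<phi>" "mlin \<kappa> x \<psi>" "!!a. c * \<kappa> a = \<kappa> a * c" "!!a. e * \<kappa> a = \<kappa> a * e"
  shows "mlin \<kappa> x (%w. c * \<phi> w + e * \<psi> w)"
  unfolding mlin_def
proof (intro allI impI)
  fix us f f' vs y z n a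
  assume p: "is_path C x (us @ f # vs)" and f: "f \<in> Hom C y z n" "f' \<in> Hom C y z n"
  have "c * (\<kappa> a * \<phi> (us @ f # vs)) = \<kappa> a * (c * \<phi> (us @ f # vs))"
    "e * (\<kappa> a * \<psi> (us @ f # vs)) = \<kappa> a * (e * \<psi> (us @ f # vs))"
    by (simp_all only: mult.assoc[symmetric] assms(3,4))
  then show "c * \<phi> (us @ add C (scl C a f) f' # vs) + e * \<psi> (us @ add C (scl C a f) f' # vs)
    = \<kappa> a * (c * \<phi> (us @ f # vs) + e * \<psi> (us @ f # vs)) + (c * \<phi> (us @ f' # vs) + e * \<psi> (us @ f' # vs))"
    by (simp add: mlinD[OF assms(1) p f] mlinD[OF assms(2) p f] distrib_left)
qed

text \<open>Two kinds of twisting cochains are used here: \<open>tht\<close> for functors, which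
  contains the differential of the target, and \<open>ta\<close> for the tensor product, which does
  not. So \<open>\<theta>\<close> and \<open>\<theta>'\<close> are left arbitrary and no
  Maurer-Cartan equation is imposed.\<close>

definition gdel :: "('o => 'm list => 'r::ring_1) => ('o => 'm list => 'r) => int => ('o => 'm list => 'r)
    => 'o => 'm list => 'r" where
  "gdel \<theta> \<theta>' p \<psi> x w = cup C p \<theta>' \<psi> x w - sg p * cup C 1 \<psi> \<theta> x w + sg p * bb C (\<psi> x) w"

lemma cup_short_left:
  assumes "!!x f g w. \<theta> x (f # g # w) = 0"
  shows "cup C p \<theta> \<psi> x w = \<theta> (path_end C x w) [] * \<psi> x w + (if w = [] then 0
     else sg (p * deg C (last w) + p) * (\<theta> (path_end C x (butlast w)) [last w] * \<psi> x (butlast w)))"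
  unfolding cup_def by (subst spl_short_right) (auto simp: assms sg_def)

lemma cup_short_right:
  assumes "!!x f g w. \<theta> x (f # g # w) = 0"
  shows "cup C q \<psi> \<theta> x w = sg (shdeg C w * q) * (\<psi> x w * \<theta> x [])
     + (case w of [] => 0 | f # v => sg (shdeg C v * q) * (\<psi> (cod C f) v * \<theta> x [f]))"
  unfolding cup_def by (subst spl_short_left) (simp_all add: assms split: list.split)

lemma gdel_cong:
  assumes "is_path C x w" "!!y v. is_path C y v ==> \<phi> y v = \<psi> y v"
  shows "gdel \<theta> \<theta>' p \<phi> x w = gdel \<theta> \<theta>' p \<psi> x w"
proof -
  have "cup C p \<theta>' \<phi> x w = cup C p \<theta>' \<psi> x w" "cup C 1 \<phi> \<theta> x w = cup C 1 \<psi> \<theta> x w"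
    "bb C (\<phi> x) w = bb C (\<psi> x) w"
    using assms by (auto intro!: cup_cong[OF assms(1)] bb_cong[OF assms(1)])
  then show ?thesis by (simp add: gdel_def)
qed

lemma gdel_abs: "gdel \<theta> \<theta>' p \<psi> = (%x w. cup C p \<theta>' \<psi> x w - sg p * cup C 1 \<psi> \<theta> x w + sg p * bb C (\<psi> x) w)"
  by (intro ext) (simp add: gdel_def)

text \<open>The mixed terms cancel by associativity of the cup product and the derivation rule. What
  remains are the two curvatures, each a cup square minus the transposed bar differential.\<close>

lemma gdel_gdel:
  assumes w: "is_path C x w" and b: "bb C (bb C (\<psi> x)) w = 0"
  shows "gdel \<theta> \<theta>' (p + 1) (gdel \<theta> \<theta>' p \<psi>) x w =
    cup C p (%x w. cup C 1 \<theta>' \<theta>' x w - bb C (\<theta>' x) w) \<psi> x w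
    - cup C 2 \<psi> (%x w. cup C 1 \<theta> \<theta> x w - bb C (\<theta> x) w) x w"
proof -
  have 1: "cup C (p + 1) \<theta>' (cup C p \<theta>' \<psi>) x w = cup C p (cup C 1 \<theta>' \<theta>') \<psi> x w"
    using cup_assoc[of p 1 \<theta>' \<theta>' \<psi> x w] by (simp add: add.commute)
  have 2: "cup C 1 (cup C 1 \<psi> \<theta>) \<theta> x w = cup C 2 \<psi> (cup C 1 \<theta> \<theta>) x w"
    using cup_assoc[of 1 1 \<psi> \<theta> \<theta> x w] by simp
  have 3: "cup C 1 (cup C p \<theta>' \<psi>) \<theta> x w = cup C (p + 1) \<theta>' (cup C 1 \<psi> \<theta>) x w"
    by (rule cup_assoc)
  have 5: "bb C (cup C p \<theta>' \<psi> x) w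
      = cup C (p + 1) \<theta>' (%x. bb C (\<psi> x)) x w + sg p * cup C p (%x. bb C (\<theta>' x)) \<psi> x w"
    by (rule bb_cup[OF w])
  have 6: "bb C (cup C 1 \<psi> \<theta> x) w
      = cup C 2 \<psi> (%x. bb C (\<theta> x)) x w - cup C 1 (%x. bb C (\<psi> x)) \<theta> x w"
    using bb_cup[OF w, of 1 \<psi> \<theta>] by simp
  show ?thesis
    unfolding gdel_def[of \<theta> \<theta>' "p + 1"] unfolding gdel_abs
    unfolding cup_add_left cup_add_right cup_diff_left cup_diff_right
      cup_mult_left cup_sg_right bb_add bb_diff bb_mult_left 1 2 3 b 5 6
    by (simp add: sg_def)
qed

text \<open>The two terms with \<open>\<theta>1\<close>, acting between \<open>\<Phi>\<close> and
  \<open>\<Psi>\<close>, cancel; everything else is the derivation rule for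
  \<open>bb\<close>.\<close>

lemma gdel_cup:
  assumes w: "is_path C x w"
  shows "gdel \<theta>0 \<theta>2 (q + r) (cup C r \<Phi> \<Psi>) x w
    = cup C r (gdel \<theta>1 \<theta>2 q \<Phi>) \<Psi> x w + sg q * cup C (r + 1) \<Phi> (gdel \<theta>0 \<theta>1 r \<Psi>) x w"
  unfolding gdel_abs cup_add_left cup_add_right cup_diff_left cup_diff_right
    cup_mult_left cup_sg_right cup_assoc bb_cup[OF w]
  by (simp add: add.commute[of 1 r] add.commute[of r q] sg_def)

lemma gdel_mlin:
  assumes "!!y. mlin \<kappa> y (\<theta> y)" "!!y. mlin \<kappa> y (\<theta>' y)" "!!y. mlin \<kappa> y (\<psi> y)"
    "!!y v a. \<theta>' y v * \<kappa> a = \<kappa> a * \<theta>' y v" "!!y v a. \<psi> y v * \<kappa> a = \<kappa> a * \<psi> y v"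
  shows "mlin \<kappa> x (gdel \<theta> \<theta>' p \<psi> x)"
proof -
  have sgk: "sg n * \<kappa> a = \<kappa> a * sg n" for n a by (simp add: sg_def)
  have "mlin \<kappa> x (%w. 1 * (1 * cup C p \<theta>' \<psi> x w + (- sg p) * cup C 1 \<psi> \<theta> x w) + sg p * bb C (\<psi> x) w)"
    by (intro mlin_comb cup_mlin bb_mlin assms) (simp_all add: sgk)
  then show ?thesis by (rule mlin_cong[rotated]) (simp add: gdel_def)
qed

text \<open>For an identity at an end of the chain, the boundary term left by \<open>bb_idn\<close>
  is compensated by the outer cup product with the unit letter at that end; in the interior each
  part vanishes by itself.\<close>

lemma gdel_nrm:
  assumes m: "mlin \<kappa> x (\<psi> x)" "\<kappa> 1 = 1" and n: "!!y. nrm y (\<psi> y)"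
    and short: "!!x f g w. \<theta> x (f # g # w) = 0" "!!x f g w. \<theta>' x (f # g # w) = 0"
    and unit: "!!y u. y \<in> Obj C ==> is_path C x u ==> path_end C x u = y ==> \<theta>' y [idn C y] * \<psi> x u = \<psi> x u"
      "!!v. is_path C x v ==> \<psi> x v * \<theta> x [idn C x] = \<psi> x v"
  shows "nrm x (gdel \<theta> \<theta>' p \<psi> x)"
  unfolding nrm_def
proof (intro allI impI)
  fix w assume p: "is_path C x w" and "\<exists>y\<in>Obj C. idn C y \<in> set w"
  then obtain y us vs where y: "y \<in> Obj C" and w: "w = us @ idn C y # vs"
    by (meson split_list)
  note n' = nrmD[OF n _ y]
  have id: "y \<in> Obj C" "dom C (idn C y) = y" "cod C (idn C y) = y" "deg C (idn C y) = 0"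
    using y by (auto simp: Arr_simps)
  have w0: "\<psi> x w = 0" by (rule n') (use p w in auto)
  have pu: "is_path C x us" and yu: "path_end C x us = y" and pv: "is_path C y vs"
    using p w y by (auto simp: is_path_append Arr_simps)
  have 1: "cup C p \<theta>' \<psi> x w = (if vs = [] then sg p * \<psi> x us else 0)"
  proof (cases vs rule: rev_cases)
    case Nil
    then show ?thesis using w0 yu unit(1)[OF y pu yu] by (simp add: cup_short_left[where \<theta> = \<theta>', OF short(2)] w id)
  next
    case (snoc v f)
    have "\<psi> x (us @ idn C y # v) = 0" by (rule n') (use p w snoc in "auto simp: is_path_append")
    then show ?thesis using snoc w0 by (simp add: cup_short_left[where \<theta> = \<theta>', OF short(2)] w butlast_append)
  qed
  have 2: "cup C 1 \<psi> \<theta> x w = (if us = [] then sg (shdeg C vs) * \<psi> x vs else 0)"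
  proof (cases us)
    case Nil
    then have x: "x = y" using yu by simp
    then show ?thesis using Nil w0 unit(2)[of vs] pv by (simp add: cup_short_right[where \<theta> = \<theta>, OF short(1)] w id)
  next
    case (Cons f u)
    have "\<psi> (cod C f) (u @ idn C y # vs) = 0"
      by (rule n') (use p w Cons in "auto simp: is_path_append")
    then show ?thesis using Cons w0 by (simp add: cup_short_right[where \<theta> = \<theta>, OF short(1)] w)
  qed
  have 3: "bb C (\<psi> x) w =
    (if vs \<noteq> [] then sg (shdeg C vs) * \<psi> x (us @ vs) else 0)
      - (if us \<noteq> [] then sg (shdeg C vs) * \<psi> x (us @ vs) else 0)"
    unfolding w by (rule bb_idn[OF m n y p[unfolded w]])
  show "gdel \<theta> \<theta>' p \<psi> x w = 0"
    unfolding gdel_def 1 2 3 by (auto simp: mult.assoc[symmetric])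
qed

lemma merge_at_path:
  assumes "is_path C x w" "i < length w - 1"
  shows "is_path C x (merge_at C w i)" "path_end C x (merge_at C w i) = path_end C x w"
    "shdeg C (merge_at C w i) = shdeg C w + 1"
proof -
  define u f g v where "u = take i w" "f = w ! i" "g = w ! (i + 1)" "v = drop (i + 2) w"
  have w: "w = u @ f # g # v"
    using assms(2) unfolding u_f_g_v_def
    by (metis Suc_eq_plus1 Suc_lessD add_2_eq_Suc' id_take_nth_drop less_diff_conv Cons_nth_drop_Suc)
  have m: "merge_at C w i = u @ cmp C g f # v"
    by (simp add: merge_at_def u_f_g_v_def)
  show "is_path C x (merge_at C w i)" "path_end C x (merge_at C w i) = path_end C x w"
    "shdeg C (merge_at C w i) = shdeg C w + 1"
    using assms(1) unfolding m unfolding w by (auto simp: is_path_append Arr_simps)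
qed

lemma update_dif_path:
  assumes "is_path C x w" "i < length w"
  shows "is_path C x (w[i := dif C (w ! i)])" "path_end C x (w[i := dif C (w ! i)]) = path_end C x w"
    "shdeg C (w[i := dif C (w ! i)]) = shdeg C w + 1"
proof -
  define u f v where "u = take i w" "f = w ! i" "v = drop (i + 1) w"
  have w: "w = u @ f # v"
    using assms(2) unfolding u_f_v_def by (simp add: id_take_nth_drop)
  have m: "w[i := dif C (w ! i)] = u @ dif C f # v"
    using assms(2) unfolding u_f_v_def by (simp add: upd_conv_take_nth_drop)
  show "is_path C x (w[i := dif C (w ! i)])" "path_end C x (w[i := dif C (w ! i)]) = path_end C x w"
    "shdeg C (w[i := dif C (w ! i)]) = shdeg C w + 1"
    using assms(1) unfolding m unfolding w by (auto simp: is_path_append Arr_simps)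
qed

lemma path_butlast:
  assumes "is_path C x w" "w \<noteq> []"
  shows "is_path C x (butlast w)" "last w \<in> Arr C" "dom C (last w) = path_end C x (butlast w)"
    "path_end C x w = cod C (last w)" "shdeg C w = shdeg C (butlast w) + deg C (last w) - 1"
  using assms by (cases w rule: rev_cases; auto simp: is_path_append)+

lemma path_tl:
  assumes "is_path C x w" "w \<noteq> []"
  shows "is_path C (cod C (hd w)) (tl w)" "hd w \<in> Arr C" "dom C (hd w) = x"
    "path_end C x w = path_end C (cod C (hd w)) (tl w)" "shdeg C w = deg C (hd w) - 1 + shdeg C (tl w)"
  using assms by (cases w; auto)+

lemma dsum_Hom:
  assumes "x \<in> Obj C" "y \<in> Obj C" "!!f. f \<in> set L ==> f \<in> Hom C x y n"
  shows "dsum C x y n L \<in> Hom C x y n"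
  using assms by (induction L) (auto simp: dsum_def intro!: zer_Hom add_Hom)

lemma rho_dsum:
  assumes "x \<in> Obj C" "y \<in> Obj C" "!!f. f \<in> set L ==> f \<in> Hom C x y n"
  shows "rho C (dsum C x y n L) = (\<Sum>f\<leftarrow>L. rho C f)"
  using assms
proof (induction L)
  case (Cons f L)
  have "dsum C x y n L \<in> Hom C x y n" using Cons.prems by (intro dsum_Hom) auto
  moreover have "dsum C x y n (f # L) = add C f (dsum C x y n L)" by (simp add: dsum_def)
  ultimately show ?case using Cons by (simp add: rho_add[of f x y n])
qed (simp add: dsum_def rho_zer)

end

section \<open>Cochains between two dg categories\<close>

locale dg_pair = src: dg_category C + tgt: dg_category D
  for C :: "('k::field, 'o, 'm) dgcat" and D :: "('k, 'p, 'q) dgcat"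
begin

abbreviation "Ch \<equiv> Coh C D"

text \<open>
  The twisting cochain of a functor: with the differential of the target as its component without
  arguments, a dg functor is a solution of the Maurer-Cartan equation, and the differential of
  cochains is a commutator with these solutions.
\<close>

definition tht :: "('o, 'm, 'p, 'q) dgfun => 'o => 'm list => ('q, 'k) endo" where
  "tht F x w = (case w of [] => prt D | f # v => if v = [] then rho D (farr F f) else 0)"

lemma tht_simps [simp]: "tht F x [] = prt D" "tht F x [f] = rho D (farr F f)" "tht F x (f # g # w) = 0"
  by (simp_all add: tht_def)

definition rv :: "('o, 'm, 'p, 'q) cochain => 'o => 'm list => ('q, 'k) endo" where
  "rv \<Psi> x w = rho D (cval \<Psi> x w)"

abbreviation del :: "('o, 'm, 'p, 'q) dgfun => ('o, 'm, 'p, 'q) dgfun => int => ('o => 'm list => ('q, 'k) endo)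
    => 'o => 'm list => ('q, 'k) endo" where
  "del F G p \<psi> \<equiv> src.gdel (tht F) (tht G) p \<psi>"

lemma cup_tht_left:
  "cup C p (tht G) \<psi> x w = prt D * \<psi> x w
     + (if w = [] then 0 else sg (p * deg C (last w) + p) * (rho D (farr G (last w)) * \<psi> x (butlast w)))"
by (subst src.cup_short_left) auto

lemma cup_tht_right:
  "cup C 1 \<psi> (tht F) x w = sg (shdeg C w) * (\<psi> x w * prt D)
     + (case w of [] => 0 | f # v => sg (shdeg C v) * (\<psi> (cod C f) v * rho D (farr F f)))"
by (subst src.cup_short_right) (auto split: list.split)

lemma tht_mlin:
  assumes "dg_functor C D F"
  shows "src.mlin kap x (tht F x)"
proof -
  interpret F: dg_functor C D F by (rule assms)
  show ?thesis
    unfolding src.mlin_def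
  proof (intro allI impI)
    fix us f f' vs y z n a
    assume f: "f \<in> Hom C y z n" "f' \<in> Hom C y z n"
    have "rho D (farr F (add C (scl C a f) f')) = kap a * rho D (farr F f) + rho D (farr F f')"
      using f by (simp add: F.farr_add[OF src.scl_Hom] F.farr_scl src.Hom_Arr
          tgt.rho_add[OF tgt.scl_Hom[OF F.farr_Hom] F.farr_Hom] tgt.rho_scl[OF tgt.Hom_Arr[OF F.farr_Hom]])
    then show "tht F x (us @ add C (scl C a f) f' # vs) = kap a * tht F x (us @ f # vs) + tht F x (us @ f' # vs)"
      by (cases us) (auto simp: tht_def)
  qed
qed

lemma tht_kap: "tht F x w * kap a = kap a * tht F x w"
  by (auto simp: tht_def tgt.kap_rho tgt.kap_prt split: list.split)

lemma rv_kap: "rv \<Psi> x w * kap a = kap a * rv \<Psi> x w"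
  by (simp add: rv_def tgt.kap_rho)

text \<open>By word length: length zero says that the differential squares to zero, length one that
  \<open>F\<close> commutes with differentials, length two that it preserves composition; longer
  words contribute nothing.\<close>

lemma tht_MC:
  assumes "dg_functor C D F" "is_path C x w"
  shows "cup C 1 (tht F) (tht F) x w = bb C (tht F x) w"
proof -
  interpret F: dg_functor C D F by (rule assms)
  consider "w = []" | f where "w = [f]" | f g where "w = [f, g]" | f g h v where "w = f # g # h # v"
    by (cases w rule: remdups_adj.cases; metis list.exhaust)
  then show ?thesis
  proof cases
    case 1
    then show ?thesis by (simp add: cup_tht_left tgt.prt_prt)
  next
    case 2
    then have f: "f \<in> Arr C" using assms(2) by simp
    note h = src.Arr_Hom[OF f]
    show ?thesis using tgt.rho_dif[OF F.farr_Hom[OF h]] f 2 by (simp add: cup_tht_left F.farr_dif sg_def)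
  next
    case 3
    then have fg: "f \<in> Hom C x (cod C f) (deg C f)" "g \<in> Hom C (cod C f) (cod C g) (deg C g)"
      using assms(2) by (auto simp: Hom_def)
    show ?thesis using 3 tgt.rho_cmp[OF F.farr_Hom[OF fg(2)] F.farr_Hom[OF fg(1)]]
      by (simp add: cup_tht_left F.farr_cmp[OF fg(2,1)] sg_def)
  next
    case 4
    then show ?thesis by (cases v rule: rev_cases) (simp_all add: cup_tht_left)
  qed
qed

lemma del_del:
  assumes F: "dg_functor C D F" and G: "dg_functor C D G" and m: "!!x. src.mlin kap x (\<psi> x)"
    and w: "is_path C x w"
  shows "del F G (p + 1) (del F G p \<psi>) x w = 0"
proof -
  have "cup C p (%x w. cup C 1 (tht G) (tht G) x w - bb C (tht G x) w) \<psi> x w = cup C p (%x w. 0) \<psi> x w"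
    by (rule src.cup_cong[OF w]) (simp_all add: tht_MC[OF G])
  moreover have "cup C 2 \<psi> (%x w. cup C 1 (tht F) (tht F) x w - bb C (tht F x) w) x w = cup C 2 \<psi> (%x w. 0) x w"
    by (rule src.cup_cong[OF w]) (simp_all add: tht_MC[OF F])
  ultimately show ?thesis
    using src.bb_bb[OF m _ _ w]
    by (subst src.gdel_gdel[OF w]) (auto simp: cup_def)
qed

text \<open>Linearity and normalization are checked in the operator ring, where they follow from
  closure properties of \<open>mlin\<close> and \<open>nrm\<close>; injectivity of
  \<open>rho D\<close> on Hom spaces brings them back.\<close>

lemma is_cochainI:
  assumes "dg_functor C D F" "dg_functor C D G"
    and H: "!!x w. is_path C x w ==> \<phi> x w \<in> Hom D (fobj F x) (fobj G (path_end C x w)) (p + shdeg C w)"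
    and m: "!!x. src.mlin kap x (%w. rho D (\<phi> x w))" and n: "!!x. src.nrm x (%w. rho D (\<phi> x w))"
  shows "is_cochain C D (Cochain F G p (on_paths C \<phi>))"
proof -
  have add: "\<phi> x (us @ add C f f' # vs) = add D (\<phi> x (us @ f # vs)) (\<phi> x (us @ f' # vs))"
    if p: "is_path C x (us @ f # vs)" and f: "f \<in> Hom C y z k" "f' \<in> Hom C y z k" for x us f f' vs y z k
  proof -
    note h = src.add_Hom[OF f]
    have p': "is_path C x (us @ add C f f' # vs)" "is_path C x (us @ f' # vs)"
      using src.is_path_Hom[OF p f(1)] h f by auto
    have e: "path_end C x (us @ add C f f' # vs) = path_end C x (us @ f # vs)"
      "path_end C x (us @ f' # vs) = path_end C x (us @ f # vs)"
      using h f by (auto simp: Hom_def)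
    have s: "shdeg C (us @ add C f f' # vs) = shdeg C (us @ f # vs)" "shdeg C (us @ f' # vs) = shdeg C (us @ f # vs)"
      using h f by (auto simp: Hom_def)
    note H1 = H[OF p] and H2 = H[OF p'(2), unfolded e s] and H3 = H[OF p'(1), unfolded e s]
    show ?thesis
      using src.mlin_add[OF m _ p f] by (intro tgt.rho_inj[OF H3 tgt.add_Hom[OF H1 H2]]) (simp add: tgt.rho_add[OF H1 H2])
  qed
  have scl: "\<phi> x (us @ scl C a f # vs) = scl D a (\<phi> x (us @ f # vs))"
    if p: "is_path C x (us @ f # vs)" for x us f vs a
  proof -
    have f: "f \<in> Arr C" using p by (auto simp: src.is_path_append)
    note h = src.scl_Hom[OF src.Arr_Hom[OF f], of a]
    have p': "is_path C x (us @ scl C a f # vs)" using src.is_path_Hom[OF p src.Arr_Hom[OF f] h] .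
    have e: "path_end C x (us @ scl C a f # vs) = path_end C x (us @ f # vs)"
      "shdeg C (us @ scl C a f # vs) = shdeg C (us @ f # vs)"
      using h f by (auto simp: Hom_def)
    note H1 = H[OF p] and H2 = H[OF p', unfolded e]
    show ?thesis
      using src.mlin_scl[OF m _ p f] by (intro tgt.rho_inj[OF H2 tgt.scl_Hom[OF H1]]) (simp add: tgt.rho_scl[OF tgt.Hom_Arr[OF H1]])
  qed
  have zer: "\<phi> x w = zer D (fobj F x) (fobj G (path_end C x w)) (p + shdeg C w)"
    if p: "is_path C x w" and y: "y \<in> Obj C" "idn C y \<in> set w" for x w y
    using src.nrmD[OF n p y] tgt.Hom_Obj[OF H[OF p]]
    by (intro tgt.rho_inj[OF H[OF p] tgt.zer_Hom]) (simp_all add: tgt.rho_zer)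
  have p2: "is_path C x (us @ add C f f' # vs)" "is_path C x (us @ f' # vs)"
    if "is_path C x (us @ f # vs)" "f \<in> Hom C y z k" "f' \<in> Hom C y z k" for x us f f' vs y z k
    using src.is_path_Hom[OF that(1,2)] src.add_Hom[OF that(2,3)] that(3) by auto
  have p3: "is_path C x (us @ scl C a f # vs)"
    if "is_path C x (us @ f # vs)" for x us f vs a
    using that by (auto simp: src.is_path_append src.Arr_simps)
  show ?thesis
    unfolding is_cochain_def
    using assms(1,2) H
    by (auto simp: on_paths_def p2 p3 intro!: add scl zer)
qed

lemma is_cochainD:
  assumes "is_cochain C D \<Psi>"
  shows cochain_csrc: "dg_functor C D (csrc \<Psi>)" and cochain_ctgt: "dg_functor C D (ctgt \<Psi>)"
    and cochain_ext: "\<not> is_path C x w ==> cval \<Psi> x w = undefined"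
    and cochain_Hom: "is_path C x w ==>
      cval \<Psi> x w \<in> Hom D (fobj (csrc \<Psi>) x) (fobj (ctgt \<Psi>) (path_end C x w)) (cdeg \<Psi> + shdeg C w)"
    and cochain_mlin: "src.mlin kap x (rv \<Psi> x)" and cochain_nrm: "src.nrm x (rv \<Psi> x)"
proof -
  show "dg_functor C D (csrc \<Psi>)" "dg_functor C D (ctgt \<Psi>)" "\<not> is_path C x w ==> cval \<Psi> x w = undefined"
    and H: "is_path C x w ==>
      cval \<Psi> x w \<in> Hom D (fobj (csrc \<Psi>) x) (fobj (ctgt \<Psi>) (path_end C x w)) (cdeg \<Psi> + shdeg C w)" for x w
    using assms unfolding is_cochain_def by blast+
  show "src.nrm x (rv \<Psi> x)"
    unfolding src.nrm_def
  proof (intro allI impI)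
    fix w assume p: "is_path C x w" and "\<exists>y\<in>Obj C. idn C y \<in> set w"
    then have "cval \<Psi> x w = zer D (fobj (csrc \<Psi>) x) (fobj (ctgt \<Psi>) (path_end C x w)) (cdeg \<Psi> + shdeg C w)"
      using assms unfolding is_cochain_def by blast
    then show "rv \<Psi> x w = 0" using tgt.Hom_Obj[OF H[OF p]] by (simp add: rv_def tgt.rho_zer)
  qed
  show "src.mlin kap x (rv \<Psi> x)"
    unfolding src.mlin_def
  proof (intro allI impI)
    fix us f f' vs y z n a
    assume p: "is_path C x (us @ f # vs)" and f: "f \<in> Hom C y z n" "f' \<in> Hom C y z n"
    note s = src.scl_Hom[OF f(1), of a]
    note p1 = src.is_path_Hom[OF p f(1) s] and p2 = src.is_path_Hom[OF p f]
    have e: "path_end C x (us @ scl C a f # vs) = path_end C x (us @ f # vs)"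
      "path_end C x (us @ f' # vs) = path_end C x (us @ f # vs)"
      "shdeg C (us @ scl C a f # vs) = shdeg C (us @ f # vs)" "shdeg C (us @ f' # vs) = shdeg C (us @ f # vs)"
      using s f by (auto simp: Hom_def)
    have "cval \<Psi> x (us @ add C (scl C a f) f' # vs) = add D (cval \<Psi> x (us @ scl C a f # vs)) (cval \<Psi> x (us @ f' # vs))"
      using assms p1 s f(2) unfolding is_cochain_def by blast
    moreover have "cval \<Psi> x (us @ scl C a f # vs) = scl D a (cval \<Psi> x (us @ f # vs))"
      using assms p unfolding is_cochain_def by blast
    ultimately show "rv \<Psi> x (us @ add C (scl C a f) f' # vs) = kap a * rv \<Psi> x (us @ f # vs) + rv \<Psi> x (us @ f' # vs)"
      using tgt.rho_add[OF H[OF p1, unfolded e] H[OF p2, unfolded e]]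
      by (simp add: rv_def tgt.rho_scl[OF tgt.Hom_Arr[OF H[OF p]]])
  qed
qed

text \<open>On chains injectivity of \<open>rho D\<close> decides; off the chains both value
  functions are \<open>undefined\<close>.\<close>

lemma cochain_eqI:
  assumes "is_cochain C D \<Phi>" "is_cochain C D \<Psi>" "csrc \<Phi> = csrc \<Psi>" "ctgt \<Phi> = ctgt \<Psi>" "cdeg \<Phi> = cdeg \<Psi>"
    and "!!x w. is_path C x w ==> rv \<Phi> x w = rv \<Psi> x w"
  shows "\<Phi> = \<Psi>"
proof (rule cochain.expand, intro conjI ext)
  fix x w
  show "cval \<Phi> x w = cval \<Psi> x w"
  proof (cases "is_path C x w")
    case True
    show ?thesis
      using cochain_Hom[OF assms(1) True] cochain_Hom[OF assms(2) True] assms(6)[OF True] unfolding rv_def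
      by (intro tgt.rho_inj) (auto simp: assms(3-5))
  next
    case False
    then show ?thesis using cochain_ext[OF assms(1)] cochain_ext[OF assms(2)] by simp
  qed
qed (use assms in auto)

lemma on_paths_eq [simp]: "is_path C x w ==> on_paths C \<phi> x w = \<phi> x w"
  by (simp add: on_paths_def)

lemma Coh_simps [simp]: "Obj Ch = {F. dg_functor C D F}" "Arr Ch = {\<Psi>. is_cochain C D \<Psi>}"
  "dom Ch = csrc" "cod Ch = ctgt" "deg Ch = cdeg"
  by (simp_all add: Coh_def)

lemma Coh_Hom: "\<Psi> \<in> Hom Ch F G p \<longleftrightarrow> is_cochain C D \<Psi> \<and> csrc \<Psi> = F \<and> ctgt \<Psi> = G \<and> cdeg \<Psi> = p"
  by (auto simp: Hom_def)

lemma fobj_Obj: "dg_functor C D F ==> x \<in> Obj C ==> fobj F x \<in> Obj D"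
  using dg_functor.fobj_Obj by fastforce

section \<open>The operations on cochains, as operations on operator values\<close>

lemma coh_zer:
  assumes "dg_functor C D F" "dg_functor C D G"
  shows "zer Ch F G p \<in> Hom Ch F G p" "is_path C x w ==> rv (zer Ch F G p) x w = 0"
proof -
  have H: "zer D (fobj F x) (fobj G (path_end C x w)) n \<in> Hom D (fobj F x) (fobj G (path_end C x w)) n"
    and z: "rho D (zer D (fobj F x) (fobj G (path_end C x w)) n) = 0"
    if "is_path C x w" for x w n
    using src.is_path_Obj[OF that] assms by (auto intro!: tgt.zer_Hom tgt.rho_zer fobj_Obj)
  show "is_path C x w ==> rv (zer Ch F G p) x w = 0"
    by (simp add: rv_def Coh_def z)
  have "src.mlin kap x (%w. 0 :: ('q, 'k) endo)" "src.nrm x (%w. 0 :: ('q, 'k) endo)" for x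
    by (auto simp: src.mlin_def src.nrm_def)
  then show "zer Ch F G p \<in> Hom Ch F G p"
    unfolding Coh_Hom by (auto simp: Coh_def intro!: is_cochainI assms H src.mlin_cong[OF z] src.nrm_cong[OF z])
qed

lemma coh_idn:
  assumes F: "dg_functor C D F"
  shows "idn Ch F \<in> Hom Ch F F 0"
    "is_path C x w ==> rv (idn Ch F) x w = (if w = [] then rho D (idn D (fobj F x)) else 0)"
proof -
  let ?\<phi> = "%x fs. if fs = [] then idn D (fobj F x) else zer D (fobj F x) (fobj F (path_end C x fs)) (shdeg C fs)"
  have H: "?\<phi> x w \<in> Hom D (fobj F x) (fobj F (path_end C x w)) (0 + shdeg C w)"
    and z: "rho D (?\<phi> x w) = (if w = [] then rho D (idn D (fobj F x)) else 0)"
    if "is_path C x w" for x w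
    using src.is_path_Obj[OF that] assms by (auto intro!: tgt.zer_Hom tgt.rho_zer tgt.idn_Hom fobj_Obj)
  show "is_path C x w ==> rv (idn Ch F) x w = (if w = [] then rho D (idn D (fobj F x)) else 0)"
    using z by (simp add: rv_def Coh_def)
  have "src.mlin kap x (%w. if w = [] then rho D (idn D (fobj F x)) else 0)"
    "src.nrm x (%w. if w = [] then rho D (idn D (fobj F x)) else 0)" for x
    by (auto simp: src.mlin_def src.nrm_def)
  then have "is_cochain C D (Cochain F F 0 (on_paths C ?\<phi>))"
    by (intro is_cochainI assms H src.mlin_cong[OF z] src.nrm_cong[OF z])
  then show "idn Ch F \<in> Hom Ch F F 0"
    unfolding Coh_Hom by (simp add: Coh_def)
qed

lemma coh_add:
  assumes "\<Phi> \<in> Hom Ch F G p" "\<Psi> \<in> Hom Ch F G p"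
  shows "add Ch \<Phi> \<Psi> \<in> Hom Ch F G p"
    "is_path C x w ==> rv (add Ch \<Phi> \<Psi>) x w = rv \<Phi> x w + rv \<Psi> x w"
proof -
  have c: "is_cochain C D \<Phi>" "is_cochain C D \<Psi>" "csrc \<Phi> = F" "csrc \<Psi> = F" "ctgt \<Phi> = G" "ctgt \<Psi> = G"
    "cdeg \<Phi> = p" "cdeg \<Psi> = p"
    using assms by (auto simp: Coh_Hom)
  have H: "cval \<Phi> x w \<in> Hom D (fobj F x) (fobj G (path_end C x w)) (p + shdeg C w)"
    "cval \<Psi> x w \<in> Hom D (fobj F x) (fobj G (path_end C x w)) (p + shdeg C w)"
    if "is_path C x w" for x w
    using cochain_Hom[OF c(1) that] cochain_Hom[OF c(2) that] c by auto
  have r: "rho D (add D (cval \<Phi> x w) (cval \<Psi> x w)) = 1 * rv \<Phi> x w + 1 * rv \<Psi> x w" if "is_path C x w" for x w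
    using tgt.rho_add[OF H[OF that]] by (simp add: rv_def)
  show "is_path C x w ==> rv (add Ch \<Phi> \<Psi>) x w = rv \<Phi> x w + rv \<Psi> x w"
    using r by (simp add: rv_def Coh_def)
  have "is_cochain C D (Cochain F G p (on_paths C (%x fs. add D (cval \<Phi> x fs) (cval \<Psi> x fs))))"
    using cochain_csrc[OF c(1)] cochain_ctgt[OF c(1)] cochain_nrm[OF c(1)] cochain_nrm[OF c(2)]
    by (intro is_cochainI src.mlin_cong[OF r] src.nrm_cong[OF r] src.mlin_comb cochain_mlin c)
      (auto simp: c src.nrm_def intro!: tgt.add_Hom H)
  then show "add Ch \<Phi> \<Psi> \<in> Hom Ch F G p"
    unfolding Coh_Hom by (simp add: Coh_def c)
qed

lemma coh_scl:
  assumes "\<Psi> \<in> Hom Ch F G p"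
  shows "scl Ch a \<Psi> \<in> Hom Ch F G p"
    "is_path C x w ==> rv (scl Ch a \<Psi>) x w = kap a * rv \<Psi> x w"
proof -
  have c: "is_cochain C D \<Psi>" "csrc \<Psi> = F" "ctgt \<Psi> = G" "cdeg \<Psi> = p"
    using assms by (auto simp: Coh_Hom)
  have H: "cval \<Psi> x w \<in> Hom D (fobj F x) (fobj G (path_end C x w)) (p + shdeg C w)"
    if "is_path C x w" for x w
    using cochain_Hom[OF c(1) that] c by auto
  have r: "rho D (scl D a (cval \<Psi> x w)) = kap a * rv \<Psi> x w + 0 * rv \<Psi> x w" if "is_path C x w" for x w
    using tgt.rho_scl[OF tgt.Hom_Arr[OF H[OF that]]] by (simp add: rv_def)
  show "is_path C x w ==> rv (scl Ch a \<Psi>) x w = kap a * rv \<Psi> x w"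
    using r by (simp add: rv_def Coh_def)
  have "is_cochain C D (Cochain F G p (on_paths C (%x fs. scl D a (cval \<Psi> x fs))))"
    using cochain_csrc[OF c(1)] cochain_ctgt[OF c(1)] cochain_nrm[OF c(1)]
    by (intro is_cochainI src.mlin_cong[OF r] src.nrm_cong[OF r] src.mlin_comb cochain_mlin c)
      (auto simp: c src.nrm_def kap_mult[symmetric] mult.commute intro!: tgt.scl_Hom H)
  then show "scl Ch a \<Psi> \<in> Hom Ch F G p"
    unfolding Coh_Hom by (simp add: Coh_def c)
qed

lemma coh_cmp:
  assumes "\<Phi> \<in> Hom Ch G H q" "\<Psi> \<in> Hom Ch F G p"
  shows "cmp Ch \<Phi> \<Psi> \<in> Hom Ch F H (q + p)"
    "is_path C x w ==> rv (cmp Ch \<Phi> \<Psi>) x w = cup C p (rv \<Phi>) (rv \<Psi>) x w"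
proof -
  have c: "is_cochain C D \<Phi>" "is_cochain C D \<Psi>" "csrc \<Phi> = G" "csrc \<Psi> = F" "ctgt \<Phi> = H" "ctgt \<Psi> = G"
    "cdeg \<Phi> = q" "cdeg \<Psi> = p"
    using assms by (auto simp: Coh_Hom)
  have FH: "dg_functor C D F" "dg_functor C D H"
    using cochain_csrc[OF c(2)] cochain_ctgt[OF c(1)] c by auto
  let ?L = "%x fs. map (%m. sscl D (shdeg C (drop m fs) * p)
                       (cmp D (cval \<Phi> (path_end C x (take m fs)) (drop m fs))
                              (cval \<Psi> x (take m fs))))
                   [0..<Suc (length fs)]"
  have trm: "cmp D (cval \<Phi> (path_end C x (take m w)) (drop m w)) (cval \<Psi> x (take m w))
      \<in> Hom D (fobj F x) (fobj H (path_end C x w)) (q + p + shdeg C w)"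
    "rho D (cmp D (cval \<Phi> (path_end C x (take m w)) (drop m w)) (cval \<Psi> x (take m w)))
      = rv \<Phi> (path_end C x (take m w)) (drop m w) * rv \<Psi> x (take m w)"
    if "is_path C x w" for x w m
  proof -
    have p: "is_path C x (take m w)" "is_path C (path_end C x (take m w)) (drop m w)"
      and e: "path_end C (path_end C x (take m w)) (drop m w) = path_end C x w"
      and s: "shdeg C (drop m w) + shdeg C (take m w) = shdeg C w"
      using that src.is_path_append[of x "take m w" "drop m w"] path_end_append[of C x "take m w" "drop m w"]
        shdeg_simps(3)[of C "take m w" "drop m w"] by auto
    note Ha = cochain_Hom[OF c(1) p(2), unfolded e c] and Hb = cochain_Hom[OF c(2) p(1), unfolded c]
    show "cmp D (cval \<Phi> (path_end C x (take m w)) (drop m w)) (cval \<Psi> x (take m w))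
      \<in> Hom D (fobj F x) (fobj H (path_end C x w)) (q + p + shdeg C w)"
      using tgt.cmp_Hom[OF Ha Hb] s by (simp add: algebra_simps)
    show "rho D (cmp D (cval \<Phi> (path_end C x (take m w)) (drop m w)) (cval \<Psi> x (take m w)))
      = rv \<Phi> (path_end C x (take m w)) (drop m w) * rv \<Psi> x (take m w)"
      unfolding rv_def by (rule tgt.rho_cmp[OF Ha Hb])
  qed
  have L: "f \<in> Hom D (fobj F x) (fobj H (path_end C x w)) (q + p + shdeg C w)"
    if "is_path C x w" "f \<in> set (?L x w)" for x w f
    using that by (auto simp del: upt_Suc intro!: tgt.scl_Hom trm)
  have O: "fobj F x \<in> Obj D" "fobj H (path_end C x w) \<in> Obj D" if "is_path C x w" for x w
    using src.is_path_Obj[OF that] FH by (auto intro!: fobj_Obj)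
  let ?\<phi> = "%x fs. dsum D (fobj F x) (fobj H (path_end C x fs)) (q + p + shdeg C fs) (?L x fs)"
  have r: "rho D (?\<phi> x w) = cup C p (rv \<Phi>) (rv \<Psi>) x w" if p: "is_path C x w" for x w
  proof -
    have "rho D (?\<phi> x w) = (\<Sum>f\<leftarrow>?L x w. rho D f)"
      by (rule tgt.rho_dsum[OF O[OF p] L[OF p]])
    also have "... = cup C p (rv \<Phi>) (rv \<Psi>) x w" unfolding cup_def spl_sum_list map_map o_def
      using trm[OF p] by (simp add: tgt.rho_sscl[OF tgt.Hom_Arr[OF trm(1)[OF p]]] del: upt_Suc)
    finally show ?thesis .
  qed
  have *: "cmp Ch \<Phi> \<Psi> = Cochain F H (q + p) (on_paths C ?\<phi>)"
    by (simp add: Coh_def c)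
  show "is_path C x w ==> rv (cmp Ch \<Phi> \<Psi>) x w = cup C p (rv \<Phi>) (rv \<Psi>) x w"
    using r unfolding * by (simp add: rv_def)
  have "is_cochain C D (Cochain F H (q + p) (on_paths C ?\<phi>))"
    by (intro is_cochainI FH src.mlin_cong[OF r] src.nrm_cong[OF r] src.cup_mlin src.cup_nrm cochain_mlin c cochain_nrm
        tgt.dsum_Hom O L rv_kap)
  then show "cmp Ch \<Phi> \<Psi> \<in> Hom Ch F H (q + p)"
    unfolding Coh_Hom * by simp
qed

lemma del_nrm:
  assumes c: "is_cochain C D \<Psi>"
  shows "src.nrm x (del (csrc \<Psi>) (ctgt \<Psi>) p (rv \<Psi>) x)"
proof (rule src.gdel_nrm[where \<kappa> = kap])
  interpret F: dg_functor C D "csrc \<Psi>" by (rule cochain_csrc[OF c])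
  interpret G: dg_functor C D "ctgt \<Psi>" by (rule cochain_ctgt[OF c])
  show "tht (ctgt \<Psi>) y [idn C y] * rv \<Psi> x u = rv \<Psi> x u"
    if "y \<in> Obj C" "is_path C x u" "path_end C x u = y" for y u
    using tgt.rho_idn_left[OF cochain_Hom[OF c that(2)]] that by (simp add: rv_def G.farr_idn)
  show "rv \<Psi> x v * tht (csrc \<Psi>) x [idn C x] = rv \<Psi> x v" if "is_path C x v" for v
    using tgt.rho_idn_right[OF cochain_Hom[OF c that]] src.is_path_Obj[OF that] by (simp add: rv_def F.farr_idn)
qed (use c in "auto intro: cochain_mlin cochain_nrm")

text \<open>Identifies the differential given by indexed sums with the twisted differential
  \<open>del\<close>. Each summand is first typed, so that \<open>rho D\<close> may be applied
  termwise.\<close>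

lemma coh_dif:
  assumes "\<Psi> \<in> Hom Ch F G p"
  shows "dif Ch \<Psi> \<in> Hom Ch F G (p + 1)"
    "is_path C x w ==> rv (dif Ch \<Psi>) x w = del F G p (rv \<Psi>) x w"
proof -
  have c: "is_cochain C D \<Psi>" "csrc \<Psi> = F" "ctgt \<Psi> = G" "cdeg \<Psi> = p"
    using assms by (auto simp: Coh_Hom)
  have FG: "dg_functor C D F" "dg_functor C D G"
    using cochain_csrc[OF c(1)] cochain_ctgt[OF c(1)] c by auto
  interpret F: dg_functor C D F by (rule FG)
  interpret G: dg_functor C D G by (rule FG)
  have O: "fobj F x \<in> Obj D" "fobj G (path_end C x w) \<in> Obj D" if "is_path C x w" for x w
    using src.is_path_Obj[OF that] FG by (auto intro!: fobj_Obj)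
  note H = cochain_Hom[OF c(1), unfolded c]
  let ?ds = "%x w. dsum D (fobj F x) (fobj G (path_end C x w)) (p + shdeg C w + 1)"
  let ?g = "%i w. p + shdeg C (drop (i + 1) w)"
  let ?cl = "%x w. cmp D (farr G (last w)) (cval \<Psi> x (butlast w))" and ?cr = "%w. cmp D (cval \<Psi> (cod C (hd w)) (tl w)) (farr F (hd w))"
  let ?T = "%x w. Hom D (fobj F x) (fobj G (path_end C x w)) (p + shdeg C w + 1)"
  have L1: "dif D (cval \<Psi> x w) \<in> ?T x w"
    if "is_path C x w" for x w
    by (rule tgt.dif_Hom[OF H[OF that]])
  have L2: "cval \<Psi> x (w[i := dif C (w ! i)]) \<in> ?T x w"
    if "is_path C x w" "i < length w" for x w i
    using H[OF src.update_dif_path(1)[OF that]] by (simp add: src.update_dif_path(2-)[OF that] add.assoc)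
  have L3: "cval \<Psi> x (merge_at C w i) \<in> ?T x w"
    if "is_path C x w" "i < length w - 1" for x w i
    using H[OF src.merge_at_path(1)[OF that]] by (simp add: src.merge_at_path(2-)[OF that] add.assoc)
  have L4: "?cl x w \<in> ?T x w"
    "rho D (?cl x w) = rho D (farr G (last w)) * rv \<Psi> x (butlast w)"
    if "is_path C x w" "w \<noteq> []" for x w
  proof -
    note b = src.path_butlast[OF that]
    note g = G.farr_Hom[OF src.Arr_Hom[OF b(2)], unfolded b(3)]
    show "?cl x w \<in> ?T x w" using tgt.cmp_Hom[OF g H[OF b(1)]] by (simp add: b(4,5) algebra_simps)
    show "rho D (?cl x w) = rho D (farr G (last w)) * rv \<Psi> x (butlast w)"
      unfolding rv_def by (rule tgt.rho_cmp[OF g H[OF b(1)]])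
  qed
  have L5: "?cr w \<in> ?T x w"
    "rho D (?cr w) = rv \<Psi> (cod C (hd w)) (tl w) * rho D (farr F (hd w))"
    if "is_path C x w" "w \<noteq> []" for x w
  proof -
    note b = src.path_tl[OF that]
    note g = F.farr_Hom[OF src.Arr_Hom[OF b(2)], unfolded b(3)]
    show "?cr w \<in> ?T x w" using tgt.cmp_Hom[OF H[OF b(1)] g] by (simp add: b(4,5) algebra_simps)
    show "rho D (?cr w) = rv \<Psi> (cod C (hd w)) (tl w) * rho D (farr F (hd w))"
      unfolding rv_def by (rule tgt.rho_cmp[OF H[OF b(1)] g])
  qed
  \<comment> \<open>The component of \<open>tht\<close> on the empty chain contributes commutators
    with \<open>prt D\<close> to the cup products. These belong to the other half of the
    differential, hence are subtracted here and reappear in \<open>D2\<close>.\<close>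
  have D1: "coh_delta C D \<Psi> x w \<in> ?T x w"
    "rho D (coh_delta C D \<Psi> x w) = cup C p (tht G) (rv \<Psi>) x w - sg p * cup C 1 (rv \<Psi>) (tht F) x w
      - (prt D * rv \<Psi> x w - sg (p + shdeg C w) * (rv \<Psi> x w * prt D))
      + (\<Sum>i\<leftarrow>[0..<length w - 1]. sg (?g i w) * rv \<Psi> x (merge_at C w i))" (is ?r)
    if p: "is_path C x w" for x w
  proof -
    let ?A = "if w = [] then [] else
           [sscl D (cdeg \<Psi> * deg C (last w) + cdeg \<Psi>)
              (cmp D (farr (ctgt \<Psi>) (last w)) (cval \<Psi> x (butlast w))),
            sscl D (cdeg \<Psi> + 1 + shdeg C (tl w))
              (cmp D (cval \<Psi> (cod C (hd w)) (tl w)) (farr (csrc \<Psi>) (hd w)))]"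
    let ?B = "map (%i. sscl D (cdeg \<Psi> + shdeg C (drop (i + 1) w))
                     (cval \<Psi> x (merge_at C w i))) [0..<length w - 1]"
    have L: "f \<in> ?T x w" if "f \<in> set (?A @ ?B)" for f
      using that L3[OF p] L4[OF p] L5[OF p] by (auto simp: c intro!: tgt.scl_Hom split: if_splits)
    have e: "coh_delta C D \<Psi> x w = ?ds x w (?A @ ?B)" unfolding coh_delta_def by (simp only: c)
    show "coh_delta C D \<Psi> x w \<in> ?T x w" unfolding e by (rule tgt.dsum_Hom[OF O[OF p] L])
    have A: "(\<Sum>f\<leftarrow>?A. rho D f) = cup C p (tht G) (rv \<Psi>) x w - sg p * cup C 1 (rv \<Psi>) (tht F) x w
      - (prt D * rv \<Psi> x w - sg (p + shdeg C w) * (rv \<Psi> x w * prt D))"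
    proof (cases w)
      case Nil
      then show ?thesis by (simp add: cup_tht_left cup_tht_right)
    next
      case (Cons f v)
      then have ne: "w \<noteq> []" by simp
      show ?thesis using L4[OF p ne] L5[OF p ne] ne
        by (simp add: c tgt.rho_sscl[OF tgt.Hom_Arr[OF L4(1)[OF p ne]]] tgt.rho_sscl[OF tgt.Hom_Arr[OF L5(1)[OF p ne]]]
            cup_tht_left cup_tht_right) (simp add: Cons sg_def)
    qed
    have B: "(\<Sum>f\<leftarrow>?B. rho D f) = (\<Sum>i\<leftarrow>[0..<length w - 1]. sg (?g i w) * rv \<Psi> x (merge_at C w i))"
    proof -
      have "rho D (sscl D (cdeg \<Psi> + shdeg C (drop (i + 1) w)) (cval \<Psi> x (merge_at C w i)))
          = sg (?g i w) * rv \<Psi> x (merge_at C w i)" if "i < length w - 1" for i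
        using tgt.rho_sscl[OF tgt.Hom_Arr[OF L3[OF p that]]] by (simp only: c rv_def)
      then show ?thesis unfolding map_map o_def by (intro arg_cong[of _ _ sum_list] map_cong refl) auto
    qed
    show ?r
    proof -
      have "rho D (coh_delta C D \<Psi> x w) = (\<Sum>f\<leftarrow>?A @ ?B. rho D f)"
        unfolding e by (rule tgt.rho_dsum[OF O[OF p] L])
      then show ?thesis by (simp only: map_append sum_list_append A B)
    qed
  qed
  have D2: "coh_delta_dg C D \<Psi> x w \<in> ?T x w"
    "rho D (coh_delta_dg C D \<Psi> x w) = prt D * rv \<Psi> x w - sg (p + shdeg C w) * (rv \<Psi> x w * prt D)
      + (\<Sum>i\<leftarrow>[0..<length w]. sg (?g i w) * rv \<Psi> x (w[i := dif C (w ! i)]))" (is ?r)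
    if p: "is_path C x w" for x w
  proof -
    let ?B = "map (%i. sscl D (cdeg \<Psi> + shdeg C (drop (i + 1) w))
                     (cval \<Psi> x (w[i := dif C (w ! i)]))) [0..<length w]"
    have L: "f \<in> ?T x w"
      if "f \<in> set ([dif D (cval \<Psi> x w)] @ ?B)" for f
      using that L1[OF p] L2[OF p] by (auto simp: c intro!: tgt.scl_Hom)
    have e: "coh_delta_dg C D \<Psi> x w = ?ds x w
       ([dif D (cval \<Psi> x w)] @ ?B)"
      unfolding coh_delta_dg_def by (simp only: c)
    show "coh_delta_dg C D \<Psi> x w \<in> ?T x w" unfolding e by (rule tgt.dsum_Hom[OF O[OF p] L])
    have B: "(\<Sum>f\<leftarrow>?B. rho D f) = (\<Sum>i\<leftarrow>[0..<length w]. sg (?g i w) * rv \<Psi> x (w[i := dif C (w ! i)]))"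
    proof -
      have "rho D (sscl D (cdeg \<Psi> + shdeg C (drop (i + 1) w)) (cval \<Psi> x (w[i := dif C (w ! i)])))
          = sg (?g i w) * rv \<Psi> x (w[i := dif C (w ! i)])" if "i < length w" for i
        using tgt.rho_sscl[OF tgt.Hom_Arr[OF L2[OF p that]]] by (simp only: c rv_def)
      then show ?thesis unfolding map_map o_def by (intro arg_cong[of _ _ sum_list] map_cong refl) auto
    qed
    show ?r
    proof -
      have "rho D (coh_delta_dg C D \<Psi> x w) = (\<Sum>f\<leftarrow>[dif D (cval \<Psi> x w)] @ ?B. rho D f)"
        unfolding e by (rule tgt.rho_dsum[OF O[OF p] L])
      then show ?thesis
        by (simp only: map_append sum_list_append B) (simp add: tgt.rho_dif[OF H[OF p]] rv_def)
    qed
  qed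
  let ?\<phi> = "%x fs. add D (coh_delta C D \<Psi> x fs) (coh_delta_dg C D \<Psi> x fs)"
  have r: "rho D (?\<phi> x w) = del F G p (rv \<Psi>) x w" if p: "is_path C x w" for x w
    unfolding tgt.rho_add[OF D1(1)[OF p] D2(1)[OF p]] D1(2)[OF p] D2(2)[OF p] src.gdel_def src.bb_sum_list
    by (simp add: sg_add mult.assoc sum_list_const_mult distrib_left)
  have *: "dif Ch \<Psi> = Cochain F G (p + 1) (on_paths C ?\<phi>)"
    by (simp add: Coh_def c)
  show "is_path C x w ==> rv (dif Ch \<Psi>) x w = del F G p (rv \<Psi>) x w"
    using r unfolding * by (simp add: rv_def)
  have m: "src.mlin kap x (del F G p (rv \<Psi>) x)" for x
    by (intro src.gdel_mlin tht_mlin FG cochain_mlin c tht_kap rv_kap)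
  have n: "src.nrm x (del F G p (rv \<Psi>) x)" for x
    using del_nrm[OF c(1)] by (simp add: c)
  have HH: "?\<phi> x w \<in> Hom D (fobj F x) (fobj G (path_end C x w)) (p + 1 + shdeg C w)" if "is_path C x w" for x w
    using tgt.add_Hom[OF D1(1)[OF that] D2(1)[OF that]] by (simp add: ac_simps)
  have "is_cochain C D (Cochain F G (p + 1) (on_paths C ?\<phi>))"
    by (intro is_cochainI FG src.mlin_cong[OF r] src.nrm_cong[OF r] m n HH)
  then show "dif Ch \<Psi> \<in> Hom Ch F G (p + 1)"
    unfolding Coh_Hom * by simp
qed

lemma Coh_eqI:
  assumes "\<Phi> \<in> Hom Ch F G p" "\<Psi> \<in> Hom Ch F G p"
    and "!!x w. is_path C x w ==> rv \<Phi> x w = rv \<Psi> x w"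
  shows "\<Phi> = \<Psi>"
  using assms by (intro cochain_eqI) (auto simp: Coh_Hom)

lemma coh_Hom_Obj: "\<Psi> \<in> Hom Ch F G p ==> dg_functor C D F" "\<Psi> \<in> Hom Ch F G p ==> dg_functor C D G"
  using cochain_csrc cochain_ctgt by (auto simp: Coh_Hom)

lemma coh_Arr_Hom: "\<Psi> \<in> Arr Ch ==> \<Psi> \<in> Hom Ch (csrc \<Psi>) (ctgt \<Psi>) (cdeg \<Psi>)"
  by (simp add: Coh_Hom)

lemma cup_rv_cong:
  assumes "is_path C x w" "!!y v. is_path C y v ==> rv \<Phi> y v = \<phi> y v" "!!y v. is_path C y v ==> rv \<Psi> y v = \<psi> y v"
  shows "cup C p (rv \<Phi>) (rv \<Psi>) x w = cup C p \<phi> \<psi> x w"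
  using assms by (intro src.cup_cong) auto

text \<open>Each axiom is compared on operator values, where it becomes a property of the cup
  product or of \<open>gdel\<close>.\<close>

lemma dg_category_Coh: "dg_category Ch"
proof
  fix \<Psi> assume "\<Psi> \<in> Arr Ch"
  then show "dom Ch \<Psi> \<in> Obj Ch" "cod Ch \<Psi> \<in> Obj Ch"
    using cochain_csrc cochain_ctgt by auto
next
  fix \<Psi> and a b :: 'k assume "\<Psi> \<in> Arr Ch"
  then have H: "\<Psi> \<in> Hom Ch (csrc \<Psi>) (ctgt \<Psi>) (cdeg \<Psi>)" by (rule coh_Arr_Hom)
  show "scl Ch 1 \<Psi> = \<Psi>"
    by (rule Coh_eqI[OF coh_scl(1)[OF H] H]) (simp add: coh_scl[OF H])
  show "scl Ch a (scl Ch b \<Psi>) = scl Ch (a * b) \<Psi>"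
    by (rule Coh_eqI[OF coh_scl(1)[OF coh_scl(1)[OF H]] coh_scl(1)[OF H]])
      (simp add: coh_scl[OF H] coh_scl[OF coh_scl(1)[OF H]] kap_mult mult.assoc)
  show "scl Ch (a + b) \<Psi> = add Ch (scl Ch a \<Psi>) (scl Ch b \<Psi>)"
    by (rule Coh_eqI[OF coh_scl(1)[OF H] coh_add(1)[OF coh_scl(1)[OF H] coh_scl(1)[OF H]]])
      (simp add: coh_scl[OF H] coh_add[OF coh_scl(1)[OF H] coh_scl(1)[OF H]] kap_add distrib_right)
next
  fix F G n assume "F \<in> Obj Ch" "G \<in> Obj Ch"
  then show "zer Ch F G n \<in> Hom Ch F G n" by (auto intro!: coh_zer)
next
  fix F assume "F \<in> Obj Ch"
  then show "idn Ch F \<in> Hom Ch F F 0" by (auto intro!: coh_idn)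
next
  fix \<Phi> F G n assume f: "\<Phi> \<in> Hom Ch F G n"
  note FG = coh_Hom_Obj[OF f]
  note i = coh_idn[OF FG(1)] coh_idn[OF FG(2)] and z = coh_zer[OF FG, where p = n] and d = coh_dif[OF f]
  note s = coh_scl[OF f]
  show "scl Ch a \<Phi> \<in> Hom Ch F G n" for a by (rule s)
  show "dif Ch \<Phi> \<in> Hom Ch F G (n + 1)" by (rule d)
  show "add Ch \<Phi> (zer Ch F G n) = \<Phi>"
    by (rule Coh_eqI[OF coh_add(1)[OF f z(1)] f]) (simp add: coh_add[OF f z(1)] z)
  show "add Ch \<Phi> (scl Ch (-1) \<Phi>) = zer Ch F G n"
  proof -
    have "kap (- 1 :: 'k) = (- 1 :: ('q, 'k) endo)" using kap_sg[of 1] by simp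
    then show ?thesis by (intro Coh_eqI[OF coh_add(1)[OF f s(1)] z(1)]) (simp add: coh_add[OF f s(1)] z s)
  qed
  have H: "cval \<Phi> x w \<in> Hom D (fobj F x) (fobj G (path_end C x w)) (n + shdeg C w)" if "is_path C x w" for x w
    using cochain_Hom[OF _ that, of \<Phi>] f by (auto simp: Coh_Hom)
  show "cmp Ch (idn Ch G) \<Phi> = \<Phi>"
  proof (rule Coh_eqI)
    show "cmp Ch (idn Ch G) \<Phi> \<in> Hom Ch F G n" using coh_cmp(1)[OF i(3) f] by simp
    fix x w assume p: "is_path C x w"
    have "rv (cmp Ch (idn Ch G) \<Phi>) x w = cup C n (%y v. if v = [] then rho D (idn D (fobj G y)) else 0) (rv \<Phi>) x w"
      unfolding coh_cmp(2)[OF i(3) f p] by (intro src.cup_cong p) (auto simp: i)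
    also have "... = rho D (idn D (fobj G (path_end C x w))) * rv \<Phi> x w"
      unfolding cup_def by (subst spl_right_nil) auto
    also have "... = rv \<Phi> x w" unfolding rv_def by (rule tgt.rho_idn_left[OF H[OF p]])
    finally show "rv (cmp Ch (idn Ch G) \<Phi>) x w = rv \<Phi> x w" .
  qed (rule f)
  show "cmp Ch \<Phi> (idn Ch F) = \<Phi>"
  proof (rule Coh_eqI)
    show "cmp Ch \<Phi> (idn Ch F) \<in> Hom Ch F G n" using coh_cmp(1)[OF f i(1)] by simp
    fix x w assume p: "is_path C x w"
    have "rv (cmp Ch \<Phi> (idn Ch F)) x w = cup C 0 (rv \<Phi>) (%y v. if v = [] then rho D (idn D (fobj F y)) else 0) x w"
      unfolding coh_cmp(2)[OF f i(1) p] by (intro src.cup_cong p) (auto simp: i)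
    also have "... = rv \<Phi> x w * rho D (idn D (fobj F x))"
      unfolding cup_def by (subst spl_left_nil) auto
    also have "... = rv \<Phi> x w" unfolding rv_def by (rule tgt.rho_idn_right[OF H[OF p]])
    finally show "rv (cmp Ch \<Phi> (idn Ch F)) x w = rv \<Phi> x w" .
  qed (rule f)
  show "dif Ch (scl Ch a \<Phi>) = scl Ch a (dif Ch \<Phi>)" for a
  proof (rule Coh_eqI[OF coh_dif(1)[OF s(1)] coh_scl(1)[OF d(1)]])
    fix x w assume p: "is_path C x w"
    have "rv (dif Ch (scl Ch a \<Phi>)) x w = del F G n (%x w. kap a * rv \<Phi> x w) x w"
      unfolding coh_dif(2)[OF s(1) p] by (rule src.gdel_cong[OF p]) (rule s)
    moreover have "cup C n (tht G) (%x w. kap a * rv \<Phi> x w) x w = kap a * cup C n (tht G) (rv \<Phi>) x w"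
      unfolding cup_def spl_mult_left[symmetric]
      by (rule spl_cong) (simp add: sg_def mult.assoc[symmetric] tht_kap)
    ultimately show "rv (dif Ch (scl Ch a \<Phi>)) x w = rv (scl Ch a (dif Ch \<Phi>)) x w"
      unfolding coh_scl(2)[OF d(1) p] d(2)[OF p] src.gdel_def src.cup_mult_left bb_mult_left
      by (simp only: distrib_left right_diff_distrib sg_left_commute)
  qed
  show "dif Ch (dif Ch \<Phi>) = zer Ch F G (n + 2)"
  proof (rule Coh_eqI)
    show "dif Ch (dif Ch \<Phi>) \<in> Hom Ch F G (n + 2)"
      using coh_dif(1)[OF d(1)] by (simp add: add.assoc)
    show "zer Ch F G (n + 2) \<in> Hom Ch F G (n + 2)" by (rule coh_zer[OF FG])
    fix x w assume p: "is_path C x w"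
    have "rv (dif Ch (dif Ch \<Phi>)) x w = del F G (n + 1) (del F G n (rv \<Phi>)) x w"
      unfolding coh_dif(2)[OF d(1) p] by (rule src.gdel_cong[OF p]) (rule d)
    also have "... = 0" using f by (intro del_del[OF FG _ p] cochain_mlin) (simp add: Coh_Hom)
    finally show "rv (dif Ch (dif Ch \<Phi>)) x w = rv (zer Ch F G (n + 2)) x w"
      by (simp add: coh_zer[OF FG] p)
  qed
  {
    fix \<Psi> assume g: "\<Psi> \<in> Hom Ch F G n"
    note sg' = coh_scl[OF g] and a = coh_add[OF f g] and a' = coh_add[OF g f]
    show "add Ch \<Phi> \<Psi> \<in> Hom Ch F G n" by (rule a)
    show "add Ch \<Phi> \<Psi> = add Ch \<Psi> \<Phi>" by (rule Coh_eqI[OF a(1) a'(1)]) (simp add: a a')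
    show "scl Ch c (add Ch \<Phi> \<Psi>) = add Ch (scl Ch c \<Phi>) (scl Ch c \<Psi>)" for c
      by (rule Coh_eqI[OF coh_scl(1)[OF a(1)] coh_add(1)[OF s(1) sg'(1)]])
        (simp add: coh_scl[OF a(1)] coh_add[OF s(1) sg'(1)] a s sg' distrib_left)
    show "dif Ch (add Ch \<Phi> \<Psi>) = add Ch (dif Ch \<Phi>) (dif Ch \<Psi>)"
    proof (rule Coh_eqI[OF coh_dif(1)[OF a(1)] coh_add(1)[OF d(1) coh_dif(1)[OF g]]])
      fix x w assume p: "is_path C x w"
      have "rv (dif Ch (add Ch \<Phi> \<Psi>)) x w = del F G n (%x w. rv \<Phi> x w + rv \<Psi> x w) x w"
        unfolding coh_dif(2)[OF a(1) p] by (rule src.gdel_cong[OF p]) (rule a)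
      then show "rv (dif Ch (add Ch \<Phi> \<Psi>)) x w = rv (add Ch (dif Ch \<Phi>) (dif Ch \<Psi>)) x w"
        unfolding coh_add(2)[OF d(1) coh_dif(1)[OF g] p] d(2)[OF p] coh_dif(2)[OF g p] src.gdel_def
          src.cup_add_left src.cup_add_right bb_add
        by (simp add: algebra_simps)
    qed
    show "add Ch (add Ch \<Phi> \<Psi>) \<Theta> = add Ch \<Phi> (add Ch \<Psi> \<Theta>)"
      if h: "\<Theta> \<in> Hom Ch F G n" for \<Theta>
      by (rule Coh_eqI[OF coh_add(1)[OF a(1) h] coh_add(1)[OF f coh_add(1)[OF g h]]])
        (simp add: coh_add[OF a(1) h] coh_add[OF f coh_add(1)[OF g h]] a coh_add[OF g h] add.assoc)
  }
next
  fix \<Phi> G H m \<Psi> F n assume g: "\<Phi> \<in> Hom Ch G H m" and f: "\<Psi> \<in> Hom Ch F G n"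
  note c = coh_cmp[OF g f] and sf = coh_scl[OF f] and sg' = coh_scl[OF g]
  show "cmp Ch \<Phi> \<Psi> \<in> Hom Ch F H (m + n)" by (rule c)
  show "cmp Ch (scl Ch a \<Phi>) \<Psi> = scl Ch a (cmp Ch \<Phi> \<Psi>)" for a
  proof (rule Coh_eqI[OF coh_cmp(1)[OF sg'(1) f] coh_scl(1)[OF c(1)]])
    fix x w assume p: "is_path C x w"
    have "rv (cmp Ch (scl Ch a \<Phi>) \<Psi>) x w = cup C n (%x w. kap a * rv \<Phi> x w) (rv \<Psi>) x w"
      unfolding coh_cmp(2)[OF sg'(1) f p] by (rule cup_rv_cong[OF p]) (auto intro: sg')
    then show "rv (cmp Ch (scl Ch a \<Phi>) \<Psi>) x w = rv (scl Ch a (cmp Ch \<Phi> \<Psi>)) x w"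
      by (simp add: src.cup_mult_left coh_scl[OF c(1)] p c)
  qed
  show "cmp Ch \<Phi> (scl Ch a \<Psi>) = scl Ch a (cmp Ch \<Phi> \<Psi>)" for a
  proof (rule Coh_eqI[OF coh_cmp(1)[OF g sf(1)] coh_scl(1)[OF c(1)]])
    fix x w assume p: "is_path C x w"
    have "rv (cmp Ch \<Phi> (scl Ch a \<Psi>)) x w = cup C n (rv \<Phi>) (%x w. kap a * rv \<Psi> x w) x w"
      unfolding coh_cmp(2)[OF g sf(1) p] by (rule cup_rv_cong[OF p]) (auto intro: sf)
    also have "... = kap a * cup C n (rv \<Phi>) (rv \<Psi>) x w"
      unfolding cup_def spl_mult_left[symmetric]
      by (rule spl_cong) (simp add: sg_def mult.assoc[symmetric] rv_kap)
    finally show "rv (cmp Ch \<Phi> (scl Ch a \<Psi>)) x w = rv (scl Ch a (cmp Ch \<Phi> \<Psi>)) x w"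
      by (simp add: coh_scl[OF c(1)] p c)
  qed
  show "cmp Ch (add Ch \<Phi> \<Phi>') \<Psi> = add Ch (cmp Ch \<Phi> \<Psi>) (cmp Ch \<Phi>' \<Psi>)"
    if g': "\<Phi>' \<in> Hom Ch G H m" for \<Phi>'
  proof (rule Coh_eqI[OF coh_cmp(1)[OF coh_add(1)[OF g g'] f] coh_add(1)[OF c(1) coh_cmp(1)[OF g' f]]])
    fix x w assume p: "is_path C x w"
    have "rv (cmp Ch (add Ch \<Phi> \<Phi>') \<Psi>) x w = cup C n (%x w. rv \<Phi> x w + rv \<Phi>' x w) (rv \<Psi>) x w"
      unfolding coh_cmp(2)[OF coh_add(1)[OF g g'] f p] by (rule cup_rv_cong[OF p]) (auto intro: coh_add[OF g g'])
    then show "rv (cmp Ch (add Ch \<Phi> \<Phi>') \<Psi>) x w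
        = rv (add Ch (cmp Ch \<Phi> \<Psi>) (cmp Ch \<Phi>' \<Psi>)) x w"
      by (simp add: src.cup_add_left coh_add[OF c(1) coh_cmp(1)[OF g' f]] p c coh_cmp[OF g' f])
  qed
  show "cmp Ch \<Phi> (add Ch \<Psi> \<Psi>') = add Ch (cmp Ch \<Phi> \<Psi>) (cmp Ch \<Phi> \<Psi>')"
    if f': "\<Psi>' \<in> Hom Ch F G n" for \<Psi>'
  proof (rule Coh_eqI[OF coh_cmp(1)[OF g coh_add(1)[OF f f']] coh_add(1)[OF c(1) coh_cmp(1)[OF g f']]])
    fix x w assume p: "is_path C x w"
    have "rv (cmp Ch \<Phi> (add Ch \<Psi> \<Psi>')) x w = cup C n (rv \<Phi>) (%x w. rv \<Psi> x w + rv \<Psi>' x w) x w"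
      unfolding coh_cmp(2)[OF g coh_add(1)[OF f f'] p] by (rule cup_rv_cong[OF p]) (auto intro: coh_add[OF f f'])
    then show "rv (cmp Ch \<Phi> (add Ch \<Psi> \<Psi>')) x w
        = rv (add Ch (cmp Ch \<Phi> \<Psi>) (cmp Ch \<Phi> \<Psi>')) x w"
      by (simp add: src.cup_add_right coh_add[OF c(1) coh_cmp(1)[OF g f']] p c coh_cmp[OF g f'])
  qed
  show "cmp Ch (cmp Ch \<Theta> \<Phi>) \<Psi> = cmp Ch \<Theta> (cmp Ch \<Phi> \<Psi>)"
    if h: "\<Theta> \<in> Hom Ch H K l" for \<Theta> K l
  proof (rule Coh_eqI)
    note hg = coh_cmp[OF h g]
    show "cmp Ch (cmp Ch \<Theta> \<Phi>) \<Psi> \<in> Hom Ch F K (l + m + n)"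
      by (rule coh_cmp[OF hg(1) f])
    show "cmp Ch \<Theta> (cmp Ch \<Phi> \<Psi>) \<in> Hom Ch F K (l + m + n)"
      using coh_cmp(1)[OF h c(1)] by (simp add: add.assoc)
    fix x w assume p: "is_path C x w"
    have "rv (cmp Ch (cmp Ch \<Theta> \<Phi>) \<Psi>) x w = cup C n (cup C m (rv \<Theta>) (rv \<Phi>)) (rv \<Psi>) x w"
      unfolding coh_cmp(2)[OF hg(1) f p] by (rule cup_rv_cong[OF p]) (auto intro: hg)
    moreover have "rv (cmp Ch \<Theta> (cmp Ch \<Phi> \<Psi>)) x w = cup C (m + n) (rv \<Theta>) (cup C n (rv \<Phi>) (rv \<Psi>)) x w"
      unfolding coh_cmp(2)[OF h c(1) p] by (rule cup_rv_cong[OF p]) (auto intro: c)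
    ultimately show "rv (cmp Ch (cmp Ch \<Theta> \<Phi>) \<Psi>) x w = rv (cmp Ch \<Theta> (cmp Ch \<Phi> \<Psi>)) x w"
      by (simp add: src.cup_assoc)
  qed
  show "dif Ch (cmp Ch \<Phi> \<Psi>)
    = add Ch (cmp Ch (dif Ch \<Phi>) \<Psi>) (sscl Ch m (cmp Ch \<Phi> (dif Ch \<Psi>)))"
  proof (rule Coh_eqI)
    note df = coh_dif[OF f] and dg = coh_dif[OF g]
    note l = coh_cmp[OF dg(1) f] and r = coh_cmp[OF g df(1)]
    have l1: "cmp Ch (dif Ch \<Phi>) \<Psi> \<in> Hom Ch F H (m + n + 1)"
      and r1: "cmp Ch \<Phi> (dif Ch \<Psi>) \<in> Hom Ch F H (m + n + 1)"
      using l r by (simp_all add: ac_simps)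
    show "dif Ch (cmp Ch \<Phi> \<Psi>) \<in> Hom Ch F H (m + n + 1)" by (rule coh_dif[OF c(1)])
    show "add Ch (cmp Ch (dif Ch \<Phi>) \<Psi>) (sscl Ch m (cmp Ch \<Phi> (dif Ch \<Psi>)))
      \<in> Hom Ch F H (m + n + 1)"
      by (rule coh_add[OF l1 coh_scl(1)[OF r1]])
    fix x w assume p: "is_path C x w"
    have "rv (dif Ch (cmp Ch \<Phi> \<Psi>)) x w = del F H (m + n) (cup C n (rv \<Phi>) (rv \<Psi>)) x w"
      unfolding coh_dif(2)[OF c(1) p] by (rule src.gdel_cong[OF p]) (rule c)
    moreover have "rv (cmp Ch (dif Ch \<Phi>) \<Psi>) x w = cup C n (del G H m (rv \<Phi>)) (rv \<Psi>) x w"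
      unfolding l(2)[OF p] by (rule cup_rv_cong[OF p]) (auto intro: dg)
    moreover have "rv (cmp Ch \<Phi> (dif Ch \<Psi>)) x w = cup C (n + 1) (rv \<Phi>) (del F G n (rv \<Psi>)) x w"
      unfolding r(2)[OF p] by (rule cup_rv_cong[OF p]) (auto intro: df)
    ultimately show "rv (dif Ch (cmp Ch \<Phi> \<Psi>)) x w
      = rv (add Ch (cmp Ch (dif Ch \<Phi>) \<Psi>) (sscl Ch m (cmp Ch \<Phi> (dif Ch \<Psi>)))) x w"
      by (simp add: src.gdel_cup[OF p, where ?\<theta>1.0 = "tht G"] coh_add(2)[OF l1 coh_scl(1)[OF r1] p] coh_scl(2)[OF r1 p] powi_sg)
  qed
qed

text \<open>Functoriality into a category of cochains can be tested on values; used for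
  transposition and for precomposition.\<close>

lemma dg_functor_CohI:
  assumes "dg_category B" "fobj K \<in> extensional (Obj B)" "farr K \<in> extensional (Arr B)"
    and o: "!!x. x \<in> Obj B ==> dg_functor C D (fobj K x)"
    and h: "!!f x y n. f \<in> Hom B x y n ==> farr K f \<in> Hom Ch (fobj K x) (fobj K y) n"
    and add: "!!f g x y n z w. f \<in> Hom B x y n ==> g \<in> Hom B x y n ==> is_path C z w ==>
      rv (farr K (add B f g)) z w = rv (farr K f) z w + rv (farr K g) z w"
    and scl: "!!f a z w. f \<in> Arr B ==> is_path C z w ==> rv (farr K (scl B a f)) z w = kap a * rv (farr K f) z w"
    and idn: "!!x z w. x \<in> Obj B ==> is_path C z w ==>
      rv (farr K (idn B x)) z w = (if w = [] then rho D (idn D (fobj (fobj K x) z)) else 0)"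
    and cmp: "!!g f x y v m n z w. g \<in> Hom B y v m ==> f \<in> Hom B x y n ==> is_path C z w ==>
      rv (farr K (cmp B g f)) z w = cup C n (rv (farr K g)) (rv (farr K f)) z w"
    and dif: "!!f z w. f \<in> Arr B ==> is_path C z w ==>
      rv (farr K (dif B f)) z w = del (fobj K (dom B f)) (fobj K (cod B f)) (deg B f) (rv (farr K f)) z w"
  shows "dg_functor B Ch K"
proof -
  interpret B: dg_category B by fact
  note c = coh_add coh_scl coh_cmp coh_dif
  show ?thesis
  proof (intro dg_functor.intro dg_functor_axioms.intro B.dg_category_axioms dg_category_Coh)
    show "fobj K \<in> Obj B \<rightarrow>\<^sub>E Obj Ch" using assms(2) o by (auto simp: PiE_def)
    fix f x y n assume f: "f \<in> Hom B x y n"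
    show "farr K (add B f g) = add Ch (farr K f) (farr K g)" if g: "g \<in> Hom B x y n" for g
      by (rule Coh_eqI[OF h[OF B.add_Hom[OF f g]] c(1)[OF h[OF f] h[OF g]]]) (simp add: add[OF f g] c(2)[OF h[OF f] h[OF g]])
  next
    fix f assume "f \<in> Arr B"
    note f = B.Arr_Hom[OF this] and a = this
    show "farr K (scl B b f) = scl Ch b (farr K f)" for b
      by (rule Coh_eqI[OF h[OF B.scl_Hom[OF f]] c(3)[OF h[OF f]]]) (simp add: scl[OF a] c(4)[OF h[OF f]])
    show "farr K (dif B f) = dif Ch (farr K f)"
      by (rule Coh_eqI[OF h[OF B.dif_Hom[OF f]] c(7)[OF h[OF f]]]) (simp add: dif[OF a] c(8)[OF h[OF f]])
  next
    fix x assume x: "x \<in> Obj B"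
    note i = coh_idn[OF o[OF x]]
    show "farr K (idn B x) = idn Ch (fobj K x)"
      by (rule Coh_eqI[OF h[OF B.idn_Hom[OF x]] i(1)]) (simp add: idn[OF x] i(2))
  next
    fix g y v m f x n assume g: "g \<in> Hom B y v m" and f: "f \<in> Hom B x y n"
    show "farr K (cmp B g f) = cmp Ch (farr K g) (farr K f)"
      by (rule Coh_eqI[OF h[OF B.cmp_Hom[OF g f]] c(5)[OF h[OF g] h[OF f]]]) (simp add: cmp[OF g f] c(6)[OF h[OF g] h[OF f]])
  qed (use assms(3) h in auto)
qed

end

section \<open>The twisted tensor product is a dg category\<close>

context dg_pair
begin

abbreviation "wft \<equiv> wf_term C D"
abbreviation "td \<equiv> tdom C D"
abbreviation "tc \<equiv> tcod C D"
abbreviation "tg \<equiv> tdeg C D"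

definition typed :: "('k, 'o, 'm, 'p, 'q) tw_term => 'o \<times> 'p => 'o \<times> 'p => int => bool" where
  "typed t x y n \<longleftrightarrow> wft t \<and> td t = x \<and> tc t = y \<and> tg t = n"

lemma typed_Obj: "wft t ==> td t \<in> Obj C \<times> Obj D \<and> tc t \<in> Obj C \<times> Obj D"
  by (induction t) (auto simp: src.Arr_simps tgt.Arr_simps dest: tgt.is_path_Obj)

lemma typed_ObjD: "typed t x y n ==> x \<in> Obj C \<times> Obj D" "typed t x y n ==> y \<in> Obj C \<times> Obj D"
  using typed_Obj unfolding typed_def by blast+

lemma typed_tsum:
  assumes "x \<in> Obj C \<times> Obj D" "y \<in> Obj C \<times> Obj D" "!!t. t \<in> set ts ==> typed t x y n"
  shows "typed (tsum x y n ts) x y n"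
  using assms by (induction ts) (auto simp: tsum_def typed_def)

lemma path_take_drop:
  assumes "is_path D d gs"
  shows "is_path D d (take m gs)" "is_path D (path_end D d (take m gs)) (drop m gs)"
    "path_end D (path_end D d (take m gs)) (drop m gs) = path_end D d gs"
    "shdeg D (drop m gs) + shdeg D (take m gs) = shdeg D gs"
  using assms tgt.is_path_append[of d "take m gs" "drop m gs"] path_end_append[of D d "take m gs" "drop m gs"]
    shdeg_simps(3)[of D "take m gs" "drop m gs"] by auto

text \<open>Each relation preserves source, target and degree. This makes them well defined on
  classes and independent of the representative chosen by \<open>rep\<close>.\<close>

lemma tw_rel_typed: "(s, t) \<in> tw_rel C D ==> wft s \<and> typed t (td s) (tc s) (tg s)"
proof (induction rule: tw_rel.induct)
  case (R4 f1 f2 d gs)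
  have "typed (tsum (dom C f1, d) (cod C f2, path_end D d gs) (deg C f2 + deg C f1 + shdeg D gs)
             (map (%m. Scl ((-1) powi (deg C f1 * shdeg D (drop m gs)))
                         (Cmp (Eps f2 (path_end D d (take m gs)) (drop m gs))
                              (Eps f1 d (take m gs))))
                  [0..<Suc (length gs)])) (dom C f1, d) (cod C f2, path_end D d gs) (deg C f2 + deg C f1 + shdeg D gs)"
    using R4 path_take_drop[OF R4(4)]
    by (intro typed_tsum) (auto simp: typed_def src.Arr_simps tgt.is_path_Obj simp del: upt_Suc)
  then show ?case
    using R4 by (simp add: src.Arr_simps)
qed (auto simp: typed_def src.Arr_simps tgt.Arr_simps tgt.is_path_append tgt.is_path_Obj src.Hom_Obj tgt.Hom_Obj Hom_def typed_Obj)

lemmas tw_sym = tw_rel.sym[where C = C and D = D] and tw_trans [trans] = tw_rel.trans[where C = C and D = D]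

lemma tw_equiv: "equiv {t. wft t} (tw_rel C D)"
proof (rule equivI)
  show "tw_rel C D \<subseteq> {t. wft t} \<times> {t. wft t}"
    using tw_rel_typed unfolding typed_def by auto
qed (auto intro: refl_onI symI transI tw_rel.refl tw_sym tw_trans)

lemma cls_eq: "wft s ==> wft t ==> cls C D s = cls C D t \<longleftrightarrow> (s, t) \<in> tw_rel C D"
  using eq_equiv_class_iff[OF tw_equiv, of s t] by (simp add: cls_def)

lemma rep_rel: "wft t ==> (t, rep (cls C D t)) \<in> tw_rel C D"
  unfolding rep_def cls_def by (rule someI2[of _ t]) (auto intro: tw_rel.refl)

lemma typed_rep: "typed t x y n ==> typed (rep (cls C D t)) x y n"
  using tw_rel_typed[OF rep_rel[of t]] by (auto simp: typed_def)

lemma Arr_tens: "X \<in> Arr (tens C D) \<longleftrightarrow> (\<exists>t. wft t \<and> X = cls C D t)"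
  by (auto simp: tens_def quotient_def cls_def)

lemma tens_cls:
  assumes "wft t"
  shows "cls C D t \<in> Arr (tens C D)" "dom (tens C D) (cls C D t) = td t" "cod (tens C D) (cls C D t) = tc t"
    "deg (tens C D) (cls C D t) = tg t"
  using assms typed_rep[of t "td t" "tc t" "tg t"] unfolding Arr_tens by (auto simp: tens_def typed_def)

lemma Hom_tens: "X \<in> Hom (tens C D) x y n \<longleftrightarrow> (\<exists>t. typed t x y n \<and> X = cls C D t)"
proof
  assume "X \<in> Hom (tens C D) x y n"
  then obtain t where "wft t" "X = cls C D t" "dom (tens C D) X = x" "cod (tens C D) X = y" "deg (tens C D) X = n"
    by (auto simp: Hom_def Arr_tens)
  then show "\<exists>t. typed t x y n \<and> X = cls C D t"
    by (auto simp: tens_cls typed_def)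
qed (auto simp: Hom_def tens_cls typed_def)

lemma Hom_tensI: "typed t x y n ==> cls C D t \<in> Hom (tens C D) x y n"
  unfolding Hom_tens by blast

lemma tens_ops:
  shows "Obj (tens C D) = Obj C \<times> Obj D" "idn (tens C D) x = cls C D (Idn x)"
    "zer (tens C D) x y n = cls C D (Zer x y n)"
    "wft (Cmp s t) ==> cmp (tens C D) (cls C D s) (cls C D t) = cls C D (Cmp s t)"
    "wft (Add s t) ==> add (tens C D) (cls C D s) (cls C D t) = cls C D (Add s t)"
    "wft t ==> scl (tens C D) a (cls C D t) = cls C D (Scl a t)"
proof -
  show "Obj (tens C D) = Obj C \<times> Obj D" "idn (tens C D) x = cls C D (Idn x)"
    "zer (tens C D) x y n = cls C D (Zer x y n)" by (simp_all add: tens_def)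
  assume w: "wft (Cmp s t)"
  then have "(Cmp s t, Cmp (rep (cls C D s)) (rep (cls C D t))) \<in> tw_rel C D"
    by (auto intro!: tw_rel.Cmp_cong rep_rel)
  then show "cmp (tens C D) (cls C D s) (cls C D t) = cls C D (Cmp s t)"
    using cls_eq[OF w] tw_rel_typed by (auto simp: tens_def typed_def)
next
  assume w: "wft (Add s t)"
  then have "(Add s t, Add (rep (cls C D s)) (rep (cls C D t))) \<in> tw_rel C D"
    by (auto intro!: tw_rel.Add_cong rep_rel)
  then show "add (tens C D) (cls C D s) (cls C D t) = cls C D (Add s t)"
    using cls_eq[OF w] tw_rel_typed by (auto simp: tens_def typed_def)
next
  assume w: "wft t"
  then have "(Scl a t, Scl a (rep (cls C D t))) \<in> tw_rel C D"
    by (auto intro!: tw_rel.Scl_cong rep_rel)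
  then show "scl (tens C D) a (cls C D t) = cls C D (Scl a t)"
    using cls_eq[of "Scl a t"] w tw_rel_typed by (auto simp: tens_def typed_def)
qed

text \<open>Adding the negative of \<open>t\<close> cancels one copy. All absorbing properties of
  zero reduce to this.\<close>

lemma tw_Zer:
  assumes t: "typed t x y n" and d: "(Add t t, t) \<in> tw_rel C D"
  shows "(t, Zer x y n) \<in> tw_rel C D"
proof -
  have w: "wft t" "td t = x" "tc t = y" "tg t = n" using t by (auto simp: typed_def)
  have n: "(Add t (Scl (-1) t), Zer x y n) \<in> tw_rel C D"
    using tw_rel.Add_neg[OF w(1)] by (simp add: w)
  have "(t, Add t (Zer x y n)) \<in> tw_rel C D"
    using tw_sym[OF tw_rel.Add_Zer[OF w(1)]] by (simp add: w)
  also have "(Add t (Zer x y n), Add t (Add t (Scl (-1) t))) \<in> tw_rel C D"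
    using w typed_ObjD[OF t] by (intro tw_rel.Add_cong tw_rel.refl tw_sym[OF n]) auto
  also have "(Add t (Add t (Scl (-1) t)), Add (Add t t) (Scl (-1) t)) \<in> tw_rel C D"
    using w by (intro tw_sym[OF tw_rel.Add_assoc]) auto
  also have "(Add (Add t t) (Scl (-1) t), Add t (Scl (-1) t)) \<in> tw_rel C D"
    using w by (intro tw_rel.Add_cong d tw_rel.refl) auto
  also note n
  finally show ?thesis .
qed

lemma tw_Zer_Zer: "x \<in> Obj C \<times> Obj D ==> y \<in> Obj C \<times> Obj D ==> (Add (Zer x y n) (Zer x y n), Zer x y n) \<in> tw_rel C D"
  using tw_rel.Add_Zer[of C D "Zer x y n"] by simp

lemma tw_Scl_Zer:
  assumes "x \<in> Obj C \<times> Obj D" "y \<in> Obj C \<times> Obj D"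
  shows "(Scl a (Zer x y n), Zer x y n) \<in> tw_rel C D"
proof (rule tw_Zer)
  have "(Add (Scl a (Zer x y n)) (Scl a (Zer x y n)), Scl a (Add (Zer x y n) (Zer x y n))) \<in> tw_rel C D"
    using assms by (intro tw_sym[OF tw_rel.Scl_Add]) auto
  also have "(Scl a (Add (Zer x y n) (Zer x y n)), Scl a (Zer x y n)) \<in> tw_rel C D"
    by (intro tw_rel.Scl_cong tw_Zer_Zer assms)
  finally show "(Add (Scl a (Zer x y n)) (Scl a (Zer x y n)), Scl a (Zer x y n)) \<in> tw_rel C D" .
qed (use assms in "auto simp: typed_def")

lemma tw_Cmp_Zer_left:
  assumes "typed t x y n" "z \<in> Obj C \<times> Obj D"
  shows "(Cmp (Zer y z m) t, Zer x z (m + n)) \<in> tw_rel C D"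
proof (rule tw_Zer)
  have w: "wft t" "td t = x" "tc t = y" "tg t = n" using assms(1) by (auto simp: typed_def)
  have o: "y \<in> Obj C \<times> Obj D" using typed_ObjD[OF assms(1)] by blast
  have "(Add (Cmp (Zer y z m) t) (Cmp (Zer y z m) t), Cmp (Add (Zer y z m) (Zer y z m)) t) \<in> tw_rel C D"
    using assms w o by (intro tw_sym[OF tw_rel.Cmp_Add_left]) auto
  also have "(Cmp (Add (Zer y z m) (Zer y z m)) t, Cmp (Zer y z m) t) \<in> tw_rel C D"
    using assms w o by (intro tw_rel.Cmp_cong tw_Zer_Zer tw_rel.refl) auto
  finally show "(Add (Cmp (Zer y z m) t) (Cmp (Zer y z m) t), Cmp (Zer y z m) t) \<in> tw_rel C D" .
qed (use assms typed_ObjD[OF assms(1)] in "auto simp: typed_def")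

lemma tw_Cmp_Zer_right:
  assumes "typed t y z m" "x \<in> Obj C \<times> Obj D"
  shows "(Cmp t (Zer x y n), Zer x z (m + n)) \<in> tw_rel C D"
proof (rule tw_Zer)
  have w: "wft t" "td t = y" "tc t = z" "tg t = m" using assms(1) by (auto simp: typed_def)
  have o: "y \<in> Obj C \<times> Obj D" using typed_ObjD[OF assms(1)] by blast
  have "(Add (Cmp t (Zer x y n)) (Cmp t (Zer x y n)), Cmp t (Add (Zer x y n) (Zer x y n))) \<in> tw_rel C D"
    using assms w o by (intro tw_sym[OF tw_rel.Cmp_Add_right]) auto
  also have "(Cmp t (Add (Zer x y n) (Zer x y n)), Cmp t (Zer x y n)) \<in> tw_rel C D"
    using assms w o by (intro tw_rel.Cmp_cong tw_Zer_Zer tw_rel.refl) auto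
  finally show "(Add (Cmp t (Zer x y n)) (Cmp t (Zer x y n)), Cmp t (Zer x y n)) \<in> tw_rel C D" .
qed (use assms typed_ObjD[OF assms(1)] in "auto simp: typed_def")

text \<open>
  With the zero differential in place of the given one, the axioms are immediate, and the resulting
  ring representation serves to analyse the differential.
\<close>

definition zten :: "('k, 'o \<times> 'p, ('k, 'o, 'm, 'p, 'q) tw_term set) dgcat" where
  "zten = (tens C D)\<lparr>dif := %X. zer (tens C D) (dom (tens C D) X) (cod (tens C D) X) (deg (tens C D) X + 1)\<rparr>"

lemma zten_simps: "Obj zten = Obj (tens C D)" "Arr zten = Arr (tens C D)" "dom zten = dom (tens C D)"
  "cod zten = cod (tens C D)" "deg zten = deg (tens C D)" "idn zten = idn (tens C D)"
  "cmp zten = cmp (tens C D)" "zer zten = zer (tens C D)" "add zten = add (tens C D)"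
  "scl zten = scl (tens C D)"
  "dif zten X = zer (tens C D) (dom (tens C D) X) (cod (tens C D) X) (deg (tens C D) X + 1)"
  "Hom zten = Hom (tens C D)"
  by (simp_all add: zten_def Hom_def fun_eq_iff)

lemma typed_simps:
  "typed s x y n ==> typed t x y n ==> typed (Add s t) x y n"
  "typed s y z m ==> typed t x y n ==> typed (Cmp s t) x z (m + n)"
  "typed t x y n ==> typed (Scl a t) x y n"
  "x \<in> Obj C \<times> Obj D ==> typed (Idn x) x x 0"
  "x \<in> Obj C \<times> Obj D ==> y \<in> Obj C \<times> Obj D ==> typed (Zer x y n) x y n"
  by (auto simp: typed_def)

lemma typed_ops:
  "typed s x y n ==> typed t x y n ==> add (tens C D) (cls C D s) (cls C D t) = cls C D (Add s t)"
  "typed s y z m ==> typed t x y n ==> cmp (tens C D) (cls C D s) (cls C D t) = cls C D (Cmp s t)"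
  "typed t x y n ==> scl (tens C D) a (cls C D t) = cls C D (Scl a t)"
  by (auto simp: typed_def intro!: tens_ops)

lemma cls_eqI: "(s, t) \<in> tw_rel C D ==> cls C D s = cls C D t"
  using tw_rel_typed[of s t] cls_eq[of s t] by (auto simp: typed_def)

lemma dg_category_zten: "dg_category zten"
proof
  fix X and a b :: 'k assume "X \<in> Arr zten"
  then obtain t where t: "X = cls C D t" "wft t" by (auto simp: zten_simps Arr_tens)
  show "dom zten X \<in> Obj zten" "cod zten X \<in> Obj zten"
    using typed_Obj[OF t(2)] by (auto simp: zten_simps t(1) tens_cls[OF t(2)] tens_ops(1))
  show "scl zten 1 X = X" "scl zten a (scl zten b X) = scl zten (a * b) X"
    "scl zten (a + b) X = add zten (scl zten a X) (scl zten b X)"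
    using t(2) by (auto simp: zten_simps t(1) tens_ops intro!: cls_eqI tw_rel.intros)
next
  fix x y n assume "x \<in> Obj zten" "y \<in> Obj zten"
  then show "zer zten x y n \<in> Hom zten x y n"
    by (auto simp: zten_simps tens_ops(1,3) intro!: Hom_tensI typed_simps)
next
  fix x assume "x \<in> Obj zten"
  then show "idn zten x \<in> Hom zten x x 0"
    by (auto simp: zten_simps tens_ops(1,2) intro!: Hom_tensI typed_simps)
next
  fix X x y n assume "X \<in> Hom zten x y n"
  then obtain s where s: "X = cls C D s" "typed s x y n" by (auto simp: zten_simps Hom_tens)
  have w: "wft s" "td s = x" "tc s = y" "tg s = n" using s(2) by (auto simp: typed_def)
  note o = typed_ObjD[OF s(2)]
  have dX: "dif zten X = cls C D (Zer x y (n + 1))"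
    by (simp add: zten_simps s tens_cls w tens_ops)
  show "scl zten a X \<in> Hom zten x y n" for a
    by (auto simp: zten_simps s(1) typed_ops[OF s(2)] intro!: Hom_tensI typed_simps s)
  show "add zten X (zer zten x y n) = X"
    using tw_rel.Add_Zer[OF w(1)] by (simp add: zten_simps s tens_ops w o cls_eqI)
  show "add zten X (scl zten (-1) X) = zer zten x y n"
    using tw_rel.Add_neg[OF w(1)] by (simp add: zten_simps s tens_ops w o cls_eqI)
  show "cmp zten (idn zten y) X = X" "cmp zten X (idn zten x) = X"
    using tw_rel.Cmp_Idn_left[OF w(1)] tw_rel.Cmp_Idn_right[OF w(1)]
    by (simp_all add: zten_simps s tens_ops w o cls_eqI)
  show "dif zten X \<in> Hom zten x y (n + 1)"
    unfolding dX unfolding zten_simps using o by (auto intro!: Hom_tensI typed_simps)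
  show "dif zten (dif zten X) = zer zten x y (n + 2)"
    using o unfolding dX by (simp add: zten_simps tens_cls tens_ops add.assoc)
  show "dif zten (scl zten a X) = scl zten a (dif zten X)" for a
    using o unfolding dX
    by (simp add: zten_simps s tens_ops tens_cls w cls_eqI[OF tw_Scl_Zer[OF o]])
  {
    fix Y assume "Y \<in> Hom zten x y n"
    then obtain t where t: "Y = cls C D t" "typed t x y n" by (auto simp: zten_simps Hom_tens)
    have wt: "wft t" "td t = x" "tc t = y" "tg t = n" using t(2) by (auto simp: typed_def)
    show "add zten X Y \<in> Hom zten x y n"
      using s t by (auto simp: zten_simps typed_ops intro!: Hom_tensI typed_simps)
    show "add zten X Y = add zten Y X"
      using w wt by (auto simp: zten_simps s t tens_ops intro!: cls_eqI tw_rel.Add_comm)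
    show "scl zten a (add zten X Y) = add zten (scl zten a X) (scl zten a Y)" for a
      using w wt by (auto simp: zten_simps s t tens_ops intro!: cls_eqI tw_rel.Scl_Add)
    show "dif zten (add zten X Y) = add zten (dif zten X) (dif zten Y)"
      using o w wt tw_sym[OF tw_Zer_Zer[OF o]] unfolding dX
      by (simp add: zten_simps s t tens_ops tens_cls cls_eqI)
    show "add zten (add zten X Y) Z = add zten X (add zten Y Z)" if "Z \<in> Hom zten x y n" for Z
    proof -
      from that obtain u where u: "Z = cls C D u" "typed u x y n" by (auto simp: zten_simps Hom_tens)
      have wu: "wft u" "td u = x" "tc u = y" "tg u = n" using u(2) by (auto simp: typed_def)
      show ?thesis
        using w wt wu by (auto simp: zten_simps s t u tens_ops intro!: cls_eqI tw_rel.Add_assoc)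
    qed
  }
next
  fix X y z m Y x n assume "X \<in> Hom zten y z m" "Y \<in> Hom zten x y n"
  then obtain s t where s: "X = cls C D s" "typed s y z m" and t: "Y = cls C D t" "typed t x y n"
    by (auto simp: zten_simps Hom_tens)
  have w: "wft s" "td s = y" "tc s = z" "tg s = m" using s(2) by (auto simp: typed_def)
  have wt: "wft t" "td t = x" "tc t = y" "tg t = n" using t(2) by (auto simp: typed_def)
  note o = typed_ObjD[OF s(2)] typed_ObjD[OF t(2)]
  show "cmp zten X Y \<in> Hom zten x z (m + n)"
    using s t by (auto simp: zten_simps typed_ops intro!: Hom_tensI typed_simps)
  show "cmp zten (scl zten a X) Y = scl zten a (cmp zten X Y)"
    "cmp zten X (scl zten a Y) = scl zten a (cmp zten X Y)" for a
    using w wt by (auto simp: zten_simps s t tens_ops intro!: cls_eqI tw_rel.Cmp_Scl_left tw_rel.Cmp_Scl_right)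
  show "cmp zten (add zten X X') Y = add zten (cmp zten X Y) (cmp zten X' Y)" if "X' \<in> Hom zten y z m" for X'
  proof -
    from that obtain u where u: "X' = cls C D u" "typed u y z m" by (auto simp: zten_simps Hom_tens)
    have wu: "wft u" "td u = y" "tc u = z" "tg u = m" using u(2) by (auto simp: typed_def)
    show ?thesis
      using w wt wu by (auto simp: zten_simps s t u tens_ops intro!: cls_eqI tw_rel.Cmp_Add_left)
  qed
  show "cmp zten X (add zten Y Y') = add zten (cmp zten X Y) (cmp zten X Y')" if "Y' \<in> Hom zten x y n" for Y'
  proof -
    from that obtain u where u: "Y' = cls C D u" "typed u x y n" by (auto simp: zten_simps Hom_tens)
    have wu: "wft u" "td u = x" "tc u = y" "tg u = n" using u(2) by (auto simp: typed_def)
    show ?thesis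
      using w wt wu by (auto simp: zten_simps s t u tens_ops intro!: cls_eqI tw_rel.Cmp_Add_right)
  qed
  show "cmp zten (cmp zten Z X) Y = cmp zten Z (cmp zten X Y)" if "Z \<in> Hom zten z w' l" for Z w' l
  proof -
    from that obtain u where u: "Z = cls C D u" "typed u z w' l" by (auto simp: zten_simps Hom_tens)
    have wu: "wft u" "td u = z" "tc u = w'" "tg u = l" using u(2) by (auto simp: typed_def)
    show ?thesis using w wt wu by (auto simp: zten_simps s t u tens_ops intro!: cls_eqI tw_rel.Cmp_assoc)
  qed
  have 1: "cls C D (Cmp (Zer y z (m + 1)) t) = cls C D (Zer x z (m + n + 1))"
    using cls_eqI[OF tw_Cmp_Zer_left[OF t(2) o(2), of "m + 1"]] by (simp add: ac_simps)
  have 2: "cls C D (Cmp s (Zer x y (n + 1))) = cls C D (Zer x z (m + n + 1))"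
    using cls_eqI[OF tw_Cmp_Zer_right[OF s(2) o(3), of "n + 1"]] by (simp add: ac_simps)
  have dX: "dif zten X = cls C D (Zer y z (m + 1))" "dif zten Y = cls C D (Zer x y (n + 1))"
    "dif zten (cmp zten X Y) = cls C D (Zer x z (m + n + 1))"
    using w wt by (simp_all add: zten_simps s t tens_cls tens_ops)
  show "dif zten (cmp zten X Y) = add zten (cmp zten (dif zten X) Y) (sscl zten m (cmp zten X (dif zten Y)))"
    unfolding dX using o w wt cls_eqI[OF tw_Scl_Zer[OF o(3,2)]] cls_eqI[OF tw_Zer_Zer[OF o(3,2)]]
    by (simp add: zten_simps s t tens_ops(4) 1 2) (simp add: tens_ops(5,6) 1 2)
qed

sublocale Z: dg_category zten
  by (rule dg_category_zten)

section \<open>Operator values of expressions\<close>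

definition vl :: "('k, 'o, 'm, 'p, 'q) tw_term => (('k, 'o, 'm, 'p, 'q) tw_term set, 'k) endo" where
  "vl t = rho zten (cls C D t)"

text \<open>\<open>zten\<close> carries the zero differential, so the differential under study
  appears only through expressions: it is applied first and the result is then represented.\<close>

definition dv :: "('k, 'o, 'm, 'p, 'q) tw_term => (('k, 'o, 'm, 'p, 'q) tw_term set, 'k) endo" where
  "dv t = vl (tdif C D t)"

lemma cls_Hom: "wft t ==> cls C D t \<in> Hom zten (td t) (tc t) (tg t)"
  unfolding zten_simps by (rule Hom_tensI) (simp add: typed_def)

lemma vl_simps [simp]:
  "wft (Add s t) ==> vl (Add s t) = vl s + vl t"
  "wft (Cmp s t) ==> vl (Cmp s t) = vl s * vl t"
  "wft t ==> vl (Scl a t) = kap a * vl t"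
  "wft (Zer x y n) ==> vl (Zer x y n) = 0"
proof -
  show "wft (Add s t) ==> vl (Add s t) = vl s + vl t"
    using Z.rho_add[OF cls_Hom[of s], of "cls C D t"] cls_Hom[of t] tens_ops(5)[of s t]
    by (simp add: vl_def zten_simps)
  show "wft (Cmp s t) ==> vl (Cmp s t) = vl s * vl t"
    using Z.rho_cmp[OF cls_Hom[of s], of "cls C D t"] cls_Hom[of t] tens_ops(4)[of s t]
    by (simp add: vl_def zten_simps)
  show "wft t ==> vl (Scl a t) = kap a * vl t"
    using Z.rho_scl[OF Z.Hom_Arr[OF cls_Hom[of t]], of a] tens_ops(6)[of t a]
    by (simp add: vl_def zten_simps)
  show "wft (Zer x y n) ==> vl (Zer x y n) = 0"
    using Z.rho_zer[of x y n] by (simp add: vl_def zten_simps tens_ops)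
qed

lemma vl_Idn: "wft t ==> vl (Idn (tc t)) * vl t = vl t" "wft t ==> vl t * vl (Idn (td t)) = vl t"
  using Z.rho_idn_left[OF cls_Hom[of t]] Z.rho_idn_right[OF cls_Hom[of t]]
  by (simp_all add: vl_def zten_simps tens_ops)

lemma vl_rel: "(s, t) \<in> tw_rel C D ==> vl s = vl t"
  by (simp add: vl_def cls_eqI)

text \<open>Faithfulness of the representation: expressions of the same type are related as soon as
  their operators agree. Relations can thus be proved by computing in a ring.\<close>

lemma relI:
  assumes "typed s x y n" "typed t x y n" "vl s = vl t"
  shows "(s, t) \<in> tw_rel C D"
proof -
  have "cls C D s = cls C D t"
    using assms Hom_tensI by (intro Z.rho_inj[of _ x y n]) (auto simp: zten_simps vl_def)
  then show ?thesis using assms cls_eq[of s t] by (simp add: typed_def)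
qed

lemma vl_kap: "vl t * kap a = kap a * vl t"
  by (simp add: vl_def Z.kap_rho)

lemma tsum_hom:
  fixes V :: "('k, 'o, 'm, 'p, 'q) tw_term => 'r::ring_1"
  assumes "!!s t. typed s x y n ==> typed t x y n ==> V (Add s t) = V s + V t" "V (Zer x y n) = 0"
    and "x \<in> Obj C \<times> Obj D" "y \<in> Obj C \<times> Obj D" "!!t. t \<in> set ts ==> typed t x y n"
  shows "V (tsum x y n ts) = (\<Sum>t\<leftarrow>ts. V t)"
  using assms(5)
proof (induction ts)
  case (Cons t ts)
  have "typed (tsum x y n ts) x y n" using Cons.prems assms(3,4) by (intro typed_tsum) auto
  moreover have "tsum x y n (t # ts) = Add t (tsum x y n ts)" by (simp add: tsum_def)
  ultimately show ?case using Cons assms(1)[of t "tsum x y n ts"] by simp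
qed (simp add: tsum_def assms(2))

text \<open>\<open>V\<close> is required to respect only sums and signs, so that the formula also
  serves for \<open>dv\<close>, which is not multiplicative.\<close>

lemma R4_hom:
  fixes V :: "('k, 'o, 'm, 'p, 'q) tw_term => 'r::ring_1"
  assumes f: "f1 \<in> Arr C" "f2 \<in> Arr C" "dom C f2 = cod C f1" and p: "is_path D d gs"
    and add: "!!s t. wft (Add s t) ==> V (Add s t) = V s + V t" and zer: "!!x y n. wft (Zer x y n) ==> V (Zer x y n) = 0"
    and scl: "!!m t. wft t ==> V (Scl (sg m) t) = sg m * V t"
  shows "V (tsum (dom C f1, d) (cod C f2, path_end D d gs) (deg C f2 + deg C f1 + shdeg D gs)
      (map (%m. Scl ((-1) powi (deg C f1 * shdeg D (drop m gs)))
         (Cmp (Eps f2 (path_end D d (take m gs)) (drop m gs)) (Eps f1 d (take m gs)))) [0..<Suc (length gs)]))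
    = spl (%u v. sg (shdeg D v * deg C f1) * V (Cmp (Eps f2 (path_end D d u) v) (Eps f1 d u))) gs"
proof -
  let ?t = "%m. Cmp (Eps f2 (path_end D d (take m gs)) (drop m gs)) (Eps f1 d (take m gs))"
  have t: "typed (?t m) (dom C f1, d) (cod C f2, path_end D d gs) (deg C f2 + deg C f1 + shdeg D gs)" for m
    using f path_take_drop[OF p] by (auto simp: typed_def)
  have s: "V (Scl (sg m) (?t i)) = sg m * V (?t i)" for m i
    using scl[of "?t i"] t[of i] by (simp only: typed_def)
  show ?thesis
    unfolding spl_sum_list using f tgt.is_path_Obj[OF p] t
    by (subst tsum_hom)
      (auto simp: add zer s typed_def powi_sg o_def src.Arr_simps mult.commute simp del: upt_Suc)
qed

text \<open>The linear multiplicative functions that respect the relations; the instances are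
  \<open>vl\<close> and the operator values of a dg functor out of the tensor product.\<close>

definition tval :: "(('k, 'o, 'm, 'p, 'q) tw_term => 'r::ring_1) => ('k => 'r) => bool" where
  "tval V \<kappa> \<longleftrightarrow> (\<forall>s t. (s, t) \<in> tw_rel C D --> V s = V t)
     \<and> (\<forall>s t. wft (Add s t) --> V (Add s t) = V s + V t) \<and> (\<forall>s t. wft (Cmp s t) --> V (Cmp s t) = V s * V t)
     \<and> (\<forall>a t. wft t --> V (Scl a t) = \<kappa> a * V t) \<and> (\<forall>x y n. wft (Zer x y n) --> V (Zer x y n) = 0)
     \<and> \<kappa> 1 = 1 \<and> (\<forall>n. \<kappa> (sg n) = sg n)"

lemma tvalD:
  assumes "tval V \<kappa>"
  shows "(s, t) \<in> tw_rel C D ==> V s = V t" "wft (Add s t) ==> V (Add s t) = V s + V t"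
    "wft (Cmp s t) ==> V (Cmp s t) = V s * V t" "wft t ==> V (Scl a t) = \<kappa> a * V t"
    "wft (Zer x y n) ==> V (Zer x y n) = 0" "\<kappa> 1 = 1" "\<kappa> (sg n) = sg n"
    "wft t ==> V (Scl ((-1) powi n) t) = sg n * V t"
  using assms unfolding tval_def powi_sg by auto

lemma tval_tsum:
  assumes V: "tval V \<kappa>"
    and "x \<in> Obj C \<times> Obj D" "y \<in> Obj C \<times> Obj D" "!!t. t \<in> set ts ==> typed t x y n"
  shows "V (tsum x y n ts) = (\<Sum>t\<leftarrow>ts. V t)"
  using assms(2-) by (intro tsum_hom) (auto simp: typed_def tvalD[OF V])

lemma tval_mlin:
  assumes V: "tval V \<kappa>" and f: "f \<in> Arr C"
  shows "tgt.mlin \<kappa> y (%w. V (Eps f y w))"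
  unfolding tgt.mlin_def
proof (intro allI impI)
  fix us g g' vs y' z n a
  assume p: "is_path D y (us @ g # vs)" and g: "g \<in> Hom D y' z n" "g' \<in> Hom D y' z n"
  note s = tgt.scl_Hom[OF g(1), of a]
  note p' = tgt.is_path_Hom[OF p g(1) s] tgt.is_path_Hom[OF p g]
  have e: "path_end D y (us @ scl D a g # vs) = path_end D y (us @ g' # vs)"
    "shdeg D (us @ scl D a g # vs) = shdeg D (us @ g' # vs)"
    using s g by (auto simp: Hom_def)
  have "V (Eps f y (us @ add D (scl D a g) g' # vs)) = V (Add (Eps f y (us @ scl D a g # vs)) (Eps f y (us @ g' # vs)))"
    by (rule tvalD(1)[OF V tw_rel.R2_add_right[OF f s g(2) p'(1)]])
  also have "... = V (Eps f y (us @ scl D a g # vs)) + V (Eps f y (us @ g' # vs))"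
    using f p' e by (intro tvalD(2)[OF V]) simp
  also have "V (Eps f y (us @ scl D a g # vs)) = \<kappa> a * V (Eps f y (us @ g # vs))"
    using tvalD(1)[OF V tw_rel.R2_scl_right[OF f p]] f p by (simp add: tvalD(4)[OF V])
  finally show "V (Eps f y (us @ add D (scl D a g) g' # vs)) = \<kappa> a * V (Eps f y (us @ g # vs)) + V (Eps f y (us @ g' # vs))"
    by simp
qed

lemma tval_nrm:
  assumes V: "tval V \<kappa>" and f: "f \<in> Arr C"
  shows "tgt.nrm y (%w. V (Eps f y w))"
  unfolding tgt.nrm_def
proof (intro allI impI)
  fix w assume p: "is_path D y w" and "\<exists>z\<in>Obj D. idn D z \<in> set w"
  then obtain z where "z \<in> Obj D" "idn D z \<in> set w" by blast
  then show "V (Eps f y w) = 0"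
    using tvalD(1)[OF V tw_rel.R3_right[OF f _ p]] f p by (simp add: src.Arr_simps tgt.is_path_Obj tvalD(5)[OF V])
qed

text \<open>The relation for \<open>\<epsilon>\<close> of a composite is literally the cup product;
  on the empty chain its part is taken by functoriality of \<open>f \<otimes> id\<close>.\<close>

lemma tval_cmp:
  assumes V: "tval V \<kappa>" and f: "f1 \<in> Arr C" "f2 \<in> Arr C" "dom C f2 = cod C f1" and p: "is_path D d gs"
  shows "V (Eps (cmp C f2 f1) d gs) = cup D (deg C f1) (%y w. V (Eps f2 y w)) (%y w. V (Eps f1 y w)) d gs"
proof (cases "gs = []")
  case True
  then have d: "d \<in> Obj D" using p by simp
  show ?thesis
    using True tvalD(1)[OF V tw_rel.R1_left[OF f(2,1,3) d]] f d by (simp add: cup_def tvalD(3)[OF V])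
next
  case False
  have "V (Eps (cmp C f2 f1) d gs) = spl (%u v. sg (shdeg D v * deg C f1) * V (Cmp (Eps f2 (path_end D d u) v) (Eps f1 d u))) gs"
    unfolding tvalD(1)[OF V tw_rel.R4[OF f p False]]
    by (rule R4_hom[OF f p]) (auto simp: tvalD[OF V])
  also have "... = cup D (deg C f1) (%y w. V (Eps f2 y w)) (%y w. V (Eps f1 y w)) d gs"
    unfolding cup_def by (rule spl_cong) (use f p in "auto simp: tgt.is_path_append tvalD(3)[OF V]")
  finally show ?thesis .
qed

lemma tval_vl: "tval vl kap"
  unfolding tval_def using vl_rel by auto

lemmas vl_tsum = tval_tsum[OF tval_vl]

section \<open>The differential of expressions respects the relations\<close>

definition tdl :: "'m => 'p => 'q list => ('k, 'o, 'm, 'p, 'q) tw_term list" where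
  "tdl f d gs = [Eps (dif C f) d gs]
       @ map (%i. Scl ((-1) powi (1 + deg C f + shdeg D (drop (i + 1) gs)))
                     (Eps f d (gs[i := dif D (gs ! i)]))) [0..<length gs]
       @ (if gs = [] then [] else
           [Scl ((-1) powi (1 + deg C f * deg D (last gs) + deg C f))
              (Cmp (Rgt (cod C f) (last gs)) (Eps f d (butlast gs))),
            Scl ((-1) powi (1 + deg C f + shdeg D (tl gs) + 1))
              (Cmp (Eps f (cod D (hd gs)) (tl gs)) (Rgt (dom C f) (hd gs)))])
       @ map (%i. Scl ((-1) powi (1 + deg C f + shdeg D (drop (i + 1) gs)))
                     (Eps f d (merge_at D gs i))) [0..<length gs - 1]"

lemma tdif_Eps: "tdif C D (Eps f d gs) =
    tsum (dom C f, d) (cod C f, path_end D d gs) (deg C f + shdeg D gs + 1) (tdl f d gs)"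
  by (simp only: tdif.simps(1) tdl_def)

declare tdif.simps(1) [simp del]

lemma tdl_parts:
  assumes f: "f \<in> Arr C" and p: "is_path D d gs"
  shows "typed (Eps (dif C f) d gs) (dom C f, d) (cod C f, path_end D d gs) (deg C f + shdeg D gs + 1)"
    and "i < length gs ==>
      typed (Eps f d (gs[i := dif D (gs ! i)])) (dom C f, d) (cod C f, path_end D d gs) (deg C f + shdeg D gs + 1)"
    and "i < length gs - 1 ==>
      typed (Eps f d (merge_at D gs i)) (dom C f, d) (cod C f, path_end D d gs) (deg C f + shdeg D gs + 1)"
    and "gs \<noteq> [] ==> typed (Cmp (Rgt (cod C f) (last gs)) (Eps f d (butlast gs)))
      (dom C f, d) (cod C f, path_end D d gs) (deg C f + shdeg D gs + 1)"
    and "gs \<noteq> [] ==> typed (Cmp (Eps f (cod D (hd gs)) (tl gs)) (Rgt (dom C f) (hd gs)))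
      (dom C f, d) (cod C f, path_end D d gs) (deg C f + shdeg D gs + 1)"
  using f p tgt.update_dif_path[OF p, of i] tgt.merge_at_path[OF p, of i] tgt.path_butlast[OF p] tgt.path_tl[OF p]
  by (auto simp: typed_def src.Arr_simps)

lemma typed_tdl:
  assumes "f \<in> Arr C" "is_path D d gs" "t \<in> set (tdl f d gs)"
  shows "typed t (dom C f, d) (cod C f, path_end D d gs) (deg C f + shdeg D gs + 1)"
  using assms(3) tdl_parts[OF assms(1,2)] by (auto simp: tdl_def intro!: typed_simps(3) split: if_splits)

lemma typed_tdif: "typed t x y n ==> typed (tdif C D t) x y (n + 1)"
proof (induction t arbitrary: x y n)
  case (Eps f d gs)
  then have p: "f \<in> Arr C" "is_path D d gs" "x = (dom C f, d)" "y = (cod C f, path_end D d gs)" "n = deg C f + shdeg D gs"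
    by (auto simp: typed_def)
  show ?case
    unfolding tdif_Eps p(3-5)
    using p(1,2) by (intro typed_tsum typed_tdl) (auto simp: src.Arr_simps tgt.is_path_Obj)
qed (auto simp: typed_def tgt.Arr_simps)

lemma wf_tdif: "wft t ==> wft (tdif C D t)" "wft t ==> td (tdif C D t) = td t"
  "wft t ==> tc (tdif C D t) = tc t" "wft t ==> tg (tdif C D t) = tg t + 1"
  using typed_tdif[of t "td t" "tc t" "tg t"] by (auto simp: typed_def)

text \<open>\<open>V\<close> stays general because the same sum is evaluated under
  \<open>vl\<close>, \<open>dv\<close>, functors out of the tensor product, and the extension
  \<open>uv\<close> of a functor into cochains.\<close>

lemma tdl_sum:
  assumes f: "f \<in> Arr C" and p: "is_path D d gs"
    and V: "!!n t. wft t ==> V (Scl ((-1) powi n) t) = sg n * V t"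
  shows "(\<Sum>t\<leftarrow>tdl f d gs. V t :: 'r::ring_1) = V (Eps (dif C f) d gs) - sg (deg C f) * bb D (%w. V (Eps f d w)) gs
    - (if gs = [] then 0 else sg (deg C f * deg D (last gs) + deg C f)
         * V (Cmp (Rgt (cod C f) (last gs)) (Eps f d (butlast gs))))
    + (if gs = [] then 0 else sg (deg C f + shdeg D (tl gs))
         * V (Cmp (Eps f (cod D (hd gs)) (tl gs)) (Rgt (dom C f) (hd gs))))"
proof -
  note w = tdl_parts[OF f p, unfolded typed_def, THEN conjunct1]
  let ?s = "%i. shdeg D (drop (i + 1) gs)"
  have 1: "(\<Sum>i\<leftarrow>[0..<length gs]. V (Scl ((-1) powi (1 + deg C f + ?s i)) (Eps f d (gs[i := dif D (gs ! i)]))))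
      = - sg (deg C f) * (\<Sum>i\<leftarrow>[0..<length gs]. sg (?s i) * V (Eps f d (gs[i := dif D (gs ! i)])))"
  proof -
    have "V (Scl ((-1) powi (1 + deg C f + ?s i)) (Eps f d (gs[i := dif D (gs ! i)])))
      = - sg (deg C f) * (sg (?s i) * V (Eps f d (gs[i := dif D (gs ! i)])))" if "i < length gs" for i
      unfolding V[OF w(2)[OF that]] by (simp add: sg_def)
    then show ?thesis
      unfolding sum_list_const_mult[symmetric] by (intro arg_cong[of _ _ sum_list] map_cong refl) auto
  qed
  have 2: "(\<Sum>i\<leftarrow>[0..<length gs - 1]. V (Scl ((-1) powi (1 + deg C f + ?s i)) (Eps f d (merge_at D gs i))))
      = - sg (deg C f) * (\<Sum>i\<leftarrow>[0..<length gs - 1]. sg (?s i) * V (Eps f d (merge_at D gs i)))"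
  proof -
    have "V (Scl ((-1) powi (1 + deg C f + ?s i)) (Eps f d (merge_at D gs i)))
      = - sg (deg C f) * (sg (?s i) * V (Eps f d (merge_at D gs i)))" if "i < length gs - 1" for i
      unfolding V[OF w(3)[OF that]] by (simp add: sg_def)
    then show ?thesis
      unfolding sum_list_const_mult[symmetric] by (intro arg_cong[of _ _ sum_list] map_cong refl) auto
  qed
  have 3: "(\<Sum>t\<leftarrow>(if gs = [] then [] else
           [Scl ((-1) powi (1 + deg C f * deg D (last gs) + deg C f))
              (Cmp (Rgt (cod C f) (last gs)) (Eps f d (butlast gs))),
            Scl ((-1) powi (1 + deg C f + shdeg D (tl gs) + 1))
              (Cmp (Eps f (cod D (hd gs)) (tl gs)) (Rgt (dom C f) (hd gs)))]). V t)
     = - (if gs = [] then 0 else sg (deg C f * deg D (last gs) + deg C f)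
         * V (Cmp (Rgt (cod C f) (last gs)) (Eps f d (butlast gs))))
    + (if gs = [] then 0 else sg (deg C f + shdeg D (tl gs))
         * V (Cmp (Eps f (cod D (hd gs)) (tl gs)) (Rgt (dom C f) (hd gs))))"
  proof (cases "gs = []")
    case False
    show ?thesis
      using False by (simp only: if_False list.map sum_list.Cons sum_list.Nil V[OF w(4)[OF False]] V[OF w(5)[OF False]])
        (auto simp: sg_def)
  qed simp
  show ?thesis
    unfolding tdl_def tgt.bb_sum_list map_append sum_list_append 3
    unfolding map_map o_def 1 2
    by (simp add: algebra_simps)
qed

text \<open>The twisting cochain of \<open>g \<mapsto> id \<otimes> g\<close>. In contrast to
  \<open>tht\<close> it is zero on the empty chain, since the differential is not yet an operator
  here.\<close>

definition ta :: "'o => 'p => 'q list => (('k, 'o, 'm, 'p, 'q) tw_term set, 'k) endo" where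
  "ta c y w = (case w of [] => 0 | g # v => if v = [] then vl (Rgt c g) else 0)"

lemma ta_simps [simp]: "ta c y [] = 0" "ta c y [g] = vl (Rgt c g)" "ta c y (f # g # w) = 0"
  by (simp_all add: ta_def)

definition ve :: "'m => 'p => 'q list => (('k, 'o, 'm, 'p, 'q) tw_term set, 'k) endo" where
  "ve f y w = vl (Eps f y w)"

lemma vl_sg: "wft t ==> vl (Scl ((-1) powi n) t) = sg n * vl t"
  by (simp add: powi_sg)

lemma dv_Eps_sum:
  assumes f: "f \<in> Arr C" and p: "is_path D d gs"
  shows "dv (Eps f d gs) = vl (Eps (dif C f) d gs) - sg (deg C f) * bb D (%w. vl (Eps f d w)) gs
    - (if gs = [] then 0 else sg (deg C f * deg D (last gs) + deg C f)
         * vl (Cmp (Rgt (cod C f) (last gs)) (Eps f d (butlast gs))))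
    + (if gs = [] then 0 else sg (deg C f + shdeg D (tl gs))
         * vl (Cmp (Eps f (cod D (hd gs)) (tl gs)) (Rgt (dom C f) (hd gs))))"
proof -
  have "dv (Eps f d gs) = (\<Sum>t\<leftarrow>tdl f d gs. vl t)"
    unfolding dv_def tdif_Eps using f tgt.is_path_Obj[OF p]
    by (intro vl_tsum typed_tdl f p) (auto simp: src.Arr_simps)
  also note tdl_sum[OF f p, of vl, OF vl_sg]
  finally show ?thesis .
qed

text \<open>The differential of \<open>\<epsilon>(f; -)\<close> measures by how much
  \<open>f \<mapsto> \<epsilon>(f; -)\<close> fails to commute with the differentials of arrows and
  of cochains twisted by \<open>ta\<close>.\<close>

lemma dv_Eps:
  assumes f: "f \<in> Arr C" and p: "is_path D d gs"
  shows "dv (Eps f d gs) = ve (dif C f) d gs - tgt.gdel (ta (dom C f)) (ta (cod C f)) (deg C f) (ve f) d gs"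
proof -
  note w = tdl_parts[OF f p, unfolded typed_def, THEN conjunct1]
  note dv_Eps_sum[OF f p]
  also have "(if gs = [] then 0 else sg (deg C f * deg D (last gs) + deg C f)
         * vl (Cmp (Rgt (cod C f) (last gs)) (Eps f d (butlast gs))))
      = cup D (deg C f) (ta (cod C f)) (ve f) d gs"
    using w(4) by (subst tgt.cup_short_left) (auto simp: ve_def)
  also have "(if gs = [] then 0 else sg (deg C f + shdeg D (tl gs))
         * vl (Cmp (Eps f (cod D (hd gs)) (tl gs)) (Rgt (dom C f) (hd gs))))
      = sg (deg C f) * cup D 1 (ve f) (ta (dom C f)) d gs"
    using w(5) by (subst tgt.cup_short_right) (auto simp: ve_def sg_add mult.assoc split: list.split)
  finally show ?thesis
    by (simp add: ve_def[abs_def] tgt.gdel_def)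
qed

lemma dv_simps [simp]:
  "wft (Add s t) ==> dv (Add s t) = dv s + dv t"
  "wft (Cmp s t) ==> dv (Cmp s t) = dv s * vl t + sg (tg s) * (vl s * dv t)"
  "wft t ==> dv (Scl a t) = kap a * dv t"
  "wft (Zer x y n) ==> dv (Zer x y n) = 0" "wft (Idn x) ==> dv (Idn x) = 0"
  by (simp_all add: dv_def wf_tdif powi_sg)

lemma dv_Rgt: "dv (Rgt c g) = vl (Rgt c (dif D g))"
  by (simp add: dv_def)

lemma dv_tsum:
  assumes "x \<in> Obj C \<times> Obj D" "y \<in> Obj C \<times> Obj D" "!!t. t \<in> set ts ==> typed t x y n"
  shows "dv (tsum x y n ts) = (\<Sum>t\<leftarrow>ts. dv t)"
  using assms by (intro tsum_hom) (auto simp: typed_def)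

lemma ve_add: "[|f \<in> Hom C c c' p; f' \<in> Hom C c c' p; is_path D d gs|] ==> ve (add C f f') d gs = ve f d gs + ve f' d gs"
  using vl_rel[OF tw_rel.R2_add_left[of f C c c' p f' D d gs]] by (auto simp: ve_def Hom_def)

lemma ve_scl: "[|f \<in> Arr C; is_path D d gs|] ==> ve (scl C a f) d gs = kap a * ve f d gs"
  using vl_rel[OF tw_rel.R2_scl_left[of f C D d gs a]] by (auto simp: ve_def)

lemma ve_zer: "[|c \<in> Obj C; c' \<in> Obj C; is_path D d gs|] ==> ve (zer C c c' p) d gs = 0"
  using ve_add[OF src.zer_Hom src.zer_Hom, of c c' d gs p] by (simp add: src.add_zer[OF src.zer_Hom])

lemma ve_kap: "ve f y v * kap a = kap a * ve f y v" "ta c y v * kap a = kap a * ta c y v"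
  by (auto simp: ve_def ta_def vl_kap split: list.split)

lemma ve_abs: "ve f y = (%w. vl (Eps f y w))"
  by (simp add: ve_def[abs_def])

lemma ve_mlin: "f \<in> Arr C ==> tgt.mlin kap y (ve f y)"
  unfolding ve_abs by (rule tval_mlin[OF tval_vl])

lemma ve_nrm: "f \<in> Arr C ==> tgt.nrm y (ve f y)"
  unfolding ve_abs by (rule tval_nrm[OF tval_vl])

lemma ve_cmp: "[|f1 \<in> Arr C; f2 \<in> Arr C; dom C f2 = cod C f1; is_path D d gs|]
    ==> ve (cmp C f2 f1) d gs = cup D (deg C f1) (ve f2) (ve f1) d gs"
  using tval_cmp[OF tval_vl] by (simp add: ve_def[abs_def])

lemma Rgt_lin:
  assumes "c \<in> Obj C" "g \<in> Hom D y z n" "g' \<in> Hom D y z n"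
  shows "vl (Rgt c (add D g g')) = vl (Rgt c g) + vl (Rgt c g')" "vl (Rgt c (scl D a g)) = kap a * vl (Rgt c g)"
  using vl_rel[OF tw_rel.Right_add[OF assms]] vl_rel[OF tw_rel.Right_scl[OF assms(1) tgt.Hom_Arr[OF assms(2)]]] assms
  by (auto simp: Hom_def)

lemma Rgt_zer: "c \<in> Obj C ==> y \<in> Obj D ==> z \<in> Obj D ==> vl (Rgt c (zer D y z n)) = 0"
  using Rgt_lin(1)[OF _ tgt.zer_Hom tgt.zer_Hom, of c y z n] by (simp add: tgt.add_zer[OF tgt.zer_Hom])

lemma ta_mlin: "c \<in> Obj C ==> tgt.mlin kap y (ta c y)"
  unfolding tgt.mlin_def
proof (intro allI impI)
  fix us g g' vs y' z n a
  assume c: "c \<in> Obj C" and g: "g \<in> Hom D y' z n" "g' \<in> Hom D y' z n"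
  then show "ta c y (us @ add D (scl D a g) g' # vs) = kap a * ta c y (us @ g # vs) + ta c y (us @ g' # vs)"
    using Rgt_lin[OF c tgt.scl_Hom[OF g(1)] g(2)] Rgt_lin(2)[OF c g]
    by (cases us) (auto simp: ta_def)
qed

lemma ve_idn: "c \<in> Obj C ==> is_path D d gs ==> ve (idn C c) d gs = (if gs = [] then vl (Idn (c, d)) else 0)"
  using vl_rel[OF tw_rel.Left_idn[of c C d D]] vl_rel[OF tw_rel.R3_left[of c C D d gs]] tgt.is_path_Obj[of d gs]
  by (auto simp: ve_def)

lemma Rgt_idn: "c \<in> Obj C ==> d \<in> Obj D ==> vl (Rgt c (idn D d)) = vl (Idn (c, d))"
  using vl_rel[OF tw_rel.Right_idn[of c C d D]] by simp

text \<open>Leibniz in \<open>C\<close> together with \<open>gdel_cup\<close>, whose intermediate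
  twisting cochain is the one of the object between \<open>f1\<close> and \<open>f2\<close>.\<close>

lemma dv_cmp:
  assumes f: "f1 \<in> Arr C" "f2 \<in> Arr C" "dom C f2 = cod C f1" and p: "is_path D d gs"
  shows "dv (Eps (cmp C f2 f1) d gs) = cup D (deg C f1) (%y w. dv (Eps f2 y w)) (ve f1) d gs
    + sg (deg C f2) * cup D (deg C f1 + 1) (ve f2) (%y w. dv (Eps f1 y w)) d gs"
proof -
  let ?p1 = "deg C f1" and ?p2 = "deg C f2"
  have h: "f1 \<in> Hom C (dom C f1) (cod C f1) ?p1" "f2 \<in> Hom C (cod C f1) (cod C f2) ?p2"
    using f by (auto simp: Hom_def)
  have a: "f1 \<in> Arr C" "f2 \<in> Arr C" "dif C f1 \<in> Arr C" "dif C f2 \<in> Arr C" "dom C f2 = cod C (dif C f1)"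
    "dom C (dif C f2) = cod C f1" "deg C (dif C f1) = ?p1 + 1"
    using f by (auto simp: src.Arr_simps)
  note c1 = src.cmp_Hom[OF src.dif_Hom[OF h(2)] h(1)] and c2 = src.cmp_Hom[OF h(2) src.dif_Hom[OF h(1)]]
  have c2': "scl C (sg ?p2) (cmp C f2 (dif C f1)) \<in> Hom C (dom C f1) (cod C f2) (?p2 + 1 + ?p1)"
    using src.scl_Hom[OF c2] by (simp add: ac_simps)
  have "dv (Eps (cmp C f2 f1) d gs) = ve (dif C (cmp C f2 f1)) d gs
      - tgt.gdel (ta (dom C f1)) (ta (cod C f2)) (?p2 + ?p1) (ve (cmp C f2 f1)) d gs"
    using dv_Eps[of "cmp C f2 f1", OF _ p] f by (simp add: src.Arr_simps)
  also have "tgt.gdel (ta (dom C f1)) (ta (cod C f2)) (?p2 + ?p1) (ve (cmp C f2 f1)) d gs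
      = tgt.gdel (ta (dom C f1)) (ta (cod C f2)) (?p2 + ?p1) (cup D ?p1 (ve f2) (ve f1)) d gs"
    by (rule tgt.gdel_cong[OF p]) (rule ve_cmp[OF f])
  also have "... = cup D ?p1 (tgt.gdel (ta (cod C f1)) (ta (cod C f2)) ?p2 (ve f2)) (ve f1) d gs
      + sg ?p2 * cup D (?p1 + 1) (ve f2) (tgt.gdel (ta (dom C f1)) (ta (cod C f1)) ?p1 (ve f1)) d gs"
    by (rule tgt.gdel_cup[OF p])
  also have "ve (dif C (cmp C f2 f1)) d gs = cup D ?p1 (ve (dif C f2)) (ve f1) d gs
     + sg ?p2 * cup D (?p1 + 1) (ve f2) (ve (dif C f1)) d gs"
    unfolding src.dif_cmp[OF h(2,1)] powi_sg ve_add[OF c1 c2' p] ve_scl[OF src.Hom_Arr[OF c2] p]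
    using ve_cmp[OF a(1,4,6) p] ve_cmp[OF a(3,2,5) p] by (simp add: a(7))
  finally have 1: "dv (Eps (cmp C f2 f1) d gs) = cup D ?p1 (ve (dif C f2)) (ve f1) d gs
     + sg ?p2 * cup D (?p1 + 1) (ve f2) (ve (dif C f1)) d gs
     - (cup D ?p1 (tgt.gdel (ta (cod C f1)) (ta (cod C f2)) ?p2 (ve f2)) (ve f1) d gs
      + sg ?p2 * cup D (?p1 + 1) (ve f2) (tgt.gdel (ta (dom C f1)) (ta (cod C f1)) ?p1 (ve f1)) d gs)" .
  have 2: "cup D ?p1 (%y w. dv (Eps f2 y w)) (ve f1) d gs = cup D ?p1 (%y w. ve (dif C f2) y w
      - tgt.gdel (ta (cod C f1)) (ta (cod C f2)) ?p2 (ve f2) y w) (ve f1) d gs"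
    by (rule tgt.cup_cong[OF p]) (simp_all add: dv_Eps f)
  have 3: "cup D (?p1 + 1) (ve f2) (%y w. dv (Eps f1 y w)) d gs = cup D (?p1 + 1) (ve f2) (%y w. ve (dif C f1) y w
      - tgt.gdel (ta (dom C f1)) (ta (cod C f1)) ?p1 (ve f1) y w) d gs"
    by (rule tgt.cup_cong[OF p]) (simp_all add: dv_Eps f)
  show ?thesis
    unfolding 1 2 3 tgt.cup_diff_left tgt.cup_diff_right by (simp add: algebra_simps)
qed

lemma dv_mlin: "f \<in> Arr C ==> tgt.mlin kap y (%w. dv (Eps f y w))"
proof -
  assume f: "f \<in> Arr C"
  have "tgt.mlin kap y (%w. 1 * ve (dif C f) y w + (- 1) * tgt.gdel (ta (dom C f)) (ta (cod C f)) (deg C f) (ve f) y w)"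
    using f by (intro tgt.mlin_comb tgt.gdel_mlin ve_mlin ta_mlin ve_kap) (auto simp: src.Arr_simps)
  then show ?thesis
    by (rule tgt.mlin_cong[rotated]) (simp add: dv_Eps f)
qed

lemma dv_nrm:
  assumes f: "f \<in> Arr C"
  shows "tgt.nrm y (%w. dv (Eps f y w))"
proof -
  have "tgt.nrm y (tgt.gdel (ta (dom C f)) (ta (cod C f)) (deg C f) (ve f) y)"
  proof (rule tgt.gdel_nrm[where \<kappa> = kap])
    show "ta (cod C f) z [idn D z] * ve f y u = ve f y u"
      if "z \<in> Obj D" "is_path D y u" "path_end D y u = z" for z u
      using vl_Idn(1)[of "Eps f y u"] that f by (simp add: Rgt_idn src.Arr_simps ve_def)
    show "ve f y v * ta (dom C f) y [idn D y] = ve f y v" if "is_path D y v" for v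
      using vl_Idn(2)[of "Eps f y v"] that f by (simp add: Rgt_idn src.Arr_simps ve_def tgt.is_path_Obj)
  qed (use f in "auto intro: ve_mlin ve_nrm")
  moreover have "tgt.nrm y (ve (dif C f) y)" using f by (intro ve_nrm) (simp add: src.Arr_simps)
  ultimately show ?thesis
    unfolding tgt.nrm_def by (auto simp: dv_Eps f)
qed

text \<open>The category axioms are ring identities. Linearity and normalization in the chain pass
  through \<open>gdel\<close> by \<open>dv_mlin\<close> and \<open>dv_nrm\<close>, and the relation
  for composites is \<open>dv_cmp\<close>.\<close>

lemma dv_rel: "(s, t) \<in> tw_rel C D ==> dv s = dv t"
proof (induction rule: tw_rel.induct)
  case (Cmp_cong s s' t t')
  then have "wft (Cmp s' t')" "tg s' = tg s" using tw_rel_typed[of s s'] tw_rel_typed[of t t'] by (auto simp: typed_def)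
  then show ?case using Cmp_cong vl_rel[of s s'] vl_rel[of t t'] by simp
next
  case (Add_cong s s' t t')
  then have "wft (Add s' t')" using tw_rel_typed[of s s'] tw_rel_typed[of t t'] by (auto simp: typed_def)
  then show ?case using Add_cong by simp
next
  case (Scl_cong t t' a)
  then have "wft t" "wft t'" using tw_rel_typed[of t t'] by (auto simp: typed_def)
  then show ?case using Scl_cong by simp
next
  case (Add_Zer t)
  then show ?case using typed_Obj[of t] by simp
next
  case (Add_neg t)
  have "kap (- 1 :: 'k) = (- 1 :: (('k, 'o, 'm, 'p, 'q) tw_term set, 'k) endo)" using kap_sg[of 1] by simp
  then show ?case using Add_neg typed_Obj[of t] by simp
next
  case (Add_Scl t a b)
  then show ?case by (simp add: kap_add distrib_right)
next
  case (Cmp_Idn_left t)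
  then show ?case using typed_Obj[of t] vl_Idn(1)[of "tdif C D t"] by (simp add: dv_def wf_tdif)
next
  case (Cmp_Idn_right t)
  then show ?case using typed_Obj[of t] vl_Idn(2)[of "tdif C D t"] by (simp add: dv_def wf_tdif)
next
  case (Left_idn c d)
  then show ?case
    using dv_Eps[of "idn C c" d "[]"]
    by (simp add: src.Arr_simps src.dif_idn ve_zer tgt.gdel_def tgt.cup_short_left tgt.cup_short_right)
next
  case (Right_idn c d)
  then show ?case by (simp add: dv_def tgt.dif_idn Rgt_zer)
next
  case (Right_add c g d d' q g')
  then show ?case
    using Rgt_lin(1)[OF Right_add(1) tgt.dif_Hom[OF Right_add(2)] tgt.dif_Hom[OF Right_add(3)]]
    by (simp add: dv_def tgt.dif_add) (simp add: Hom_def tgt.Arr_simps)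
next
  case (Right_scl c g a)
  note g = tgt.Arr_Hom[OF Right_scl(2)]
  show ?case
    using Right_scl Rgt_lin(2)[OF Right_scl(1) tgt.dif_Hom[OF g] tgt.dif_Hom[OF g]]
    by (simp add: dv_def tgt.dif_scl[OF g] tgt.Arr_simps)
next
  case (R1_right c g1 g2)
  then have h: "g1 \<in> Hom D (cod D g2) (cod D g1) (deg D g1)" "g2 \<in> Hom D (dom D g2) (cod D g2) (deg D g2)"
    by (auto simp: Hom_def)
  note c1 = tgt.cmp_Hom[OF tgt.dif_Hom[OF h(1)] h(2)] and c2 = tgt.cmp_Hom[OF h(1) tgt.dif_Hom[OF h(2)]]
  have c2': "cmp D g1 (dif D g2) \<in> Hom D (dom D g2) (cod D g1) (deg D g1 + 1 + deg D g2)"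
    using c2 by (simp add: ac_simps)
  have 1: "vl (Rgt c (cmp D (dif D g1) g2)) = vl (Rgt c (dif D g1)) * vl (Rgt c g2)"
    using vl_rel[OF tw_rel.R1_right[of c C "dif D g1" D g2]] R1_right by (simp add: tgt.Arr_simps)
  have 2: "vl (Rgt c (cmp D g1 (dif D g2))) = vl (Rgt c g1) * vl (Rgt c (dif D g2))"
    using vl_rel[OF tw_rel.R1_right[of c C g1 D "dif D g2"]] R1_right by (simp add: tgt.Arr_simps)
  have "dv (Rgt c (cmp D g1 g2)) = vl (Rgt c (dif D g1)) * vl (Rgt c g2)
      + sg (deg D g1) * (vl (Rgt c g1) * vl (Rgt c (dif D g2)))"
    unfolding dv_def tdif.simps tgt.dif_cmp[OF h] powi_sg
      Rgt_lin(1)[OF R1_right(1) c1 tgt.scl_Hom[OF c2']] Rgt_lin(2)[OF R1_right(1) c2 c2] 1 2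
    by simp
  then show ?case using R1_right by (simp add: dv_Rgt)
next
  case (R1_left f1 f2 d)
  have p: "is_path D d []" using R1_left by simp
  show ?case
    using dv_cmp[OF R1_left(2,1,3) p] R1_left by (simp add: cup_def ve_def)
next
  case (R2_add_left f c c' p f' d gs)
  note h = R2_add_left(1,2)
  have f: "f \<in> Arr C" "f' \<in> Arr C" "add C f f' \<in> Arr C" "dom C f' = dom C f" "cod C f' = cod C f" "deg C f' = deg C f"
    "dom C (add C f f') = dom C f" "cod C (add C f f') = cod C f" "deg C (add C f f') = deg C f"
    using h src.add_Hom[OF h] by (auto simp: Hom_def)
  have "tgt.gdel (ta (dom C f)) (ta (cod C f)) (deg C f) (ve (add C f f')) d gs
      = tgt.gdel (ta (dom C f)) (ta (cod C f)) (deg C f) (%y w. ve f y w + ve f' y w) d gs"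
    by (rule tgt.gdel_cong[OF R2_add_left(3)]) (rule ve_add[OF h])
  then have "dv (Eps (add C f f') d gs) = dv (Eps f d gs) + dv (Eps f' d gs)"
    using R2_add_left(3) f
    by (simp add: dv_Eps src.dif_add[OF h] ve_add[OF src.dif_Hom[OF h(1)] src.dif_Hom[OF h(2)]] tgt.gdel_def
        tgt.cup_add_left tgt.cup_add_right bb_add algebra_simps)
  then show ?case using R2_add_left(3) f by simp
next
  case (R2_scl_left f d gs a)
  note h = src.Arr_Hom[OF R2_scl_left(1)]
  have f: "scl C a f \<in> Arr C" "dom C (scl C a f) = dom C f" "cod C (scl C a f) = cod C f" "deg C (scl C a f) = deg C f"
    "dif C f \<in> Arr C"
    using R2_scl_left by (auto simp: src.Arr_simps)
  have "tgt.gdel (ta (dom C f)) (ta (cod C f)) (deg C f) (ve (scl C a f)) d gs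
      = tgt.gdel (ta (dom C f)) (ta (cod C f)) (deg C f) (%y w. kap a * ve f y w) d gs"
    by (rule tgt.gdel_cong[OF R2_scl_left(2)]) (rule ve_scl[OF R2_scl_left(1)])
  also have "cup D (deg C f) (ta (cod C f)) (%y w. kap a * ve f y w) d gs = kap a * cup D (deg C f) (ta (cod C f)) (ve f) d gs"
    unfolding cup_def spl_mult_left[symmetric]
    by (rule spl_cong) (simp add: sg_def mult.assoc[symmetric] ve_kap)
  then have "tgt.gdel (ta (dom C f)) (ta (cod C f)) (deg C f) (%y w. kap a * ve f y w) d gs
     = kap a * tgt.gdel (ta (dom C f)) (ta (cod C f)) (deg C f) (ve f) d gs"
    unfolding tgt.gdel_def tgt.cup_mult_left bb_mult_left
    by (simp only: distrib_left right_diff_distrib sg_left_commute)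
  finally show ?case
    using R2_scl_left f by (simp add: dv_Eps src.dif_scl[OF h] ve_scl right_diff_distrib)
next
  case (R2_add_right f g y y' q g' d gs hs)
  have e: "is_path D d (gs @ g' # hs)" "path_end D d (gs @ g' # hs) = path_end D d (gs @ g # hs)"
    "shdeg D (gs @ g' # hs) = shdeg D (gs @ g # hs)"
    using tgt.is_path_Hom[OF R2_add_right(4,2,3)] R2_add_right(2,3) by (auto simp: Hom_def)
  show ?case
    using tgt.mlin_add[OF dv_mlin[OF R2_add_right(1)] _ R2_add_right(4,2,3)] R2_add_right(1,4) e
    by (subst dv_simps(1)) auto
next
  case (R2_scl_right f d gs g hs a)
  have g: "g \<in> Arr D" using R2_scl_right(2) by (auto simp: tgt.is_path_append)
  show ?case
    using tgt.mlin_scl[OF dv_mlin[OF R2_scl_right(1)] _ R2_scl_right(2) g] R2_scl_right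
    by (subst dv_simps(3)) auto
next
  case (R3_left c d gs)
  \<comment> \<open>The value of \<open>\<epsilon>\<close> at an identity is the unit for the cup
    product, so its left and right products with \<open>ta c\<close> agree and their difference
    vanishes.\<close>
  let ?i = "%y w. if w = [] then vl (Idn (c, y)) else 0"
  obtain g v where gs: "gs = g # v" using R3_left(3) by (cases gs) auto
  have g: "g \<in> Arr D" "dom D g = d" using R3_left gs by auto
  have u: "vl (Rgt c g) * vl (Idn (c, d)) = vl (Rgt c g)" "vl (Idn (c, cod D g)) * vl (Rgt c g) = vl (Rgt c g)"
    using vl_Idn[of "Rgt c g"] R3_left(1) g by simp_all
  have "bb D (?i d) gs = 0"
    unfolding gs by (cases v) simp_all
  moreover have "cup D 0 (ta c) ?i d gs = (if v = [] then vl (Rgt c g) else 0)"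
    by (cases v rule: rev_cases) (auto simp: tgt.cup_short_left gs u)
  moreover have "cup D 1 ?i (ta c) d gs = (if v = [] then vl (Rgt c g) else 0)"
    by (auto simp: tgt.cup_short_right gs u)
  ultimately have "tgt.gdel (ta c) (ta c) 0 ?i d gs = 0"
    by (simp add: tgt.gdel_def)
  moreover have "tgt.gdel (ta c) (ta c) 0 (ve (idn C c)) d gs = tgt.gdel (ta c) (ta c) 0 ?i d gs"
    by (rule tgt.gdel_cong[OF R3_left(2)]) (simp add: ve_idn R3_left(1))
  ultimately show ?case
    using R3_left tgt.is_path_Obj[OF R3_left(2)] by (simp add: dv_Eps src.Arr_simps src.dif_idn ve_zer)
next
  case (R3_right f y d gs)
  then show ?case
    using tgt.nrmD[OF dv_nrm[OF R3_right(1)] R3_right(3,2,4)] tgt.is_path_Obj[OF R3_right(3)]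
    by (simp add: src.Arr_simps)
next
  case (R4 f1 f2 d gs)
  note p = R4(4)
  note R4_hom[OF R4(1-3) p, of dv, OF dv_simps(1,4)]
  also have "spl (%u v. sg (shdeg D v * deg C f1) * dv (Cmp (Eps f2 (path_end D d u) v) (Eps f1 d u))) gs
    = cup D (deg C f1) (%y w. dv (Eps f2 y w)) (ve f1) d gs
    + sg (deg C f2) * cup D (deg C f1 + 1) (ve f2) (%y w. dv (Eps f1 y w)) d gs"
    unfolding cup_def spl_mult_left[symmetric] spl_add[symmetric]
  proof (rule spl_cong)
    fix u v assume "u @ v = gs"
    then have "is_path D d u" "is_path D (path_end D d u) v" using p by (auto simp: tgt.is_path_append)
    then show "sg (shdeg D v * deg C f1) * dv (Cmp (Eps f2 (path_end D d u) v) (Eps f1 d u))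
      = sg (shdeg D v * deg C f1) * (dv (Eps f2 (path_end D d u) v) * ve f1 d u)
      + sg (deg C f2) * (sg (shdeg D v * (deg C f1 + 1)) * (ve f2 (path_end D d u) v * dv (Eps f1 d u)))"
      using R4 by (subst dv_simps(2)) (auto simp: ve_def sg_def)
  qed
  finally show ?case
    using dv_cmp[OF R4(1-3) p] by simp
next
  case (Cmp_Scl_right s t a)
  have "dv s * (kap a * vl t) = kap a * (dv s * vl t)" "vl s * (kap a * dv t) = kap a * (vl s * dv t)"
    unfolding dv_def by (simp_all only: mult.assoc[symmetric] vl_kap)
  then show ?case using Cmp_Scl_right by (simp add: distrib_left sg_def)
qed (auto simp: algebra_simps sg_def kap_mult)

lemma tdif_rel:
  assumes "(s, t) \<in> tw_rel C D"
  shows "(tdif C D s, tdif C D t) \<in> tw_rel C D"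
proof (rule relI)
  show "typed (tdif C D s) (td s) (tc s) (tg s + 1)" "typed (tdif C D t) (td s) (tc s) (tg s + 1)"
    using tw_rel_typed[OF assms] by (auto simp: typed_def wf_tdif)
  show "vl (tdif C D s) = vl (tdif C D t)"
    using dv_rel[OF assms] by (simp add: dv_def)
qed

lemma dif_cls: "wft t ==> dif (tens C D) (cls C D t) = cls C D (tdif C D t)"
  using cls_eqI[OF tdif_rel[OF rep_rel]] by (simp add: tens_def)

text \<open>On \<open>\<epsilon>(f; gs)\<close> the square of \<open>gdel\<close> leaves the
  curvatures of \<open>ta\<close>; these are compensated by the terms in which a bare letter
  \<open>id \<otimes> g\<close> is differentiated.\<close>

lemma dv_tdif: "wft t ==> dv (tdif C D t) = 0"
proof (induction t)
  case (Eps f d gs)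
  then have f: "f \<in> Arr C" and p: "is_path D d gs" by auto
  let ?p = "deg C f" and ?F = "ta (dom C f)" and ?G = "ta (cod C f)"
  let ?dt = "%c y w. case w of [] => 0 | g # v => if v = [] then vl (Rgt c (dif D g)) else 0"
  let ?E = "%y w. dv (Eps f y w)"
  note w = tdl_parts[OF f p, unfolded typed_def, THEN conjunct1]
  have "dv (tdif C D (Eps f d gs)) = (\<Sum>t\<leftarrow>tdl f d gs. dv t)"
    unfolding tdif_Eps using f tgt.is_path_Obj[OF p]
    by (intro dv_tsum typed_tdl f p) (auto simp: src.Arr_simps)
  also have "... = dv (Eps (dif C f) d gs) - sg (deg C f) * bb D (%w. dv (Eps f d w)) gs
    - (if gs = [] then 0 else sg (deg C f * deg D (last gs) + deg C f)
         * dv (Cmp (Rgt (cod C f) (last gs)) (Eps f d (butlast gs))))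
    + (if gs = [] then 0 else sg (deg C f + shdeg D (tl gs))
         * dv (Cmp (Eps f (cod D (hd gs)) (tl gs)) (Rgt (dom C f) (hd gs))))"
    by (rule tdl_sum[OF f p]) (simp add: powi_sg)
  also have "(if gs = [] then 0 else sg (deg C f * deg D (last gs) + deg C f)
         * dv (Cmp (Rgt (cod C f) (last gs)) (Eps f d (butlast gs))))
      = cup D ?p (?dt (cod C f)) (ve f) d gs - cup D (?p + 1) ?G ?E d gs"
    using w(4) by (subst (1 2) tgt.cup_short_left) (auto simp: ve_def dv_Rgt sg_def)
  also have "(if gs = [] then 0 else sg (deg C f + shdeg D (tl gs))
         * dv (Cmp (Eps f (cod D (hd gs)) (tl gs)) (Rgt (dom C f) (hd gs))))
      = sg ?p * cup D 1 ?E ?F d gs + cup D 2 (ve f) (?dt (dom C f)) d gs"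
    using w(5) by (subst (1 2) tgt.cup_short_right) (auto simp: ve_def dv_Rgt sg_def split: list.split)
  also have "dv (Eps (dif C f) d gs) = - tgt.gdel ?F ?G (?p + 1) (ve (dif C f)) d gs"
    using f p src.dif_dif[OF src.Arr_Hom[OF f]] by (simp add: dv_Eps src.Arr_simps ve_zer)
  finally have 1: "dv (tdif C D (Eps f d gs)) = - tgt.gdel ?F ?G (?p + 1) (ve (dif C f)) d gs
      + tgt.gdel ?F ?G (?p + 1) ?E d gs - cup D ?p (?dt (cod C f)) (ve f) d gs + cup D 2 (ve f) (?dt (dom C f)) d gs"
    by (simp add: tgt.gdel_def sg_add)
  have "tgt.gdel ?F ?G (?p + 1) ?E d gs
      = tgt.gdel ?F ?G (?p + 1) (%y w. ve (dif C f) y w - tgt.gdel ?F ?G ?p (ve f) y w) d gs"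
    by (rule tgt.gdel_cong[OF p]) (simp add: dv_Eps f)
  also have "... = tgt.gdel ?F ?G (?p + 1) (ve (dif C f)) d gs - tgt.gdel ?F ?G (?p + 1) (tgt.gdel ?F ?G ?p (ve f)) d gs"
    unfolding tgt.gdel_def[of _ _ "?p + 1"] tgt.cup_diff_left tgt.cup_diff_right bb_diff
    by (simp add: algebra_simps)
  also have "tgt.gdel ?F ?G (?p + 1) (tgt.gdel ?F ?G ?p (ve f)) d gs
     = cup D ?p (%x w. cup D 1 ?G ?G x w - bb D (?G x) w) (ve f) d gs
      - cup D 2 (ve f) (%x w. cup D 1 ?F ?F x w - bb D (?F x) w) d gs"
    by (intro tgt.gdel_gdel p tgt.bb_bb[OF ve_mlin[OF f] _ _ p]) auto
  finally have 2: "tgt.gdel ?F ?G (?p + 1) ?E d gs = tgt.gdel ?F ?G (?p + 1) (ve (dif C f)) d gs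
     - (cup D ?p (%x w. cup D 1 ?G ?G x w - bb D (?G x) w) (ve f) d gs
      - cup D 2 (ve f) (%x w. cup D 1 ?F ?F x w - bb D (?F x) w) d gs)" .
  \<comment> \<open>The curvature of \<open>ta\<close> is minus the differential of a single letter:
    products of two letters cancel by functoriality, and no operator for the differential is
    included in \<open>ta\<close>.\<close>
  have mc: "cup D 1 (ta c) (ta c) x w - bb D (ta c x) w = (- 1) * ?dt c x w" if "c \<in> Obj C" "is_path D x w" for c x w
  proof -
    consider "w = []" | g where "w = [g]" | g h where "w = [g, h]" | g h k v where "w = g # h # k # v"
      by (cases w rule: remdups_adj.cases; metis list.exhaust)
    then show ?thesis
    proof cases
      case 3
      then have "vl (Rgt c h) * vl (Rgt c g) = vl (Rgt c (cmp D h g))"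
        using vl_rel[OF tw_rel.R1_right[of c C h D g]] that by simp
      then show ?thesis by (simp add: 3 tgt.cup_short_left sg_def)
    next
      case 4
      then show ?thesis by (cases v rule: rev_cases) (simp_all add: tgt.cup_short_left)
    qed (simp_all add: tgt.cup_short_left)
  qed
  have o: "dom C f \<in> Obj C" "cod C f \<in> Obj C" using f by (auto simp: src.Arr_simps)
  have "cup D ?p (%x w. cup D 1 ?G ?G x w - bb D (?G x) w) (ve f) d gs
      = cup D ?p (%x w. (- 1) * ?dt (cod C f) x w) (ve f) d gs"
    by (rule tgt.cup_cong[OF p]) (simp_all only: mc[OF o(2)])
  moreover have "cup D 2 (ve f) (%x w. cup D 1 ?F ?F x w - bb D (?F x) w) d gs
      = cup D 2 (ve f) (%x w. sg 1 * ?dt (dom C f) x w) d gs"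
    by (rule tgt.cup_cong[OF p]) (simp_all only: mc[OF o(1)] sg_1)
  ultimately show ?case
    unfolding 1 2 tgt.cup_mult_left tgt.cup_sg_right by simp
next
  case (Rgt c g)
  then show ?case
    using tgt.dif_dif[OF tgt.Arr_Hom, of g] by (simp add: dv_def Rgt_zer tgt.Arr_simps)
next
  case (Cmp s t)
  then have w: "wft s" "wft t" "td s = tc t" by auto
  note h = wf_tdif[OF w(1)] wf_tdif[OF w(2)]
  show ?case
    using Cmp w h by (simp add: powi_sg dv_def[symmetric]) (simp add: sg_def)
qed (auto simp: wf_tdif)

text \<open>The axioms without differential are those of \<open>zten\<close>, which has the same
  operations.\<close>

lemma dg_category_tens: "dg_category (tens C D)"
proof
  fix X x y n assume "X \<in> Hom (tens C D) x y n"
  then obtain s where s: "X = cls C D s" "typed s x y n" by (auto simp: Hom_tens)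
  have w: "wft s" "td s = x" "tc s = y" "tg s = n" using s(2) by (auto simp: typed_def)
  note o = typed_ObjD[OF s(2)]
  note d = typed_tdif[OF s(2)]
  show "dif (tens C D) X \<in> Hom (tens C D) x y (n + 1)"
    using d by (simp add: s dif_cls w Hom_tensI)
  show "dif (tens C D) (scl (tens C D) a X) = scl (tens C D) a (dif (tens C D) X)" for a
    using w by (simp add: s tens_ops dif_cls wf_tdif)
  have "(tdif C D (tdif C D s), Zer x y (n + 2)) \<in> tw_rel C D"
    using typed_tdif[OF d] typed_simps(5)[OF o] dv_tdif[OF w(1)] o
    by (intro relI[of _ x y "n + 2"]) (auto simp: dv_def add.assoc)
  then show "dif (tens C D) (dif (tens C D) X) = zer (tens C D) x y (n + 2)"
    using w by (simp add: s dif_cls wf_tdif tens_ops cls_eqI)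
  show "dif (tens C D) (add (tens C D) X Y) = add (tens C D) (dif (tens C D) X) (dif (tens C D) Y)"
    if "Y \<in> Hom (tens C D) x y n" for Y
  proof -
    from that obtain t where t: "Y = cls C D t" "typed t x y n" by (auto simp: Hom_tens)
    have wt: "wft t" "td t = x" "tc t = y" "tg t = n" using t(2) by (auto simp: typed_def)
    show ?thesis using w wt by (simp add: s t tens_ops dif_cls wf_tdif)
  qed
next
  fix X y z m Y x n assume "X \<in> Hom (tens C D) y z m" "Y \<in> Hom (tens C D) x y n"
  then obtain s t where s: "X = cls C D s" "typed s y z m" and t: "Y = cls C D t" "typed t x y n"
    by (auto simp: Hom_tens)
  have w: "wft s" "td s = y" "tc s = z" "tg s = m" using s(2) by (auto simp: typed_def)
  have wt: "wft t" "td t = x" "tc t = y" "tg t = n" using t(2) by (auto simp: typed_def)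
  show "dif (tens C D) (cmp (tens C D) X Y)
      = add (tens C D) (cmp (tens C D) (dif (tens C D) X) Y) (sscl (tens C D) m (cmp (tens C D) X (dif (tens C D) Y)))"
    using w wt by (simp add: s t tens_ops dif_cls wf_tdif)
qed (use Z.dom_Obj Z.cod_Obj Z.zer_Hom Z.add_Hom Z.scl_Hom Z.add_assoc Z.add_comm Z.add_zer Z.add_neg Z.scl_one
    Z.scl_scl Z.scl_add Z.add_scl Z.idn_Hom Z.cmp_Hom Z.cmp_add_left Z.cmp_add_right Z.cmp_scl_left
    Z.cmp_scl_right Z.cmp_assoc Z.cmp_idn_left Z.cmp_idn_right in "simp_all only: zten_simps")

end

section \<open>Functors on the twisted tensor product\<close>

lemma dg_functor_eqI:
  assumes F: "dg_functor C D F" and G: "dg_functor C D G"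
    and "!!x. x \<in> Obj C ==> fobj F x = fobj G x" "!!f. f \<in> Arr C ==> farr F f = farr G f"
  shows "F = G"
proof -
  interpret F: dg_functor C D F by (rule F)
  interpret G: dg_functor C D G by (rule G)
  have "fobj F = fobj G"
    using F.fobj_Obj G.fobj_Obj assms(3) by (intro extensionalityI[of _ "Obj C"]) (auto simp: PiE_def)
  moreover have "farr F = farr G"
    using F.farr_ext G.farr_ext assms(4) by (intro extensionalityI[of _ "Arr C"]) auto
  ultimately show ?thesis by simp
qed

lemma fun_comp_simps [simp]:
  "x \<in> Obj C ==> fobj (fun_comp C G F) x = fobj G (fobj F x)"
  "f \<in> Arr C ==> farr (fun_comp C G F) f = farr G (farr F f)"
  by (simp_all add: fun_comp_def compose_def)

lemma fun_id_simps [simp]: "x \<in> Obj C ==> fobj (fun_id C) x = x" "f \<in> Arr C ==> farr (fun_id C) f = f"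
  by (simp_all add: fun_id_def)

lemma dg_functor_fun_id:
  assumes "dg_category C"
  shows "dg_functor C C (fun_id C)"
proof -
  interpret dg_category C by fact
  show ?thesis
  proof
    show "fobj (fun_id C) \<in> Obj C \<rightarrow>\<^sub>E Obj C" "farr (fun_id C) \<in> extensional (Arr C)"
      by (auto simp: fun_id_def)
    fix f x y n assume f: "f \<in> Hom C x y n"
    show "farr (fun_id C) f \<in> Hom C (fobj (fun_id C) x) (fobj (fun_id C) y) n"
      using f Hom_Obj[OF f] by (simp add: Hom_Arr)
    show "farr (fun_id C) (add C f g) = add C (farr (fun_id C) f) (farr (fun_id C) g)" if "g \<in> Hom C x y n" for g
      using f that by (simp add: Hom_Arr[OF add_Hom[OF f that]] Hom_Arr)
  next
    fix g y z m f x n assume "g \<in> Hom C y z m" "f \<in> Hom C x y n"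
    then show "farr (fun_id C) (cmp C g f) = cmp C (farr (fun_id C) g) (farr (fun_id C) f)"
      using Hom_Arr[OF cmp_Hom] by (simp add: Hom_Arr)
  qed (auto simp: Arr_simps)
qed

lemma dg_functor_Arr:
  assumes "dg_functor C D F" "f \<in> Arr C"
  shows "farr F f \<in> Arr D" "dom D (farr F f) = fobj F (dom C f)" "cod D (farr F f) = fobj F (cod C f)"
    "deg D (farr F f) = deg C f"
proof -
  interpret dg_functor C D F by fact
  show "farr F f \<in> Arr D" "dom D (farr F f) = fobj F (dom C f)" "cod D (farr F f) = fobj F (cod C f)"
    "deg D (farr F f) = deg C f"
    using farr_Hom[OF source.Arr_Hom[OF assms(2)]] by (auto simp: Hom_def)
qed

lemma dg_functor_Obj: "dg_functor C D F ==> x \<in> Obj C ==> fobj F x \<in> Obj D"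
  using dg_functor.fobj_Obj by fastforce

lemma dg_functor_path:
  assumes "dg_functor C D F" "is_path C x w"
  shows "is_path D (fobj F x) (map (farr F) w)" "path_end D (fobj F x) (map (farr F) w) = fobj F (path_end C x w)"
    "shdeg D (map (farr F) w) = shdeg C w"
  using assms(2) by (induction w arbitrary: x) (auto simp: dg_functor_Arr[OF assms(1)] dg_functor_Obj[OF assms(1)])

lemma dg_functor_zer:
  assumes "dg_functor C D F" and o: "x \<in> Obj C" "y \<in> Obj C"
  shows "farr F (zer C x y n) = zer D (fobj F x) (fobj F y) n"
proof -
  interpret dg_functor C D F by fact
  note z = source.zer_Hom[OF o, of n]
  show ?thesis
    using farr_add[OF z z] by (intro target.zer_unique farr_Hom[OF z]) (simp add: source.add_zer[OF z])
qed

lemma dg_functor_comp: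
  assumes F: "dg_functor C D F" and G: "dg_functor D E G"
  shows "dg_functor C E (fun_comp C G F)"
proof -
  interpret F: dg_functor C D F by (rule F)
  interpret G: dg_functor D E G by (rule G)
  show ?thesis
  proof
    show "fobj (fun_comp C G F) \<in> Obj C \<rightarrow>\<^sub>E Obj E" "farr (fun_comp C G F) \<in> extensional (Arr C)"
      using F.fobj_Obj G.fobj_Obj by (auto simp: fun_comp_def compose_def)
    fix f x y n assume f: "f \<in> Hom C x y n"
    note s = F.source.Hom_Arr[OF f] F.source.Hom_Obj[OF f]
    show "farr (fun_comp C G F) f \<in> Hom E (fobj (fun_comp C G F) x) (fobj (fun_comp C G F) y) n"
      using G.farr_Hom[OF F.farr_Hom[OF f]] s by simp
    show "farr (fun_comp C G F) (add C f g) = add E (farr (fun_comp C G F) f) (farr (fun_comp C G F) g)"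
      if g: "g \<in> Hom C x y n" for g
      using G.farr_add[OF F.farr_Hom[OF f] F.farr_Hom[OF g]] s F.source.Hom_Arr[OF g]
        F.source.Hom_Arr[OF F.source.add_Hom[OF f g]] F.farr_add[OF f g] by simp
  next
    fix g y z m f x n assume g: "g \<in> Hom C y z m" and f: "f \<in> Hom C x y n"
    show "farr (fun_comp C G F) (cmp C g f) = cmp E (farr (fun_comp C G F) g) (farr (fun_comp C G F) f)"
      using G.farr_cmp[OF F.farr_Hom[OF g] F.farr_Hom[OF f]] F.farr_cmp[OF g f]
        F.source.Hom_Arr[OF g] F.source.Hom_Arr[OF f] F.source.Hom_Arr[OF F.source.cmp_Hom[OF g f]] by simp
  qed (auto simp: F.source.Arr_simps F.farr_scl F.farr_idn F.farr_dif G.farr_scl G.farr_idn G.farr_dif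
      dg_functor_Arr[OF F] dg_functor_Obj[OF F])
qed

text \<open>Reads an expression in \<open>E\<close> through a functor \<open>K\<close> into
  cochains. This is the inverse of transposition on the level of expressions.\<close>

primrec ut :: "('k, 'e, 'h) dgcat => ('c, 'f, ('d, 'g, 'e, 'h) dgfun, ('d, 'g, 'e, 'h) cochain) dgfun
    => ('k, 'c, 'f, 'd, 'g) tw_term => 'h" where
  "ut E K (Eps f d gs) = cval (farr K f) d gs"
| "ut E K (Rgt c g) = farr (fobj K c) g"
| "ut E K (Idn x) = idn E (fobj (fobj K (fst x)) (snd x))"
| "ut E K (Cmp s t) = cmp E (ut E K s) (ut E K t)"
| "ut E K (Zer x y n) = zer E (fobj (fobj K (fst x)) (snd x)) (fobj (fobj K (fst y)) (snd y)) n"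
| "ut E K (Add s t) = add E (ut E K s) (ut E K t)"
| "ut E K (Scl a t) = scl E a (ut E K t)"

definition untr :: "('k::field, 'c, 'f) dgcat => ('k, 'd, 'g) dgcat => ('k, 'e, 'h) dgcat
    => ('c, 'f, ('d, 'g, 'e, 'h) dgfun, ('d, 'g, 'e, 'h) cochain) dgfun
    => ('c \<times> 'd, ('k, 'c, 'f, 'd, 'g) tw_term set, 'e, 'h) dgfun" where
  "untr C D E K = \<lparr>fobj = (\<lambda>x\<in>Obj C \<times> Obj D. fobj (fobj K (fst x)) (snd x)),
     farr = (\<lambda>X\<in>Arr (tens C D). ut E K (rep X))\<rparr>"

context dg_pair
begin

lemma eps_Arr:
  assumes "f \<in> Arr C" "is_path D d gs"
  shows "eps C D f d gs \<in> Arr (tens C D)" "dom (tens C D) (eps C D f d gs) = (dom C f, d)"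
    "cod (tens C D) (eps C D f d gs) = (cod C f, path_end D d gs)"
    "deg (tens C D) (eps C D f d gs) = deg C f + shdeg D gs"
  using tens_cls[of "Eps f d gs"] assms by (simp_all add: eps_def)

lemma rgt_Arr:
  assumes "c \<in> Obj C" "g \<in> Arr D"
  shows "rgt C D c g \<in> Arr (tens C D)" "dom (tens C D) (rgt C D c g) = (c, dom D g)"
    "cod (tens C D) (rgt C D c g) = (c, cod D g)" "deg (tens C D) (rgt C D c g) = deg D g"
  using tens_cls[of "Rgt c g"] assms by (simp_all add: rgt_def)

text \<open>Every arrow is a class of expressions built from generators by operations that functors
  preserve.\<close>

lemma tens_functor_eqI:
  assumes H: "dg_functor (tens C D) E H" and H': "dg_functor (tens C D) E H'"
    and o: "!!c d. c \<in> Obj C ==> d \<in> Obj D ==> fobj H (c, d) = fobj H' (c, d)"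
    and e: "!!f d gs. f \<in> Arr C ==> is_path D d gs ==> farr H (eps C D f d gs) = farr H' (eps C D f d gs)"
    and r: "!!c g. c \<in> Obj C ==> g \<in> Arr D ==> farr H (rgt C D c g) = farr H' (rgt C D c g)"
  shows "H = H'"
proof (rule dg_functor_eqI[OF H H'])
  interpret H: dg_functor "tens C D" E H by (rule H)
  interpret H': dg_functor "tens C D" E H' by (rule H')
  show "fobj H x = fobj H' x" if "x \<in> Obj (tens C D)" for x
    using that o by (cases x) (auto simp: tens_ops)
  have *: "farr H (cls C D t) = farr H' (cls C D t)" if "wft t" for t
    using that
  proof (induction t)
    case (Eps f d gs)
    then show ?case using e[of f d gs] by (simp add: eps_def)
  next
    case (Rgt c g)
    then show ?case using r[of c g] by (simp add: rgt_def)
  next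
    case (Idn x)
    then show ?case using H.farr_idn[of x] H'.farr_idn[of x] o by (cases x) (auto simp: tens_ops)
  next
    case (Cmp s t)
    then have h: "cls C D s \<in> Hom (tens C D) (tc t) (tc s) (tg s)" "cls C D t \<in> Hom (tens C D) (td t) (tc t) (tg t)"
      by (auto intro!: Hom_tensI simp: typed_def)
    show ?case using Cmp H.farr_cmp[OF h] H'.farr_cmp[OF h] tens_ops(4)[OF Cmp.prems] by simp
  next
    case (Zer x y n)
    then show ?case using dg_functor_zer[OF H, of x y n] dg_functor_zer[OF H', of x y n] o
      by (cases x, cases y) (auto simp: tens_ops)
  next
    case (Add s t)
    then have h: "cls C D s \<in> Hom (tens C D) (td t) (tc t) (tg t)" "cls C D t \<in> Hom (tens C D) (td t) (tc t) (tg t)"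
      by (auto intro!: Hom_tensI simp: typed_def)
    show ?case using Add H.farr_add[OF h] H'.farr_add[OF h] tens_ops(5)[OF Add.prems] by simp
  next
    case (Scl a t)
    then show ?case
      using H.farr_scl[OF tens_cls(1)[of t], of a] H'.farr_scl[OF tens_cls(1)[of t], of a] tens_ops(6)[of t a] by simp
  qed
  show "farr H X = farr H' X" if "X \<in> Arr (tens C D)" for X
    using that * unfolding Arr_tens by auto
qed

lemma rgt_ops:
  assumes c: "c \<in> Obj C"
  shows "g \<in> Hom D x y n ==> rgt C D c g \<in> Hom (tens C D) (c, x) (c, y) n"
    "[|g \<in> Hom D x y n; g' \<in> Hom D x y n|] ==> rgt C D c (add D g g') = add (tens C D) (rgt C D c g) (rgt C D c g')"
    "g \<in> Arr D ==> rgt C D c (scl D a g) = scl (tens C D) a (rgt C D c g)"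
    "d \<in> Obj D ==> rgt C D c (idn D d) = idn (tens C D) (c, d)"
    "[|h \<in> Hom D y z m; g \<in> Hom D x y n|] ==> rgt C D c (cmp D h g) = cmp (tens C D) (rgt C D c h) (rgt C D c g)"
    "g \<in> Arr D ==> rgt C D c (dif D g) = dif (tens C D) (rgt C D c g)"
proof -
  show "g \<in> Hom D x y n ==> rgt C D c g \<in> Hom (tens C D) (c, x) (c, y) n"
    unfolding rgt_def using c by (intro Hom_tensI) (auto simp: typed_def Hom_def)
  show "[|g \<in> Hom D x y n; g' \<in> Hom D x y n|] ==> rgt C D c (add D g g') = add (tens C D) (rgt C D c g) (rgt C D c g')"
    unfolding rgt_def using c cls_eqI[OF tw_rel.Right_add[OF c]] by (subst tens_ops(5)) (auto simp: Hom_def)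
  show "g \<in> Arr D ==> rgt C D c (scl D a g) = scl (tens C D) a (rgt C D c g)"
    unfolding rgt_def using c cls_eqI[OF tw_rel.Right_scl[OF c]] by (subst tens_ops(6)) auto
  show "d \<in> Obj D ==> rgt C D c (idn D d) = idn (tens C D) (c, d)"
    unfolding rgt_def tens_ops using cls_eqI[OF tw_rel.Right_idn[OF c]] by auto
  show "[|h \<in> Hom D y z m; g \<in> Hom D x y n|] ==> rgt C D c (cmp D h g) = cmp (tens C D) (rgt C D c h) (rgt C D c g)"
    unfolding rgt_def using c cls_eqI[OF tw_rel.R1_right[OF c, of h D g]] by (subst tens_ops(4)) (auto simp: Hom_def)
  show "g \<in> Arr D ==> rgt C D c (dif D g) = dif (tens C D) (rgt C D c g)"
    unfolding rgt_def using c dif_cls[of "Rgt c g"] by simp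
qed

end

section \<open>The universal property of the twisted tensor product\<close>

locale dg_triple = dg_pair C D + trd: dg_category E
  for C :: "('k::field, 'o, 'm) dgcat" and D :: "('k, 'p, 'q) dgcat" and E :: "('k, 'r, 's) dgcat"
begin

sublocale DE: dg_pair D E by unfold_locales

context
  fixes K
  assumes K: "dg_functor C DE.Ch K"
begin

lemma untr_arr:
  assumes "f \<in> Arr C"
  shows "is_cochain D E (farr K f)" "csrc (farr K f) = fobj K (dom C f)" "ctgt (farr K f) = fobj K (cod C f)"
    "cdeg (farr K f) = deg C f" "farr K f \<in> Hom DE.Ch (fobj K (dom C f)) (fobj K (cod C f)) (deg C f)"
  using dg_functor.farr_Hom[OF K src.Arr_Hom[OF assms]] by (auto simp: DE.Coh_Hom)

lemma untr_obj: "c \<in> Obj C ==> dg_functor D E (fobj K c)"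
  using dg_functor_Obj[OF K] by simp

definition uo :: "'o \<times> 'p => 'r" where
  "uo x = fobj (fobj K (fst x)) (snd x)"

lemma uo_Obj: "x \<in> Obj C \<times> Obj D ==> uo x \<in> Obj E"
  using dg_functor_Obj[OF untr_obj] by (auto simp: uo_def)

lemma ut_Hom: "typed t x y n ==> ut E K t \<in> Hom E (uo x) (uo y) n"
proof (induction t arbitrary: x y n)
  case (Eps f d gs)
  then show ?case
    using DE.cochain_Hom[OF untr_arr(1), of f d gs] by (auto simp: typed_def uo_def untr_arr)
next
  case (Rgt c g)
  then show ?case
    using dg_functor.farr_Hom[OF untr_obj tgt.Arr_Hom, of c g] by (auto simp: typed_def uo_def)
next
  case (Idn z)
  then show ?case using uo_Obj[of z] by (auto simp: typed_def uo_def intro!: trd.idn_Hom)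
next
  case (Cmp s t)
  then have "typed s (tc t) y (tg s)" "typed t x (tc t) (tg t)" and n: "n = tg s + tg t" by (auto simp: typed_def)
  from trd.cmp_Hom[OF Cmp.IH(1)[OF this(1)] Cmp.IH(2)[OF this(2)]] show ?case by (simp add: n)
next
  case (Zer z w m)
  then show ?case using uo_Obj[of z] uo_Obj[of w] by (auto simp: typed_def uo_def intro!: trd.zer_Hom)
next
  case (Add s t)
  then have "typed s x y n" "typed t x y n" by (auto simp: typed_def)
  from trd.add_Hom[OF Add.IH(1)[OF this(1)] Add.IH(2)[OF this(2)]] show ?case by simp
next
  case (Scl a t)
  then have "typed t x y n" by (auto simp: typed_def)
  from trd.scl_Hom[OF Scl.IH[OF this]] show ?case by simp
qed

definition uv :: "('k, 'o, 'm, 'p, 'q) tw_term => ('s, 'k) endo" where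
  "uv t = rho E (ut E K t)"

lemma ut_Hom': "wft t ==> ut E K t \<in> Hom E (uo (td t)) (uo (tc t)) (tg t)"
  by (rule ut_Hom) (simp add: typed_def)

lemma uv_simps:
  "wft (Add s t) ==> uv (Add s t) = uv s + uv t"
  "wft (Cmp s t) ==> uv (Cmp s t) = uv s * uv t"
  "wft t ==> uv (Scl a t) = kap a * uv t"
  "wft (Zer x y n) ==> uv (Zer x y n) = 0"
  "wft t ==> uv (Idn (tc t)) * uv t = uv t" "wft t ==> uv t * uv (Idn (td t)) = uv t"
proof -
  show "wft (Add s t) ==> uv (Add s t) = uv s + uv t"
    using trd.rho_add[OF ut_Hom'[of s], of "ut E K t"] ut_Hom'[of t] by (simp add: uv_def)
  show "wft (Cmp s t) ==> uv (Cmp s t) = uv s * uv t"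
    using trd.rho_cmp[OF ut_Hom'[of s], of "ut E K t"] ut_Hom'[of t] by (simp add: uv_def)
  show "wft t ==> uv (Scl a t) = kap a * uv t"
    using trd.rho_scl[OF trd.Hom_Arr[OF ut_Hom'[of t]], of a] by (simp add: uv_def)
  show "wft (Zer x y n) ==> uv (Zer x y n) = 0"
    using trd.rho_zer[OF uo_Obj[of x] uo_Obj[of y]] by (simp add: uv_def uo_def)
  show "wft t ==> uv (Idn (tc t)) * uv t = uv t" "wft t ==> uv t * uv (Idn (td t)) = uv t"
    using trd.rho_idn_left[OF ut_Hom'[of t]] trd.rho_idn_right[OF ut_Hom'[of t]] by (simp_all add: uv_def uo_def)
qed

lemma uv_Eps: "uv (Eps f d gs) = DE.rv (farr K f) d gs"
  by (simp add: uv_def DE.rv_def)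

lemma uv_tsum:
  assumes "x \<in> Obj C \<times> Obj D" "y \<in> Obj C \<times> Obj D" "!!t. t \<in> set ts ==> typed t x y n"
  shows "uv (tsum x y n ts) = (\<Sum>t\<leftarrow>ts. uv t)"
  using assms by (intro tsum_hom) (auto simp: typed_def uv_simps)

lemma uv_cmp:
  assumes f: "f1 \<in> Arr C" "f2 \<in> Arr C" "dom C f2 = cod C f1" and p: "is_path D d gs"
  shows "uv (Eps (cmp C f2 f1) d gs) = cup D (deg C f1) (DE.rv (farr K f2)) (DE.rv (farr K f1)) d gs"
proof -
  have h: "f2 \<in> Hom C (cod C f1) (cod C f2) (deg C f2)" "f1 \<in> Hom C (dom C f1) (cod C f1) (deg C f1)"
    using f by (auto simp: Hom_def)
  show ?thesis
    using DE.coh_cmp(2)[OF dg_functor.farr_Hom[OF K h(1)] dg_functor.farr_Hom[OF K h(2)] p]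
    by (simp add: uv_Eps dg_functor.farr_cmp[OF K h])
qed

text \<open>Each defining relation becomes a property of \<open>K\<close>: relations in the first
  argument hold because \<open>K\<close> is a functor, those in the chain because its values are
  reduced multilinear cochains, and those for bare letters because its objects are functors.\<close>

lemma uv_rel: "(s, t) \<in> tw_rel C D ==> uv s = uv t"
proof (induction rule: tw_rel.induct)
  case (Cmp_cong s s' t t')
  then have "wft (Cmp s' t')" using tw_rel_typed[of s s'] tw_rel_typed[of t t'] by (auto simp: typed_def)
  then show ?case using Cmp_cong by (simp add: uv_simps)
next
  case (Add_cong s s' t t')
  then have "wft (Add s' t')" using tw_rel_typed[of s s'] tw_rel_typed[of t t'] by (auto simp: typed_def)
  then show ?case using Add_cong by (simp add: uv_simps)
next
  case (Scl_cong t t' a)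
  then have "wft t" "wft t'" using tw_rel_typed[of t t'] by (auto simp: typed_def)
  then show ?case using Scl_cong by (simp add: uv_simps)
next
  case (Add_Zer t)
  then show ?case using typed_Obj[of t] by (simp add: uv_simps)
next
  case (Add_neg t)
  have "kap (- 1 :: 'k) = (- 1 :: ('s, 'k) endo)" using kap_sg[of 1] by simp
  then show ?case using Add_neg typed_Obj[of t] by (simp add: uv_simps)
next
  case (Add_Scl t a b)
  then show ?case by (simp add: uv_simps kap_add distrib_right)
next
  case (Cmp_Idn_left t)
  then show ?case using typed_Obj[of t] by (simp add: uv_simps)
next
  case (Cmp_Idn_right t)
  then show ?case using typed_Obj[of t] by (simp add: uv_simps)
next
  case (Cmp_Scl_right s t a)
  have "uv s * (kap a * uv t) = kap a * (uv s * uv t)"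
    unfolding uv_def by (simp only: mult.assoc[symmetric] trd.kap_rho)
  then show ?case using Cmp_Scl_right by (simp add: uv_simps)
next
  case (Left_idn c d)
  then have p: "is_path D d []" by simp
  show ?case
    using DE.coh_idn(2)[OF untr_obj[OF Left_idn(1)] p] Left_idn dg_functor.farr_idn[OF K Left_idn(1)]
    by (simp add: uv_Eps) (simp add: uv_def)
next
  case (Right_idn c d)
  then show ?case
    using dg_functor.farr_idn[OF untr_obj[OF Right_idn(1)] Right_idn(2)] by (simp add: uv_def)
next
  case (Right_add c g d d' q g')
  note F = untr_obj[OF Right_add(1)]
  show ?case
    using trd.rho_add[OF dg_functor.farr_Hom[OF F Right_add(2)] dg_functor.farr_Hom[OF F Right_add(3)]]
      dg_functor.farr_add[OF F Right_add(2,3)] by (simp add: uv_def)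
next
  case (Right_scl c g a)
  note F = untr_obj[OF Right_scl(1)]
  show ?case
    using dg_functor.farr_scl[OF F Right_scl(2)] by (simp add: uv_def)
next
  case (R1_right c g1 g2)
  note F = untr_obj[OF R1_right(1)]
  have h: "g1 \<in> Hom D (cod D g2) (cod D g1) (deg D g1)" "g2 \<in> Hom D (dom D g2) (cod D g2) (deg D g2)"
    using R1_right by (auto simp: Hom_def)
  show ?case
    using dg_functor.farr_cmp[OF F h] by (simp add: uv_def)
next
  case (R1_left f1 f2 d)
  have p: "is_path D d []" using R1_left by simp
  show ?case
    using uv_cmp[OF R1_left(2,1,3) p] R1_left by (simp add: uv_simps cup_def uv_Eps)
next
  case (R2_add_left f c c' p f' d gs)
  have w: "wft (Add (Eps f d gs) (Eps f' d gs))" using R2_add_left by (auto simp: Hom_def)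
  show ?case
    using DE.coh_add(2)[OF dg_functor.farr_Hom[OF K R2_add_left(1)] dg_functor.farr_Hom[OF K R2_add_left(2)] R2_add_left(3)]
      dg_functor.farr_add[OF K R2_add_left(1,2)] uv_simps(1)[OF w] by (simp add: uv_Eps)
next
  case (R2_scl_left f d gs a)
  show ?case
    using DE.coh_scl(2)[OF untr_arr(5)[OF R2_scl_left(1)] R2_scl_left(2)] R2_scl_left
      dg_functor.farr_scl[OF K R2_scl_left(1)] by (simp add: uv_simps uv_Eps)
next
  case (R2_add_right f g y y' q g' d gs hs)
  have e: "is_path D d (gs @ g' # hs)" "path_end D d (gs @ g' # hs) = path_end D d (gs @ g # hs)"
    "shdeg D (gs @ g' # hs) = shdeg D (gs @ g # hs)"
    using tgt.is_path_Hom[OF R2_add_right(4,2,3)] R2_add_right(2,3) by (auto simp: Hom_def)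
  show ?case
    using tgt.mlin_add[OF DE.cochain_mlin[OF untr_arr(1)[OF R2_add_right(1)]] _ R2_add_right(4,2,3)] R2_add_right(1,4) e
    by (subst uv_simps(1)) (auto simp: uv_Eps)
next
  case (R2_scl_right f d gs g hs a)
  have g: "g \<in> Arr D" using R2_scl_right(2) by (auto simp: tgt.is_path_append)
  show ?case
    using tgt.mlin_scl[OF DE.cochain_mlin[OF untr_arr(1)[OF R2_scl_right(1)]] _ R2_scl_right(2) g] R2_scl_right
    by (subst uv_simps(3)) (auto simp: uv_Eps)
next
  case (R3_left c d gs)
  then show ?case
    using DE.coh_idn(2)[OF untr_obj[OF R3_left(1)] R3_left(2)] dg_functor.farr_idn[OF K R3_left(1)]
      tgt.is_path_Obj[OF R3_left(2)] by (simp add: uv_Eps uv_simps)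
next
  case (R3_right f y d gs)
  then show ?case
    using tgt.nrmD[OF DE.cochain_nrm[OF untr_arr(1)[OF R3_right(1)]] R3_right(3,2,4)] tgt.is_path_Obj[OF R3_right(3)]
    by (simp add: src.Arr_simps uv_Eps uv_simps)
next
  case (R4 f1 f2 d gs)
  note p = R4(4)
  have "spl (%u v. sg (shdeg D v * deg C f1) * uv (Cmp (Eps f2 (path_end D d u) v) (Eps f1 d u))) gs
    = cup D (deg C f1) (DE.rv (farr K f2)) (DE.rv (farr K f1)) d gs"
    unfolding cup_def by (rule spl_cong) (use R4 in "auto simp: tgt.is_path_append uv_simps uv_Eps")
  then show ?case
    unfolding uv_cmp[OF R4(1-3) p] by (subst R4_hom[OF R4(1-3) p]) (auto simp: uv_simps)
qed (auto simp: algebra_simps uv_simps kap_mult)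

lemma ut_rel:
  assumes "(s, t) \<in> tw_rel C D"
  shows "ut E K s = ut E K t"
  using tw_rel_typed[OF assms] uv_rel[OF assms] unfolding uv_def
  by (intro trd.rho_inj[OF ut_Hom[of s] ut_Hom[of t]]) (auto simp: typed_def)

text \<open>By \<open>rho_dif\<close> the differential of \<open>E\<close> is the commutator with
  \<open>prt E\<close>; the generators have to be shown to produce the same commutator.\<close>

lemma uv_tdif: "wft t ==> uv (tdif C D t) = prt E * uv t - sg (tg t) * (uv t * prt E)"
proof (induction t)
  case (Eps f d gs)
  then have f: "f \<in> Arr C" and p: "is_path D d gs" by auto
  let ?p = "deg C f" and ?\<psi> = "DE.rv (farr K f)"
  note w = tdl_parts[OF f p, unfolded typed_def, THEN conjunct1]
  have o: "dom C f \<in> Obj C" "cod C f \<in> Obj C" using f by (auto simp: src.Arr_simps)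
  have "uv (tdif C D (Eps f d gs)) = (\<Sum>t\<leftarrow>tdl f d gs. uv t)"
    unfolding tdif_Eps using f tgt.is_path_Obj[OF p]
    by (intro uv_tsum typed_tdl f p) (auto simp: src.Arr_simps)
  also have "... = uv (Eps (dif C f) d gs) - sg (deg C f) * bb D (%w. uv (Eps f d w)) gs
    - (if gs = [] then 0 else sg (deg C f * deg D (last gs) + deg C f)
         * uv (Cmp (Rgt (cod C f) (last gs)) (Eps f d (butlast gs))))
    + (if gs = [] then 0 else sg (deg C f + shdeg D (tl gs))
         * uv (Cmp (Eps f (cod D (hd gs)) (tl gs)) (Rgt (dom C f) (hd gs))))"
    by (rule tdl_sum[OF f p]) (simp add: powi_sg uv_simps)
  also have "(if gs = [] then 0 else sg (deg C f * deg D (last gs) + deg C f)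
         * uv (Cmp (Rgt (cod C f) (last gs)) (Eps f d (butlast gs))))
      = cup D ?p (DE.tht (fobj K (cod C f))) ?\<psi> d gs - prt E * ?\<psi> d gs"
  proof (cases "gs = []")
    case False
    have "uv (Cmp (Rgt (cod C f) (last gs)) (Eps f d (butlast gs)))
      = rho E (farr (fobj K (cod C f)) (last gs)) * ?\<psi> d (butlast gs)"
      using uv_simps(2)[OF w(4)[OF False]] by (simp add: uv_Eps) (simp add: uv_def)
    then show ?thesis using False by (simp add: DE.cup_tht_left)
  qed (simp add: DE.cup_tht_left)
  also have "(if gs = [] then 0 else sg (deg C f + shdeg D (tl gs))
         * uv (Cmp (Eps f (cod D (hd gs)) (tl gs)) (Rgt (dom C f) (hd gs))))
      = sg ?p * cup D 1 ?\<psi> (DE.tht (fobj K (dom C f))) d gs - sg (?p + shdeg D gs) * (?\<psi> d gs * prt E)"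
  proof (cases gs)
    case (Cons g v)
    have "uv (Cmp (Eps f (cod D (hd gs)) (tl gs)) (Rgt (dom C f) (hd gs)))
      = ?\<psi> (cod D g) v * rho E (farr (fobj K (dom C f)) g)"
      using uv_simps(2)[OF w(5)] Cons by (simp add: uv_Eps) (simp add: uv_def)
    then show ?thesis using Cons by (simp add: DE.cup_tht_right sg_def)
  qed (simp add: DE.cup_tht_right)
  \<comment> \<open>\<open>K\<close> commutes with differentials, so this is the differential of the
    cochain \<open>farr K f\<close>. It cancels all other terms except the two containing
    \<open>prt E\<close>.\<close>
  also have "uv (Eps (dif C f) d gs) = DE.del (fobj K (dom C f)) (fobj K (cod C f)) ?p ?\<psi> d gs"
    using DE.coh_dif(2)[OF untr_arr(5)[OF f] p] dg_functor.farr_dif[OF K f] by (simp add: uv_Eps)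
  finally show ?case
    by (simp add: tgt.gdel_def uv_Eps)
next
  case (Rgt c g)
  note F = untr_obj[of c]
  show ?case
    using Rgt trd.rho_dif[OF dg_functor.farr_Hom[OF F tgt.Arr_Hom[of g]]] dg_functor.farr_dif[OF F, of g]
    by (simp add: uv_def)
next
  case (Idn x)
  have o: "uo x \<in> Obj E" using Idn uo_Obj by simp
  show ?case
    using trd.rho_dif[OF trd.idn_Hom[OF o]] trd.dif_idn[OF o] trd.rho_zer[OF o o, of 1] Idn
    by (simp add: uv_simps(4)) (simp add: uv_def uo_def)
next
  case (Cmp s t)
  then have w: "wft s" "wft t" "td s = tc t" by auto
  note h = wf_tdif[OF w(1)] wf_tdif[OF w(2)]
  show ?case
    using Cmp w h by (simp add: uv_simps powi_sg) (simp add: sg_def algebra_simps)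
next
  case (Add s t)
  then have w: "wft s" "wft t" by auto
  show ?case
    using Add wf_tdif[OF w(1)] wf_tdif[OF w(2)] by (simp add: uv_simps) (simp add: algebra_simps)
next
  case (Scl a t)
  then have w: "wft t" by auto
  have k: "prt E * (kap a * uv t) = kap a * (prt E * uv t)"
    by (simp only: mult.assoc[symmetric] trd.kap_prt)
  show ?case
    using Scl wf_tdif[OF w] by (simp add: uv_simps) (simp add: k sg_def algebra_simps)
qed (auto simp: uv_simps)

lemma ut_tdif:
  assumes "wft t"
  shows "ut E K (tdif C D t) = dif E (ut E K t)"
proof (rule trd.rho_inj)
  show "ut E K (tdif C D t) \<in> Hom E (uo (td t)) (uo (tc t)) (tg t + 1)"
    using assms by (intro ut_Hom typed_tdif) (simp add: typed_def)
  show "dif E (ut E K t) \<in> Hom E (uo (td t)) (uo (tc t)) (tg t + 1)"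
    by (rule trd.dif_Hom[OF ut_Hom'[OF assms]])
  show "rho E (ut E K (tdif C D t)) = rho E (dif E (ut E K t))"
    using uv_tdif[OF assms] trd.rho_dif[OF ut_Hom'[OF assms]] by (simp add: uv_def)
qed

lemma untr_cls: "wft t ==> farr (untr C D E K) (cls C D t) = ut E K t"
  using ut_rel[OF rep_rel[of t]] tens_cls(1)[of t] by (simp add: untr_def)

lemma untr_fobj: "c \<in> Obj C ==> d \<in> Obj D ==> fobj (untr C D E K) (c, d) = fobj (fobj K c) d"
  by (simp add: untr_def)

lemma untr_eps: "f \<in> Arr C ==> is_path D d gs ==> farr (untr C D E K) (eps C D f d gs) = cval (farr K f) d gs"
  by (simp add: eps_def untr_cls)

lemma untr_rgt: "c \<in> Obj C ==> g \<in> Arr D ==> farr (untr C D E K) (rgt C D c g) = farr (fobj K c) g"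
  by (simp add: rgt_def untr_cls)

lemma dg_functor_untr: "dg_functor (tens C D) E (untr C D E K)"
proof (intro dg_functor.intro dg_functor_axioms.intro dg_category_tens trd.dg_category_axioms)
  let ?H = "untr C D E K"
  have ob: "fobj ?H x = uo x" if "x \<in> Obj C \<times> Obj D" for x
    using that by (simp add: untr_def uo_def)
  show "fobj ?H \<in> Obj (tens C D) \<rightarrow>\<^sub>E Obj E" "farr ?H \<in> extensional (Arr (tens C D))"
    using uo_Obj by (auto simp: untr_def uo_def tens_ops(1))
  fix X x y n assume "X \<in> Hom (tens C D) x y n"
  then obtain s where s: "X = cls C D s" "typed s x y n" by (auto simp: Hom_tens)
  have w: "wft s" "td s = x" "tc s = y" "tg s = n" using s(2) by (auto simp: typed_def)
  show "farr ?H X \<in> Hom E (fobj ?H x) (fobj ?H y) n"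
    using ut_Hom[OF s(2)] typed_ObjD[OF s(2)] w by (simp add: s(1) untr_cls ob)
  show "farr ?H (add (tens C D) X Y) = add E (farr ?H X) (farr ?H Y)" if "Y \<in> Hom (tens C D) x y n" for Y
  proof -
    from that obtain t where t: "Y = cls C D t" "typed t x y n" by (auto simp: Hom_tens)
    have wt: "wft t" "td t = x" "tc t = y" "tg t = n" using t(2) by (auto simp: typed_def)
    show ?thesis using w wt by (simp add: s t tens_ops untr_cls)
  qed
next
  let ?H = "untr C D E K"
  fix X assume "X \<in> Arr (tens C D)"
  then obtain s where s: "X = cls C D s" "wft s" by (auto simp: Arr_tens)
  show "farr ?H (scl (tens C D) a X) = scl E a (farr ?H X)" for a
    using s by (simp add: tens_ops untr_cls)
  show "farr ?H (dif (tens C D) X) = dif E (farr ?H X)"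
    using s wf_tdif by (simp add: dif_cls untr_cls ut_tdif)
next
  fix x assume "x \<in> Obj (tens C D)"
  then show "farr (untr C D E K) (idn (tens C D) x) = idn E (fobj (untr C D E K) x)"
    by (simp add: tens_ops untr_cls) (simp add: untr_def)
next
  fix X y z m Y x n assume "X \<in> Hom (tens C D) y z m" "Y \<in> Hom (tens C D) x y n"
  then obtain s t where s: "X = cls C D s" "typed s y z m" and t: "Y = cls C D t" "typed t x y n"
    by (auto simp: Hom_tens)
  have w: "wft s" "td s = y" "tc s = z" "tg s = m" using s(2) by (auto simp: typed_def)
  have wt: "wft t" "td t = x" "tc t = y" "tg t = n" using t(2) by (auto simp: typed_def)
  show "farr (untr C D E K) (cmp (tens C D) X Y) = cmp E (farr (untr C D E K) X) (farr (untr C D E K) Y)"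
    using w wt by (simp add: s t tens_ops untr_cls)
qed

end

section \<open>Transposing a functor out of the tensor product\<close>

context
  fixes H
  assumes H: "dg_functor (tens C D) E H"
begin

lemma functor_tval: "tval (%t. rho E (farr H (cls C D t))) kap"
proof -
  interpret H: dg_functor "tens C D" E H by (rule H)
  have h: "cls C D t \<in> Hom (tens C D) (td t) (tc t) (tg t)" if "wft t" for t
    using that by (intro Hom_tensI) (simp add: typed_def)
  show ?thesis
    unfolding tval_def
  proof (intro conjI allI impI)
    fix s t assume "(s, t) \<in> tw_rel C D"
    then show "rho E (farr H (cls C D s)) = rho E (farr H (cls C D t))" by (simp add: cls_eqI)
  next
    fix s t assume w: "wft (Add s t)"
    then have hs: "cls C D s \<in> Hom (tens C D) (td t) (tc t) (tg t)" and ht: "cls C D t \<in> Hom (tens C D) (td t) (tc t) (tg t)"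
      using h[of s] h[of t] by auto
    show "rho E (farr H (cls C D (Add s t))) = rho E (farr H (cls C D s)) + rho E (farr H (cls C D t))"
      using trd.rho_add[OF H.farr_Hom[OF hs] H.farr_Hom[OF ht]] H.farr_add[OF hs ht] tens_ops(5)[OF w] by simp
  next
    fix s t assume w: "wft (Cmp s t)"
    then have hs: "cls C D s \<in> Hom (tens C D) (tc t) (tc s) (tg s)" and ht: "cls C D t \<in> Hom (tens C D) (td t) (tc t) (tg t)"
      using h[of s] h[of t] by auto
    show "rho E (farr H (cls C D (Cmp s t))) = rho E (farr H (cls C D s)) * rho E (farr H (cls C D t))"
      using trd.rho_cmp[OF H.farr_Hom[OF hs] H.farr_Hom[OF ht]] H.farr_cmp[OF hs ht] tens_ops(4)[OF w] by simp
  next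
    fix a t assume w: "wft t"
    show "rho E (farr H (cls C D (Scl a t))) = kap a * rho E (farr H (cls C D t))"
      using trd.rho_scl[OF trd.Hom_Arr[OF H.farr_Hom[OF h[OF w]]]] H.farr_scl[OF tens_cls(1)[OF w]] tens_ops(6)[OF w] by simp
  next
    fix x y n assume "wft (Zer x y n)"
    then show "rho E (farr H (cls C D (Zer x y n))) = 0"
      using dg_functor_zer[OF H, of x y n] dg_functor_Obj[OF H] tens_ops(1) tens_ops(3)[of x y n]
      by (auto simp: trd.rho_zer)
  qed simp_all
qed

lemma transpose_obj_simps [simp]:
  "d \<in> Obj D ==> fobj (transpose_obj C D H c) d = fobj H (c, d)"
  "g \<in> Arr D ==> farr (transpose_obj C D H c) g = farr H (rgt C D c g)"
  by (simp_all add: transpose_obj_def)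

lemma dg_functor_transpose_obj:
  assumes c: "c \<in> Obj C"
  shows "dg_functor D E (transpose_obj C D H c)"
proof (intro dg_functor.intro dg_functor_axioms.intro tgt.dg_category_axioms trd.dg_category_axioms)
  let ?F = "transpose_obj C D H c"
  interpret H: dg_functor "tens C D" E H by (rule H)
  show "fobj ?F \<in> Obj D \<rightarrow>\<^sub>E Obj E" "farr ?F \<in> extensional (Arr D)"
    using dg_functor_Obj[OF H] c by (auto simp: transpose_obj_def tens_ops(1))
  fix g x y n assume g: "g \<in> Hom D x y n"
  note r = rgt_ops(1)[OF c]
  show "farr ?F g \<in> Hom E (fobj ?F x) (fobj ?F y) n"
    using H.farr_Hom[OF r[OF g]] tgt.Hom_Obj[OF g] tgt.Hom_Arr[OF g] by simp
  show "farr ?F (add D g g') = add E (farr ?F g) (farr ?F g')" if g': "g' \<in> Hom D x y n" for g'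
    using H.farr_add[OF r[OF g] r[OF g']] rgt_ops(2)[OF c g g'] tgt.Hom_Arr[OF g] tgt.Hom_Arr[OF g']
      tgt.Hom_Arr[OF tgt.add_Hom[OF g g']] by simp
next
  let ?F = "transpose_obj C D H c"
  interpret H: dg_functor "tens C D" E H by (rule H)
  fix g assume g: "g \<in> Arr D"
  have a: "rgt C D c g \<in> Arr (tens C D)" by (rule rgt_Arr[OF c g])
  show "farr ?F (scl D a g) = scl E a (farr ?F g)" for a
    using H.farr_scl[OF a] g rgt_ops(3)[OF c g] by (simp add: tgt.Arr_simps)
  show "farr ?F (dif D g) = dif E (farr ?F g)"
    using H.farr_dif[OF a] g rgt_ops(6)[OF c g] by (simp add: tgt.Arr_simps)
next
  interpret H: dg_functor "tens C D" E H by (rule H)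
  fix d assume d: "d \<in> Obj D"
  show "farr (transpose_obj C D H c) (idn D d) = idn E (fobj (transpose_obj C D H c) d)"
    using H.farr_idn[of "(c, d)"] d c rgt_ops(4)[OF c d] by (simp add: tgt.Arr_simps tens_ops(1))
next
  interpret H: dg_functor "tens C D" E H by (rule H)
  fix h y z m g x n assume h: "h \<in> Hom D y z m" and g: "g \<in> Hom D x y n"
  show "farr (transpose_obj C D H c) (cmp D h g)
    = cmp E (farr (transpose_obj C D H c) h) (farr (transpose_obj C D H c) g)"
    using H.farr_cmp[OF rgt_ops(1)[OF c h] rgt_ops(1)[OF c g]] rgt_ops(5)[OF c h g]
      tgt.Hom_Arr[OF h] tgt.Hom_Arr[OF g] tgt.Hom_Arr[OF tgt.cmp_Hom[OF h g]] by simp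
qed

lemma transpose_fun_simps:
  "c \<in> Obj C ==> fobj (transpose_fun C D H) c = transpose_obj C D H c"
  "f \<in> Arr C ==> farr (transpose_fun C D H) f =
    Cochain (transpose_obj C D H (dom C f)) (transpose_obj C D H (cod C f)) (deg C f)
      (on_paths D (%d gs. farr H (eps C D f d gs)))"
  "f \<in> Arr C ==> is_path D d gs ==> DE.rv (farr (transpose_fun C D H) f) d gs = rho E (farr H (cls C D (Eps f d gs)))"
  by (simp_all add: transpose_fun_def DE.rv_def eps_def)

lemma transpose_fun_Hom:
  assumes f: "f \<in> Arr C"
  shows "farr (transpose_fun C D H) f
    \<in> Hom DE.Ch (transpose_obj C D H (dom C f)) (transpose_obj C D H (cod C f)) (deg C f)"
proof -
  interpret H: dg_functor "tens C D" E H by (rule H)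
  have o: "dom C f \<in> Obj C" "cod C f \<in> Obj C" using f by (auto simp: src.Arr_simps)
  have "farr H (eps C D f x w) \<in> Hom E (fobj (transpose_obj C D H (dom C f)) x)
      (fobj (transpose_obj C D H (cod C f)) (path_end D x w)) (deg C f + shdeg D w)" if p: "is_path D x w" for x w
  proof -
    have "eps C D f x w \<in> Hom (tens C D) (dom C f, x) (cod C f, path_end D x w) (deg C f + shdeg D w)"
      unfolding eps_def using f p by (intro Hom_tensI) (simp add: typed_def)
    from H.farr_Hom[OF this] show ?thesis using tgt.is_path_Obj[OF p] by simp
  qed
  then show ?thesis
    unfolding DE.Coh_Hom transpose_fun_simps(2)[OF f]
    using tval_mlin[OF functor_tval f] tval_nrm[OF functor_tval f]
    by (auto intro!: DE.is_cochainI dg_functor_transpose_obj o simp: eps_def)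
qed

text \<open>The argument of \<open>uv_rel\<close> and \<open>uv_tdif\<close> read backwards: the
  relations among \<open>\<epsilon>\<close> give the algebraic laws, and the formula for the
  differential of \<open>\<epsilon>\<close> gives the differential of cochains.\<close>

lemma dg_functor_transpose: "dg_functor C DE.Ch (transpose_fun C D H)"
proof (rule DE.dg_functor_CohI[OF src.dg_category_axioms])
  let ?K = "transpose_fun C D H"
  let ?V = "%t. rho E (farr H (cls C D t))"
  interpret H: dg_functor "tens C D" E H by (rule H)
  note V = functor_tval and simps = transpose_fun_simps(3)
  show "fobj ?K \<in> extensional (Obj C)" "farr ?K \<in> extensional (Arr C)"
    by (auto simp: transpose_fun_def)
  show o: "dg_functor D E (fobj ?K c)" if "c \<in> Obj C" for c
    using dg_functor_transpose_obj that by (simp add: transpose_fun_simps)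
  show "farr ?K f \<in> Hom DE.Ch (fobj ?K x) (fobj ?K y) n" if "f \<in> Hom C x y n" for f x y n
    using transpose_fun_Hom[of f] src.Hom_Obj[OF that] that by (simp add: transpose_fun_simps Hom_def)
  fix d gs assume p: "is_path D d gs"
  have o: "d \<in> Obj D" "path_end D d gs \<in> Obj D" using tgt.is_path_Obj[OF p] by auto
  show "DE.rv (farr ?K (add C f g)) d gs = DE.rv (farr ?K f) d gs + DE.rv (farr ?K g) d gs"
    if fg: "f \<in> Hom C x y n" "g \<in> Hom C x y n" for f g x y n
    using tvalD(1)[OF V tw_rel.R2_add_left[OF fg p]] tvalD(2)[OF V, of "Eps f d gs" "Eps g d gs"] fg p
      src.Hom_Arr[OF src.add_Hom[OF fg]] by (simp add: simps Hom_def)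
  show "DE.rv (farr ?K (scl C a f)) d gs = kap a * DE.rv (farr ?K f) d gs" if f: "f \<in> Arr C" for f a
    using tvalD(1)[OF V tw_rel.R2_scl_left[OF f p]] f p by (simp add: simps tvalD(4)[OF V] src.Arr_simps)
  show "DE.rv (farr ?K (idn C c)) d gs = (if gs = [] then rho E (idn E (fobj (fobj ?K c) d)) else 0)" if c: "c \<in> Obj C" for c
  proof (cases "gs = []")
    case True
    then show ?thesis using tvalD(1)[OF V tw_rel.Left_idn[OF c o(1)]] c o H.farr_idn[of "(c, d)"]
      by (simp add: simps transpose_fun_simps(1) src.Arr_simps tens_ops)
  next
    case False
    then show ?thesis
      using tvalD(1)[OF V tw_rel.R3_left[OF c p False]] tvalD(5)[OF V] c o p by (simp add: simps src.Arr_simps)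
  qed
  show "DE.rv (farr ?K (cmp C f2 f1)) d gs = cup D n (DE.rv (farr ?K f2)) (DE.rv (farr ?K f1)) d gs"
    if "f2 \<in> Hom C y z m" "f1 \<in> Hom C x y n" for f1 f2 x y z m n
  proof -
    have a: "f1 \<in> Arr C" "f2 \<in> Arr C" "dom C f2 = cod C f1" "deg C f1 = n" using that by (auto simp: Hom_def)
    have "cup D n (DE.rv (farr ?K f2)) (DE.rv (farr ?K f1)) d gs
      = cup D n (%y w. ?V (Eps f2 y w)) (%y w. ?V (Eps f1 y w)) d gs"
      by (rule DE.cup_rv_cong[OF p]) (simp_all add: simps a)
    then show ?thesis using tval_cmp[OF V a(1-3) p] a p by (simp add: simps src.Arr_simps)
  qed
  fix f assume f: "f \<in> Arr C"
  let ?F = "transpose_obj C D H (dom C f)" and ?G = "transpose_obj C D H (cod C f)"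
  let ?p = "deg C f" and ?\<psi> = "%d gs. ?V (Eps f d gs)"
  note w = tdl_parts[OF f p, unfolded typed_def, THEN conjunct1]
  have e: "wft (Eps f d gs)" using f p by simp
  have h: "cls C D (Eps f d gs) \<in> Hom (tens C D) (dom C f, d) (cod C f, path_end D d gs) (?p + shdeg D gs)"
    using f p by (intro Hom_tensI) (simp add: typed_def)
  \<comment> \<open>The differential of \<open>\<epsilon>(f; gs)\<close> is computed by its formula
    and as a commutator with \<open>prt E\<close>; comparing the two determines the value at
    \<open>dif C f\<close>.\<close>
  have "?V (tdif C D (Eps f d gs)) = (\<Sum>t\<leftarrow>tdl f d gs. ?V t)"
    unfolding tdif_Eps using f o by (intro tval_tsum[OF V] typed_tdl f p) (auto simp: src.Arr_simps)
  also note tdl_sum[OF f p, of ?V, OF tvalD(8)[OF V]]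
  also have "(if gs = [] then 0 else sg (deg C f * deg D (last gs) + deg C f)
       * ?V (Cmp (Rgt (cod C f) (last gs)) (Eps f d (butlast gs))))
    = cup D ?p (DE.tht ?G) ?\<psi> d gs - prt E * ?\<psi> d gs"
    using tvalD(3)[OF V w(4)] w(4) by (auto simp: DE.cup_tht_left rgt_def)
  also have "(if gs = [] then 0 else sg (deg C f + shdeg D (tl gs))
       * ?V (Cmp (Eps f (cod D (hd gs)) (tl gs)) (Rgt (dom C f) (hd gs))))
    = sg ?p * cup D 1 ?\<psi> (DE.tht ?F) d gs - sg (?p + shdeg D gs) * (?\<psi> d gs * prt E)"
    using tvalD(3)[OF V w(5)] w(5) by (cases gs) (auto simp: DE.cup_tht_right rgt_def sg_def)
  also have "?V (tdif C D (Eps f d gs)) = prt E * ?\<psi> d gs - sg (?p + shdeg D gs) * (?\<psi> d gs * prt E)"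
    using trd.rho_dif[OF H.farr_Hom[OF h]] H.farr_dif[OF tens_cls(1)[OF e]] dif_cls[OF e] by simp
  finally have "?V (Eps (dif C f) d gs) = DE.del ?F ?G ?p ?\<psi> d gs"
    by (simp add: tgt.gdel_def algebra_simps)
  also have "... = DE.del ?F ?G ?p (DE.rv (farr ?K f)) d gs"
    by (rule tgt.gdel_cong[OF p]) (simp add: simps f)
  finally show "DE.rv (farr ?K (dif C f)) d gs
      = DE.del (fobj ?K (dom C f)) (fobj ?K (cod C f)) (deg C f) (DE.rv (farr ?K f)) d gs"
    using f p by (simp add: simps transpose_fun_simps(1) src.Arr_simps)
qed

end

end

lemma dg_tripleI: "dg_category C ==> dg_category D ==> dg_category E ==> dg_triple C D E"
  by (simp add: dg_triple_def dg_pair_def)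

section \<open>The evaluation functor\<close>

definition eval_spec where
  "eval_spec C D H \<longleftrightarrow>
     dg_functor (tens (Coh C D) C) D H \<and>
     (\<forall>F\<in>Obj (Coh C D). \<forall>c\<in>Obj C. fobj H (F, c) = fobj F c) \<and>
     (\<forall>\<Psi>\<in>Arr (Coh C D). \<forall>c fs. is_path C c fs -->
        farr H (eps (Coh C D) C \<Psi> c fs) = cval \<Psi> c fs) \<and>
     (\<forall>F\<in>Obj (Coh C D). \<forall>f\<in>Arr C. farr H (rgt (Coh C D) C F f) = farr F f)"

text \<open>Existence comes from the universal property applied to the identity of the cochain
  category, uniqueness from the generators.\<close>

lemma eval_fun_spec:
  assumes "dg_category C" "dg_category D"
  shows "eval_spec C D (eval_fun C D)"
proof -
  interpret P: dg_pair C D using assms by (simp add: dg_pair_def)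
  interpret T: dg_triple "Coh C D" C D
    using assms P.dg_category_Coh by (intro dg_tripleI)
  let ?K = "fun_id (Coh C D)"
  note K = dg_functor_fun_id[OF P.dg_category_Coh]
  have ex: "eval_spec C D (untr (Coh C D) C D ?K)"
    unfolding eval_spec_def
    using T.dg_functor_untr[OF K] T.untr_fobj[OF K] T.untr_eps[OF K] T.untr_rgt[OF K] by simp
  moreover have "H = untr (Coh C D) C D ?K" if "eval_spec C D H" for H
    using that ex unfolding eval_spec_def by (intro T.tens_functor_eqI) auto
  ultimately show ?thesis
    unfolding eval_fun_def eval_spec_def[symmetric] by (rule theI)
qed

lemma eval_fun_props:
  assumes "dg_category C" "dg_category D"
  shows "dg_functor (tens (Coh C D) C) D (eval_fun C D)"
    and "dg_functor C D F ==> c \<in> Obj C ==> fobj (eval_fun C D) (F, c) = fobj F c"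
    and "is_cochain C D \<Psi> ==> is_path C c fs ==> farr (eval_fun C D) (eps (Coh C D) C \<Psi> c fs) = cval \<Psi> c fs"
    and "dg_functor C D F ==> f \<in> Arr C ==> farr (eval_fun C D) (rgt (Coh C D) C F f) = farr F f"
  using eval_fun_spec[OF assms] assms unfolding eval_spec_def
  by (auto simp: dg_pair.Coh_simps[of C D] dg_pair_def)

text \<open>Precomposition of functors and cochains with \<open>G\<close>. It supplies the second
  argument when the tensor product of two functors is constructed.\<close>

definition pull :: "('k::field, 'd, 'g) dgcat => ('k, 'd2, 'g2) dgcat => ('k, 'e, 'h) dgcat
    => ('d, 'g, 'd2, 'g2) dgfun
    => (('d2, 'g2, 'e, 'h) dgfun, ('d2, 'g2, 'e, 'h) cochain, ('d, 'g, 'e, 'h) dgfun, ('d, 'g, 'e, 'h) cochain) dgfun" where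
  "pull D D' E G = \<lparr>fobj = (\<lambda>F\<in>Obj (Coh D' E). fun_comp D F G),
     farr = (\<lambda>\<Psi>\<in>Arr (Coh D' E). Cochain (fun_comp D (csrc \<Psi>) G) (fun_comp D (ctgt \<Psi>) G) (cdeg \<Psi>)
        (on_paths D (%d gs. cval \<Psi> (fobj G d) (map (farr G) gs))))\<rparr>"

lemma spl_map: "spl P (map h w) = spl (%u v. P (map h u) (map h v)) w"
  by (induction w arbitrary: P) simp_all

lemma dg_functor_pull:
  fixes D :: "('k::field, 'd, 'g) dgcat" and D' :: "('k, 'd2, 'g2) dgcat" and E :: "('k, 'e, 'h) dgcat"
  assumes G: "dg_functor D D' G" and E: "dg_category E"
  shows "dg_functor (Coh D' E) (Coh D E) (pull D D' E G)"
proof -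
  interpret G: dg_functor D D' G by (rule G)
  interpret P: dg_pair D E using E by (intro dg_pair.intro G.source.dg_category_axioms)
  interpret P': dg_pair D' E using E by (intro dg_pair.intro G.target.dg_category_axioms)
  let ?g = "map (farr G)"
  let ?K = "pull D D' E G"
  note gp = dg_functor_path[OF G]
  have rv: "P.rv (farr ?K \<Psi>) d gs = P'.rv \<Psi> (fobj G d) (?g gs)"
    if "is_cochain D' E \<Psi>" "is_path D d gs" for \<Psi> d gs
    using that by (simp add: pull_def P.rv_def P'.rv_def)
  \<comment> \<open>\<open>G\<close> preserves composites and differentials, so mapping letters
    commutes with the bar differential; \<open>cupG\<close> is the analogue for cutting
    chains.\<close>
  have bbG: "bb D (%w. \<psi> (?g w)) w = bb D' \<psi> (?g w)"
    if "is_path D d w" for d w and \<psi> :: "'g2 list => ('h, 'k) endo"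
    using that
  proof (induction w arbitrary: d \<psi>)
    case (Cons f w)
    have f: "f \<in> Arr D" "is_path D (cod D f) w" using Cons.prems by auto
    have c: "farr G (cmp D g f) = cmp D' (farr G g) (farr G f)" if "w = g # v" for g v
      using f that by (intro G.farr_cmp[OF G.source.Arr_Hom]) (auto simp: Hom_def)
    show ?case
    proof (cases w)
      case w: (Cons g v)
      have "shdeg D' (?g v) = shdeg D v" "deg D' (farr G g) = deg D g"
        using f w by (auto intro!: gp(3) dg_functor_Arr[OF G])
      then show ?thesis using Cons.IH[OF f(2), of "%u. \<psi> (farr G f # u)"] f c[OF w]
        by (simp add: w G.farr_dif)
    qed (simp add: G.farr_dif f)
  qed simp
  have cupG: "cup D q (%d w. \<Phi> (fobj G d) (?g w)) (%d w. \<Psi> (fobj G d) (?g w)) d w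
     = cup D' q \<Phi> \<Psi> (fobj G d) (?g w)" if "is_path D d w" for q d w and \<Phi> \<Psi> :: "'d2 => 'g2 list => ('h, 'k) endo"
    unfolding cup_def spl_map
    using that by (intro spl_cong) (auto simp: G.source.is_path_append gp)
  have th: "P.tht (fun_comp D F G) d w = P'.tht F (fobj G d) (?g w)" if "is_path D d w" for F d w
    using that by (cases w) (auto simp: P.tht_def P'.tht_def)
  have K: "farr ?K \<Psi> \<in> Hom P.Ch (fun_comp D F G) (fun_comp D F' G) p" if \<Psi>: "\<Psi> \<in> Hom P'.Ch F F' p" for \<Psi> F F' p
  proof -
    have c: "is_cochain D' E \<Psi>" "csrc \<Psi> = F" "ctgt \<Psi> = F'" "cdeg \<Psi> = p"
      using \<Psi> by (auto simp: P'.Coh_Hom)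
    have m: "G.source.mlin kap d (%w. P'.rv \<Psi> (fobj G d) (?g w))" for d
      unfolding G.source.mlin_def
    proof (intro allI impI)
      fix us f f' vs y z n a
      assume p: "is_path D d (us @ f # vs)" and f: "f \<in> Hom D y z n" "f' \<in> Hom D y z n"
      have "farr G (add D (scl D a f) f') = add D' (scl D' a (farr G f)) (farr G f')"
        using G.farr_add[OF G.source.scl_Hom[OF f(1)] f(2)] G.farr_scl[OF G.source.Hom_Arr[OF f(1)]] by simp
      then show "P'.rv \<Psi> (fobj G d) (?g (us @ add D (scl D a f) f' # vs))
        = kap a * P'.rv \<Psi> (fobj G d) (?g (us @ f # vs)) + P'.rv \<Psi> (fobj G d) (?g (us @ f' # vs))"
        using G.target.mlinD[OF P'.cochain_mlin[OF c(1)] _ G.farr_Hom[OF f(1)] G.farr_Hom[OF f(2)],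
            of "fobj G d" "map (farr G) us" "map (farr G) vs" a] gp(1)[OF p] by simp
    qed
    have n: "G.source.nrm d (%w. P'.rv \<Psi> (fobj G d) (?g w))" for d
      unfolding G.source.nrm_def
    proof (intro allI impI)
      fix w assume p: "is_path D d w" and "\<exists>y\<in>Obj D. idn D y \<in> set w"
      then obtain y where y: "y \<in> Obj D" "idn D y \<in> set w" by blast
      then have "idn D' (fobj G y) \<in> set (?g w)" using G.farr_idn[of y] by (metis image_eqI set_map)
      then show "P'.rv \<Psi> (fobj G d) (?g w) = 0"
        using G.target.nrmD[OF P'.cochain_nrm[OF c(1)] gp(1)[OF p]] dg_functor_Obj[OF G y(1)] by simp
    qed
    have "is_cochain D E (Cochain (fun_comp D F G) (fun_comp D F' G) p
        (on_paths D (%d gs. cval \<Psi> (fobj G d) (?g gs))))"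
    proof (rule P.is_cochainI)
      show "dg_functor D E (fun_comp D F G)" "dg_functor D E (fun_comp D F' G)"
        using P'.coh_Hom_Obj[OF \<Psi>] by (auto intro: dg_functor_comp[OF G])
      show "cval \<Psi> (fobj G x) (?g w)
        \<in> Hom E (fobj (fun_comp D F G) x) (fobj (fun_comp D F' G) (path_end D x w)) (p + shdeg D w)"
        if w: "is_path D x w" for x w
        using P'.cochain_Hom[OF c(1) gp(1)[OF w]] G.source.is_path_Obj[OF w] by (simp add: c gp[OF w])
    qed (use m n in "simp_all add: P'.rv_def")
    then show ?thesis using c by (simp add: pull_def P.Coh_Hom)
  qed
  show ?thesis
  proof (rule P.dg_functor_CohI[OF P'.dg_category_Coh])
    show "fobj ?K \<in> extensional (Obj P'.Ch)" "farr ?K \<in> extensional (Arr P'.Ch)"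
      by (auto simp: pull_def)
    have Ko: "fobj ?K F = fun_comp D F G" if "dg_functor D' E F" for F
      using that by (simp add: pull_def)
    show "dg_functor D E (fobj ?K F)" if "F \<in> Obj P'.Ch" for F
      using that by (simp add: Ko dg_functor_comp[OF G])
    show "farr ?K \<Psi> \<in> Hom P.Ch (fobj ?K F) (fobj ?K F') p" if "\<Psi> \<in> Hom P'.Ch F F' p" for \<Psi> F F' p
      using K[OF that] P'.coh_Hom_Obj[OF that] by (simp add: Ko)
    fix d gs assume p: "is_path D d gs"
    note gp = gp[OF p] and rv' = rv[OF _ p]
    show "P.rv (farr ?K (add P'.Ch \<Psi> \<Phi>)) d gs = P.rv (farr ?K \<Psi>) d gs + P.rv (farr ?K \<Phi>) d gs"
      if "\<Psi> \<in> Hom P'.Ch F F' p" "\<Phi> \<in> Hom P'.Ch F F' p" for \<Psi> \<Phi> F F' p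
      using that P'.coh_add[OF that] gp by (simp add: rv' P'.Coh_Hom)
    show "P.rv (farr ?K (idn P'.Ch F)) d gs = (if gs = [] then rho E (idn E (fobj (fobj ?K F) d)) else 0)"
      if "F \<in> Obj P'.Ch" for F
      using that P'.coh_idn[of F] gp G.source.is_path_Obj[OF p] by (simp add: Ko rv' P'.Coh_Hom)
    show "P.rv (farr ?K (cmp P'.Ch \<Psi> \<Phi>)) d gs = cup D n (P.rv (farr ?K \<Psi>)) (P.rv (farr ?K \<Phi>)) d gs"
      if \<Psi>: "\<Psi> \<in> Hom P'.Ch F' F'' m" and \<Phi>: "\<Phi> \<in> Hom P'.Ch F F' n" for \<Psi> \<Phi> F F' F'' m n
    proof -
      have "cup D n (P.rv (farr ?K \<Psi>)) (P.rv (farr ?K \<Phi>)) d gs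
        = cup D n (%d w. P'.rv \<Psi> (fobj G d) (?g w)) (%d w. P'.rv \<Phi> (fobj G d) (?g w)) d gs"
        by (rule P.cup_rv_cong[OF p]) (use \<Psi> \<Phi> in "auto simp: rv P'.Coh_Hom")
      then show ?thesis using P'.coh_cmp[OF \<Psi> \<Phi>] gp(1) by (simp add: rv' P'.Coh_Hom cupG[OF p])
    qed
    fix \<Psi> assume "\<Psi> \<in> Arr P'.Ch"
    then have c: "is_cochain D' E \<Psi>" and \<Psi>: "\<Psi> \<in> Hom P'.Ch (csrc \<Psi>) (ctgt \<Psi>) (cdeg \<Psi>)"
      by (auto intro: P'.coh_Arr_Hom)
    show "P.rv (farr ?K (scl P'.Ch a \<Psi>)) d gs = kap a * P.rv (farr ?K \<Psi>) d gs" for a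
      using \<Psi> P'.coh_scl[OF \<Psi>] gp by (simp add: rv' P'.Coh_Hom)
    let ?F = "csrc \<Psi>" and ?F' = "ctgt \<Psi>" and ?p = "cdeg \<Psi>"
    let ?\<psi> = "%d gs. P'.rv \<Psi> (fobj G d) (?g gs)"
    have "P.del (fun_comp D ?F G) (fun_comp D ?F' G) ?p (P.rv (farr ?K \<Psi>)) d gs
        = P.del (fun_comp D ?F G) (fun_comp D ?F' G) ?p ?\<psi> d gs"
      by (rule G.source.gdel_cong[OF p]) (simp add: rv c)
    also have "... = P'.del ?F ?F' ?p (P'.rv \<Psi>) (fobj G d) (?g gs)"
    proof -
      have "cup D ?p (P.tht (fun_comp D ?F' G)) ?\<psi> d gs = cup D ?p (%d w. P'.tht ?F' (fobj G d) (?g w)) ?\<psi> d gs"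
        "cup D 1 ?\<psi> (P.tht (fun_comp D ?F G)) d gs = cup D 1 ?\<psi> (%d w. P'.tht ?F (fobj G d) (?g w)) d gs"
        by (auto intro!: G.source.cup_cong[OF p] th)
      then show ?thesis
        unfolding G.source.gdel_def G.target.gdel_def by (simp only: cupG[OF p] bbG[OF p])
    qed
    finally show "P.rv (farr ?K (dif P'.Ch \<Psi>)) d gs = P.del (fobj ?K (dom P'.Ch \<Psi>))
        (fobj ?K (cod P'.Ch \<Psi>)) (deg P'.Ch \<Psi>) (P.rv (farr ?K \<Psi>)) d gs"
      using P'.coh_dif[OF \<Psi>] gp(1) P'.coh_Hom_Obj[OF \<Psi>] c by (simp add: rv' Ko P'.Coh_Hom)
  qed
qed

section \<open>The tensor product of two dg functors\<close>

definition tens_fun_spec where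
  "tens_fun_spec C D C' D' F G H \<longleftrightarrow>
     dg_functor (tens C D) (tens C' D') H \<and>
     (\<forall>c\<in>Obj C. \<forall>d\<in>Obj D. fobj H (c, d) = (fobj F c, fobj G d)) \<and>
     (\<forall>f\<in>Arr C. \<forall>d gs. is_path D d gs -->
        farr H (eps C D f d gs) = eps C' D' (farr F f) (fobj G d) (map (farr G) gs)) \<and>
     (\<forall>c\<in>Obj C. \<forall>g\<in>Arr D. farr H (rgt C D c g) = rgt C' D' (fobj F c) (farr G g))"

text \<open>Rather than checking relations, the functor is obtained from its transpose, which is a
  composite of functors already available.\<close>

lemma tens_fun_spec:
  assumes F: "dg_functor C C' F" and G: "dg_functor D D' G"
  shows "tens_fun_spec C D C' D' F G (tens_fun C D C' D' F G)"
proof -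
  interpret F: dg_functor C C' F by (rule F)
  interpret G: dg_functor D D' G by (rule G)
  interpret P: dg_pair C' D' ..
  interpret Q: dg_triple C' D' "tens C' D'"
    by (intro dg_tripleI F.target.dg_category_axioms G.target.dg_category_axioms P.dg_category_tens)
  interpret T: dg_triple C D "tens C' D'"
    by (intro dg_tripleI F.source.dg_category_axioms G.source.dg_category_axioms P.dg_category_tens)
  let ?I = "fun_id (tens C' D')"
  note I = dg_functor_fun_id[OF P.dg_category_tens]
  note eta = Q.dg_functor_transpose[OF I]
  \<comment> \<open>The transpose of the identity of the target is the unit of the adjunction; it is
    restricted along \<open>F\<close> in the first argument and along \<open>G\<close> inside the
    cochains.\<close>
  let ?K = "fun_comp C (pull D D' (tens C' D') G) (fun_comp C (transpose_fun C' D' ?I) F)"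
  have K: "dg_functor C (Coh D (tens C' D')) ?K"
    by (rule dg_functor_comp[OF dg_functor_comp[OF F eta] dg_functor_pull[OF G P.dg_category_tens]])
  have Ko: "fobj ?K c = fun_comp D (transpose_obj C' D' ?I (fobj F c)) G" if "c \<in> Obj C" for c
    using that dg_functor_Obj[OF F] Q.dg_functor_transpose_obj[OF I]
    by (simp add: Q.transpose_fun_simps[OF I]) (simp add: pull_def)
  have Ka: "cval (farr ?K f) d gs = eps C' D' (farr F f) (fobj G d) (map (farr G) gs)"
    if "f \<in> Arr C" "is_path D d gs" for f d gs
  proof -
    have f: "farr F f \<in> Arr C'" using dg_functor_Arr[OF F that(1)] by simp
    have "is_cochain D' (tens C' D') (farr (transpose_fun C' D' ?I) (farr F f))"
      using Q.transpose_fun_Hom[OF I f] by (simp add: Q.DE.Coh_Hom)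
    then show ?thesis using that f dg_functor_path[OF G that(2)] P.eps_Arr[OF f]
      by (simp add: pull_def) (simp add: Q.transpose_fun_simps[OF I])
  qed
  let ?H = "untr C D (tens C' D') ?K"
  have o: "fobj ?H (c, d) = (fobj F c, fobj G d)" if "c \<in> Obj C" "d \<in> Obj D" for c d
    unfolding T.untr_fobj[OF K that] Ko[OF that(1)]
    using that dg_functor_Obj[OF F] dg_functor_Obj[OF G]
    by (simp add: Q.transpose_obj_simps[OF I] P.tens_ops(1))
  have e: "farr ?H (eps C D f d gs) = eps C' D' (farr F f) (fobj G d) (map (farr G) gs)"
    if "f \<in> Arr C" "is_path D d gs" for f d gs
    unfolding T.untr_eps[OF K that] by (rule Ka[OF that])
  have r: "farr ?H (rgt C D c g) = rgt C' D' (fobj F c) (farr G g)" if "c \<in> Obj C" "g \<in> Arr D" for c g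
    unfolding T.untr_rgt[OF K that] Ko[OF that(1)]
    using that dg_functor_Obj[OF F] dg_functor_Arr[OF G] P.rgt_Arr
    by (simp add: Q.transpose_obj_simps[OF I])
  have ex: "tens_fun_spec C D C' D' F G ?H"
    unfolding tens_fun_spec_def
    by (intro conjI ballI allI impI T.dg_functor_untr[OF K] o e r)
  moreover have "H = untr C D (tens C' D') ?K" if "tens_fun_spec C D C' D' F G H" for H
    using that ex unfolding tens_fun_spec_def by (intro T.tens_functor_eqI) auto
  ultimately show ?thesis
    unfolding tens_fun_def tens_fun_spec_def[symmetric] by (rule theI)
qed

lemma tens_fun_props:
  assumes "dg_functor C C' F" "dg_functor D D' G"
  shows "dg_functor (tens C D) (tens C' D') (tens_fun C D C' D' F G)"
    and "c \<in> Obj C ==> d \<in> Obj D ==> fobj (tens_fun C D C' D' F G) (c, d) = (fobj F c, fobj G d)"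
    and "f \<in> Arr C ==> is_path D d gs ==>
      farr (tens_fun C D C' D' F G) (eps C D f d gs) = eps C' D' (farr F f) (fobj G d) (map (farr G) gs)"
    and "c \<in> Obj C ==> g \<in> Arr D ==> farr (tens_fun C D C' D' F G) (rgt C D c g) = rgt C' D' (fobj F c) (farr G g)"
  using tens_fun_spec[OF assms] unfolding tens_fun_spec_def by auto

section \<open>The brace operator\<close>

text \<open>
  \<open>brc C D rg ep \<psi> y z gs hs\<close> is the signed sum of the values of \<open>\<psi>\<close> on the words of
  \<open>brace_args\<close>, with letters formed by arbitrary functions \<open>rg\<close> and \<open>ep\<close>.  It is the transpose of
  a coalgebra map from the tensor product of two bar constructions; the recursion splits off the
  first letter of the word.
\<close>

fun brc :: "('k, 'c, 'f) dgcat => ('k, 'd, 'g) dgcat => ('c => 'g => 'l) => ('f => 'd => 'g list => 'l)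
    => ('l list => 'r::ring_1) => 'c => 'd => 'f list => 'g list => 'r" where
  "brc C D rg ep \<psi> y z [] hs = \<psi> (map (rg y) hs)"
| "brc C D rg ep \<psi> y z (g # gs) [] = brc C D rg ep (%w. \<psi> (ep g z [] # w)) (cod C g) z gs []"
| "brc C D rg ep \<psi> y z (g # gs) (h # hs) =
     spl (%u v. sg ((deg C g - 1) * shdeg D v)
        * brc C D rg ep (%w. \<psi> (ep g z u # w)) (cod C g) (path_end D z u) gs v) (h # hs)
     + brc C D rg ep (%w. \<psi> (rg y h # w)) y (cod D h) (g # gs) hs"

text \<open>One step of the brace recursion, with the continuation \<open>K\<close> as a parameter.
  The first letter is either \<open>\<epsilon>\<close> of the first \<open>g\<close> with an initial
  segment of \<open>hs\<close>, or a bare \<open>h\<close>; the sign moves the shifted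
  \<open>g\<close> past the remaining \<open>hs\<close>.\<close>

definition fst_letter :: "('k, 'c, 'f) dgcat => ('k, 'd, 'g) dgcat => ('c => 'g => 'l) => ('f => 'd => 'g list => 'l)
    => ('l => 'c => 'd => 'f list => 'g list => 'r::ring_1) => 'c => 'd => 'f list => 'g list => 'r" where
  "fst_letter C D rg ep K y z gs hs =
     (case gs of [] => 0 | g # gs' =>
        spl (%u v. sg ((deg C g - 1) * shdeg D v) * K (ep g z u) (cod C g) (path_end D z u) gs' v) hs)
     + (case hs of [] => 0 | h # hs' => K (rg y h) y (cod D h) gs hs')"

text \<open>A uniform recursion replacing the case distinction of the defining equations. Since the
  continuation always receives fewer letters, properties of \<open>brc\<close> follow by induction
  on the total length.\<close>

lemma brc_fst_letter:
  "brc C D rg ep \<psi> y z gs hs = (if gs = [] \<and> hs = [] then \<psi> [] else 0)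
     + fst_letter C D rg ep (%l. brc C D rg ep (%w. \<psi> (l # w))) y z gs hs"
  by (cases gs; cases hs) (simp_all add: fst_letter_def)

lemma fst_letter_cong:
  assumes "!!g gs' u v. gs = g # gs' ==> hs = u @ v ==>
      K (ep g z u) (cod C g) (path_end D z u) gs' v = K' (ep' g z u) (cod C g) (path_end D z u) gs' v"
    and "!!h hs'. hs = h # hs' ==> K (rg y h) y (cod D h) gs hs' = K' (rg' y h) y (cod D h) gs hs'"
  shows "fst_letter C D rg ep K y z gs hs = fst_letter C D rg' ep' K' y z gs hs"
proof -
  have "spl (%u v. sg ((deg C g - 1) * shdeg D v) * K (ep g z u) (cod C g) (path_end D z u) gs' v) hs
    = spl (%u v. sg ((deg C g - 1) * shdeg D v) * K' (ep' g z u) (cod C g) (path_end D z u) gs' v) hs"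
    if "gs = g # gs'" for g gs'
    using assms(1)[OF that] by (intro spl_cong) auto
  then show ?thesis
    using assms(2) by (auto simp: fst_letter_def split: list.split)
qed

lemma fst_letter_add: "fst_letter C D rg ep (%l y z gs hs. K l y z gs hs + K' l y z gs hs) y z gs hs
    = fst_letter C D rg ep K y z gs hs + fst_letter C D rg ep K' y z gs hs"
  by (auto simp: fst_letter_def distrib_left spl_add ac_simps split: list.split)

lemma fst_letter_mult_left: "fst_letter C D rg ep (%l y z gs hs. c * K l y z gs hs) y z gs hs
    = c * fst_letter C D rg ep K y z gs hs"
proof -
  have "sg n * (c * a) = c * (sg n * a)" for n a by (simp add: sg_def)
  then show ?thesis
    by (auto simp: fst_letter_def spl_mult_left distrib_left split: list.split)
qed

lemma brc_induct [case_names less]: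
  fixes gs :: "'f list" and hs :: "'g list"
  assumes "!!gs hs. (!!gs' hs'. length gs' + length hs' < length gs + length (hs :: 'g list) ==> P (gs' :: 'f list) hs') ==> P gs hs"
  shows "P gs hs"
proof (induction "length gs + length hs" arbitrary: gs hs rule: less_induct)
  case less
  show ?case by (rule assms) (simp add: less)
qed

lemma brc_add: "brc C D rg ep (%w. \<phi> w + \<psi> w) y z gs hs = brc C D rg ep \<phi> y z gs hs + brc C D rg ep \<psi> y z gs hs"
proof (induction gs hs arbitrary: \<phi> \<psi> y z rule: brc_induct)
  case (less gs hs)
  have "fst_letter C D rg ep (%l. brc C D rg ep (%w. \<phi> (l # w) + \<psi> (l # w))) y z gs hs
    = fst_letter C D rg ep (%l y z gs hs. brc C D rg ep (%w. \<phi> (l # w)) y z gs hs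
        + brc C D rg ep (%w. \<psi> (l # w)) y z gs hs) y z gs hs"
    by (rule fst_letter_cong) (auto intro!: less)
  then show ?case
    unfolding brc_fst_letter[of C D rg ep _ y z gs hs] by (simp add: fst_letter_add ac_simps)
qed

lemma brc_mult_left: "brc C D rg ep (%w. c * \<psi> w) y z gs hs = c * brc C D rg ep \<psi> y z gs hs"
proof (induction gs hs arbitrary: \<psi> y z rule: brc_induct)
  case (less gs hs)
  have "fst_letter C D rg ep (%l. brc C D rg ep (%w. c * \<psi> (l # w))) y z gs hs
    = fst_letter C D rg ep (%l y z gs hs. c * brc C D rg ep (%w. \<psi> (l # w)) y z gs hs) y z gs hs"
    by (rule fst_letter_cong) (auto intro!: less)
  then show ?case
    unfolding brc_fst_letter[of C D rg ep _ y z gs hs] by (simp add: fst_letter_mult_left distrib_left)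
qed

lemma brc_mult_right: "brc C D rg ep (%w. \<psi> w * c) y z gs hs = brc C D rg ep \<psi> y z gs hs * c"
proof (induction gs hs arbitrary: \<psi> y z rule: brc_induct)
  case (less gs hs)
  have "fst_letter C D rg ep (%l. brc C D rg ep (%w. \<psi> (l # w) * c)) y z gs hs
    = fst_letter C D rg ep (%l y z gs hs. brc C D rg ep (%w. \<psi> (l # w)) y z gs hs * c) y z gs hs"
    by (rule fst_letter_cong) (auto intro!: less)
  also have "... = fst_letter C D rg ep (%l. brc C D rg ep (%w. \<psi> (l # w))) y z gs hs * c"
    by (auto simp: fst_letter_def spl_mult_right[symmetric] distrib_right mult.assoc split: list.split)
  finally show ?case
    unfolding brc_fst_letter[of C D rg ep _ y z gs hs] by (simp add: distrib_right)
qed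

lemma brc_map: "brc C D rg ep (%w. \<psi> (map e w)) y z gs hs
    = brc C D (%y h. e (rg y h)) (%g z u. e (ep g z u)) \<psi> y z gs hs"
proof (induction gs hs arbitrary: \<psi> y z rule: brc_induct)
  case (less gs hs)
  have "fst_letter C D rg ep (%l. brc C D rg ep (%w. \<psi> (map e (l # w)))) y z gs hs
    = fst_letter C D (%y h. e (rg y h)) (%g z u. e (ep g z u))
        (%l. brc C D (%y h. e (rg y h)) (%g z u. e (ep g z u)) (%w. \<psi> (l # w))) y z gs hs"
  proof -
    have "brc C D rg ep (%w. \<psi> (e l # map e w)) y' z' gs' hs'
      = brc C D (%y h. e (rg y h)) (%g z u. e (ep g z u)) (%w. \<psi> (e l # w)) y' z' gs' hs'"
      if "length gs' + length hs' < length gs + length hs" for l y' z' gs' hs'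
      using less[OF that, of "%w. \<psi> (e l # w)"] by simp
    then show ?thesis
      by (auto simp: fst_letter_def intro!: spl_cong dest!: arg_cong[of _ _ length] split: list.split)
  qed
  then show ?case
    unfolding brc_fst_letter[of C D _ _ _ y z gs hs] by simp
qed

text \<open>The coproduct on the tensor product of two bar constructions, with the Koszul sign for
  interchanging the middle pieces \<open>a\<close> and \<open>v\<close>.\<close>

definition spl2 :: "('k, 'c, 'f) dgcat => ('k, 'd, 'g) dgcat
    => ('f list => 'g list => 'f list => 'g list => 'r::ring_1) => 'f list => 'g list => 'r" where
  "spl2 C D P gs hs = spl (%a b. spl (%u v. sg (shdeg C a * shdeg D v) * P a u b v) hs) gs"

lemma spl_swap: "spl (%a b. spl (%u v. P a b u v) hs) gs = spl (%u v. spl (%a b. P a b u v) gs) hs"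
  by (induction gs arbitrary: P) (simp_all add: spl_add)

lemma spl2_add: "spl2 C D (%a u b v. P a u b v + Q a u b v) gs hs = spl2 C D P gs hs + spl2 C D Q gs hs"
  by (simp add: spl2_def distrib_left spl_add)

lemma spl2_cong:
  "(!!a u b v. a @ b = gs ==> u @ v = hs ==> P a u b v = Q a u b v) ==> spl2 C D P gs hs = spl2 C D Q gs hs"
  unfolding spl2_def by (intro spl_cong) auto

lemma spl_nil: "spl (%u v. if u = [] then P v else 0) w = P w"
  by (cases w) simp_all

text \<open>Choosing the first letter commutes with cutting the remainder: the first letter uses up
  an initial segment of the initial piece, and coassociativity lets it be chosen before the
  cut.\<close>

lemma spl2_fst_letter:
  "spl2 C D (%a u b v. fst_letter C D rg ep (%l y z g h. K l y z g h b v) y z a u) gs hs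
    = fst_letter C D rg ep (%l y z gs hs. spl2 C D (K l y z) gs hs) y z gs hs"
proof -
  let ?c = "%a b u v. case u of [] => 0 | h # u' => K (rg y h) y (cod D h) a u' b v"
  have R: "spl2 C D (%a u b v. ?c a b u v) gs hs
      = (case hs of [] => 0 | h # hs' => spl2 C D (K (rg y h) y (cod D h)) gs hs')"
    by (cases hs) (simp_all add: spl2_def)
  let ?s = "%a b u v. case a of [] => 0 | g # a' =>
        spl (%p q. sg ((deg C g - 1) * shdeg D q) * K (ep g z p) (cod C g) (path_end D z p) a' q b v) u"
  have S: "spl2 C D (%a u b v. ?s a b u v) gs hs = (case gs of [] => 0 | g # gs' =>
      spl (%p q. sg ((deg C g - 1) * shdeg D q) * spl2 C D (K (ep g z p) (cod C g) (path_end D z p)) gs' q) hs)"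
  proof (cases gs)
    case (Cons g gs')
    have "spl2 C D (%a u b v. ?s a b u v) gs hs = spl (%a b. spl (%u v. spl (%p q.
        sg (shdeg C (g # a) * shdeg D v) * (sg ((deg C g - 1) * shdeg D q) * K (ep g z p) (cod C g) (path_end D z p) a q b v)) u) hs) gs'"
      by (simp add: Cons spl2_def spl_mult_left)
    also have "... = spl (%a b. spl (%p r. spl (%q v.
        sg (shdeg C (g # a) * shdeg D v) * (sg ((deg C g - 1) * shdeg D q) * K (ep g z p) (cod C g) (path_end D z p) a q b v)) r) hs) gs'"
      by (simp only: spl_coassoc)
    also have "... = spl (%p r. spl (%a b. spl (%q v.
        sg (shdeg C (g # a) * shdeg D v) * (sg ((deg C g - 1) * shdeg D q) * K (ep g z p) (cod C g) (path_end D z p) a q b v)) r) gs') hs"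
      by (rule spl_swap)
    also have "... = spl (%p r. sg ((deg C g - 1) * shdeg D r) * spl2 C D (K (ep g z p) (cod C g) (path_end D z p)) gs' r) hs"
      unfolding spl2_def spl_mult_left[symmetric]
      by (intro spl_cong) (auto simp: sg_def)
    finally show ?thesis by (simp add: Cons)
  qed (simp add: spl2_def)
  show ?thesis
    unfolding fst_letter_def by (simp only: spl2_add R S)
qed

text \<open>The transposed statement that the brace map is a morphism of coalgebras: cutting the
  resulting word amounts to cutting both input chains. A cut is either before the first letter or
  behind it, and the latter case is the induction hypothesis.\<close>

lemma brc_spl:
  fixes C :: "('k, 'c, 'f) dgcat" and D :: "('k, 'd, 'g) dgcat" and gs :: "'f list" and hs :: "'g list"
  shows
  "brc C D rg ep (%w. spl Q w) y z gs hs = spl2 C D (%a u b v.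
      brc C D rg ep (%p. brc C D rg ep (Q p) (path_end C y a) (path_end D z u) b v) y z a u) gs hs"
proof (induction gs hs arbitrary: Q y z rule: brc_induct)
  case (less gs hs)
  let ?B = "brc C D rg ep"
  \<comment> \<open>The initial part of the word is either empty, which forces both initial pieces
    to be empty, or begins with a letter.\<close>
  have rec: "spl2 C D (%a u b v. ?B (%p. ?B (Q p) (path_end C y a) (path_end D z u) b v) y z a u) gs hs
    = ?B (Q []) y z gs hs + spl2 C D (%a u b v. fst_letter C D rg ep
        (%l. ?B (%p. ?B (Q (l # p)) (path_end C y a) (path_end D z u) b v)) y z a u) gs hs"
  proof -
    have "spl2 C D (%a u b v. if a = [] \<and> u = [] then ?B (Q []) (path_end C y a) (path_end D z u) b v else 0) gs hs
      = spl (%a b. if a = [] then spl (%u v. if u = [] then ?B (Q []) y z b v else 0) hs else 0) gs"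
      unfolding spl2_def by (rule spl_cong) (auto intro!: spl_cong)
    then show ?thesis by (subst brc_fst_letter) (simp add: spl2_add spl_nil cong: if_cong)
  qed
  have "spl2 C D (%a u b v. fst_letter C D rg ep
        (%l. ?B (%p. ?B (Q (l # p)) (path_end C y a) (path_end D z u) b v)) y z a u) gs hs
    = spl2 C D (%a u b v. fst_letter C D rg ep (%l y z a u.
        ?B (%p. ?B (Q (l # p)) (path_end C y a) (path_end D z u) b v) y z a u) y z a u) gs hs"
  proof (rule spl2_cong, rule fst_letter_cong)
    fix a b gs' :: "'f list" and u v u' v' :: "'g list" and g :: 'f
    assume "a = g # gs'" "u = u' @ v'"
    then show "?B (%p. ?B (Q (ep g z u' # p)) (path_end C y a) (path_end D z u) b v) (cod C g) (path_end D z u') gs' v'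
      = ?B (%p. ?B (Q (ep g z u' # p)) (path_end C (cod C g) gs') (path_end D (path_end D z u') v') b v) (cod C g) (path_end D z u') gs' v'"
      by simp
  qed simp
  also have "... = fst_letter C D rg ep (%l y z gs hs. spl2 C D (%a u b v.
        ?B (%p. ?B (Q (l # p)) (path_end C y a) (path_end D z u) b v) y z a u) gs hs) y z gs hs"
    by (rule spl2_fst_letter)
  also have "... = fst_letter C D rg ep (%l. ?B (%w. spl (%u v. Q (l # u) v) w)) y z gs hs"
    by (rule fst_letter_cong) (auto intro!: less[symmetric])
  finally have tail: "spl2 C D (%a u b v. fst_letter C D rg ep
        (%l. ?B (%p. ?B (Q (l # p)) (path_end C y a) (path_end D z u) b v)) y z a u) gs hs
    = fst_letter C D rg ep (%l. ?B (%w. spl (%u v. Q (l # u) v) w)) y z gs hs" .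
  have "fst_letter C D rg ep (%l. ?B (%w. spl Q (l # w))) y z gs hs
      = fst_letter C D rg ep (%l. ?B (%w. Q [] (l # w))) y z gs hs
       + fst_letter C D rg ep (%l. ?B (%w. spl (%u v. Q (l # u) v) w)) y z gs hs"
    unfolding spl.simps brc_add fst_letter_add[symmetric] by (rule HOL.refl)
  then show ?case
    unfolding rec tail
    by (subst (1 2) brc_fst_letter) simp
qed

lemma sum_list_concat: "sum_list (concat xss) = (\<Sum>xs\<leftarrow>xss. sum_list xs)"
  by (induction xss) simp_all

text \<open>The specification chooses \<open>i\<close> and \<open>j\<close> at once for each
  \<open>g\<close>, while the recursion emits one letter at a time. They agree after collecting the
  run of bare letters in front of the first \<open>\<epsilon>\<close>.\<close>

lemma brace_args_brc:
  fixes C :: "('k::field, 'c, 'f) dgcat" and D :: "('k, 'd, 'g) dgcat" and \<psi> :: "_ => 'r::ring_1"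
  shows
  "(\<Sum>(n, args)\<leftarrow>brace_args C D y z gs hs. sg n * \<psi> args) = brc C D (rgt C D) (eps C D) \<psi> y z gs hs"
proof (induction gs arbitrary: \<psi> y z hs)
  case (Cons g gs)
  let ?B = "brc C D (rgt C D) (eps C D)"
  \<comment> \<open>\<open>a\<close> is the run of bare letters, \<open>b\<close> the segment inside
    the first \<open>\<epsilon>\<close>, and \<open>v\<close> what remains.\<close>
  let ?T = "%\<psi> z hs a b v. sg ((deg C g - 1) * shdeg D v)
    * ?B (%w. \<psi> (map (rgt C D y) a @ eps C D g (path_end D z a) b # w)) (cod C g) (path_end D z (a @ b)) gs v"
  have *: "?B \<psi> y z (g # gs) hs = spl (%a r. spl (%b v. ?T \<psi> z hs a b v) r) hs" for \<psi> z
  proof (induction hs arbitrary: \<psi> z)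
    case (Cons h hs)
    show ?case using Cons[of "%w. \<psi> (rgt C D y h # w)" "cod D h"] by simp
  qed simp
  \<comment> \<open>For fixed \<open>i\<close>, summing over \<open>j\<close> amounts to cutting
    \<open>drop i hs\<close> at position \<open>j - i\<close>.\<close>
  have ij: "(\<Sum>j\<leftarrow>[i..<Suc (length hs)]. F (drop i (take j hs)) (take j hs) (drop j hs))
      = spl (%b v. F b (take i hs @ b) v) (drop i hs)" if "i \<le> length hs" for i and F :: "'g list => 'g list => 'g list => 'r"
  proof -
    have "[i..<Suc (length hs)] = map (%m. m + i) [0..<Suc (length hs - i)]"
      using that by (simp add: map_add_upt Suc_diff_le del: upt_Suc)
    then show ?thesis
      using that by (simp add: spl_sum_list o_def drop_take take_add[symmetric] add.commute del: upt_Suc)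
  qed
  have "(\<Sum>(n, args)\<leftarrow>brace_args C D y z (g # gs) hs. sg n * \<psi> args)
    = (\<Sum>i\<leftarrow>[0..<Suc (length hs)]. \<Sum>j\<leftarrow>[i..<Suc (length hs)].
        sg ((deg C g - 1) * shdeg D (drop j hs)) *
        (\<Sum>(n, args)\<leftarrow>brace_args C D (cod C g) (path_end D z (take j hs)) gs (drop j hs).
          sg n * \<psi> (map (rgt C D y) (take i hs) @ eps C D g (path_end D z (take i hs)) (drop i (take j hs)) # args)))"
    by (simp add: sum_list_concat o_def split_def sum_list_const_mult[symmetric] sg_add mult.assoc map_concat del: upt_Suc)
  also have "... = (\<Sum>i\<leftarrow>[0..<Suc (length hs)]. spl (%b v. ?T \<psi> z hs (take i hs) b v) (drop i hs))"
  proof (intro arg_cong[of _ _ sum_list] map_cong HOL.refl)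
    fix i assume "i \<in> set [0..<Suc (length hs)]"
    then have "i \<le> length hs" by auto
    from ij[OF this, of "%b t v. sg ((deg C g - 1) * shdeg D v)
      * ?B (%w. \<psi> (map (rgt C D y) (take i hs) @ eps C D g (path_end D z (take i hs)) b # w)) (cod C g) (path_end D z t) gs v"]
    show "(\<Sum>j\<leftarrow>[i..<Suc (length hs)].
        sg ((deg C g - 1) * shdeg D (drop j hs)) *
        (\<Sum>(n, args)\<leftarrow>brace_args C D (cod C g) (path_end D z (take j hs)) gs (drop j hs).
          sg n * \<psi> (map (rgt C D y) (take i hs) @ eps C D g (path_end D z (take i hs)) (drop i (take j hs)) # args)))
      = spl (%b v. ?T \<psi> z hs (take i hs) b v) (drop i hs)"
      by (simp add: Cons del: upt_Suc)
  qed
  also have "... = spl (%a r. spl (%b v. ?T \<psi> z hs a b v) r) hs"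
    by (simp only: spl_sum_list)
  finally show ?case unfolding * .
qed simp

text \<open>A nonempty second piece loses its first letter to the end of the first piece. It
  identifies a bare letter behind \<open>\<epsilon>\<close> with the last argument split off by the
  differential of \<open>\<epsilon>\<close>.\<close>

lemma spl_shift: "spl (%u v. case v of [] => 0 | h # v' => F u h v') w
    = spl (%u v. if u = [] then 0 else F (butlast u) (last u) v) w"
proof (induction w arbitrary: F)
  case (Cons h w)
  have "spl (%u v. F (butlast (h # u)) (last (h # u)) v) w
      = F [] h w + spl (%u v. if u = [] then 0 else F (h # butlast u) (last u) v) w"
    by (cases w) (auto intro!: spl_cong)
  then show ?case using Cons[of "%u. F (h # u)"] by (simp cong: if_cong)
qed simp

lemma bb_spl_swap: "bb C (%x. spl (%u v. P x u v) w) gs = spl (%u v. bb C (%x. P x u v) gs) w"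
  by (induction w arbitrary: P) (simp_all add: bb_add)

lemma bb_nonempty: "(!!f w. \<phi> (f # w) = \<psi> (f # w)) ==> bb C \<phi> w = bb C \<psi> w"
  by (cases w) (auto split: list.split)

text \<open>The transposed differential of the tensor product of two bar constructions; it passes
  \<open>gs\<close> before reaching \<open>hs\<close>.\<close>

definition bbt :: "('k, 'c, 'f) dgcat => ('k, 'd, 'g) dgcat => ('f list => 'g list => 'r::ring_1)
    => 'f list => 'g list => 'r" where
  "bbt C D P gs hs = bb C (%gs. P gs hs) gs + sg (shdeg C gs) * bb D (P gs) hs"

section \<open>Compatibility of the brace operator with differentials\<close>

context dg_pair
begin

abbreviation "X \<equiv> tens C D"
abbreviation "FL \<equiv> fst_letter C D (rgt C D) (eps C D)"
abbreviation "Br \<equiv> brc C D (rgt C D) (eps C D)"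

text \<open>A continuation sees the first letter merely as an arrow. Additivity in that letter is
  what allows relations of the tensor product to be applied to it.\<close>

definition addv :: "'o \<times> 'p => 'o \<times> 'p => (('k, 'o, 'm, 'p, 'q) tw_term set => 'r::ring_1) => bool" where
  "addv x y k \<longleftrightarrow> (\<forall>n. \<forall>l\<in>Hom X x y n. \<forall>l'\<in>Hom X x y n. k (add X l l') = k l + k l')"

lemma addv_vl:
  assumes "addv x y k" "x \<in> Obj C \<times> Obj D" "y \<in> Obj C \<times> Obj D"
  obtains L where "additive L" "!!t. typed t x y n ==> L (vl t) = k (cls C D t)"
proof -
  obtain L where "additive L" "!!f. f \<in> Hom zten x y n ==> L (rho zten f) = k f"
    by (rule Z.ex_additive_rho[of x y n k]) (use assms in "auto simp: zten_simps tens_ops addv_def")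
  then show thesis
    using that[of L] Hom_tensI by (simp add: vl_def zten_simps)
qed

text \<open>The formula for the differential of \<open>\<epsilon>\<close> in operators, sent through
  the additive functional that extends \<open>k\<close>. \<open>addv_eps_cmp\<close> treats the
  relation for composites in the same way.\<close>

lemma addv_dif_eps:
  assumes f: "f \<in> Arr C" and p: "is_path D d gs" and k: "addv (dom C f, d) (cod C f, path_end D d gs) k"
  shows "k (dif X (eps C D f d gs)) = k (eps C D (dif C f) d gs) - sg (deg C f) * bb D (%w. k (eps C D f d w)) gs
    - (if gs = [] then 0 else sg (deg C f * deg D (last gs) + deg C f)
         * k (cmp X (rgt C D (cod C f) (last gs)) (eps C D f d (butlast gs))))
    + (if gs = [] then 0 else sg (deg C f + shdeg D (tl gs))
         * k (cmp X (eps C D f (cod D (hd gs)) (tl gs)) (rgt C D (dom C f) (hd gs))))"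
proof -
  let ?x = "(dom C f, d)" and ?y = "(cod C f, path_end D d gs)" and ?n = "deg C f + shdeg D gs + 1"
  have o: "?x \<in> Obj C \<times> Obj D" "?y \<in> Obj C \<times> Obj D"
    using f tgt.is_path_Obj[OF p] by (auto simp: src.Arr_simps)
  obtain L where L: "additive L" "!!t. typed t ?x ?y ?n ==> L (vl t) = k (cls C D t)"
    using addv_vl[OF k o, of ?n] by blast
  note w = tdl_parts[OF f p]
  have t: "typed (Eps f d gs) ?x ?y (deg C f + shdeg D gs)" using f p by (simp add: typed_def)
  have "bb D (%w. L (vl (Eps f d w))) gs = bb D (%w. k (eps C D f d w)) gs"
    by (rule tgt.bb_cong[OF p]) (use f L(2) in "auto simp: typed_def eps_def")
  moreover have "k (dif X (eps C D f d gs)) = L (dv (Eps f d gs))"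
    using L(2)[OF typed_tdif[OF t]] f p by (simp add: eps_def dif_cls dv_def)
  ultimately show ?thesis
    unfolding dv_Eps_sum[OF f p] using w(1,4,5) f p
    by (simp add: additive.add[OF L(1)] additive.diff[OF L(1)] additive_sg[OF L(1)] additive_bb[OF L(1)] additive.zero[OF L(1)]
        L(2) eps_def rgt_def tens_ops(4) typed_def del: vl_simps cong: if_cong)
qed

lemma addv_eps_cmp:
  assumes f: "f1 \<in> Arr C" "f2 \<in> Arr C" "dom C f2 = cod C f1" and p: "is_path D d gs"
    and k: "addv (dom C f1, d) (cod C f2, path_end D d gs) k"
  shows "k (eps C D (cmp C f2 f1) d gs) = spl (%u v. sg (shdeg D v * deg C f1)
      * k (cmp X (eps C D f2 (path_end D d u) v) (eps C D f1 d u))) gs"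
proof -
  let ?x = "(dom C f1, d)" and ?y = "(cod C f2, path_end D d gs)" and ?n = "deg C f2 + deg C f1 + shdeg D gs"
  have o: "?x \<in> Obj C \<times> Obj D" "?y \<in> Obj C \<times> Obj D"
    using f tgt.is_path_Obj[OF p] by (auto simp: src.Arr_simps)
  obtain L where L: "additive L" "!!t. typed t ?x ?y ?n ==> L (vl t) = k (cls C D t)"
    using addv_vl[OF k o, of ?n] by blast
  have "k (eps C D (cmp C f2 f1) d gs) = L (ve (cmp C f2 f1) d gs)"
    using f p L(2)[of "Eps (cmp C f2 f1) d gs"] by (simp add: typed_def eps_def ve_def src.Arr_simps)
  also have "... = spl (%u v. sg (shdeg D v * deg C f1) * L (ve f2 (path_end D d u) v * ve f1 d u)) gs"
    unfolding ve_cmp[OF f p] cup_def additive_spl[OF L(1)] additive_sg[OF L(1)] ..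
  also have "... = spl (%u v. sg (shdeg D v * deg C f1)
      * k (cmp X (eps C D f2 (path_end D d u) v) (eps C D f1 d u))) gs"
  proof (rule spl_cong)
    fix u v assume "u @ v = gs"
    then have t: "typed (Cmp (Eps f2 (path_end D d u) v) (Eps f1 d u)) ?x ?y ?n"
      using f p by (auto simp: typed_def tgt.is_path_append path_end_append)
    then show "sg (shdeg D v * deg C f1) * L (ve f2 (path_end D d u) v * ve f1 d u)
      = sg (shdeg D v * deg C f1) * k (cmp X (eps C D f2 (path_end D d u) v) (eps C D f1 d u))"
      using L(2)[OF t] tens_ops(4) by (simp add: typed_def ve_def eps_def)
  qed
  finally show ?thesis .
qed

text \<open>
  Compatibility of splitting off the first letter with the differentials: this is the formula for
  the differential of \<open>\<epsilon>(g; h\<^sub>1, ..., h\<^sub>n)\<close> together with the relations for composites.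
\<close>

lemma bbt_fst_letter:
  fixes K :: "('k, 'o, 'm, 'p, 'q) tw_term set => 'o => 'p => 'm list => 'q list => 'rr::ring_1"
  assumes gs: "is_path C y gs" and hs: "is_path D z hs"
    and K: "!!l y' z' g h. is_path C y' g ==> is_path D z' h ==> addv (y, z) (y', z') (%l. K l y' z' g h)"
  shows "bbt C D (FL K y z) gs hs =
     FL (%l y' z'. bbt C D (K l y' z')) y z gs hs
   + FL (%l y' z' g h. sg (shdeg C g + shdeg D h) * K (dif X l) y' z' g h) y z gs hs
   + FL (%l y' z' g h. sg (shdeg C g + shdeg D h) * FL (%l'. K (cmp X l' l)) y' z' g h) y z gs hs"
proof (cases gs)
  case Nil
  have y: "y \<in> Obj C" using gs Nil by simp
  show ?thesis
  proof (cases hs)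
    case hs': (Cons h hs')
    have h: "h \<in> Arr D" "dom D h = z" "is_path D (cod D h) hs'" using hs hs' by auto
    note d = rgt_ops(6)[OF y h(1)]
    have c: "rgt C D y (cmp D h2 h) = cmp X (rgt C D y h2) (rgt C D y h)" if "hs' = h2 # v" for h2 v
      using h that by (intro rgt_ops(5)[OF y]) (auto simp: Hom_def)
    show ?thesis
      using h c by (auto simp: Nil hs' bbt_def fst_letter_def d tgt.Arr_simps split: list.split)
  qed (simp add: Nil bbt_def fst_letter_def)
next
  case gs': (Cons g gs')
  have g: "g \<in> Arr C" "dom C g = y" "is_path C (cod C g) gs'" using gs gs' by auto
  have y: "y \<in> Obj C" using g by (auto simp: src.Arr_simps)
  let ?sg = "deg C g - 1" and ?s = "shdeg C gs'"
  let ?z = "path_end D z" and ?e = "eps C D g z" and ?r = "rgt C D y"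
  let ?cg = "cod C g"
  \<comment> \<open>Names by what happens to the first letter. \<open>?F\<close>: \<open>g\<close>
    is differentiated; \<open>?H\<close>: \<open>g\<close> is multiplied with its successor;
    \<open>?D\<close>: the letter \<open>\<epsilon>\<close> is differentiated; \<open>?B\<close>,
    \<open>?C\<close>: it is multiplied with a bare letter behind or before it; \<open>?I\<close>:
    two letters \<open>\<epsilon>\<close> are multiplied. \<open>?Y\<close>, \<open>?Z\<close>: the
    differential acts on the chains that remain. \<open>?R\<close> collects the words starting with
    a bare letter, \<open>?Rd\<close> and \<open>?Q\<close> the differential of that letter and its
    product with another one.\<close>
  let ?A = "%u v. K (?e u) ?cg (?z u) gs' v"
  let ?P = "%u v. sg (?sg * shdeg D v) * ?A u v"
  let ?R = "%gs hs. case hs of [] => 0 | h # hs' => K (?r h) y (cod D h) gs hs'"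
  let ?M = "%F. case gs' of [] => 0 | g2 # gs'' => F g2 gs''"
  let ?B = "%u v. if u = [] then 0 else sg (?sg * (deg D (last u) - 1 + shdeg D v) + ?s + (deg D (last u) - 1 + shdeg D v)) * K (cmp X (rgt C D ?cg (last u)) (?e (butlast u))) ?cg (?z u) gs' v"
  let ?C = "%u v. case u of [] => 0 | h # u' => sg (?sg + ?s + shdeg D u' + shdeg D v + ?sg * shdeg D v) * K (cmp X (eps C D g (cod D h) u') (?r h)) ?cg (?z u) gs' v"
  let ?D = "%u v. sg (?sg * shdeg D v) * (sg (?s + shdeg D v) * K (dif X (?e u)) ?cg (?z u) gs' v)"
  let ?F = "%u v. sg ?s * (sg (deg C g * shdeg D v) * K (eps C D (dif C g) z u) ?cg (?z u) gs' v)"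
  let ?H = "%u v. ?M (%g2 gs''. sg ?s * (sg ((?sg + deg C g2) * shdeg D v) * K (eps C D (cmp C g2 g) z u) (cod C g2) (?z u) gs'' v))"
  let ?I = "%u v. ?M (%g2 gs''. spl (%a b. sg (?sg * (shdeg D b + shdeg D v) + ?s + (shdeg D b + shdeg D v) + (deg C g2 - 1) * shdeg D v) * K (cmp X (eps C D g2 (?z a) b) (?e a)) (cod C g2) (?z u) gs'' v) u)"
  let ?T = "%a b v g2 x gs''. sg (?sg * (shdeg D b + shdeg D v) + ?s + (shdeg D b + shdeg D v) + (deg C g2 - 1) * shdeg D v) * K (cmp X (eps C D g2 (?z a) b) (?e a)) (cod C g2) x gs'' v"
  let ?Q = "%h hs'. case hs' of [] => 0 | h2 # v => K (cmp X (?r h2) (?r h)) y (cod D h2) gs v"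
  let ?Y = "%u v. sg (?sg * shdeg D v) * bb C (%x. K (?e u) ?cg (?z u) x v) gs'"
  let ?Z = "%u v. sg (?sg * shdeg D v) * (sg ?s * bb D (?A u) v)"
  let ?Rd = "%h hs'. sg (?sg + ?s + shdeg D hs') * K (dif X (?r h)) y (cod D h) gs hs'"
  let ?Rb = "case hs of [] => 0 | h # hs' => bbt C D (K (?r h) y (cod D h)) gs hs'"
  note path = tgt.is_path_append
  have pth: "is_path D z u" "is_path D (?z u) v" if "u @ v = hs" for u v
    using hs that by (auto simp: path)
  have ka: "addv (y, z) (?cg, ?z u) (%l. K l ?cg (?z u) gs' v)" if "u @ v = hs" for u v
    using K[OF g(3) pth(2)[OF that]] .
  \<comment> \<open>The formula for the differential of \<open>\<epsilon>(g; u)\<close>: terms with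
    \<open>g\<close> or the chain \<open>u\<close> differentiated on the left, the differentiated
    letter and the two boundary products on the right.\<close>
  have E: "sg ?s * (sg (deg C g * shdeg D v) * K (eps C D (dif C g) z u) ?cg (?z u) gs' v)
     + sg (?sg + ?s) * (sg (shdeg D v) * bb D (%u. sg (?sg * shdeg D v) * K (?e u) ?cg (?z u) gs' v) u)
    = ?D u v
     + (?B u v)
     + (?C u v)" if uv: "u @ v = hs" for u v
  proof -
    let ?k = "%l. K l ?cg (?z u) gs' v"
    have b: "bb D (%u. sg (?sg * shdeg D v) * K (?e u) ?cg (?z u) gs' v) u
        = sg (?sg * shdeg D v) * bb D (%w. ?k (?e w)) u"
      unfolding bb_mult_left[symmetric] by (rule tgt.bb_cong[OF pth(1)[OF uv]]) simp
    have kd: "?k (dif X (?e u)) = ?k (eps C D (dif C g) z u) - sg (deg C g) * bb D (%w. ?k (?e w)) u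
      - (if u = [] then 0 else sg (deg C g * deg D (last u) + deg C g)
         * ?k (cmp X (rgt C D ?cg (last u)) (?e (butlast u))))
      + (if u = [] then 0 else sg (deg C g + shdeg D (tl u))
         * ?k (cmp X (eps C D g (cod D (hd u)) (tl u)) (?r (hd u))))"
      using addv_dif_eps[OF g(1) pth(1)[OF uv], of ?k] ka[OF uv] g(2) by simp
    show ?thesis
    proof (cases "u = []")
      case True
      then show ?thesis unfolding b kd by (auto simp: sg_def algebra_simps)
    next
      case False
      then have cu: "(case u of [] => 0 | h # u' => F h u') = F (hd u) (tl u)" for F :: "'q => 'q list => 'rr"
        by (cases u) auto
      show ?thesis unfolding b kd cu using False
        by (auto simp: sg_def algebra_simps)
    qed
  qed
  \<comment> \<open>The relation for \<open>\<epsilon>\<close> of a composite, applied to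
    \<open>g\<close> and its successor.\<close>
  have G: "?M (%g2 gs''. sg ?s * (sg ((?sg + deg C g2) * shdeg D v)
        * K (eps C D (cmp C g2 g) z u) (cod C g2) (?z u) gs'' v))
    = ?I u v"
    if uv: "u @ v = hs" for u v
  proof (cases gs')
    case (Cons g2 gs'')
    have g2: "g2 \<in> Arr C" "dom C g2 = cod C g" "is_path C (cod C g2) gs''" using g(3) Cons by auto
    have k2: "addv (y, z) (cod C g2, ?z u) (%l. K l (cod C g2) (?z u) gs'' v)"
      using K[OF g2(3) pth(2)[OF uv]] .
    have "K (eps C D (cmp C g2 g) z u) (cod C g2) (?z u) gs'' v
      = spl (%a b. sg (shdeg D b * deg C g) * K (cmp X (eps C D g2 (?z a) b) (?e a)) (cod C g2) (?z u) gs'' v) u"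
      using addv_eps_cmp[OF g(1) g2(1,2) pth(1)[OF uv]] k2 g(2) by simp
    then show ?thesis by (simp add: Cons spl_mult_left[symmetric], intro spl_cong) (auto simp: sg_def)
  qed simp
  have L1: "bb C (%x. FL K y z x hs) gs
     = spl ?F hs
     + spl ?H hs
     + spl ?Y hs
     + bb C (%x. ?R x hs) gs"
  proof -
    have c: "deg C (cmp C g2 g) - 1 = ?sg + deg C g2" "cod C (cmp C g2 g) = cod C g2" if "gs' = g2 # gs''" for g2 gs''
      using g that by (auto simp: src.Arr_simps)
    have "bb C (%x. FL K y z x hs) gs = bb C (%x. (case x of [] => 0 | g # x' =>
        spl (%u v. sg ((deg C g - 1) * shdeg D v) * K (eps C D g z u) (cod C g) (?z u) x' v) hs)) gs
       + bb C (%x. ?R x hs) gs"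
      unfolding fst_letter_def bb_add by (rule HOL.refl)
    moreover have "spl ?H hs
      = ?M (%g2 gs''. sg ?s * spl (%u v. sg ((deg C (cmp C g2 g) - 1) * shdeg D v)
        * K (eps C D (cmp C g2 g) z u) (cod C (cmp C g2 g)) (?z u) gs'' v) hs)"
      using c by (auto simp: spl_mult_left algebra_simps split: list.split)
    ultimately show ?thesis unfolding gs' bb.simps using g
      by (simp add: bb_spl_swap bb_mult_left spl_mult_left src.Arr_simps split: list.split)
  qed
  have L2: "bb D (FL K y z gs) hs
     = spl (%u v. sg (shdeg D v) * bb D (%u. ?P u v) u) hs
     + spl (%u v. sg (?sg * (shdeg D v + 1)) * bb D (?A u) v) hs + bb D (?R gs) hs"
  proof -
    have "bb D (FL K y z gs) hs = bb D (%hs. spl ?P hs) hs + bb D (?R gs) hs"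
      unfolding fst_letter_def gs' bb_add by simp
    moreover have "spl (%u v. sg (shdeg D v) * bb D (%u. ?P u v) u + bb D (?P u) v) hs
      = spl (%u v. sg (shdeg D v) * bb D (%u. ?P u v) u + sg (?sg * (shdeg D v + 1)) * bb D (?A u) v) hs"
      by (rule spl_cong) (use tgt.bb_sg_mult[OF pth(2), of _ _ ?sg] in "simp add: mult.commute")
    ultimately show ?thesis by (simp add: bb_spl spl_add)
  qed
  \<comment> \<open>A bare first letter may be differentiated or multiplied with the next bare
    letter, and \<open>id \<otimes> -\<close> is functorial for both. The part of \<open>?R\<close>
    from \<open>bb C\<close> leaves that letter alone.\<close>
  have R: "bb C (%x. ?R x hs) gs + sg (?sg + ?s) * bb D (?R gs) hs
    = (case hs of [] => 0 | h # hs' => bbt C D (K (?r h) y (cod D h)) gs hs'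
       + ?Rd h hs'
       + sg (?sg + ?s + shdeg D hs') * (?Q h hs'))"
  proof (cases hs)
    case hs': (Cons h hs')
    have h: "h \<in> Arr D" "dom D h = z" "is_path D (cod D h) hs'" using hs hs' by auto
    note d = rgt_ops(6)[OF y h(1)]
    have c: "?r (cmp D h2 h) = cmp X (?r h2) (?r h)" if "hs' = h2 # v" for h2 v
      using h that by (intro rgt_ops(5)[OF y]) (auto simp: Hom_def)
    have "bb D (?R gs) hs = sg (shdeg D hs') * K (dif X (?r h)) y (cod D h) gs hs'
        + sg (shdeg D hs') * (?Q h hs')
        + bb D (K (?r h) y (cod D h) gs) hs'"
      using h c by (auto simp: hs' d tgt.Arr_simps split: list.split)
    moreover have "shdeg C gs = ?sg + ?s" by (simp add: gs')
    ultimately show ?thesis by (simp add: hs' bbt_def sg_add mult.assoc distrib_left)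
  qed simp
  \<comment> \<open>A product of the first two letters of a word is one of four kinds: both
    \<open>\<epsilon>\<close>, a bare letter after \<open>\<epsilon>\<close>,
    \<open>\<epsilon>\<close> after a bare letter, or both bare.\<close>
  have T3: "FL (%l y' z' x h. sg (shdeg C x + shdeg D h) * FL (%l'. K (cmp X l' l)) y' z' x h) y z gs hs
    = spl ?I hs
    + spl ?B hs
    + spl ?C hs
    + (case hs of [] => 0 | h # hs' => sg (?sg + ?s + shdeg D hs')
       * (?Q h hs'))" (is "_ = ?a + ?b + ?c + ?d")
  proof -
    have a: "spl (%u v. sg (?sg * shdeg D v) * (sg (?s + shdeg D v) * (?M (%g2 gs''.
        spl (%a b. sg ((deg C g2 - 1) * shdeg D b) * K (cmp X (eps C D g2 (?z u) a) (?e u)) (cod C g2) (path_end D (?z u) a) gs'' b) v)))) hs = ?a"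
    proof (cases gs')
      case (Cons g2 gs'')
      have "?a = spl (%u v. spl (%a b. ?T a b v g2 (?z (a @ b)) gs'') u) hs"
        by (simp add: Cons, intro spl_cong) auto
      also have "... = spl (%a r. spl (%b v. ?T a b v g2 (?z (a @ b)) gs'') r) hs" by (rule spl_coassoc)
      also have "... = spl (%u v. sg (?sg * shdeg D v) * (sg (?s + shdeg D v) *
        spl (%a b. sg ((deg C g2 - 1) * shdeg D b) * K (cmp X (eps C D g2 (?z u) a) (?e u)) (cod C g2) (path_end D (?z u) a) gs'' b) v)) hs"
        unfolding spl_mult_left[symmetric] by (intro spl_cong) (auto simp: sg_def)
      finally show ?thesis by (simp add: Cons)
    qed simp
    have b: "spl (%u v. sg (?sg * shdeg D v) * (sg (?s + shdeg D v) * (case v of [] => 0 | h # v' =>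
        K (cmp X (rgt C D ?cg h) (?e u)) ?cg (cod D h) gs' v'))) hs = ?b"
    proof -
      have "spl (%u v. sg (?sg * shdeg D v) * (sg (?s + shdeg D v) * (case v of [] => 0 | h # v' =>
          K (cmp X (rgt C D ?cg h) (?e u)) ?cg (cod D h) gs' v'))) hs
        = spl (%u v. case v of [] => 0 | h # v' => sg (?sg * (deg D h - 1 + shdeg D v') + ?s + (deg D h - 1 + shdeg D v')) *
          K (cmp X (rgt C D ?cg h) (?e u)) ?cg (cod D h) gs' v') hs"
        by (rule spl_cong) (auto simp: sg_def split: list.split)
      also have "... = spl (%u v. if u = [] then 0 else sg (?sg * (deg D (last u) - 1 + shdeg D v) + ?s + (deg D (last u) - 1 + shdeg D v)) *
          K (cmp X (rgt C D ?cg (last u)) (?e (butlast u))) ?cg (cod D (last u)) gs' v) hs"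
        by (rule spl_shift)
      also have "... = ?b"
      proof (rule spl_cong)
        fix u v assume "u @ v = hs"
        then have "u \<noteq> [] ==> ?z u = cod D (last u)" using tgt.path_butlast(4)[OF pth(1)] by blast
        then show "(if u = [] then 0 else sg (?sg * (deg D (last u) - 1 + shdeg D v) + ?s + (deg D (last u) - 1 + shdeg D v)) *
          K (cmp X (rgt C D ?cg (last u)) (?e (butlast u))) ?cg (cod D (last u)) gs' v)
         = (?B u v)" by simp
      qed
      finally show ?thesis .
    qed
    have c: "(case hs of [] => 0 | h # hs' => sg (?sg + ?s + shdeg D hs') * spl (%u v. sg (?sg * shdeg D v)
        * K (cmp X (eps C D g (cod D h) u) (?r h)) ?cg (path_end D (cod D h) u) gs' v) hs') = ?c"
    proof (cases hs)
      case (Cons h hs')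
      show ?thesis unfolding Cons spl_mult_left[symmetric] by (simp, intro spl_cong) (auto simp: sg_def)
    qed simp
    show ?thesis unfolding a[symmetric] b[symmetric] c[symmetric]
      by (auto simp: fst_letter_def gs' distrib_left spl_add split: list.split)
  qed
  have T1: "FL (%l y' z'. bbt C D (K l y' z')) y z gs hs
    = spl ?Y hs
     + spl ?Z hs
     + ?Rb"
    by (auto simp: fst_letter_def gs' bbt_def distrib_left spl_add split: list.split)
  have T2: "FL (%l y' z' x h. sg (shdeg C x + shdeg D h) * K (dif X l) y' z' x h) y z gs hs
    = spl ?D hs
     + (case hs of [] => 0 | h # hs' => ?Rd h hs')"
    by (simp add: fst_letter_def gs' split: list.split)
  have A2: "sg (?sg + ?s) * spl (%u v. sg (?sg * (shdeg D v + 1)) * bb D (?A u) v) hs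
    = spl ?Z hs"
    unfolding spl_mult_left[symmetric] by (intro spl_cong) (auto simp: sg_def)
  have EE: "spl ?F hs
     + sg (?sg + ?s) * spl (%u v. sg (shdeg D v) * bb D (%u. ?P u v) u) hs
    = spl ?D hs
     + spl ?B hs
     + spl ?C hs"
    unfolding spl_mult_left[symmetric] spl_add[symmetric] by (rule spl_cong) (rule E)
  have GG: "spl ?H hs
    = spl ?I hs"
    by (rule spl_cong) (rule G)
  have RR: "bb C (%x. ?R x hs) gs + sg (?sg + ?s) * bb D (?R gs) hs
    = ?Rb
       + (case hs of [] => 0 | h # hs' => ?Rd h hs')
       + (case hs of [] => 0 | h # hs' => sg (?sg + ?s + shdeg D hs')
          * (?Q h hs'))"
    unfolding R by (cases hs) simp_all
  \<comment> \<open>Pure regrouping: the three identities \<open>EE\<close>, \<open>GG\<close> and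
    \<open>RR\<close> account for all terms except those where the differential acts on what
    remains.\<close>
  have comb: "(e + g' + a + r) + (e' + b + r') = (a + b + q) + (f + q') + (h' + f' + f'' + q'')"
    if "e + e' = f + f' + f''" "g' = h'" "r + r' = q + q' + q''" for e e' f f' f'' g' h' r r' q q' q'' a b :: 'rr
  proof -
    have "(e + g' + a + r) + (e' + b + r') = (e + e') + g' + a + b + (r + r')" by (simp only: ac_simps)
    then show ?thesis unfolding that by (simp only: ac_simps)
  qed
  have "shdeg C gs = ?sg + ?s" by (simp add: gs')
  then have "bbt C D (FL K y z) gs hs = bb C (%x. FL K y z x hs) gs + sg (?sg + ?s) * bb D (FL K y z gs) hs"
    by (simp add: bbt_def)
  then show ?thesis
    unfolding L1 L2 T1 T2 T3 distrib_left[where 'a='rr] A2 by (simp only: comb[OF EE GG RR])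
qed

text \<open>The letters may be arrows of any category \<open>T\<close> whose objects are indexed by
  \<open>e\<close>. Two cases are needed: the generators in the tensor product, and the letters
  obtained from them by evaluation, with \<open>fobj\<close> as \<open>e\<close>.\<close>

lemma brc_cong_letters:
  assumes rg: "!!y h. y \<in> Obj C ==> h \<in> Arr D ==> rg y h \<in> Hom T (e y (dom D h)) (e y (cod D h)) (deg D h)"
    and ep: "!!g z u. g \<in> Arr C ==> is_path D z u ==>
      ep g z u \<in> Hom T (e (dom C g) z) (e (cod C g) (path_end D z u)) (deg C g + shdeg D u)"
    and e: "!!y z. y \<in> Obj C ==> z \<in> Obj D ==> e y z \<in> Obj T"
    and "is_path C y gs" "is_path D z hs"
    and "!!w. is_path T (e y z) w ==> path_end T (e y z) w = e (path_end C y gs) (path_end D z hs)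
      ==> shdeg T w = shdeg C gs + shdeg D hs ==> \<phi> w = \<psi> w"
    and rg': "!!y h. y \<in> Obj C ==> h \<in> Arr D ==> rg' y h = rg y h"
    and ep': "!!g z u. g \<in> Arr C ==> is_path D z u ==> ep' g z u = ep g z u"
  shows "brc C D rg ep \<phi> y z gs hs = brc C D rg' ep' \<psi> y z gs hs"
  using assms(4-6)
proof (induction gs hs arbitrary: \<phi> \<psi> y z rule: brc_induct)
  case (less gs hs)
  have y: "y \<in> Obj C" and z: "z \<in> Obj D" using less.prems src.is_path_Obj tgt.is_path_Obj by blast+
  have "fst_letter C D rg ep (%l. brc C D rg ep (%w. \<phi> (l # w))) y z gs hs
    = fst_letter C D rg' ep' (%l. brc C D rg' ep' (%w. \<psi> (l # w))) y z gs hs"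
  proof (rule fst_letter_cong)
    fix g gs' u v assume gs: "gs = g # gs'" and hs: "hs = u @ v"
    then have g: "g \<in> Arr C" "dom C g = y" "is_path C (cod C g) gs'" and u: "is_path D z u" "is_path D (path_end D z u) v"
      using less.prems by (auto simp: tgt.is_path_append)
    show "brc C D rg ep (%w. \<phi> (ep g z u # w)) (cod C g) (path_end D z u) gs' v
        = brc C D rg' ep' (%w. \<psi> (ep' g z u # w)) (cod C g) (path_end D z u) gs' v"
      using g u ep[OF g(1) u(1)] unfolding ep'[OF g(1) u(1)] by (intro less.IH g u less.prems(3)) (auto simp: gs hs Hom_def)
  next
    fix h hs' assume hs: "hs = h # hs'"
    then have h: "h \<in> Arr D" "dom D h = z" "is_path D (cod D h) hs'" using less.prems by auto
    show "brc C D rg ep (%w. \<phi> (rg y h # w)) y (cod D h) gs hs' = brc C D rg' ep' (%w. \<psi> (rg' y h # w)) y (cod D h) gs hs'"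
      using h y rg[OF y h(1)] unfolding rg'[OF y h(1)] by (intro less.IH h less.prems) (auto simp: hs Hom_def)
  qed
  moreover have "\<phi> [] = \<psi> []" if "gs = [] \<and> hs = []"
    using that e[OF y z] by (intro less.prems(3)) auto
  ultimately show ?case
    by (subst (1 2) brc_fst_letter) simp
qed

lemma brc_cong:
  assumes "is_path C y gs" "is_path D z hs"
    and "!!w. is_path X (y, z) w ==> path_end X (y, z) w = (path_end C y gs, path_end D z hs)
      ==> shdeg X w = shdeg C gs + shdeg D hs ==> \<phi> w = \<psi> w"
  shows "Br \<phi> y z gs hs = Br \<psi> y z gs hs"
  by (rule brc_cong_letters[where e = Pair and T = X])
    (use assms in "auto simp: Hom_def rgt_Arr eps_Arr tens_ops")

text \<open>The transposed statement that the brace map commutes with differentials. Unfolding the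
  bar differential at the first letter reduces it to \<open>bbt_fst_letter\<close>.\<close>

lemma brc_bb:
  assumes gs: "is_path C y gs" and hs: "is_path D z hs"
    and m: "dg_category.mlin X \<kappa> (y, z) \<psi>" and \<kappa>: "\<kappa> 1 = 1"
  shows "Br (bb X \<psi>) y z gs hs = bbt C D (Br \<psi> y z) gs hs"
  using gs hs m
proof (induction gs hs arbitrary: \<psi> y z rule: brc_induct)
  case (less gs hs)
  interpret X: dg_category X by (rule dg_category_tens)
  let ?K = "%l. Br (%w. \<psi> (l # w))"
  have y: "y \<in> Obj C" and z: "z \<in> Obj D" using less.prems src.is_path_Obj tgt.is_path_Obj by blast+
  \<comment> \<open>The differential changes the letter \<open>l\<close>, multiplies it with the
    next letter, or acts entirely behind it, where the induction hypothesis applies.\<close>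
  have step: "Br (%w. bb X \<psi> (l # w)) y' z' g h = bbt C D (?K l y' z') g h
      + sg (shdeg C g + shdeg D h) * ?K (dif X l) y' z' g h
      + sg (shdeg C g + shdeg D h) * FL (%l'. ?K (cmp X l' l)) y' z' g h"
    if l: "l \<in> Arr X" "dom X l = (y, z)" "cod X l = (y', z')" and g: "is_path C y' g" and h: "is_path D z' h"
      and len: "length g + length h < length gs + length hs" for l y' z' g h
  proof -
    have IH: "Br (bb X (%w. \<psi> (l # w))) y' z' g h = bbt C D (?K l y' z') g h"
      using less.prems(3) l X.mlin_tail[of \<kappa> l \<psi>] by (intro less.IH len g h) simp
    have 1: "Br (%w. sg (shdeg X w) * \<psi> (dif X l # w)) y' z' g h = sg (shdeg C g + shdeg D h) * ?K (dif X l) y' z' g h"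
      unfolding brc_mult_left[symmetric] by (rule brc_cong[OF g h]) simp
    have 2: "Br (%w. case w of [] => 0 | l' # w' => sg (shdeg X w) * \<psi> (cmp X l' l # w')) y' z' g h
        = sg (shdeg C g + shdeg D h) * FL (%l'. ?K (cmp X l' l)) y' z' g h"
    proof -
      have "Br (%w. case w of [] => 0 | l' # w' => sg (shdeg X w) * \<psi> (cmp X l' l # w')) y' z' g h
        = Br (%w. sg (shdeg C g + shdeg D h) * (case w of [] => 0 | l' # w' => \<psi> (cmp X l' l # w'))) y' z' g h"
        by (rule brc_cong[OF g h]) (auto split: list.split)
      moreover have "Br (%w. case w of [] => 0 | l' # w' => \<psi> (cmp X l' l # w')) y' z' g h
        = FL (%l'. ?K (cmp X l' l)) y' z' g h"
        by (subst brc_fst_letter) simp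
      ultimately show ?thesis unfolding brc_mult_left by simp
    qed
    show ?thesis unfolding bb.simps(2) brc_add IH 1 2 by (simp add: ac_simps)
  qed
  have "Br (bb X \<psi>) y z gs hs = FL (%l. Br (%w. bb X \<psi> (l # w))) y z gs hs"
    by (subst brc_fst_letter) simp
  also have "... = FL (%l y' z' g h. bbt C D (?K l y' z') g h
      + sg (shdeg C g + shdeg D h) * ?K (dif X l) y' z' g h
      + sg (shdeg C g + shdeg D h) * FL (%l'. ?K (cmp X l' l)) y' z' g h) y z gs hs"
  proof (rule fst_letter_cong)
    fix g gs' u v assume gs: "gs = g # gs'" and hs: "hs = u @ v"
    then have g: "g \<in> Arr C" "dom C g = y" "is_path C (cod C g) gs'" and u: "is_path D z u" "is_path D (path_end D z u) v"
      using less.prems by (auto simp: tgt.is_path_append)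
    show "Br (%w. bb X \<psi> (eps C D g z u # w)) (cod C g) (path_end D z u) gs' v
      = bbt C D (?K (eps C D g z u) (cod C g) (path_end D z u)) gs' v
      + sg (shdeg C gs' + shdeg D v) * ?K (dif X (eps C D g z u)) (cod C g) (path_end D z u) gs' v
      + sg (shdeg C gs' + shdeg D v) * FL (%l'. ?K (cmp X l' (eps C D g z u))) (cod C g) (path_end D z u) gs' v"
      using g u by (intro step) (auto simp: gs hs eps_Arr)
  next
    fix h hs' assume hs: "hs = h # hs'"
    then have h: "h \<in> Arr D" "dom D h = z" "is_path D (cod D h) hs'" using less.prems by auto
    show "Br (%w. bb X \<psi> (rgt C D y h # w)) y (cod D h) gs hs'
      = bbt C D (?K (rgt C D y h) y (cod D h)) gs hs'
      + sg (shdeg C gs + shdeg D hs') * ?K (dif X (rgt C D y h)) y (cod D h) gs hs'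
      + sg (shdeg C gs + shdeg D hs') * FL (%l'. ?K (cmp X l' (rgt C D y h))) y (cod D h) gs hs'"
      using h y less.prems by (intro step) (auto simp: hs rgt_Arr)
  qed
  also have "... = bbt C D (FL ?K y z) gs hs"
  proof -
    have "addv (y, z) (y', z') (%l. ?K l y' z' g h)" if g: "is_path C y' g" and h: "is_path D z' h" for y' z' g h
      unfolding addv_def
    proof (intro allI ballI)
      fix n l l' assume l: "l \<in> Hom X (y, z) (y', z') n" "l' \<in> Hom X (y, z) (y', z') n"
      have "Br (%w. \<psi> (add X l l' # w)) y' z' g h = Br (%w. \<psi> (l # w) + \<psi> (l' # w)) y' z' g h"
        using X.mlin_add[OF less.prems(3) \<kappa> _ l, of "[]"] l
        by (intro brc_cong[OF g h]) (auto simp: Hom_def)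
      then show "?K (add X l l') y' z' g h = ?K l y' z' g h + ?K l' y' z' g h" by (simp add: brc_add)
    qed
    from bbt_fst_letter[OF less.prems(1,2), of ?K, OF this] show ?thesis
      by (simp add: fst_letter_add)
  qed
  also have "... = bbt C D (Br \<psi> y z) gs hs"
  proof -
    have "bb C (%gs. FL ?K y z gs hs) gs = bb C (%gs. Br \<psi> y z gs hs) gs"
      by (rule bb_nonempty) (subst brc_fst_letter, simp)
    moreover have "bb D (FL ?K y z gs) hs = bb D (Br \<psi> y z gs) hs"
      by (rule bb_nonempty) (subst brc_fst_letter, simp)
    ultimately show ?thesis by (simp add: bbt_def)
  qed
  finally show ?case .
qed

end

section \<open>Currying coherent natural transformations\<close>

context dg_pair
begin

lemma eps_lin:
  "f \<in> Hom C c c' p ==> f' \<in> Hom C c c' p ==> is_path D d gs ==>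
    eps C D (add C (scl C a f) f') d gs = add X (scl X a (eps C D f d gs)) (eps C D f' d gs)"
  "f \<in> Arr C ==> is_path D d (us @ g # vs) ==> g \<in> Hom D z z' q ==> g' \<in> Hom D z z' q ==>
    eps C D f d (us @ add D (scl D a g) g' # vs) = add X (scl X a (eps C D f d (us @ g # vs))) (eps C D f d (us @ g' # vs))"
proof -
  show "eps C D (add C (scl C a f) f') d gs = add X (scl X a (eps C D f d gs)) (eps C D f' d gs)"
    if f: "f \<in> Hom C c c' p" "f' \<in> Hom C c c' p" and p: "is_path D d gs"
    using cls_eqI[OF tw_rel.R2_add_left[OF src.scl_Hom[OF f(1)] f(2) p], of a]
      cls_eqI[OF tw_rel.R2_scl_left[OF src.Hom_Arr[OF f(1)] p], of a] src.scl_Hom[OF f(1), of a] f p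
    by (simp add: eps_def tens_ops(5,6)[symmetric] Hom_def)
  show "eps C D f d (us @ add D (scl D a g) g' # vs) = add X (scl X a (eps C D f d (us @ g # vs))) (eps C D f d (us @ g' # vs))"
    if f: "f \<in> Arr C" and p: "is_path D d (us @ g # vs)" and g: "g \<in> Hom D z z' q" "g' \<in> Hom D z z' q"
  proof -
    note s = tgt.scl_Hom[OF g(1), of a]
    note p1 = tgt.is_path_Hom[OF p g(1) s] and p2 = tgt.is_path_Hom[OF p g]
    show ?thesis
      using cls_eqI[OF tw_rel.R2_add_right[OF f s g(2) p1]] cls_eqI[OF tw_rel.R2_scl_right[OF f p], of a] f p p1 p2 s g
      by (simp add: eps_def tens_ops(5,6)[symmetric] Hom_def)
  qed
qed

lemma eps_idn:
  "c \<in> Obj C ==> d \<in> Obj D ==> eps C D (idn C c) d [] = idn X (c, d)"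
  "c \<in> Obj C ==> d \<in> Obj D ==> rgt C D c (idn D d) = idn X (c, d)"
  "c \<in> Obj C ==> is_path D d gs ==> gs \<noteq> [] ==> eps C D (idn C c) d gs = zer X (c, d) (c, path_end D d gs) (shdeg D gs)"
  "f \<in> Arr C ==> is_path D d gs ==> y \<in> Obj D ==> idn D y \<in> set gs ==>
    eps C D f d gs = zer X (dom C f, d) (cod C f, path_end D d gs) (deg C f + shdeg D gs)"
  using cls_eqI[OF tw_rel.Left_idn[of c C d D]] cls_eqI[OF tw_rel.Right_idn[of c C d D]]
    cls_eqI[OF tw_rel.R3_left[of c C D d gs]] cls_eqI[OF tw_rel.R3_right[of f C y D d gs]]
  by (simp_all add: eps_def rgt_def tens_ops(2,3))

text \<open>The varied letter is the outer argument of the first letter \<open>\<epsilon>\<close>,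
  where \<open>\<epsilon>\<close> is linear, or it belongs to what remains, where induction
  applies.\<close>

lemma brc_mlin_left:
  assumes m: "dg_category.mlin X \<kappa> (y, z) \<psi>" and hs: "is_path D z hs"
  shows "src.mlin \<kappa> y (%gs. Br \<psi> y z gs hs)"
  unfolding src.mlin_def
proof (intro allI impI)
  fix us f f' vs c c' n a
  assume gs: "is_path C y (us @ f # vs)" and f: "f \<in> Hom C c c' n" "f' \<in> Hom C c c' n"
  interpret X: dg_category X by (rule dg_category_tens)
  let ?f = "add C (scl C a f) f'"
  note lf = src.lin_Hom[OF f, of a]
  have sgk: "sg i * (\<kappa> a * b) = \<kappa> a * (sg i * b)" for i b by (simp add: sg_def)
  show "Br \<psi> y z (us @ ?f # vs) hs = \<kappa> a * Br \<psi> y z (us @ f # vs) hs + Br \<psi> y z (us @ f' # vs) hs"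
    using m hs gs
  proof (induction us hs arbitrary: \<psi> y z rule: brc_induct)
    case (less us hs)
    have y: "y \<in> Obj C" and z: "z \<in> Obj D" using less.prems src.is_path_Obj tgt.is_path_Obj by blast+
    let ?R = "%x. case hs of [] => 0 | h # hs' => Br (%w. \<psi> (rgt C D y h # w)) y (cod D h) x hs'"
    have R: "?R (us @ ?f # vs) = \<kappa> a * ?R (us @ f # vs) + ?R (us @ f' # vs)"
    proof (cases hs)
      case (Cons h hs')
      have h: "h \<in> Arr D" "dom D h = z" "is_path D (cod D h) hs'" using less.prems Cons by auto
      show ?thesis
        using h y X.mlin_tail[of \<kappa> "rgt C D y h" \<psi>] less.prems by (simp add: Cons, intro less.IH) (auto simp: Cons rgt_Arr)
    qed simp
    show ?case
    proof (cases us)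
      case Nil
      let ?A = "%f. spl (%u v. sg ((deg C f - 1) * shdeg D v)
        * Br (%w. \<psi> (eps C D f z u # w)) (cod C f) (path_end D z u) vs v) hs"
      have fd: "f \<in> Arr C" "dom C f = y" "is_path C (cod C f) vs" "c = y" using less.prems(3) Nil f by (auto simp: Hom_def)
      have "?A ?f = \<kappa> a * ?A f + ?A f'" unfolding spl_mult_left[symmetric] spl_add[symmetric]
      proof (rule spl_cong)
        fix u v assume "u @ v = hs"
        then have u: "is_path D z u" "is_path D (path_end D z u) v" using less.prems(2) by (auto simp: tgt.is_path_append)
        have h: "eps C D f z u \<in> Hom X (y, z) (c', path_end D z u) (n + shdeg D u)"
          "eps C D f' z u \<in> Hom X (y, z) (c', path_end D z u) (n + shdeg D u)"
          using f u(1) fd(4) eps_Arr[of f z u] eps_Arr[of f' z u] by (auto simp: Hom_def)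
        have d: "cod C ?f = c'" "cod C f = c'" "cod C f' = c'" "deg C ?f = n" "deg C f = n" "deg C f' = n"
          using f lf by (auto simp: Hom_def)
        have "Br (%w. \<psi> (eps C D ?f z u # w)) c' (path_end D z u) vs v
          = Br (%w. \<kappa> a * \<psi> (eps C D f z u # w) + \<psi> (eps C D f' z u # w)) c' (path_end D z u) vs v"
          unfolding eps_lin(1)[OF f u(1)]
          using X.mlinD[OF less.prems(1) _ h, of "[]"] h fd d u by (intro brc_cong) (auto simp: Hom_def)
        then show "sg ((deg C ?f - 1) * shdeg D v) * Br (%w. \<psi> (eps C D ?f z u # w)) (cod C ?f) (path_end D z u) vs v
          = \<kappa> a * (sg ((deg C f - 1) * shdeg D v) * Br (%w. \<psi> (eps C D f z u # w)) (cod C f) (path_end D z u) vs v)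
          + sg ((deg C f' - 1) * shdeg D v) * Br (%w. \<psi> (eps C D f' z u # w)) (cod C f') (path_end D z u) vs v"
          by (simp add: d brc_add brc_mult_left distrib_left sgk)
      qed
      then show ?thesis unfolding Nil append_Nil using R[unfolded Nil append_Nil]
        by (subst (1 2 3) brc_fst_letter) (simp add: fst_letter_def Nil distrib_left ac_simps)
    next
      case (Cons g us')
      then have g: "g \<in> Arr C" "dom C g = y" "is_path C (cod C g) (us' @ f # vs)" using less.prems(3) by auto
      let ?A = "%f. spl (%u v. sg ((deg C g - 1) * shdeg D v)
        * Br (%w. \<psi> (eps C D g z u # w)) (cod C g) (path_end D z u) (us' @ f # vs) v) hs"
      have "?A ?f = \<kappa> a * ?A f + ?A f'" unfolding spl_mult_left[symmetric] spl_add[symmetric]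
      proof (rule spl_cong)
        fix u v assume uv: "u @ v = hs"
        then have u: "is_path D z u" "is_path D (path_end D z u) v" using less.prems(2) by (auto simp: tgt.is_path_append)
        have len: "length us' + length v < length us + length hs" using Cons uv by auto
        have "X.mlin \<kappa> (cod C g, path_end D z u) (%w. \<psi> (eps C D g z u # w))"
          using X.mlin_tail[of \<kappa> "eps C D g z u" \<psi>] less.prems(1) g u by (simp add: eps_Arr)
        note less.IH[OF len this u(2) g(3)]
        then show "sg ((deg C g - 1) * shdeg D v) * Br (%w. \<psi> (eps C D g z u # w)) (cod C g) (path_end D z u) (us' @ ?f # vs) v
          = \<kappa> a * (sg ((deg C g - 1) * shdeg D v) * Br (%w. \<psi> (eps C D g z u # w)) (cod C g) (path_end D z u) (us' @ f # vs) v)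
          + sg ((deg C g - 1) * shdeg D v) * Br (%w. \<psi> (eps C D g z u # w)) (cod C g) (path_end D z u) (us' @ f' # vs) v"
          by (simp add: distrib_left sgk)
      qed
      then show ?thesis
        using R[unfolded Cons append_Cons] unfolding Cons append_Cons by (subst (1 2 3) brc_fst_letter) (simp add: fst_letter_def Cons distrib_left ac_simps)
    qed
  qed
qed

text \<open>The varied letter is the first bare letter, an inner argument of the first
  \<open>\<epsilon>\<close>, or part of what remains; \<open>spl_insert\<close> separates the last
  two cases.\<close>

lemma brc_mlin_right:
  assumes m: "dg_category.mlin X \<kappa> (y, z) \<psi>" and gs: "is_path C y gs"
  shows "tgt.mlin \<kappa> z (%hs. Br \<psi> y z gs hs)"
  unfolding tgt.mlin_def
proof (intro allI impI)
  fix us f f' vs c c' n a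
  assume hs: "is_path D z (us @ f # vs)" and f: "f \<in> Hom D c c' n" "f' \<in> Hom D c c' n"
  interpret X: dg_category X by (rule dg_category_tens)
  let ?f = "add D (scl D a f) f'"
  note lf = tgt.lin_Hom[OF f, of a]
  have sgk: "sg i * (\<kappa> a * b) = \<kappa> a * (sg i * b)" for i b by (simp add: sg_def)
  show "Br \<psi> y z gs (us @ ?f # vs) = \<kappa> a * Br \<psi> y z gs (us @ f # vs) + Br \<psi> y z gs (us @ f' # vs)"
    using m gs hs
  proof (induction gs us arbitrary: \<psi> y z rule: brc_induct)
    case (less gs us)
    have y: "y \<in> Obj C" and z: "z \<in> Obj D" using less.prems src.is_path_Obj tgt.is_path_Obj by blast+
    let ?A = "%hs. case gs of [] => 0 | g # gs' => spl (%u v. sg ((deg C g - 1) * shdeg D v)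
        * Br (%w. \<psi> (eps C D g z u # w)) (cod C g) (path_end D z u) gs' v) hs"
    have A: "?A (us @ ?f # vs) = \<kappa> a * ?A (us @ f # vs) + ?A (us @ f' # vs)"
    proof (cases gs)
      case (Cons g gs')
      have g: "g \<in> Arr C" "dom C g = y" "is_path C (cod C g) gs'" using less.prems Cons by auto
      let ?P = "%u v. sg ((deg C g - 1) * shdeg D v) * Br (%w. \<psi> (eps C D g z u # w)) (cod C g) (path_end D z u) gs' v"
      have "spl (%u v. ?P u (v @ ?f # vs)) us = \<kappa> a * spl (%u v. ?P u (v @ f # vs)) us + spl (%u v. ?P u (v @ f' # vs)) us"
        unfolding spl_mult_left[symmetric] spl_add[symmetric]
      proof (rule spl_cong)
        fix u v assume uv: "u @ v = us"
        then have u: "is_path D z u" "is_path D (path_end D z u) (v @ f # vs)"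
          using less.prems(3) by (auto simp: tgt.is_path_append)
        have len: "length gs' + length v < length gs + length us" using Cons uv by auto
        have "X.mlin \<kappa> (cod C g, path_end D z u) (%w. \<psi> (eps C D g z u # w))"
          using X.mlin_tail[of \<kappa> "eps C D g z u" \<psi>] less.prems(1) g u by (simp add: eps_Arr)
        note less.IH[OF len this g(3) u(2)]
        then show "?P u (v @ ?f # vs) = \<kappa> a * ?P u (v @ f # vs) + ?P u (v @ f' # vs)"
          using tgt.shdeg_Hom[OF lf f(1), of v vs] tgt.shdeg_Hom[OF f, of v vs] by (simp add: distrib_left sgk)
      qed
      moreover have "spl (%u v. ?P (us @ ?f # u) v) vs
        = \<kappa> a * spl (%u v. ?P (us @ f # u) v) vs + spl (%u v. ?P (us @ f' # u) v) vs"
        unfolding spl_mult_left[symmetric] spl_add[symmetric]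
      proof (rule spl_cong)
        fix u v assume "u @ v = vs"
        then have u: "is_path D z (us @ f # u)" "is_path D (path_end D z (us @ f # u)) v"
          using less.prems(3) by (auto simp: tgt.is_path_append)
        have e: "path_end D z (us @ ?f # u) = path_end D z (us @ f # u)" "path_end D z (us @ f' # u) = path_end D z (us @ f # u)"
          using lf f by (auto simp: Hom_def)
        have h: "eps C D g z (us @ f # u) \<in> Hom X (y, z) (cod C g, path_end D z (us @ f # u)) (deg C g + shdeg D (us @ f # u))"
          "eps C D g z (us @ f' # u) \<in> Hom X (y, z) (cod C g, path_end D z (us @ f # u)) (deg C g + shdeg D (us @ f # u))"
          using g eps_Arr[OF g(1) u(1)] eps_Arr[OF g(1) tgt.is_path_Hom[OF u(1) f]] e tgt.shdeg_Hom[OF f, of us u] by (auto simp: Hom_def)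
        have "Br (%w. \<psi> (eps C D g z (us @ ?f # u) # w)) (cod C g) (path_end D z (us @ f # u)) gs' v
          = Br (%w. \<kappa> a * \<psi> (eps C D g z (us @ f # u) # w) + \<psi> (eps C D g z (us @ f' # u) # w)) (cod C g) (path_end D z (us @ f # u)) gs' v"
          unfolding eps_lin(2)[OF g(1) u(1) f]
          using X.mlinD[OF less.prems(1) _ h, of "[]"] h u by (intro brc_cong g) (auto simp: Hom_def)
        then show "?P (us @ ?f # u) v = \<kappa> a * ?P (us @ f # u) v + ?P (us @ f' # u) v"
          unfolding e by (simp add: brc_add brc_mult_left distrib_left sgk)
      qed
      ultimately show ?thesis unfolding Cons list.case spl_insert by (simp only: distrib_left ac_simps)
    qed simp
    show ?case
    proof (cases us)
      case Nil
      have fd: "f \<in> Arr D" "dom D f = z" "is_path D (cod D f) vs" "c = z" using less.prems(3) Nil f by (auto simp: Hom_def)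
      have h: "rgt C D y f \<in> Hom X (y, z) (y, c') n" "rgt C D y f' \<in> Hom X (y, z) (y, c') n"
        using f fd(4) rgt_Arr[OF y] by (auto simp: Hom_def)
      have d: "cod D ?f = c'" "cod D f = c'" "cod D f' = c'" using f lf by (auto simp: Hom_def)
      have "Br (%w. \<psi> (rgt C D y ?f # w)) y c' gs vs
        = Br (%w. \<kappa> a * \<psi> (rgt C D y f # w) + \<psi> (rgt C D y f' # w)) y c' gs vs"
        unfolding rgt_ops(2)[OF y tgt.scl_Hom[OF f(1)] f(2)] rgt_ops(3)[OF y tgt.Hom_Arr[OF f(1)]]
        using X.mlinD[OF less.prems(1) _ h, of "[]"] h fd d less.prems(2) by (intro brc_cong) (auto simp: Hom_def)
      then show ?thesis using A unfolding Nil append_Nil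
        by (subst (1 2 3) brc_fst_letter) (simp add: fst_letter_def d brc_add brc_mult_left distrib_left ac_simps split del: list.split)
    next
      case (Cons h us')
      then have h: "h \<in> Arr D" "dom D h = z" "is_path D (cod D h) (us' @ f # vs)" using less.prems(3) by auto
      have len: "length gs + length us' < length gs + length us" using Cons by simp
      have "X.mlin \<kappa> (y, cod D h) (%w. \<psi> (rgt C D y h # w))"
        using X.mlin_tail[of \<kappa> "rgt C D y h" \<psi>] less.prems(1) h y by (simp add: rgt_Arr)
      note less.IH[OF len this less.prems(2) h(3)]
      then show ?thesis using A unfolding Cons append_Cons
        by (subst (1 2 3) brc_fst_letter) (simp add: fst_letter_def distrib_left ac_simps)
    qed
  qed
qed

text \<open>An identity used in the first letter makes this letter an identity or zero, and
  \<open>\<psi>\<close> vanishes in either case; otherwise the identity is still among the remaining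
  letters.\<close>

lemma brc_nrm:
  assumes m: "dg_category.mlin X \<kappa> (y, z) \<psi>" "\<kappa> 1 = 1" and n: "dg_category.nrm X (y, z) \<psi>"
    and gs: "is_path C y gs" and hs: "is_path D z hs"
    and i: "(\<exists>c\<in>Obj C. idn C c \<in> set gs) \<or> (\<exists>d\<in>Obj D. idn D d \<in> set hs)"
  shows "Br \<psi> y z gs hs = 0"
  using m(1) n gs hs i
proof (induction gs hs arbitrary: \<psi> y z rule: brc_induct)
  case (less gs hs)
  interpret X: dg_category X by (rule dg_category_tens)
  have y: "y \<in> Obj C" and z: "z \<in> Obj D" using less.prems src.is_path_Obj tgt.is_path_Obj by blast+
  have zero: "Br (%w. \<psi> (l # w)) y' z' gs' hs' = 0"
    if l: "l \<in> Arr X" "dom X l = (y, z)" "cod X l = (y', z')" "(\<exists>x\<in>Obj X. l = idn X x) \<or> (\<exists>n. l = zer X (y, z) (y', z') n)"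
      and p: "is_path C y' gs'" "is_path D z' hs'" for l y' z' gs' hs'
  proof -
    have "Br (%w. \<psi> (l # w)) y' z' gs' hs' = Br (%w. 0 * \<psi> (l # w)) y' z' gs' hs'"
    proof (rule brc_cong[OF p])
      fix w assume "is_path X (y', z') w"
      then have "is_path X (y, z) (l # w)" using l by simp
      then show "\<psi> (l # w) = 0 * \<psi> (l # w)"
        using l X.nrmD[OF less.prems(2), of "l # w"] X.mlin_zer[OF less.prems(1) m(2), of "[]"]
          X.dom_Obj[OF l(1)] X.cod_Obj[OF l(1)] by auto
    qed
    then show ?thesis unfolding brc_mult_left by simp
  qed
  have "FL (%l. Br (%w. \<psi> (l # w))) y z gs hs = FL (%l y z gs hs. 0) y z gs hs"
  proof (rule fst_letter_cong)
    fix g gs' u v assume gs: "gs = g # gs'" and hs: "hs = u @ v"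
    then have g: "g \<in> Arr C" "dom C g = y" "is_path C (cod C g) gs'" and u: "is_path D z u" "is_path D (path_end D z u) v"
      using less.prems by (auto simp: tgt.is_path_append)
    note e = eps_Arr[OF g(1) u(1), unfolded g(2)]
    have zi: "(\<exists>x\<in>Obj X. eps C D g z u = idn X x) \<or> (\<exists>n. eps C D g z u = zer X (y, z) (cod C g, path_end D z u) n)"
      if "(\<exists>c\<in>Obj C. g = idn C c) \<or> (\<exists>d\<in>Obj D. idn D d \<in> set u)"
      using that
    proof
      assume "\<exists>c\<in>Obj C. g = idn C c"
      then obtain c where c: "c \<in> Obj C" "g = idn C c" by blast
      then have "c = y" "cod C g = y" using g src.idn_Hom[OF c(1)] by (auto simp: Hom_def)
      then show ?thesis
        using c z u eps_idn(1)[OF c(1) z] eps_idn(3)[OF c(1) u(1)] by (cases "u = []") (auto simp: tens_ops)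
    next
      assume "\<exists>d\<in>Obj D. idn D d \<in> set u"
      then show ?thesis using eps_idn(4)[OF g(1) u(1)] g(2) by auto
    qed
    show "Br (%w. \<psi> (eps C D g z u # w)) (cod C g) (path_end D z u) gs' v = 0"
    proof (cases "(\<exists>c\<in>Obj C. g = idn C c) \<or> (\<exists>d\<in>Obj D. idn D d \<in> set u)")
      case True
      then show ?thesis using zero[OF e(1-3) zi[OF True] g(3) u(2)] by simp
    next
      case False
      then have "(\<exists>c\<in>Obj C. idn C c \<in> set gs') \<or> (\<exists>d\<in>Obj D. idn D d \<in> set v)"
        using less.prems(5) by (auto simp: gs hs)
      then show ?thesis
        using less.prems(1,2) X.mlin_tail[of \<kappa> "eps C D g z u" \<psi>] X.nrm_tail[of "eps C D g z u" \<psi>] e g u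
        by (intro less.IH) (auto simp: gs hs)
    qed
  next
    fix h hs' assume hs: "hs = h # hs'"
    then have h: "h \<in> Arr D" "dom D h = z" "is_path D (cod D h) hs'" using less.prems by auto
    note e = rgt_Arr[OF y h(1), unfolded h(2)]
    show "Br (%w. \<psi> (rgt C D y h # w)) y (cod D h) gs hs' = 0"
    proof (cases "\<exists>d\<in>Obj D. h = idn D d")
      case True
      then have "\<exists>x\<in>Obj X. rgt C D y h = idn X x" using eps_idn(2)[OF y] y by (auto simp: tens_ops)
      then show ?thesis using zero[OF e(1-3) _ less.prems(3) h(3)] by simp
    next
      case False
      then have "(\<exists>c\<in>Obj C. idn C c \<in> set gs) \<or> (\<exists>d\<in>Obj D. idn D d \<in> set hs')"
        using less.prems(5) by (auto simp: hs)
      then show ?thesis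
        using less.prems X.mlin_tail[of \<kappa> "rgt C D y h" \<psi>] X.nrm_tail[of "rgt C D y h" \<psi>] e h
        by (intro less.IH) (auto simp: hs)
    qed
  qed
  also have "... = 0" by (simp add: fst_letter_def split: list.split)
  finally show ?case
    using less.prems(5) by (subst brc_fst_letter) auto
qed

text \<open>\<open>brc_spl\<close> for the cup product. This iterated convolution is the composition
  of cochains whose values are composed as cochains themselves.\<close>

lemma brc_cup:
  assumes gs: "is_path C y gs" and hs: "is_path D z hs"
  shows "Br (cup X q \<Phi> \<Psi> (y, z)) y z gs hs = spl (%a b. spl (%u v.
     sg (shdeg C a * shdeg D v + (shdeg C b + shdeg D v) * q) *
      (Br (\<Phi> (path_end C y a, path_end D z u)) (path_end C y a) (path_end D z u) b v * Br (\<Psi> (y, z)) y z a u)) hs) gs"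
proof -
  let ?e = "path_end C y" and ?z = "path_end D z"
  have "Br (cup X q \<Phi> \<Psi> (y, z)) y z gs hs = spl2 C D (%a u b v.
      Br (%p. Br (%s. sg (shdeg X s * q) * (\<Phi> (path_end X (y, z) p) s * \<Psi> (y, z) p))
        (?e a) (?z u) b v) y z a u) gs hs"
    unfolding cup_def brc_spl by (rule HOL.refl)
  also have "... = spl2 C D (%a u b v. sg ((shdeg C b + shdeg D v) * q) *
      (Br (\<Phi> (?e a, ?z u)) (?e a) (?z u) b v * Br (\<Psi> (y, z)) y z a u)) gs hs"
  proof (rule spl2_cong)
    fix a b u v assume "a @ b = gs" "u @ v = hs"
    then have p: "is_path C y a" "is_path C (?e a) b" "is_path D z u" "is_path D (?z u) v"
      using gs hs by (auto simp: src.is_path_append tgt.is_path_append)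
    let ?B = "Br (\<Phi> (?e a, ?z u)) (?e a) (?z u) b v"
    have "Br (%s. sg (shdeg X s * q) * (\<Phi> (path_end X (y, z) p) s * \<Psi> (y, z) p)) (?e a) (?z u) b v
      = sg ((shdeg C b + shdeg D v) * q) * (?B * \<Psi> (y, z) p)"
      if "path_end X (y, z) p = (?e a, ?z u)" for p
      unfolding brc_mult_right[symmetric] brc_mult_left[symmetric] that by (rule brc_cong[OF p(2,4)]) simp
    then have "Br (%p. Br (%s. sg (shdeg X s * q) * (\<Phi> (path_end X (y, z) p) s * \<Psi> (y, z) p))
        (?e a) (?z u) b v) y z a u
      = Br (%p. sg ((shdeg C b + shdeg D v) * q) * (?B * \<Psi> (y, z) p)) y z a u"
      by (intro brc_cong[OF p(1,3)])
    then show "Br (%p. Br (%s. sg (shdeg X s * q) * (\<Phi> (path_end X (y, z) p) s * \<Psi> (y, z) p))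
        (?e a) (?z u) b v) y z a u
      = sg ((shdeg C b + shdeg D v) * q) * (?B * Br (\<Psi> (y, z)) y z a u)"
      unfolding brc_mult_left .
  qed
  also have "... = spl (%a b. spl (%u v.
     sg (shdeg C a * shdeg D v + (shdeg C b + shdeg D v) * q) *
      (Br (\<Phi> (?e a, ?z u)) (?e a) (?z u) b v * Br (\<Psi> (y, z)) y z a u)) hs) gs"
    unfolding spl2_def by (simp add: sg_add mult.assoc)
  finally show ?thesis .
qed

end

lemma brc_diff: "brc C D rg ep (%w. \<phi> w - \<psi> w) y z gs hs = brc C D rg ep \<phi> y z gs hs - brc C D rg ep \<psi> y z gs hs"
  using brc_add[of C D rg ep \<phi> "%w. - 1 * \<psi> w" y z gs hs] brc_mult_left[of C D rg ep "- 1" \<psi> y z gs hs] by simp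

lemma brc_zero [simp]: "brc C D rg ep (%w. 0) y z gs hs = 0"
  using brc_mult_left[of C D rg ep 0 "%w. 0" y z gs hs] by simp

text \<open>A word with at most one letter arises only from empty chains, one bare letter, or a
  single \<open>g\<close> that takes in all of \<open>hs\<close>.\<close>

lemma brc_short:
  assumes "!!l l' w. \<phi> (l # l' # w) = 0"
  shows "brc C D rg ep \<phi> y z gs hs = (case gs of
      [] => (case hs of [] => \<phi> [] | [h] => \<phi> [rg y h] | _ => 0)
    | [g] => \<phi> [ep g z hs] | _ => 0)"
proof -
  have 1: "brc C D rg ep (%w. \<phi> (l # w)) y z gs hs = (if gs = [] \<and> hs = [] then \<phi> [l] else 0)" for l y z gs hs
  proof -
    have "fst_letter C D rg ep (%l'. brc C D rg ep (%w. \<phi> (l # l' # w))) y z gs hs = 0"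
      by (simp add: assms fst_letter_def split: list.split)
    then show ?thesis by (subst brc_fst_letter) simp
  qed
  have 2: "spl (%u v. sg ((deg C g - 1) * shdeg D v) * (if v = [] then \<phi> [ep g z u] else 0)) hs = \<phi> [ep g z hs]" for g
    by (subst spl_right_nil) simp_all
  show ?thesis
  proof (cases gs)
    case (Cons g gs')
    then show ?thesis
      by (subst brc_fst_letter) (cases gs'; auto simp: fst_letter_def 1 2 split: list.split)
  qed (auto simp: assms split: list.split)
qed

text \<open>The transposed brace map, with \<open>gs\<close> held fixed. It is stated through
  \<open>brace_args\<close> so that the prescribed values of \<open>assoc_map\<close> appear from it
  by unfolding.\<close>

definition cur1 :: "('k::field, 'c, 'f) dgcat => ('k, 'd, 'g) dgcat => ('k, 'e, 'h) dgcat
    => ('c \<times> 'd, ('k, 'c, 'f, 'd, 'g) tw_term set, 'e, 'h) cochain => 'c => 'f list => ('d, 'g, 'e, 'h) cochain" where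
  "cur1 C D E \<Psi> y gs = Cochain (transpose_obj C D (csrc \<Psi>) y) (transpose_obj C D (ctgt \<Psi>) (path_end C y gs))
     (cdeg \<Psi> + shdeg C gs) (on_paths D (%z hs.
       dsum E (fobj (csrc \<Psi>) (y, z)) (fobj (ctgt \<Psi>) (path_end C y gs, path_end D z hs)) (cdeg \<Psi> + shdeg C gs + shdeg D hs)
         (map (%(n, args). sscl E n (cval \<Psi> (y, z) args)) (brace_args C D y z gs hs))))"

definition cur :: "('k::field, 'c, 'f) dgcat => ('k, 'd, 'g) dgcat => ('k, 'e, 'h) dgcat
    => ('c \<times> 'd, ('k, 'c, 'f, 'd, 'g) tw_term set, 'e, 'h) cochain
    => ('c, 'f, ('d, 'g, 'e, 'h) dgfun, ('d, 'g, 'e, 'h) cochain) cochain" where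
  "cur C D E \<Psi> = Cochain (transpose_fun C D (csrc \<Psi>)) (transpose_fun C D (ctgt \<Psi>)) (cdeg \<Psi>)
     (on_paths C (cur1 C D E \<Psi>))"

definition curry_fun where
  "curry_fun C D E = \<lparr>fobj = (\<lambda>F\<in>Obj (Coh (tens C D) E). transpose_fun C D F),
     farr = (\<lambda>\<Psi>\<in>Arr (Coh (tens C D) E). cur C D E \<Psi>)\<rparr>"

context dg_pair
begin

lemma rgt_path:
  assumes "y \<in> Obj C" "is_path D z hs"
  shows "is_path X (y, z) (map (rgt C D y) hs)" "path_end X (y, z) (map (rgt C D y) hs) = (y, path_end D z hs)"
    "shdeg X (map (rgt C D y) hs) = shdeg D hs"
  using assms(2) by (induction hs arbitrary: z) (auto simp: assms(1) rgt_Arr tens_ops)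

lemma brace_args_path:
  assumes "is_path C y gs" "is_path D z hs" "(n, w) \<in> set (brace_args C D y z gs hs)"
  shows "is_path X (y, z) w" "path_end X (y, z) w = (path_end C y gs, path_end D z hs)"
    "shdeg X w = shdeg C gs + shdeg D hs"
proof -
  interpret X: dg_category X by (rule dg_category_tens)
  have "is_path X (y, z) w \<and> path_end X (y, z) w = (path_end C y gs, path_end D z hs) \<and> shdeg X w = shdeg C gs + shdeg D hs"
    using assms
  proof (induction gs arbitrary: y z hs n w)
    case Nil
    then show ?case using rgt_path[of y z hs] by auto
  next
    case (Cons g gs)
    then obtain i j m args where w: "w = map (rgt C D y) (take i hs) @ eps C D g (path_end D z (take i hs)) (drop i (take j hs)) # args"
      and ij: "i \<le> j" and a: "(m, args) \<in> set (brace_args C D (cod C g) (path_end D z (take j hs)) gs (drop j hs))"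
      by (auto simp del: upt_Suc)
    have g: "g \<in> Arr C" "dom C g = y" "is_path C (cod C g) gs" and y: "y \<in> Obj C"
      using Cons.prems(1) src.is_path_Obj[OF Cons.prems(1)] by auto
    have t: "take j hs = take i hs @ drop i (take j hs)"
      using ij by (metis append_take_drop_id min.absorb1 take_take)
    note pj = path_take_drop[OF Cons.prems(2), of j] and pi = path_take_drop[OF Cons.prems(2), of i]
    have pij: "is_path D (path_end D z (take i hs)) (drop i (take j hs))"
      using pj(1) t by (metis tgt.is_path_append)
    have e: "path_end D (path_end D z (take i hs)) (drop i (take j hs)) = path_end D z (take j hs)"
      and s: "shdeg D (take i hs) + shdeg D (drop i (take j hs)) = shdeg D (take j hs)"
      using t by (metis path_end_append, metis shdeg_simps(3))
    show ?case using Cons.IH[OF g(3) pj(2) a] rgt_path[OF y pi(1)] eps_Arr[OF g(1) pij] g pj e s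
      by (auto simp: w X.is_path_append path_end_append)
  qed
  then show "is_path X (y, z) w" "path_end X (y, z) w = (path_end C y gs, path_end D z hs)"
    "shdeg X w = shdeg C gs + shdeg D hs" by auto
qed

end

section \<open>Currying as a dg functor between categories of cochains\<close>

context dg_triple
begin

sublocale XE: dg_pair X E
  by (intro dg_pair.intro dg_category_tens trd.dg_category_axioms)

sublocale CC: dg_pair C "Coh D E"
  by (intro dg_pair.intro src.dg_category_axioms DE.dg_category_Coh)

text \<open>The brace operator turns the twisting cochain of \<open>F\<close> into the data of its
  transpose: on empty \<open>gs\<close> the twisting cochain of a functor on \<open>D\<close>, on
  one letter the cochain assigned to it.\<close>

lemma brc_tht:
  assumes "dg_functor X E F" and gs: "is_path C y gs" and hs: "is_path D z hs"
  shows "Br (XE.tht F (y, z)) y z gs hs = (case gs of [] => DE.tht (transpose_obj C D F y) z hs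
     | [g] => DE.rv (farr (transpose_fun C D F) g) z hs | _ => 0)"
proof (subst brc_short)
  show "XE.tht F (y, z) (l # l' # w) = 0" for l l' w by simp
qed (use gs hs in "auto simp: transpose_obj_simps[OF assms(1)] transpose_fun_simps(3)[OF assms(1)] eps_def split: list.split")

context
  fixes \<Psi> F G p
  assumes \<Psi>: "\<Psi> \<in> Hom XE.Ch F G p"
begin

lemma cur_props: "is_cochain X E \<Psi>" "csrc \<Psi> = F" "ctgt \<Psi> = G" "cdeg \<Psi> = p" "dg_functor X E F" "dg_functor X E G"
  using \<Psi> XE.coh_Hom_Obj[OF \<Psi>] by (auto simp: XE.Coh_Hom)

lemma cur1_rv:
  assumes gs: "is_path C y gs" and hs: "is_path D z hs"
  shows "DE.rv (cur1 C D E \<Psi> y gs) z hs = Br (XE.rv \<Psi> (y, z)) y z gs hs"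
    "cval (cur1 C D E \<Psi> y gs) z hs \<in> Hom E (fobj F (y, z)) (fobj G (path_end C y gs, path_end D z hs)) (p + shdeg C gs + shdeg D hs)"
proof -
  let ?L = "map (%(n, args). sscl E n (cval \<Psi> (y, z) args)) (brace_args C D y z gs hs)"
  let ?x = "fobj F (y, z)" and ?y = "fobj G (path_end C y gs, path_end D z hs)"
  let ?n = "p + shdeg C gs + shdeg D hs"
  have h: "cval \<Psi> (y, z) w \<in> Hom E ?x ?y ?n" if "(n, w) \<in> set (brace_args C D y z gs hs)" for n w
    using XE.cochain_Hom[OF cur_props(1) brace_args_path(1)[OF gs hs that]] brace_args_path(2,3)[OF gs hs that]
    by (simp add: cur_props add.assoc)
  have o: "?x \<in> Obj E" "?y \<in> Obj E"
    using src.is_path_Obj[OF gs] tgt.is_path_Obj[OF hs] cur_props(5,6) by (auto intro!: dg_functor_Obj simp: tens_ops)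
  have L: "f \<in> Hom E ?x ?y ?n" if "f \<in> set ?L" for f
    using that h by (auto intro!: trd.scl_Hom)
  have c: "cval (cur1 C D E \<Psi> y gs) z hs = dsum E ?x ?y ?n ?L"
    using hs by (simp add: cur1_def cur_props)
  show "cval (cur1 C D E \<Psi> y gs) z hs \<in> Hom E ?x ?y ?n"
    unfolding c by (rule trd.dsum_Hom[OF o L])
  have "DE.rv (cur1 C D E \<Psi> y gs) z hs = (\<Sum>f\<leftarrow>?L. rho E f)"
    unfolding DE.rv_def c by (rule trd.rho_dsum[OF o L])
  also have "... = (\<Sum>(n, args)\<leftarrow>brace_args C D y z gs hs. sg n * XE.rv \<Psi> (y, z) args)"
    unfolding map_map
    using trd.rho_sscl[OF trd.Hom_Arr[OF h]]
    by (intro arg_cong[of _ _ sum_list] map_cong HOL.refl) (auto simp: XE.rv_def)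
  finally show "DE.rv (cur1 C D E \<Psi> y gs) z hs = Br (XE.rv \<Psi> (y, z)) y z gs hs"
    by (simp only: brace_args_brc)
qed

lemma cur1_Hom:
  assumes gs: "is_path C y gs"
  shows "cur1 C D E \<Psi> y gs \<in> Hom DE.Ch (transpose_obj C D F y) (transpose_obj C D G (path_end C y gs)) (p + shdeg C gs)"
proof -
  have o: "y \<in> Obj C" "path_end C y gs \<in> Obj C" using src.is_path_Obj[OF gs] by auto
  let ?\<phi> = "%z hs. cval (cur1 C D E \<Psi> y gs) z hs"
  have r: "rho E (?\<phi> z hs) = Br (XE.rv \<Psi> (y, z)) y z gs hs" if "is_path D z hs" for z hs
    using cur1_rv(1)[OF gs that] by (simp add: DE.rv_def)
  have "is_cochain D E (Cochain (transpose_obj C D F y) (transpose_obj C D G (path_end C y gs)) (p + shdeg C gs) (on_paths D ?\<phi>))"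
  proof (rule DE.is_cochainI)
    show "dg_functor D E (transpose_obj C D F y)" "dg_functor D E (transpose_obj C D G (path_end C y gs))"
      using o cur_props(5,6) by (auto intro: dg_functor_transpose_obj)
    show "tgt.mlin kap z (%hs. rho E (?\<phi> z hs))" for z
      by (rule tgt.mlin_cong[OF r brc_mlin_right[OF XE.cochain_mlin[OF cur_props(1)] gs]])
    show "tgt.nrm z (%hs. rho E (?\<phi> z hs))" for z
      by (rule tgt.nrm_cong[OF r])
        (auto simp: tgt.nrm_def intro!: brc_nrm[OF XE.cochain_mlin[OF cur_props(1)] kap_1 XE.cochain_nrm[OF cur_props(1)] gs])
    show "?\<phi> z hs \<in> Hom E (fobj (transpose_obj C D F y) z)
        (fobj (transpose_obj C D G (path_end C y gs)) (path_end D z hs)) (p + shdeg C gs + shdeg D hs)" if "is_path D z hs" for z hs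
      using cur1_rv(2)[OF gs that] tgt.is_path_Obj[OF that] by (simp add: transpose_obj_simps cur_props)
  qed
  moreover have "on_paths D ?\<phi> = ?\<phi>"
    by (auto simp: on_paths_def cur1_def fun_eq_iff)
  ultimately show ?thesis
    unfolding DE.Coh_Hom by (simp add: cur_props cur1_def)
qed

lemma cur_Hom: "cur C D E \<Psi> \<in> Hom CC.Ch (transpose_fun C D F) (transpose_fun C D G) p"
proof -
  have m: "src.mlin kap y (%gs. rho DE.Ch (cur1 C D E \<Psi> y gs))" for y
    unfolding src.mlin_def
  proof (intro allI impI)
    fix us f f' vs c c' n a
    assume gs: "is_path C y (us @ f # vs)" and f: "f \<in> Hom C c c' n" "f' \<in> Hom C c c' n"
    let ?f = "add C (scl C a f) f'"
    note lf = src.lin_Hom[OF f, of a]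
    note p1 = src.is_path_Hom[OF gs f(1) lf] and p2 = src.is_path_Hom[OF gs f]
    have e: "path_end C y (us @ ?f # vs) = path_end C y (us @ f # vs)" "path_end C y (us @ f' # vs) = path_end C y (us @ f # vs)"
      using lf f by (auto simp: Hom_def)
    note h = cur1_Hom[OF gs] and h1 = cur1_Hom[OF p1, unfolded e src.shdeg_Hom[OF lf f(1)]]
      and h2 = cur1_Hom[OF p2, unfolded e src.shdeg_Hom[OF f(2,1)]]
    have "cur1 C D E \<Psi> y (us @ ?f # vs)
        = add DE.Ch (scl DE.Ch a (cur1 C D E \<Psi> y (us @ f # vs))) (cur1 C D E \<Psi> y (us @ f' # vs))"
    proof (rule DE.Coh_eqI[OF h1 DE.coh_add(1)[OF DE.coh_scl(1)[OF h] h2]])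
      fix z hs assume hs: "is_path D z hs"
      show "DE.rv (cur1 C D E \<Psi> y (us @ ?f # vs)) z hs
        = DE.rv (add DE.Ch (scl DE.Ch a (cur1 C D E \<Psi> y (us @ f # vs))) (cur1 C D E \<Psi> y (us @ f' # vs))) z hs"
        using src.mlinD[OF brc_mlin_left[OF XE.cochain_mlin[OF cur_props(1)] hs] gs f]
        by (simp add: DE.coh_add(2)[OF DE.coh_scl(1)[OF h] h2 hs] DE.coh_scl(2)[OF h hs] cur1_rv gs p1 p2 hs)
    qed
    then show "rho DE.Ch (cur1 C D E \<Psi> y (us @ ?f # vs))
      = kap a * rho DE.Ch (cur1 C D E \<Psi> y (us @ f # vs)) + rho DE.Ch (cur1 C D E \<Psi> y (us @ f' # vs))"
      using CC.tgt.rho_add[OF DE.coh_scl(1)[OF h] h2] by (simp add: CC.tgt.rho_scl[OF CC.tgt.Hom_Arr[OF h]])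
  qed
  have n: "src.nrm y (%gs. rho DE.Ch (cur1 C D E \<Psi> y gs))" for y
    unfolding src.nrm_def
  proof (intro allI impI)
    fix gs assume gs: "is_path C y gs" and i: "\<exists>c\<in>Obj C. idn C c \<in> set gs"
    note h = cur1_Hom[OF gs]
    note z = DE.coh_zer[OF DE.coh_Hom_Obj[OF h], where p = "p + shdeg C gs"]
    have "cur1 C D E \<Psi> y gs = zer DE.Ch (transpose_obj C D F y) (transpose_obj C D G (path_end C y gs)) (p + shdeg C gs)"
    proof (rule DE.Coh_eqI[OF h z(1)])
      fix w hs assume hs: "is_path D w hs"
      show "DE.rv (cur1 C D E \<Psi> y gs) w hs
        = DE.rv (zer DE.Ch (transpose_obj C D F y) (transpose_obj C D G (path_end C y gs)) (p + shdeg C gs)) w hs"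
        using brc_nrm[OF XE.cochain_mlin[OF cur_props(1)] kap_1 XE.cochain_nrm[OF cur_props(1)] gs hs] i
        by (simp add: z(2)[OF hs] cur1_rv[OF gs hs])
    qed
    then show "rho DE.Ch (cur1 C D E \<Psi> y gs) = 0"
      using CC.tgt.Hom_Obj[OF h] by (simp add: CC.tgt.rho_zer)
  qed
  have o: "y \<in> Obj C" "path_end C y gs \<in> Obj C" if "is_path C y gs" for y gs
    using src.is_path_Obj[OF that] by auto
  show ?thesis
    unfolding CC.Coh_Hom cur_def
    using CC.is_cochainI[OF dg_functor_transpose[OF cur_props(5)] dg_functor_transpose[OF cur_props(6)], of "cur1 C D E \<Psi>" p, OF _ m n]
      cur1_Hom o by (simp add: cur_props transpose_fun_simps)
qed

lemma cur_rv: "is_path C y gs ==> CC.rv (cur C D E \<Psi>) y gs = rho DE.Ch (cur1 C D E \<Psi> y gs)"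
  by (simp add: CC.rv_def cur_def)

text \<open>Descends two levels of cochains, from operators of \<open>Coh D E\<close> to operators
  of \<open>E\<close>, so that identities about \<open>cur\<close> can be checked on pairs of
  chains.\<close>

lemma cur_eqI:
  assumes \<Theta>: "\<Theta> \<in> Hom CC.Ch (transpose_fun C D F) (transpose_fun C D G) p"
    and eq: "!!y gs z hs. is_path C y gs ==> is_path D z hs ==> DE.rv (cval \<Theta> y gs) z hs = Br (XE.rv \<Psi> (y, z)) y z gs hs"
  shows "cur C D E \<Psi> = \<Theta>"
proof (rule CC.Coh_eqI[OF cur_Hom \<Theta>])
  fix y gs assume gs: "is_path C y gs"
  then have o: "y \<in> Obj C" "path_end C y gs \<in> Obj C" using src.is_path_Obj by auto
  have "cval \<Theta> y gs \<in> Hom DE.Ch (transpose_obj C D F y) (transpose_obj C D G (path_end C y gs)) (p + shdeg C gs)"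
    using CC.cochain_Hom[OF _ gs, of \<Theta>] \<Theta> o by (simp add: CC.Coh_Hom transpose_fun_simps cur_props)
  then have "cur1 C D E \<Psi> y gs = cval \<Theta> y gs"
    by (rule DE.Coh_eqI[OF cur1_Hom[OF gs]]) (simp add: cur1_rv eq gs)
  then show "CC.rv (cur C D E \<Psi>) y gs = CC.rv \<Theta> y gs"
    by (simp add: cur_rv[OF gs]) (simp add: CC.rv_def)
qed

end

text \<open>Evaluating a cochain at a fixed chain is additive, hence extends to operators of
  \<open>Coh D E\<close>. Formulas for the outer cochains are thereby brought down to operators of
  \<open>E\<close>.\<close>

lemma ex_additive_rv:
  assumes "dg_functor D E P" "dg_functor D E Q" and hs: "is_path D z hs"
  obtains L where "additive L" "!!f. f \<in> Hom DE.Ch P Q n ==> L (rho DE.Ch f) = DE.rv f z hs"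
  by (rule CC.tgt.ex_additive_rho[of P Q n "%f. DE.rv f z hs"])
    (use assms DE.coh_add(2)[OF _ _ hs] in auto)

text \<open>Composing curried cochains cuts \<open>gs\<close>, and composing their values cuts
  \<open>hs\<close>; together this is the double cut of \<open>brc_cup\<close>, with matching
  signs.\<close>

lemma cur_cmp:
  assumes \<Phi>: "\<Phi> \<in> Hom XE.Ch G H q" and \<Psi>: "\<Psi> \<in> Hom XE.Ch F G p"
  shows "cur C D E (cmp XE.Ch \<Phi> \<Psi>) = cmp CC.Ch (cur C D E \<Phi>) (cur C D E \<Psi>)"
proof (rule cur_eqI[OF XE.coh_cmp(1)[OF \<Phi> \<Psi>]])
  let ?\<Theta> = "cmp CC.Ch (cur C D E \<Phi>) (cur C D E \<Psi>)"
  note c = CC.coh_cmp[OF cur_Hom[OF \<Phi>] cur_Hom[OF \<Psi>]]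
  show "?\<Theta> \<in> Hom CC.Ch (transpose_fun C D F) (transpose_fun C D H) (q + p)" by (rule c)
  fix y gs z hs assume gs: "is_path C y gs" and hs: "is_path D z hs"
  let ?P = "transpose_obj C D F y" and ?Q = "transpose_obj C D H (path_end C y gs)"
  let ?s = "%a b u v. sg (shdeg C a * shdeg D v + (shdeg C b + shdeg D v) * p) * (Br (XE.rv \<Phi> (path_end C y a, path_end D z u)) (path_end C y a) (path_end D z u) b v * Br (XE.rv \<Psi> (y, z)) y z a u)"
  let ?cp = "cur C D E \<Phi>"
  let ?cs = "cur C D E \<Psi>"
  have o: "y \<in> Obj C" "path_end C y gs \<in> Obj C" using src.is_path_Obj[OF gs] by auto
  have PQ: "dg_functor D E ?P" "dg_functor D E ?Q"
    using o cur_props[OF \<Phi>] cur_props[OF \<Psi>] by (auto intro: dg_functor_transpose_obj)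
  obtain L where L: "additive L" "!!f. f \<in> Hom DE.Ch ?P ?Q (q + p + shdeg C gs) ==> L (rho DE.Ch f) = DE.rv f z hs"
    using ex_additive_rv[OF PQ hs, where n = "q + p + shdeg C gs"] by blast
  have "cval ?\<Theta> y gs \<in> Hom DE.Ch ?P ?Q (q + p + shdeg C gs)"
    using CC.cochain_Hom[OF _ gs, of ?\<Theta>] c(1) o cur_props[OF \<Phi>] cur_props[OF \<Psi>]
    by (simp add: CC.Coh_Hom transpose_fun_simps)
  then have "DE.rv (cval ?\<Theta> y gs) z hs = L (CC.rv ?\<Theta> y gs)"
    by (simp add: L(2) CC.rv_def)
  also have "... = L (cup C p (CC.rv ?cp) (CC.rv ?cs) y gs)"
    unfolding c(2)[OF gs] by (rule HOL.refl)
  also have "... = spl (%a b. spl (%u v. ?s a b u v) hs) gs"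
    unfolding cup_def additive_spl[OF L(1)] additive_sg[OF L(1)]
  proof (rule spl_cong)
    fix a b assume ab: "a @ b = gs"
    then have p: "is_path C y a" "is_path C (path_end C y a) b" using gs by (auto simp: src.is_path_append)
    have s: "q + shdeg C b + (p + shdeg C a) = q + p + shdeg C gs" "path_end C (path_end C y a) b = path_end C y gs"
      using ab by (auto simp: path_end_append)
    note h = cur1_Hom[OF \<Phi> p(2)] cur1_Hom[OF \<Psi> p(1)]
    note m = DE.coh_cmp[OF h]
    have "L (CC.rv ?cp (path_end C y a) b * CC.rv ?cs y a)
      = DE.rv (cmp DE.Ch (cur1 C D E \<Phi> (path_end C y a) b) (cur1 C D E \<Psi> y a)) z hs"
      using L(2)[OF m(1)[unfolded s]] by (simp add: cur_rv[OF \<Phi> p(2)] cur_rv[OF \<Psi> p(1)] CC.tgt.rho_cmp[OF h])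
    also have "... = spl (%u v. sg (shdeg D v * (p + shdeg C a)) *
      (Br (XE.rv \<Phi> (path_end C y a, path_end D z u)) (path_end C y a) (path_end D z u) b v * Br (XE.rv \<Psi> (y, z)) y z a u)) hs"
      unfolding m(2)[OF hs] cup_def
      by (rule spl_cong) (use hs in \<open>auto simp: tgt.is_path_append cur1_rv[OF \<Phi> p(2)] cur1_rv[OF \<Psi> p(1)]\<close>)
    finally show "sg (shdeg C b * p) * L (CC.rv ?cp (path_end C y a) b * CC.rv ?cs y a)
      = spl (%u v. ?s a b u v) hs"
      by (simp only: spl_mult_left[symmetric]) (intro spl_cong, auto simp: sg_def)
  qed
  also have "... = Br (cup X p (XE.rv \<Phi>) (XE.rv \<Psi>) (y, z)) y z gs hs"
    by (rule brc_cup[OF gs hs, symmetric])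
  also have "... = Br (XE.rv (cmp XE.Ch \<Phi> \<Psi>) (y, z)) y z gs hs"
    by (rule brc_cong[OF gs hs]) (simp add: XE.coh_cmp(2)[OF \<Phi> \<Psi>])
  finally show "DE.rv (cval ?\<Theta> y gs) z hs = Br (XE.rv (cmp XE.Ch \<Phi> \<Psi>) (y, z)) y z gs hs" .
qed

text \<open>\<open>brc_bb\<close> accounts for the bar differentials of both chains. By
  \<open>brc_tht\<close> the commutators with the twisting cochains of \<open>F\<close> and
  \<open>G\<close> split into those of the inner differential and those of the outer one.\<close>

lemma cur_dif:
  assumes \<Psi>: "\<Psi> \<in> Hom XE.Ch F G p"
  shows "cur C D E (dif XE.Ch \<Psi>) = dif CC.Ch (cur C D E \<Psi>)"
proof (rule cur_eqI[OF XE.coh_dif(1)[OF \<Psi>]])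
  let ?\<Theta> = "dif CC.Ch (cur C D E \<Psi>)"
  let ?TF = "transpose_fun C D F" and ?TG = "transpose_fun C D G"
  note FG = cur_props(5,6)[OF \<Psi>]
  interpret TF: dg_functor C "Coh D E" ?TF by (rule dg_functor_transpose[OF FG(1)])
  interpret TG: dg_functor C "Coh D E" ?TG by (rule dg_functor_transpose[OF FG(2)])
  note c = CC.coh_dif[OF cur_Hom[OF \<Psi>]]
  show "?\<Theta> \<in> Hom CC.Ch ?TF ?TG (p + 1)" by (rule c)
  fix y gs z hs assume gs: "is_path C y gs" and hs: "is_path D z hs"
  let ?P = "transpose_obj C D F y" and ?Q = "transpose_obj C D G (path_end C y gs)"
  let ?n = "p + shdeg C gs"
  let ?\<psi> = "%x. XE.rv \<Psi> x"
  let ?c = "cur1 C D E \<Psi>"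
  let ?cu = "cur C D E \<Psi>"
  let ?W1 = "if gs = [] then 0 else sg (p * deg C (last gs) + p) * (rho DE.Ch (farr ?TG (last gs)) * CC.rv ?cu y (butlast gs))"
  let ?W2 = "case gs of [] => 0 | f # v => sg (p + shdeg C v + 1) * (CC.rv ?cu (cod C f) v * rho DE.Ch (farr ?TF f))"
  let ?Bz = "Br (?\<psi> (y, z)) y z"
  let ?b = "butlast gs"
  let ?e = "path_end C y"
  let ?ez = "path_end D z"
  let ?l = "last gs"
  let ?DE = "Coh D E"
  let ?XE = "Coh X E"
  have o: "y \<in> Obj C" "?e gs \<in> Obj C" using src.is_path_Obj[OF gs] by auto
  have PQ: "dg_functor D E ?P" "dg_functor D E ?Q"
    using o FG by (auto intro: dg_functor_transpose_obj)
  have fo: "fobj ?TF x = transpose_obj C D F x" "fobj ?TG x = transpose_obj C D G x" if "x \<in> Obj C" for x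
    using that by (simp_all add: transpose_fun_simps[OF FG(1)] transpose_fun_simps[OF FG(2)])
  obtain L where L: "additive L" "!!f. f \<in> Hom ?DE ?P ?Q (?n + 1) ==> L (rho ?DE f) = DE.rv f z hs"
    using ex_additive_rv[OF PQ hs, where n = "?n + 1"] by blast
  note h = cur1_Hom[OF \<Psi> gs]
  \<comment> \<open>\<open>?CL\<close> and \<open>?CR\<close> are the boundary terms of the outer
    differential, in which the last or the first letter of \<open>gs\<close> is sent through the
    transposed functor.\<close>
  let ?cl = "DE.rv (cmp ?DE (farr ?TG ?l) (?c y ?b)) z hs"
  let ?cr = "%f v. DE.rv (cmp ?DE (?c (cod C f) v) (farr ?TF f)) z hs"
  let ?CL = "if gs = [] then 0 else sg (p * deg C ?l + p) * ?cl"
  let ?CR = "case gs of [] => 0 | f # v => sg (p + shdeg C v + 1) * ?cr f v"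
  let ?s1 = "%a b v q. sg (shdeg C a * shdeg D v + (shdeg C b + shdeg D v) * q)"
  have cl: "L (rho ?DE (farr ?TG ?l) * CC.rv ?cu y ?b) = ?cl"
    "?cl = cup D (p + shdeg C ?b) (DE.rv (farr ?TG ?l)) (%z u. Br (?\<psi> (y, z)) y z ?b u) z hs"
    if "gs \<noteq> []"
  proof -
    note b = src.path_butlast[OF gs that]
    have e: "?e ?b \<in> Obj C" using src.is_path_Obj[OF b(1)] by simp
    have g: "farr ?TG ?l \<in> Hom ?DE (transpose_obj C D G (?e ?b)) ?Q (deg C ?l)"
      using TG.farr_Hom[OF src.Arr_Hom[OF b(2)]] b(3,4) e o by (simp add: fo)
    note m = DE.coh_cmp[OF g cur1_Hom[OF \<Psi> b(1)]]
    have n: "deg C ?l + (p + shdeg C ?b) = ?n + 1" using b(5) by simp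
    show "L (rho ?DE (farr ?TG ?l) * CC.rv ?cu y ?b) = ?cl"
      using L(2)[OF m(1)[unfolded n]] by (simp add: cur_rv[OF \<Psi> b(1)] CC.tgt.rho_cmp[OF g cur1_Hom[OF \<Psi> b(1)], symmetric])
    show "?cl = cup D (p + shdeg C ?b) (DE.rv (farr ?TG ?l)) (%z u. Br (?\<psi> (y, z)) y z ?b u) z hs"
      unfolding m(2)[OF hs] by (rule tgt.cup_cong[OF hs]) (simp_all add: cur1_rv[OF \<Psi> b(1)])
  qed
  have cr: "L (CC.rv ?cu (cod C f) v * rho ?DE (farr ?TF f)) = ?cr f v"
    "?cr f v = cup D (deg C f) (%z w. Br (?\<psi> (cod C f, z)) (cod C f) z v w) (DE.rv (farr ?TF f)) z hs"
    if "gs = f # v" for f v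
  proof -
    have b: "f \<in> Arr C" "dom C f = y" "is_path C (cod C f) v" using gs that by auto
    have g: "farr ?TF f \<in> Hom ?DE ?P (transpose_obj C D F (cod C f)) (deg C f)"
      using TF.farr_Hom[OF src.Arr_Hom[OF b(1)]] b src.is_path_Obj[OF b(3)] o by (simp add: fo)
    note m = DE.coh_cmp[OF cur1_Hom[OF \<Psi> b(3)] g]
    have n: "p + shdeg C v + deg C f = ?n + 1" "path_end C (cod C f) v = ?e gs" using that by simp_all
    show "L (CC.rv ?cu (cod C f) v * rho ?DE (farr ?TF f)) = ?cr f v"
      using L(2)[OF m(1)[unfolded n]] by (simp add: cur_rv[OF \<Psi> b(3)] CC.tgt.rho_cmp[OF cur1_Hom[OF \<Psi> b(3)] g, symmetric])
    show "?cr f v = cup D (deg C f) (%z w. Br (?\<psi> (cod C f, z)) (cod C f) z v w) (DE.rv (farr ?TF f)) z hs"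
      unfolding m(2)[OF hs] by (rule tgt.cup_cong[OF hs]) (simp_all add: cur1_rv[OF \<Psi> b(3)])
  qed
  let ?R = "%z u. Br (?\<psi> (y, z)) y z gs u"
  have dc: "DE.rv (dif ?DE (?c y gs)) z hs = DE.del ?P ?Q ?n ?R z hs"
    unfolding DE.coh_dif(2)[OF h hs] by (rule tgt.gdel_cong[OF hs]) (simp add: cur1_rv[OF \<Psi> gs])
  have "cval ?\<Theta> y gs \<in> Hom ?DE ?P ?Q (?n + 1)"
    using CC.cochain_Hom[OF _ gs, of ?\<Theta>] c(1) o by (simp add: CC.Coh_Hom fo ac_simps)
  then have "DE.rv (cval ?\<Theta> y gs) z hs = L (CC.rv ?\<Theta> y gs)"
    by (simp add: L(2) CC.rv_def)
  also have "CC.rv ?\<Theta> y gs = CC.del ?TF ?TG p (CC.rv ?cu) y gs"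
    by (rule c(2)[OF gs])
  also have "CC.del ?TF ?TG p (CC.rv ?cu) y gs = rho ?DE (dif ?DE (?c y gs))
     + ?W1
     + ?W2
     + sg p * bb C (CC.rv ?cu y) gs"
    unfolding src.gdel_def CC.cup_tht_left CC.cup_tht_right CC.tgt.rho_dif[OF h] cur_rv[OF \<Psi> gs]
    by (simp add: sg_def split: list.split)
  also have "bb C (CC.rv ?cu y) gs = bb C (%w. rho ?DE (?c y w)) gs"
    by (rule src.bb_cong[OF gs]) (simp add: cur_rv[OF \<Psi>])
  also have "L (rho ?DE (dif ?DE (?c y gs))
     + ?W1
     + ?W2
     + sg p * bb C (%w. rho ?DE (?c y w)) gs)
    = DE.del ?P ?Q ?n ?R z hs + ?CL
     + ?CR
     + sg p * bb C (%w. L (rho ?DE (?c y w))) gs"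
    using cl(1) cr(1) L(2)[OF DE.coh_dif(1)[OF h]]
    by (simp add: additive.add[OF L(1)] additive_sg[OF L(1)] additive_bb[OF L(1)] additive.zero[OF L(1)] dc split: list.split)
  also have "bb C (%w. L (rho ?DE (?c y w))) gs = bb C (%w. ?Bz w hs) gs"
  proof (rule src.bb_cong[OF gs])
    fix w assume w: "is_path C y w" "?e w = ?e gs" "shdeg C w = shdeg C gs + 1"
    show "L (rho ?DE (?c y w)) = ?Bz w hs"
      using L(2) cur1_Hom[OF \<Psi> w(1)] w cur1_rv(1)[OF \<Psi> w(1) hs] by (simp add: add.assoc)
  qed
  finally have lhs: "DE.rv (cval ?\<Theta> y gs) z hs = DE.del ?P ?Q ?n ?R z hs
     + ?CL
     + ?CR
     + sg p * bb C (%w. ?Bz w hs) gs" .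
  \<comment> \<open>The twisting cochain of \<open>G\<close> takes no letter or the last letter of
    \<open>gs\<close>: the former is part of the inner differential, the latter is
    \<open>?CL\<close>.\<close>
  have "Br (cup X p (XE.tht G) ?\<psi> (y, z)) y z gs hs = cup D ?n (DE.tht ?Q) ?R z hs
     + ?CL"
  proof -
    let ?k = "%a b u v. (case b of [] => DE.tht (transpose_obj C D G (?e a)) (?ez u) v | [g] => DE.rv (farr ?TG g) (?ez u) v | _ => 0) * ?Bz a u"
    let ?K = "%a b. spl (%u v. ?s1 a b v p *
      ?k a b u v) hs"
    have "Br (cup X p (XE.tht G) ?\<psi> (y, z)) y z gs hs = spl ?K gs" unfolding brc_cup[OF gs hs]
    proof (intro spl_cong)
      fix a b u v assume "a @ b = gs" "u @ v = hs"
      then have "is_path C (?e a) b" "is_path D (?ez u) v"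
        using gs hs by (auto simp: src.is_path_append tgt.is_path_append)
      from brc_tht[OF FG(2) this] show "?s1 a b v p *
        (Br (XE.tht G (?e a, ?ez u)) (?e a) (?ez u) b v * ?Bz a u)
      = ?s1 a b v p *
      ?k a b u v" by simp
    qed
    also have "... = ?K gs [] + (if gs = [] then 0 else ?K ?b [?l])" by (rule spl_short_right) simp
    also have "?K gs [] = cup D ?n (DE.tht ?Q) ?R z hs"
      unfolding cup_def by (rule spl_cong) (simp add: algebra_simps)
    also have "(if gs = [] then 0 else ?K ?b [?l])
       = ?CL"
    proof (cases "gs = []")
      case False
      have "?K ?b [?l] = sg (p * deg C ?l + p) * ?cl"
        unfolding cl(2)[OF False] cup_def spl_mult_left[symmetric] by (rule spl_cong) (auto simp: sg_def)
      then show ?thesis by simp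
    qed simp
    finally show ?thesis .
  qed
  \<comment> \<open>The mirror image for \<open>F\<close>: no letter of \<open>gs\<close> gives the
    inner part, the first letter gives \<open>?CR\<close>.\<close>
  moreover have "sg p * Br (cup X 1 ?\<psi> (XE.tht F) (y, z)) y z gs hs = sg ?n * cup D 1 ?R (DE.tht ?P) z hs
     - ?CR"
  proof -
    let ?k = "%a b u v. Br (?\<psi> (?e a, ?ez u)) (?e a) (?ez u) b v * (case a of [] => DE.tht ?P z u | [g] => DE.rv (farr ?TF g) z u | _ => 0)"
    let ?K = "%a b. spl (%u v. ?s1 a b v 1 *
      ?k a b u v) hs"
    have "Br (cup X 1 ?\<psi> (XE.tht F) (y, z)) y z gs hs = spl ?K gs" unfolding brc_cup[OF gs hs]
    proof (intro spl_cong)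
      fix a b u v assume "a @ b = gs" "u @ v = hs"
      then have "is_path C y a" "is_path D z u"
        using gs hs by (auto simp: src.is_path_append tgt.is_path_append)
      from brc_tht[OF FG(1) this] show "?s1 a b v 1 *
        (Br (?\<psi> (?e a, ?ez u)) (?e a) (?ez u) b v * Br (XE.tht F (y, z)) y z a u)
      = ?s1 a b v 1 *
      ?k a b u v" by simp
    qed
    also have "... = ?K [] gs + (case gs of [] => 0 | f # v => ?K [f] v)" by (rule spl_short_left) simp
    also have "?K [] gs = sg (shdeg C gs) * cup D 1 ?R (DE.tht ?P) z hs"
      unfolding cup_def spl_mult_left[symmetric] by (rule spl_cong) (auto simp: sg_def)
    also have "(case gs of [] => 0 | f # v => ?K [f] v) = (case gs of [] => 0 | f # v => sg (shdeg C v) * ?cr f v)"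
    proof (cases gs)
      case (Cons f v)
      have "?K [f] v = sg (shdeg C v) * ?cr f v"
        unfolding cr(2)[OF Cons] cup_def spl_mult_left[symmetric] by (rule spl_cong) (auto simp: sg_def)
      then show ?thesis by (simp add: Cons)
    qed simp
    finally show ?thesis by (cases gs) (simp_all add: sg_def)
  qed
  moreover have "Br (bb X (?\<psi> (y, z))) y z gs hs = bb C (%w. ?Bz w hs) gs + sg (shdeg C gs) * bb D (?R z) hs"
    using brc_bb[OF gs hs XE.cochain_mlin[OF cur_props(1)[OF \<Psi>]] kap_1] by (simp add: bbt_def)
  moreover have "Br (XE.rv (dif ?XE \<Psi>) (y, z)) y z gs hs = Br (XE.del F G p ?\<psi> (y, z)) y z gs hs"
    by (rule brc_cong[OF gs hs]) (simp add: XE.coh_dif(2)[OF \<Psi>])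
  ultimately show "DE.rv (cval ?\<Theta> y gs) z hs = Br (XE.rv (dif ?XE \<Psi>) (y, z)) y z gs hs"
    unfolding lhs XE.src.gdel_abs tgt.gdel_def brc_add brc_diff brc_mult_left
    by (simp add: sg_add mult.assoc distrib_left right_diff_distrib)
qed

lemma dg_functor_curry: "dg_functor XE.Ch CC.Ch (curry_fun C D E)"
proof (intro dg_functor.intro dg_functor_axioms.intro XE.dg_category_Coh CC.dg_category_Coh)
  let ?K = "curry_fun C D E"
  have ko: "fobj ?K F = transpose_fun C D F" if "dg_functor X E F" for F
    using that by (simp add: curry_fun_def)
  have ka: "farr ?K \<Psi> = cur C D E \<Psi>" if "is_cochain X E \<Psi>" for \<Psi>
    using that by (simp add: curry_fun_def)
  show "fobj ?K \<in> Obj XE.Ch \<rightarrow>\<^sub>E Obj CC.Ch" "farr ?K \<in> extensional (Arr XE.Ch)"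
    using dg_functor_transpose by (auto simp: curry_fun_def)
  fix \<Psi> F G p assume \<Psi>: "\<Psi> \<in> Hom XE.Ch F G p"
  note c = cur_props[OF \<Psi>]
  show "farr ?K \<Psi> \<in> Hom CC.Ch (fobj ?K F) (fobj ?K G) p"
    using cur_Hom[OF \<Psi>] c by (simp add: ka ko)
  show "farr ?K (add XE.Ch \<Psi> \<Phi>) = add CC.Ch (farr ?K \<Psi>) (farr ?K \<Phi>)" if \<Phi>: "\<Phi> \<in> Hom XE.Ch F G p" for \<Phi>
  proof -
    note a = XE.coh_add[OF \<Psi> \<Phi>]
    have "cur C D E (add XE.Ch \<Psi> \<Phi>) = add CC.Ch (cur C D E \<Psi>) (cur C D E \<Phi>)"
    proof (rule cur_eqI[OF a(1) CC.coh_add(1)[OF cur_Hom[OF \<Psi>] cur_Hom[OF \<Phi>]]])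
      fix y gs z hs assume p: "is_path C y gs" "is_path D z hs"
      have "Br (XE.rv (add XE.Ch \<Psi> \<Phi>) (y, z)) y z gs hs = Br (%w. XE.rv \<Psi> (y, z) w + XE.rv \<Phi> (y, z) w) y z gs hs"
        by (rule brc_cong[OF p]) (simp add: a)
      moreover have "cval (add CC.Ch (cur C D E \<Psi>) (cur C D E \<Phi>)) y gs
        = add DE.Ch (cur1 C D E \<Psi> y gs) (cur1 C D E \<Phi> y gs)"
        using p(1) by (simp add: Coh_def[of C] cur_def)
      ultimately show "DE.rv (cval (add CC.Ch (cur C D E \<Psi>) (cur C D E \<Phi>)) y gs) z hs
        = Br (XE.rv (add XE.Ch \<Psi> \<Phi>) (y, z)) y z gs hs"
        by (simp add: DE.coh_add(2)[OF cur1_Hom[OF \<Psi> p(1)] cur1_Hom[OF \<Phi> p(1)] p(2)] brc_add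
            cur1_rv[OF \<Psi> p] cur1_rv[OF \<Phi> p])
    qed
    then show ?thesis using a(1) c(1) cur_props(1)[OF \<Phi>] by (simp add: ka XE.Coh_Hom)
  qed
next
  let ?K = "curry_fun C D E"
  have ka: "farr ?K \<Psi> = cur C D E \<Psi>" if "is_cochain X E \<Psi>" for \<Psi>
    using that by (simp add: curry_fun_def)
  fix \<Psi> assume "\<Psi> \<in> Arr XE.Ch"
  then have \<Psi>: "\<Psi> \<in> Hom XE.Ch (csrc \<Psi>) (ctgt \<Psi>) (cdeg \<Psi>)" and w: "is_cochain X E \<Psi>"
    by (auto intro: XE.coh_Arr_Hom)
  show "farr ?K (dif XE.Ch \<Psi>) = dif CC.Ch (farr ?K \<Psi>)"
    using cur_dif[OF \<Psi>] XE.coh_dif(1)[OF \<Psi>] w by (simp add: ka XE.Coh_Hom)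
  fix a
  have "cur C D E (scl XE.Ch a \<Psi>) = scl CC.Ch a (cur C D E \<Psi>)"
  proof (rule cur_eqI[OF XE.coh_scl(1)[OF \<Psi>] CC.coh_scl(1)[OF cur_Hom[OF \<Psi>]]])
    fix y gs z hs assume p: "is_path C y gs" "is_path D z hs"
    have "Br (XE.rv (scl XE.Ch a \<Psi>) (y, z)) y z gs hs = Br (%w. kap a * XE.rv \<Psi> (y, z) w) y z gs hs"
      by (rule brc_cong[OF p]) (simp add: XE.coh_scl(2)[OF \<Psi>])
    moreover have "cval (scl CC.Ch a (cur C D E \<Psi>)) y gs = scl DE.Ch a (cur1 C D E \<Psi> y gs)"
      using p(1) by (simp add: Coh_def[of C] cur_def)
    ultimately show "DE.rv (cval (scl CC.Ch a (cur C D E \<Psi>)) y gs) z hs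
      = Br (XE.rv (scl XE.Ch a \<Psi>) (y, z)) y z gs hs"
      by (simp add: DE.coh_scl(2)[OF cur1_Hom[OF \<Psi> p(1)] p(2)] brc_mult_left cur1_rv[OF \<Psi> p])
  qed
  then show "farr ?K (scl XE.Ch a \<Psi>) = scl CC.Ch a (farr ?K \<Psi>)"
    using XE.coh_scl(1)[OF \<Psi>] w by (simp add: ka XE.Coh_Hom)
next
  let ?K = "curry_fun C D E"
  fix F assume "F \<in> Obj XE.Ch"
  then have F: "dg_functor X E F" by simp
  note i = XE.coh_idn[OF F]
  have "cur C D E (idn XE.Ch F) = idn CC.Ch (transpose_fun C D F)"
  proof (rule cur_eqI[OF i(1) CC.coh_idn(1)[OF dg_functor_transpose[OF F]]])
    fix y gs z hs assume p: "is_path C y gs" "is_path D z hs"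
    have o: "y \<in> Obj C" "path_end C y gs \<in> Obj C" "z \<in> Obj D"
      using src.is_path_Obj[OF p(1)] tgt.is_path_Obj[OF p(2)] by auto
    note t = dg_functor_transpose_obj[OF F o(1)] dg_functor_transpose_obj[OF F o(2)]
    have "Br (XE.rv (idn XE.Ch F) (y, z)) y z gs hs = Br (%w. if w = [] then rho E (idn E (fobj F (y, z))) else 0) y z gs hs"
      by (rule brc_cong[OF p]) (simp add: i)
    also have "... = (if gs = [] \<and> hs = [] then rho E (idn E (fobj F (y, z))) else 0)"
      by (subst brc_short) (auto split: list.split)
    finally show "DE.rv (cval (idn CC.Ch (transpose_fun C D F)) y gs) z hs = Br (XE.rv (idn XE.Ch F) (y, z)) y z gs hs"
      using p o DE.coh_idn(2)[OF t(1) p(2)] DE.coh_idn(2)[OF t(1), of z "[]"] DE.coh_zer(2)[OF t p(2)]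
      by (simp add: Coh_def[of C] transpose_fun_simps[OF F] transpose_obj_simps[OF F])
  qed
  then show "farr ?K (idn XE.Ch F) = idn CC.Ch (fobj ?K F)"
    using F i(1) by (simp add: curry_fun_def XE.Coh_Hom)
next
  let ?K = "curry_fun C D E"
  fix \<Phi> G H q \<Psi> F p assume \<Phi>: "\<Phi> \<in> Hom XE.Ch G H q" and \<Psi>: "\<Psi> \<in> Hom XE.Ch F G p"
  show "farr ?K (cmp XE.Ch \<Phi> \<Psi>) = cmp CC.Ch (farr ?K \<Phi>) (farr ?K \<Psi>)"
    using cur_cmp[OF \<Phi> \<Psi>] XE.coh_cmp(1)[OF \<Phi> \<Psi>] cur_props(1)[OF \<Phi>] cur_props(1)[OF \<Psi>]
    by (simp add: curry_fun_def XE.Coh_Hom)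
qed

end

section \<open>The associativity map\<close>

text \<open>The hypotheses cover \<open>\<epsilon>(l; hs)\<close> only for generators
  \<open>l\<close> of the inner tensor product. The transposes are functors on that product and
  agree on its generators, hence everywhere, which gives all \<open>l\<close>.\<close>

lemma tens_tens_functor_eqI:
  assumes "dg_category C" "dg_category D" "dg_category E"
    and H: "dg_functor (tens (tens C D) E) T H" and H': "dg_functor (tens (tens C D) E) T H'"
    and o: "!!x y z. x \<in> Obj C ==> y \<in> Obj D ==> z \<in> Obj E ==> fobj H ((x, y), z) = fobj H' ((x, y), z)"
    and r: "!!x y h. x \<in> Obj C ==> y \<in> Obj D ==> h \<in> Arr E ==>
      farr H (rgt (tens C D) E (x, y) h) = farr H' (rgt (tens C D) E (x, y) h)"
    and er: "!!x g z hs. x \<in> Obj C ==> g \<in> Arr D ==> is_path E z hs ==>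
      farr H (eps (tens C D) E (rgt C D x g) z hs) = farr H' (eps (tens C D) E (rgt C D x g) z hs)"
    and ee: "!!f y gs z hs. f \<in> Arr C ==> is_path D y gs ==> is_path E z hs ==>
      farr H (eps (tens C D) E (eps C D f y gs) z hs) = farr H' (eps (tens C D) E (eps C D f y gs) z hs)"
  shows "H = H'"
proof -
  let ?X = "tens C D"
  let ?o = "transpose_obj ?X E" and ?f = "transpose_fun ?X E"
  interpret P: dg_pair C D using assms by (simp add: dg_pair_def)
  have T: "dg_category T" using H by (rule dg_functor.axioms)
  interpret Q: dg_triple "?X" E T by (intro dg_tripleI P.dg_category_tens assms T)
  note t = Q.transpose_fun_simps[OF H] and t' = Q.transpose_fun_simps[OF H']
  have to: "?o H x = ?o H' x" if x: "x \<in> Obj ?X" for x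
  proof (rule dg_functor_eqI[OF Q.dg_functor_transpose_obj[OF H x] Q.dg_functor_transpose_obj[OF H' x]])
    obtain c d where cd: "x = (c, d)" "c \<in> Obj C" "d \<in> Obj D" using x by (auto simp: P.tens_ops)
    show "fobj (?o H x) z = fobj (?o H' x) z" if "z \<in> Obj E" for z
      using that cd o by (simp add: Q.transpose_obj_simps[OF H] Q.transpose_obj_simps[OF H'])
    show "farr (?o H x) h = farr (?o H' x) h" if "h \<in> Arr E" for h
      using that cd r by (simp add: Q.transpose_obj_simps[OF H] Q.transpose_obj_simps[OF H'])
  qed
  have "?f H = ?f H'"
  proof (rule P.tens_functor_eqI[OF Q.dg_functor_transpose[OF H] Q.dg_functor_transpose[OF H']])
    show "fobj (?f H) (c, d) = fobj (?f H') (c, d)"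
      if "c \<in> Obj C" "d \<in> Obj D" for c d
      using that to by (simp add: t t' P.tens_ops)
    show "farr (?f H) (eps C D f d gs) = farr (?f H') (eps C D f d gs)"
      if "f \<in> Arr C" "is_path D d gs" for f d gs
      using P.eps_Arr[OF that] ee[OF that] to[OF Q.src.dom_Obj[OF P.eps_Arr(1)[OF that]]] to[OF Q.src.cod_Obj[OF P.eps_Arr(1)[OF that]]]
      by (auto simp: t(2) t'(2) on_paths_def fun_eq_iff)
    show "farr (?f H) (rgt C D c g) = farr (?f H') (rgt C D c g)"
      if "c \<in> Obj C" "g \<in> Arr D" for c g
      using P.rgt_Arr[OF that] er[OF that] to[OF Q.src.dom_Obj[OF P.rgt_Arr(1)[OF that]]] to[OF Q.src.cod_Obj[OF P.rgt_Arr(1)[OF that]]]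
      by (auto simp: t(2) t'(2) on_paths_def fun_eq_iff)
  qed
  note tf = this
  show ?thesis
  proof (rule Q.tens_functor_eqI[OF H H'])
    show "fobj H (x, z) = fobj H' (x, z)" if "x \<in> Obj ?X" "z \<in> Obj E" for x z
      using that o by (auto simp: P.tens_ops)
    show "farr H (eps ?X E F z hs) = farr H' (eps ?X E F z hs)"
      if "F \<in> Arr ?X" "is_path E z hs" for F z hs
    proof -
      have "cval (farr (?f H) F) z hs = cval (farr (?f H') F) z hs" by (simp only: tf)
      then show ?thesis using that by (simp add: t(2) t'(2))
    qed
    show "farr H (rgt ?X E x h) = farr H' (rgt ?X E x h)" if "x \<in> Obj ?X" "h \<in> Arr E" for x h
      using that r by (auto simp: P.tens_ops)
  qed
qed

definition assoc_spec where
  "assoc_spec C D E H \<longleftrightarrow>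
     dg_functor (tens (tens C D) E) (tens C (tens D E)) H \<and>
     (\<forall>x\<in>Obj C. \<forall>y\<in>Obj D. \<forall>z\<in>Obj E. fobj H ((x, y), z) = (x, (y, z))) \<and>
     (\<forall>x\<in>Obj C. \<forall>y\<in>Obj D. \<forall>h\<in>Arr E.
        farr H (rgt (tens C D) E (x, y) h) = rgt C (tens D E) x (rgt D E y h)) \<and>
     (\<forall>x\<in>Obj C. \<forall>g\<in>Arr D. \<forall>z hs. is_path E z hs -->
        farr H (eps (tens C D) E (rgt C D x g) z hs) = rgt C (tens D E) x (eps D E g z hs)) \<and>
     (\<forall>f\<in>Arr C. \<forall>y gs z hs. is_path D y gs \<and> is_path E z hs -->
        farr H (eps (tens C D) E (eps C D f y gs) z hs) =
          dsum (tens C (tens D E)) (dom C f, (y, z)) (cod C f, (path_end D y gs, path_end E z hs))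
            (deg C f + shdeg D gs + shdeg E hs)
            (map (%(n, args). sscl (tens C (tens D E)) n (eps C (tens D E) f (y, z) args))
                 (brace_args D E y z gs hs)))"

text \<open>Applying the universal property twice, a functor on the triple product is the same as a
  functor from \<open>C\<close> into cochains on \<open>D\<close> with values in cochains on
  \<open>E\<close>. No relation of the triple product has to be inspected.\<close>

lemma assoc_map_spec:
  assumes "dg_category C" "dg_category D" "dg_category E"
  shows "assoc_spec C D E (assoc_map C D E)"
proof -
  interpret P: dg_pair C D using assms by (simp add: dg_pair_def)
  interpret DE: dg_pair D E using assms by (simp add: dg_pair_def)
  interpret PT: dg_pair C "tens D E" by (intro dg_pair.intro assms DE.dg_category_tens)
  let ?X = "tens C D" and ?Y = "tens D E"
  let ?T = "tens C ?Y"
  note T = PT.dg_category_tens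
  interpret A: dg_triple C ?Y ?T by (intro dg_tripleI assms DE.dg_category_tens T)
  interpret B: dg_triple D E ?T by (intro dg_tripleI assms T)
  interpret Q: dg_triple C D "Coh E ?T" by (intro dg_tripleI assms B.DE.dg_category_Coh)
  interpret R: dg_triple ?X E ?T by (intro dg_tripleI P.dg_category_tens assms T)
  let ?I = "fun_id ?T"
  let ?F = "transpose_fun C ?Y ?I" and ?br = "brace_args D E"
  note I = dg_functor_fun_id[OF T]
  note eta = A.dg_functor_transpose[OF I]
  \<comment> \<open>The unit of the adjunction for \<open>C\<close> and the tensor product of
    \<open>D\<close> and \<open>E\<close>, followed by currying.\<close>
  define K where "K = fun_comp C (curry_fun D E ?T) ?F"
  have K: "dg_functor C (Coh D (Coh E ?T)) K"
    unfolding K_def by (rule dg_functor_comp[OF eta B.dg_functor_curry])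
  have Ko: "fobj K x = transpose_fun D E (transpose_obj C ?Y ?I x)" if "x \<in> Obj C" for x
    using that A.dg_functor_transpose_obj[OF I] by (simp add: K_def curry_fun_def A.transpose_fun_simps[OF I])
  have Ka: "farr K f = cur D E ?T (farr ?F f)" if "f \<in> Arr C" for f
    using that A.transpose_fun_Hom[OF I that] by (simp add: K_def curry_fun_def A.DE.Coh_Hom)
  \<comment> \<open>The first untransposition yields a functor on the tensor product of
    \<open>C\<close> and \<open>D\<close> into cochains on \<open>E\<close>; \<open>?H\<close> is
    the second.\<close>
  define K' where "K' = untr C D (Coh E ?T) K"
  have K': "dg_functor ?X (Coh E ?T) K'"
    unfolding K'_def by (rule Q.dg_functor_untr[OF K])
  have Ko': "fobj K' (x, y) = transpose_obj D E (transpose_obj C ?Y ?I x) y" if "x \<in> Obj C" "y \<in> Obj D" for x y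
    using that unfolding K'_def Q.untr_fobj[OF K that]
    by (simp add: Ko B.transpose_fun_simps[OF A.dg_functor_transpose_obj[OF I]])
  let ?H = "untr ?X E ?T K'"
  have H: "dg_functor (tens ?X E) ?T ?H" by (rule R.dg_functor_untr[OF K'])
  have o: "fobj ?H ((x, y), z) = (x, (y, z))" if "x \<in> Obj C" "y \<in> Obj D" "z \<in> Obj E" for x y z
    using that R.untr_fobj[OF K', of "(x, y)" z] A.dg_functor_transpose_obj[OF I that(1)]
    by (simp add: Ko' P.tens_ops DE.tens_ops PT.tens_ops B.transpose_obj_simps A.transpose_obj_simps[OF I])
  have r: "farr ?H (rgt ?X E (x, y) h) = rgt C ?Y x (rgt D E y h)"
    if "x \<in> Obj C" "y \<in> Obj D" "h \<in> Arr E" for x y h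
    using that R.untr_rgt[OF K', of "(x, y)" h] A.dg_functor_transpose_obj[OF I that(1)] DE.rgt_Arr[OF that(2,3)] PT.rgt_Arr
    by (simp add: Ko' P.tens_ops B.transpose_obj_simps A.transpose_obj_simps[OF I])
  have er: "farr ?H (eps ?X E (rgt C D x g) z hs) = rgt C ?Y x (eps D E g z hs)"
    if "x \<in> Obj C" "g \<in> Arr D" "is_path E z hs" for x g z hs
    unfolding R.untr_eps[OF K' P.rgt_Arr(1)[OF that(1,2)] that(3)] unfolding K'_def Q.untr_rgt[OF K that(1,2)]
    using that DE.eps_Arr[OF that(2,3)] PT.rgt_Arr
    by (simp add: Ko B.transpose_fun_simps[OF A.dg_functor_transpose_obj[OF I that(1)]] A.transpose_obj_simps[OF I])
  have ee: "farr ?H (eps ?X E (eps C D f y gs) z hs) =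
          dsum ?T (dom C f, (y, z)) (cod C f, (path_end D y gs, path_end E z hs))
            (deg C f + shdeg D gs + shdeg E hs)
            (map (%(n, args). sscl ?T n (eps C ?Y f (y, z) args)) (?br y z gs hs))"
    if f: "f \<in> Arr C" and gs: "is_path D y gs" and hs: "is_path E z hs" for f y gs z hs
  proof -
    let ?\<Psi> = "farr ?F f"
    note t = A.transpose_fun_simps(2)[OF I f]
    have ob: "dom C f \<in> Obj C" "cod C f \<in> Obj C" "(y, z) \<in> Obj ?Y" "(path_end D y gs, path_end E z hs) \<in> Obj ?Y"
      using f P.src.dom_Obj P.src.cod_Obj P.tgt.is_path_Obj[OF gs] DE.tgt.is_path_Obj[OF hs] by (auto simp: DE.tens_ops)
    have "farr ?H (eps ?X E (eps C D f y gs) z hs) = cval (cur1 D E ?T ?\<Psi> y gs) z hs"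
      unfolding R.untr_eps[OF K' P.eps_Arr(1)[OF f gs] hs] unfolding K'_def Q.untr_eps[OF K f gs]
      using gs by (simp add: Ka[OF f] cur_def)
    also have "... = dsum ?T (dom C f, (y, z)) (cod C f, (path_end D y gs, path_end E z hs))
            (deg C f + shdeg D gs + shdeg E hs)
            (map (%(n, args). sscl ?T n (cval ?\<Psi> (y, z) args)) (?br y z gs hs))"
      using hs ob by (simp add: cur1_def t A.transpose_obj_simps[OF I] PT.tens_ops)
    also have "map (%(n, args). sscl ?T n (cval ?\<Psi> (y, z) args)) (?br y z gs hs)
      = map (%(n, args). sscl ?T n (eps C ?Y f (y, z) args)) (?br y z gs hs)"
      using DE.brace_args_path(1)[OF gs hs] PT.eps_Arr[OF f] by (auto simp: t)
    finally show ?thesis .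
  qed
  have ex: "assoc_spec C D E ?H"
    unfolding assoc_spec_def by (intro conjI ballI allI impI H o r er ee) auto
  moreover have "H' = ?H" if "assoc_spec C D E H'" for H'
    using that ex unfolding assoc_spec_def by (intro tens_tens_functor_eqI[OF assms]) auto
  ultimately show ?thesis
    unfolding assoc_map_def assoc_spec_def[symmetric] by (rule theI)
qed

lemma assoc_map_props:
  assumes "dg_category C" "dg_category D" "dg_category E"
  shows "dg_functor (tens (tens C D) E) (tens C (tens D E)) (assoc_map C D E)"
    and "[|x \<in> Obj C; y \<in> Obj D; z \<in> Obj E|] ==> fobj (assoc_map C D E) ((x, y), z) = (x, (y, z))"
    and "[|x \<in> Obj C; y \<in> Obj D; h \<in> Arr E|] ==>
        farr (assoc_map C D E) (rgt (tens C D) E (x, y) h) = rgt C (tens D E) x (rgt D E y h)"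
    and "[|x \<in> Obj C; g \<in> Arr D; is_path E z hs|] ==>
        farr (assoc_map C D E) (eps (tens C D) E (rgt C D x g) z hs) = rgt C (tens D E) x (eps D E g z hs)"
    and "[|f \<in> Arr C; is_path D y gs; is_path E z hs|] ==>
        farr (assoc_map C D E) (eps (tens C D) E (eps C D f y gs) z hs) =
          dsum (tens C (tens D E)) (dom C f, (y, z)) (cod C f, (path_end D y gs, path_end E z hs))
            (deg C f + shdeg D gs + shdeg E hs)
            (map (%(n, args). sscl (tens C (tens D E)) n (eps C (tens D E) f (y, z) args))
                 (brace_args D E y z gs hs))"
  using assoc_map_spec[OF assms] unfolding assoc_spec_def by auto

section \<open>The twisted composition\<close>

lemma brc_spl_swap: "brc C D rg ep (%w. spl (P w) us) y z gs hs = spl (%u v. brc C D rg ep (%w. P w u v) y z gs hs) us"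
  by (induction us arbitrary: P) (simp_all add: brc_add)

context dg_category
begin

text \<open>A function that is merely additive already respects zero, signs and finite sums, which
  is all that signed brace sums require.\<close>

lemma additive_Hom:
  fixes k :: "'m => 'r::ring_1"
  assumes k: "!!f g. f \<in> Hom C x y n ==> g \<in> Hom C x y n ==> k (add C f g) = k f + k g"
    and o: "x \<in> Obj C" "y \<in> Obj C"
  shows "f \<in> Hom C x y n ==> k (sscl C m f) = sg m * k f"
    "(!!f. f \<in> set fs ==> f \<in> Hom C x y n) ==> k (dsum C x y n fs) = (\<Sum>f\<leftarrow>fs. k f)"
proof -
  have z: "k (zer C x y n) = 0"
    using k[OF zer_Hom zer_Hom] o add_zer[OF zer_Hom] by (metis add_cancel_left_left)
  show "k (sscl C m f) = sg m * k f" if f: "f \<in> Hom C x y n"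
    using k[OF f scl_Hom[OF f], of "-1"] add_neg[OF f] z scl_one[OF Hom_Arr[OF f]]
    unfolding powi_sg by (auto simp: sg_def eq_neg_iff_add_eq_0 add.commute)
  show "k (dsum C x y n fs) = (\<Sum>f\<leftarrow>fs. k f)" if "!!f. f \<in> set fs ==> f \<in> Hom C x y n"
    using that
  proof (induction fs)
    case (Cons f fs)
    have "dsum C x y n fs \<in> Hom C x y n" using Cons.prems by (intro dsum_Hom o) auto
    moreover have "dsum C x y n (f # fs) = add C f (dsum C x y n fs)" by (simp add: dsum_def)
    ultimately show ?case using Cons k[of f] by simp
  qed (simp add: dsum_def z)
qed

end

text \<open>The brace operator followed by evaluation: letters are values of cochains and of
  functors, hence arrows of \<open>D\<close>.\<close>

abbreviation brv where
  "brv C D \<equiv> brc (Coh C D) C farr cval"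

text \<open>The formulas on objects and generators. \<open>k\<close> is an arbitrary function,
  additive on the relevant Hom space, since the last formula is needed both for \<open>rho\<close>
  and for a further brace operator applied to the value.\<close>

lemma twisted_comp_props:
  fixes C :: "('k::field, 'c, 'f) dgcat" and D :: "('k, 'd, 'g) dgcat" and E :: "('k, 'e, 'h) dgcat"
    and k :: "'h => 'r::ring_1"
  assumes "dg_category C" "dg_category D" "dg_category E"
  shows "dg_functor (tens (Coh D E) (Coh C D)) (Coh C E) (twisted_comp C D E)"
    and "[|dg_functor D E F; dg_functor C D G|] ==> fobj (twisted_comp C D E) (F, G) = fun_comp C F G"
    and "[|dg_functor D E F; is_cochain C D \<Phi>; is_path C x fs|] ==>
      cval (farr (twisted_comp C D E) (rgt (Coh D E) (Coh C D) F \<Phi>)) x fs = farr F (cval \<Phi> x fs)"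
    and "[|is_cochain D E \<Psi>; is_path (Coh C D) G \<Phi>s; is_path C x fs;
      !!f g. f \<in> Hom E (fobj (csrc \<Psi>) (fobj G x)) (fobj (ctgt \<Psi>) (fobj (path_end (Coh C D) G \<Phi>s) (path_end C x fs)))
          (cdeg \<Psi> + shdeg (Coh C D) \<Phi>s + shdeg C fs) ==>
        g \<in> Hom E (fobj (csrc \<Psi>) (fobj G x)) (fobj (ctgt \<Psi>) (fobj (path_end (Coh C D) G \<Phi>s) (path_end C x fs)))
          (cdeg \<Psi> + shdeg (Coh C D) \<Phi>s + shdeg C fs) ==> k (add E f g) = k f + k g|] ==>
      k (cval (farr (twisted_comp C D E) (eps (Coh D E) (Coh C D) \<Psi> G \<Phi>s)) x fs)
        = brv C D (%w. k (cval \<Psi> (fobj G x) w)) G x \<Phi>s fs"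
proof -
  interpret CD: dg_pair C D using assms by (simp add: dg_pair_def)
  interpret DE: dg_pair D E using assms by (simp add: dg_pair_def)
  let ?P = "Coh D E" and ?Q = "Coh C D"
  let ?X = "tens ?P ?Q"
  let ?Y = "tens ?Q C"
  let ?M = "twisted_comp C D E"
  let ?Z = "tens ?P ?Y"
  let ?T = "tens ?X C"
  let ?e = "eval_fun C D"
  let ?ep = "eps ?P ?Y"
  note cats = DE.dg_category_Coh CD.dg_category_Coh
  interpret PQ: dg_pair ?P ?Q by (intro dg_pair.intro cats)
  interpret QC: dg_pair ?Q C by (intro dg_pair.intro cats assms)
  interpret PX: dg_pair ?P "?Y" by (intro dg_pair.intro cats QC.dg_category_tens)
  interpret XC: dg_triple "?X" C E by (intro dg_tripleI PQ.dg_category_tens assms)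
  note I = dg_functor_fun_id[OF cats(1)]
  note ev = eval_fun_props[OF assms(1,2)] and ev' = eval_fun_props[OF assms(2,3)]
  note tf = tens_fun_props[OF I ev(1)]
  note as = assoc_map_props[OF cats assms(1)]
  let ?tf = "tens_fun ?P ?Y ?P D (fun_id ?P) ?e"
  \<comment> \<open>The part of the twisted composition that comes after the associativity
    map.\<close>
  define V where "V = fun_comp ?Z (eval_fun D E) ?tf"
  have V: "dg_functor ?Z E V"
    unfolding V_def by (rule dg_functor_comp[OF tf(1) ev'(1)])
  interpret V: dg_functor "?Z" E V by (rule V)
  define W where "W = fun_comp ?T (eval_fun D E) (fun_comp ?T ?tf (assoc_map ?P ?Q C))"
  have W: "dg_functor ?T E W"
    unfolding W_def by (rule dg_functor_comp[OF dg_functor_comp[OF as(1) tf(1)] ev'(1)])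
  have M: "?M = transpose_fun ?X C W"
    by (simp add: twisted_comp_def W_def Let_def)
  show "dg_functor ?X (Coh C E) ?M"
    unfolding M by (rule XC.dg_functor_transpose[OF W])
  have Vo: "fobj V (F, (G, x)) = fobj F (fobj G x)" if "dg_functor D E F" "dg_functor C D G" "x \<in> Obj C" for F G x
    using that dg_functor_Obj[OF that(2)] by (simp add: V_def PX.tens_ops QC.tens_ops tf ev ev')
  have Vr: "farr V (rgt ?P ?Y F l) = farr F (farr ?e l)" if "dg_functor D E F" "l \<in> Arr ?Y" for F l
    using that dg_functor_Arr(1)[OF ev(1) that(2)] PX.rgt_Arr[of F l] by (simp add: V_def tf(4) ev'(4))
  have Ve: "farr V (?ep \<Psi> (G, x) w) = cval \<Psi> (fobj G x) (map (farr ?e) w)"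
    if "is_cochain D E \<Psi>" "is_path ?Y (G, x) w" for \<Psi> G x w
  proof -
    have o: "dg_functor C D G" "x \<in> Obj C" using dg_category.is_path_Obj[OF QC.dg_category_tens that(2)] by (auto simp: QC.tens_ops)
    then show ?thesis
      using that dg_functor_path(1)[OF ev(1) that(2)] PX.eps_Arr[of \<Psi> "(G, x)" w] ev(2)[of G x]
      by (simp add: V_def tf(3) ev'(3))
  qed
  have Wo: "fobj W ((F, G), x) = fobj F (fobj G x)" if "dg_functor D E F" "dg_functor C D G" "x \<in> Obj C" for F G x
    using Vo[OF that] that by (simp add: W_def V_def as PQ.tens_ops XC.tens_ops PX.tens_ops QC.tens_ops)
  have WV: "farr W l = farr V (farr (assoc_map ?P ?Q C) l)" if "l \<in> Arr ?T" for l
    using that dg_functor_Arr(1)[OF as(1) that] by (simp add: W_def V_def)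
  show "fobj ?M (F, G) = fun_comp C F G" if FG: "dg_functor D E F" "dg_functor C D G"
  proof (rule dg_functor_eqI)
    have o: "(F, G) \<in> Obj ?X" using FG by (simp add: PQ.tens_ops)
    have f: "fobj ?M (F, G) = transpose_obj ?X C W (F, G)"
      using o by (simp add: M XC.transpose_fun_simps[OF W])
    show "dg_functor C E (fobj ?M (F, G))" unfolding f by (rule XC.dg_functor_transpose_obj[OF W o])
    show "dg_functor C E (fun_comp C F G)" by (rule dg_functor_comp[OF FG(2,1)])
    show "fobj (fobj ?M (F, G)) x = fobj (fun_comp C F G) x" if "x \<in> Obj C" for x
      using that Wo[OF FG] by (simp add: f XC.transpose_obj_simps[OF W])
    show "farr (fobj ?M (F, G)) h = farr (fun_comp C F G) h" if h: "h \<in> Arr C" for h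
      using h FG WV[OF XC.rgt_Arr(1)[OF o h]] QC.rgt_Arr(1)[of G h] as(3)[of F G h]
      by (simp add: f XC.transpose_obj_simps[OF W] Vr ev)
  qed
  show "cval (farr ?M (rgt ?P ?Q F \<Phi>)) x fs = farr F (cval \<Phi> x fs)"
    if F: "dg_functor D E F" and \<Phi>: "is_cochain C D \<Phi>" and p: "is_path C x fs"
  proof -
    have a: "rgt ?P ?Q F \<Phi> \<in> Arr ?X" using F \<Phi> PQ.rgt_Arr(1)[of F \<Phi>] by simp
    show ?thesis
      using F \<Phi> p WV[OF XC.eps_Arr(1)[OF a p]] QC.eps_Arr(1)[of \<Phi> x fs] as(4)[of F \<Phi> x fs]
      by (simp add: M XC.transpose_fun_simps(2)[OF W a] Vr ev)
  qed
  assume \<Psi>: "is_cochain D E \<Psi>" and \<Phi>s: "is_path ?Q G \<Phi>s" and p: "is_path C x fs"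
  let ?x = "fobj (csrc \<Psi>) (fobj G x)" and ?y = "fobj (ctgt \<Psi>) (fobj (path_end ?Q G \<Phi>s) (path_end C x fs))"
  let ?n = "cdeg \<Psi> + shdeg ?Q \<Phi>s + shdeg C fs"
  assume k: "!!f g. f \<in> Hom E ?x ?y ?n ==> g \<in> Hom E ?x ?y ?n ==> k (add E f g) = k f + k g"
  have \<Psi>': "\<Psi> \<in> Arr ?P" using \<Psi> by simp
  let ?s = "(csrc \<Psi>, (G, x))" and ?t = "(ctgt \<Psi>, (path_end ?Q G \<Phi>s, path_end C x fs))"
  have fo: "dg_functor D E (csrc \<Psi>)" "dg_functor D E (ctgt \<Psi>)" "dg_functor C D G" "dg_functor C D (path_end ?Q G \<Phi>s)"
    "x \<in> Obj C" "path_end C x fs \<in> Obj C"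
    using DE.cochain_csrc[OF \<Psi>] DE.cochain_ctgt[OF \<Psi>] PQ.tgt.is_path_Obj[OF \<Phi>s] CD.src.is_path_Obj[OF p] by auto
  then have o: "?s \<in> Obj ?Z" "?t \<in> Obj ?Z"
    by (auto simp: PX.tens_ops QC.tens_ops)
  have kV: "k (farr V (add ?Z f g)) = k (farr V f) + k (farr V g)"
    if "f \<in> Hom ?Z ?s ?t ?n" "g \<in> Hom ?Z ?s ?t ?n" for f g
    using V.farr_add[OF that] k V.farr_Hom[OF that(1)] V.farr_Hom[OF that(2)] fo by (simp add: Vo)
  have scl: "k (farr V (sscl ?Z m f)) = sg m * k (farr V f)"
    if "f \<in> Hom ?Z ?s ?t ?n" for f m
    by (rule V.source.additive_Hom(1)[of ?s ?t ?n "%f. k (farr V f)"]) (use kV o that in auto)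
  note ba = QC.brace_args_path[OF \<Phi>s p]
  let ?L = "map (%(n, args). sscl ?Z n (?ep \<Psi> (G, x) args)) (brace_args ?Q C G x \<Phi>s fs)"
  have h: "?ep \<Psi> (G, x) w \<in> Hom ?Z ?s ?t ?n"
    if "(n, w) \<in> set (brace_args ?Q C G x \<Phi>s fs)" for n w
    using PX.eps_Arr[OF \<Psi>' ba(1)[OF that]] ba(2,3)[OF that] \<Psi> by (simp add: Hom_def add.assoc)
  have L: "f \<in> Hom ?Z ?s ?t ?n" if "f \<in> set ?L" for f
    using that h by (auto intro!: V.source.scl_Hom)
  have a: "eps ?P ?Q \<Psi> G \<Phi>s \<in> Arr ?X" by (rule PQ.eps_Arr[OF \<Psi>' \<Phi>s])
  have "k (cval (farr ?M (eps ?P ?Q \<Psi> G \<Phi>s)) x fs) = k (farr V (dsum ?Z ?s ?t ?n ?L))"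
    using p WV[OF XC.eps_Arr(1)[OF a p]] as(5)[OF \<Psi>' \<Phi>s p] by (simp add: M XC.transpose_fun_simps(2)[OF W a])
  also have "... = (\<Sum>f\<leftarrow>?L. k (farr V f))" by (rule V.source.additive_Hom(2)[of ?s ?t ?n "%f. k (farr V f)"]) (use kV o L in auto)
  also have "... = (\<Sum>(n, args)\<leftarrow>brace_args ?Q C G x \<Phi>s fs. sg n * k (farr V (?ep \<Psi> (G, x) args)))"
    unfolding map_map using scl[OF h] by (intro arg_cong[of _ _ sum_list] map_cong HOL.refl) auto
  also have "... = QC.Br (%args. k (farr V (?ep \<Psi> (G, x) args))) G x \<Phi>s fs"
    by (rule brace_args_brc)
  also have "... = QC.Br (%w. k (cval \<Psi> (fobj G x) (map (farr ?e) w))) G x \<Phi>s fs"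
    by (rule QC.brc_cong[OF \<Phi>s p]) (simp add: Ve \<Psi>)
  also have "... = brc ?Q C (%y h. farr ?e (rgt ?Q C y h)) (%g z u. farr ?e (eps ?Q C g z u))
      (%w. k (cval \<Psi> (fobj G x) w)) G x \<Phi>s fs"
    by (rule brc_map)
  \<comment> \<open>Evaluation sends the generators to values of cochains and functors, so the words
    now consist of arrows of \<open>D\<close>.\<close>
  also have "... = brv C D (%w. k (cval \<Psi> (fobj G x) w)) G x \<Phi>s fs"
    by (rule QC.brc_cong_letters[where e = fobj and T = D, symmetric])
      (use ev \<Phi>s p in "auto intro: dg_functor_Obj CD.cochain_Hom dg_functor.farr_Hom[OF _ CD.src.Arr_Hom]")
  finally show "k (cval (farr ?M (eps ?P ?Q \<Psi> G \<Phi>s)) x fs)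
        = brv C D (%w. k (cval \<Psi> (fobj G x) w)) G x \<Phi>s fs" .
qed

lemma (in dg_pair) brv_cong:
  assumes "is_path (Coh C D) G \<Phi>s" "is_path C x fs"
    and "!!w. is_path D (fobj G x) w ==> path_end D (fobj G x) w = fobj (path_end (Coh C D) G \<Phi>s) (path_end C x fs)
      ==> shdeg D w = shdeg (Coh C D) \<Phi>s + shdeg C fs ==> \<phi> w = \<psi> w"
  shows "brv C D \<phi> G x \<Phi>s fs = brv C D \<psi> G x \<Phi>s fs"
proof -
  interpret P: dg_pair "Coh C D" C by (intro dg_pair.intro dg_category_Coh src.dg_category_axioms)
  show ?thesis
    by (intro P.brc_cong_letters[where e = fobj and T = D] assms cochain_Hom)
      (auto intro: dg_functor_Obj cochain_Hom dg_functor.farr_Hom[OF _ src.Arr_Hom])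
qed

text \<open>On the left \<open>\<Theta>s\<close> and \<open>us\<close> are braced first and the
  result with \<open>\<Phi>s\<close>; on the right \<open>\<Phi>s\<close> and
  \<open>\<Theta>s\<close> are composed first and then braced with \<open>us\<close>. Both sides
  satisfy the same recursion over the origin of the first letter in \<open>C\<close>.\<close>

lemma brv_assoc:
  fixes A :: "('k::field, 'a, 'x) dgcat" and B :: "('k, 'b, 'y) dgcat" and C :: "('k, 'c, 'f) dgcat"
    and \<psi> :: "'f list => 'r::ring_1"
  assumes "dg_category A" "dg_category B" "dg_category C" and \<kappa>: "\<kappa> 1 = 1"
    and "is_path (Coh B C) G \<Phi>s" "is_path (Coh A B) H \<Theta>s" "is_path A a us"
    and "dg_category.mlin C \<kappa> (fobj G (fobj H a)) \<psi>"
  shows "brv A B (%w. brv B C \<psi> G (fobj H a) \<Phi>s w) H a \<Theta>s us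
    = brc (Coh B C) (Coh A B) (%G \<Theta>. farr (twisted_comp A B C) (rgt (Coh B C) (Coh A B) G \<Theta>))
        (%\<Phi> H u. farr (twisted_comp A B C) (eps (Coh B C) (Coh A B) \<Phi> H u))
        (%W. brv A C \<psi> (fun_comp A G H) a W us) G H \<Phi>s \<Theta>s"
  using assms(5-)
proof (induction "length \<Phi>s + length \<Theta>s + length us" arbitrary: \<psi> G H a \<Phi>s \<Theta>s us rule: less_induct)
  case less
  interpret AB: dg_pair A B using assms by (simp add: dg_pair_def)
  interpret BC: dg_pair B C using assms by (simp add: dg_pair_def)
  interpret AC: dg_pair A C using assms by (simp add: dg_pair_def)
  interpret MM: dg_pair "Coh B C" "Coh A B" by (intro dg_pair.intro AB.dg_category_Coh BC.dg_category_Coh)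
  note M = twisted_comp_props[OF assms(1-3)]
  let ?BC = "Coh B C"
    and ?AB = "Coh A B"
    and ?b = "brv A B"
  let ?M = "twisted_comp A B C"
  let ?mr = "%G \<Theta>. farr ?M (rgt ?BC ?AB G \<Theta>)" and ?me = "%\<Phi> H u. farr ?M (eps ?BC ?AB \<Phi> H u)"
  let ?br = "brc ?BC ?AB ?mr ?me"
  let ?L = "%\<psi> G H a \<Phi>s \<Theta>s us. ?b (%w. brv B C \<psi> G (fobj H a) \<Phi>s w) H a \<Theta>s us"
  let ?R = "%\<psi> G H a \<Phi>s \<Theta>s us. ?br (%W. brv A C \<psi> (fun_comp A G H) a W us) G H \<Phi>s \<Theta>s"
  note IH = less.hyps
  note \<Phi>s = less.prems(1) and \<Theta>s = less.prems(2) and us = less.prems(3) and m = less.prems(4)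
  have G: "dg_functor B C G" and H: "dg_functor A B H" and a: "a \<in> Obj A"
    using MM.src.is_path_Obj[OF \<Phi>s] MM.tgt.is_path_Obj[OF \<Theta>s] AB.src.is_path_Obj[OF us] by auto
  have tail: "BC.tgt.mlin \<kappa> (cod C l) (%w. \<psi> (l # w))" if "l \<in> Arr C" "dom C l = fobj G (fobj H a)" for l
    using m that by (intro BC.tgt.mlin_tail) simp_all
  let ?h = "%p. path_end ?AB H p"
  let ?e = "%u. path_end A a u"
  let ?d = "%q. shdeg ?AB q"
  let ?t = "%l. %w. \<psi> (l # w)"
  \<comment> \<open>The contributions to this recursion: \<open>e0\<close> is the empty word; in
    \<open>e1\<close> the first letter is a value of the first \<open>\<Phi>\<close> on letters
    coming from \<open>p\<close> and \<open>u\<close>; in \<open>e2\<close> it is \<open>G\<close>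
    applied to a value of the first \<open>\<Theta>\<close>; in \<open>e3\<close> it is
    \<open>G\<close> applied to \<open>H\<close> of the first letter of \<open>us\<close>.\<close>
  define e0 where "e0 = (if \<Phi>s = [] \<and> \<Theta>s = [] \<and> us = [] then \<psi> [] else 0)"
  define e1 where "e1 = (case \<Phi>s of [] => 0 | \<Phi> # \<Phi>s' =>
     spl (%p q. spl (%u v. sg (?d p * shdeg A v + (deg ?BC \<Phi> - 1) * (?d q + shdeg A v))
       * ?b (%s. ?L (%w. \<psi> (cval \<Phi> (fobj H a) s # w)) (ctgt \<Phi>) (?h p) (?e u) \<Phi>s' q v) H a p u) us) \<Theta>s)"
  define e2 where "e2 = (case \<Theta>s of [] => 0 | \<Theta> # \<Theta>s' => spl (%u v. sg ((deg ?AB \<Theta> - 1) * shdeg A v)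
       * ?L (%w. \<psi> (farr G (cval \<Theta> a u) # w)) G (ctgt \<Theta>) (?e u) \<Phi>s \<Theta>s' v) us)"
  define e3 where "e3 = (case us of [] => 0 | f # us' => ?L (%w. \<psi> (farr G (farr H f) # w)) G H (cod A f) \<Phi>s \<Theta>s us')"
  have pth: "is_path ?AB H p" "is_path ?AB (?h p) q" if "p @ q = \<Theta>s" for p q
    using \<Theta>s that by (auto simp: MM.tgt.is_path_append)
  have put: "is_path A a u" "is_path A (?e u) v" if "u @ v = us" for u v
    using us that by (auto simp: AB.src.is_path_append)
  have "?L \<psi> G H a \<Phi>s \<Theta>s us = e0 + (e1 + (e2 + e3))"
  proof -
    let ?N = "%l w. brv B C (%w. \<psi> (farr G l # w)) G (cod B l) \<Phi>s w"
    let ?Q = "%s t. case \<Phi>s of [] => 0 | \<Phi> # \<Phi>s' => sg ((deg ?BC \<Phi> - 1) * shdeg B t)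
        * brv B C (%w. \<psi> (cval \<Phi> (fobj H a) s # w)) (ctgt \<Phi>) (path_end B (fobj H a) s) \<Phi>s' t"
    have "brv B C \<psi> G (fobj H a) \<Phi>s w = (if \<Phi>s = [] \<and> w = [] then \<psi> [] else 0)
      + (spl ?Q w + (case w of [] => 0 | l # w' => ?N l w'))" for w
      by (subst brc_fst_letter) (simp add: fst_letter_def split: list.split)
    then have "?L \<psi> G H a \<Phi>s \<Theta>s us = ?b (%w. if \<Phi>s = [] \<and> w = [] then \<psi> [] else 0) H a \<Theta>s us
       + (?b (%w. spl ?Q w) H a \<Theta>s us + ?b (%w. case w of [] => 0 | l # w' => ?N l w') H a \<Theta>s us)"
      by (simp only: brc_add)
    also have "?b (%w. if \<Phi>s = [] \<and> w = [] then \<psi> [] else 0) H a \<Theta>s us = e0"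
      by (subst brc_short) (auto simp: e0_def split: list.split)
    also have "?b (%w. spl ?Q w) H a \<Theta>s us = e1"
    proof (cases \<Phi>s)
      case (Cons \<Phi> \<Phi>s')
      have \<Phi>: "is_path ?BC (ctgt \<Phi>) \<Phi>s'" using \<Phi>s Cons by simp
      show ?thesis unfolding brc_spl spl2_def e1_def Cons list.case
      proof (intro spl_cong)
        fix p q u v assume "p @ q = \<Theta>s" "u @ v = us"
        note pq = pth[OF this(1)] and uv = put[OF this(2)]
        have hp: "dg_functor A B (?h p)" using MM.tgt.is_path_Obj[OF pq(1)] by simp
        have "?b (%s. ?b (%t. sg ((deg ?BC \<Phi> - 1) * shdeg B t)
            * brv B C (%w. \<psi> (cval \<Phi> (fobj H a) s # w)) (ctgt \<Phi>) (path_end B (fobj H a) s) \<Phi>s' t)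
              (?h p) (?e u) q v) H a p u
          = ?b (%s. sg ((deg ?BC \<Phi> - 1) * (?d q + shdeg A v))
            * ?L (%w. \<psi> (cval \<Phi> (fobj H a) s # w)) (ctgt \<Phi>) (?h p) (?e u) \<Phi>s' q v) H a p u"
        proof (rule AB.brv_cong[OF pq(1) uv(1)])
          fix s assume s: "path_end B (fobj H a) s = fobj (?h p) (?e u)"
          show "?b (%t. sg ((deg ?BC \<Phi> - 1) * shdeg B t)
            * brv B C (%w. \<psi> (cval \<Phi> (fobj H a) s # w)) (ctgt \<Phi>) (path_end B (fobj H a) s) \<Phi>s' t)
              (?h p) (?e u) q v
            = sg ((deg ?BC \<Phi> - 1) * (?d q + shdeg A v))
            * ?L (%w. \<psi> (cval \<Phi> (fobj H a) s # w)) (ctgt \<Phi>) (?h p) (?e u) \<Phi>s' q v"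
            unfolding s brc_mult_left[symmetric] by (rule AB.brv_cong[OF pq(2) uv(2)]) simp
        qed
        then show "sg (?d p * shdeg A v) * ?b (%s. ?b (%t. sg ((deg ?BC \<Phi> - 1) * shdeg B t)
            * brv B C (%w. \<psi> (cval \<Phi> (fobj H a) s # w)) (ctgt \<Phi>) (path_end B (fobj H a) s) \<Phi>s' t)
              (?h p) (?e u) q v) H a p u
          = sg (?d p * shdeg A v + (deg ?BC \<Phi> - 1) * (?d q + shdeg A v))
            * ?b (%s. ?L (%w. \<psi> (cval \<Phi> (fobj H a) s # w)) (ctgt \<Phi>) (?h p) (?e u) \<Phi>s' q v) H a p u"
          unfolding brc_mult_left by (simp only: sg_add mult.assoc)
      qed
    qed (simp add: e1_def)
    also have "?b (%w. case w of [] => 0 | l # w' => ?N l w') H a \<Theta>s us = e2 + e3"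
    proof -
      have "?b (%w. case w of [] => 0 | l # w' => ?N l w') H a \<Theta>s us
        = (case \<Theta>s of [] => 0 | \<Theta> # \<Theta>s' => spl (%u v. sg ((deg ?AB \<Theta> - 1) * shdeg A v)
            * ?b (?N (cval \<Theta> a u)) (ctgt \<Theta>) (?e u) \<Theta>s' v) us)
         + (case us of [] => 0 | f # us' => ?b (?N (farr H f)) H (cod A f) \<Theta>s us')"
        by (subst brc_fst_letter) (simp add: fst_letter_def split: list.split)
      also have "(case us of [] => 0 | f # us' => ?b (?N (farr H f)) H (cod A f) \<Theta>s us') = e3"
        unfolding e3_def using us by (auto simp: dg_functor_Arr[OF H] split: list.split)
      also have "(case \<Theta>s of [] => 0 | \<Theta> # \<Theta>s' => spl (%u v. sg ((deg ?AB \<Theta> - 1) * shdeg A v)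
            * ?b (?N (cval \<Theta> a u)) (ctgt \<Theta>) (?e u) \<Theta>s' v) us) = e2"
      proof (cases \<Theta>s)
        case (Cons \<Theta> \<Theta>s')
        show ?thesis unfolding Cons list.case e2_def
        proof (rule spl_cong)
        fix u v assume uv: "u @ v = us"
        have "is_cochain A B \<Theta>" using \<Theta>s Cons by simp
        then have "cod B (cval \<Theta> a u) = fobj (ctgt \<Theta>) (?e u)"
          using AB.cochain_Hom[OF _ put(1)[OF uv]] by (simp add: Hom_def)
        then show "sg ((deg ?AB \<Theta> - 1) * shdeg A v)
            * ?b (?N (cval \<Theta> a u)) (ctgt \<Theta>) (?e u) \<Theta>s' v
          = sg ((deg ?AB \<Theta> - 1) * shdeg A v)
            * ?L (%w. \<psi> (farr G (cval \<Theta> a u) # w)) G (ctgt \<Theta>) (?e u) \<Phi>s \<Theta>s' v" by simp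
      qed
      qed (simp add: e2_def)
      finally show ?thesis .
    qed
    finally show ?thesis .
  qed
  moreover have "?R \<psi> G H a \<Phi>s \<Theta>s us = e0 + (e1 + (e2 + e3))"
  proof -
    let ?GH = "fun_comp A G H"
    let ?K = "%l W. spl (%u v. sg ((deg (Coh A C) l - 1) * shdeg A v)
        * brv A C (%w. \<psi> (cval l a u # w)) (ctgt l) (?e u) W v) us"
    let ?N = "%W. case us of [] => 0 | f # us' => brv A C (%w. \<psi> (farr ?GH f # w)) ?GH (cod A f) W us'"
    have "brv A C \<psi> ?GH a W us = (if W = [] \<and> us = [] then \<psi> [] else 0)
      + ((case W of [] => 0 | l # W' => ?K l W') + ?N W)" for W
      by (subst brc_fst_letter) (simp add: fst_letter_def split: list.split)
    then have "?R \<psi> G H a \<Phi>s \<Theta>s us = ?br (%W. if W = [] \<and> us = [] then \<psi> [] else 0) G H \<Phi>s \<Theta>s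
       + (?br (%W. case W of [] => 0 | l # W' => ?K l W') G H \<Phi>s \<Theta>s + ?br ?N G H \<Phi>s \<Theta>s)"
      by (simp only: brc_add)
    also have "?br (%W. if W = [] \<and> us = [] then \<psi> [] else 0) G H \<Phi>s \<Theta>s = e0"
      by (subst brc_short) (auto simp: e0_def split: list.split)
    also have "?br ?N G H \<Phi>s \<Theta>s = e3"
    proof (cases us)
      case (Cons f us')
      then have f: "f \<in> Arr A" "dom A f = a" "is_path A (cod A f) us'" using us by auto
      have l: "farr G (farr H f) \<in> Arr C" "dom C (farr G (farr H f)) = fobj G (fobj H a)"
        "cod C (farr G (farr H f)) = fobj G (fobj H (cod A f))"
        using dg_functor_Arr[OF H f(1)] dg_functor_Arr[OF G, of "farr H f"] f by auto
      show ?thesis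
        using IH[OF _ \<Phi>s \<Theta>s f(3), of "%w. \<psi> (farr G (farr H f) # w)"] tail[OF l(1,2)] f(1) l(3) by (simp add: Cons e3_def)
    qed (simp add: e3_def)
    also have "?br (%W. case W of [] => 0 | l # W' => ?K l W') G H \<Phi>s \<Theta>s = e1 + e2"
    proof -
      \<comment> \<open>The cut of \<open>us\<close> does not depend on how \<open>\<Phi>s\<close>
        and \<open>\<Theta>s\<close> are braced, so the two sums may be interchanged.\<close>
      have swap: "?br (?K l) G' H' \<Phi>' \<Theta>' = spl (%u v. sg ((deg (Coh A C) l - 1) * shdeg A v)
        * ?br (%W. brv A C (%w. \<psi> (cval l a u # w)) (ctgt l) (?e u) W v) G' H' \<Phi>' \<Theta>') us" for l G' H' \<Phi>' \<Theta>'
        by (simp only: brc_spl_swap brc_mult_left)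
      have "?br (%W. case W of [] => 0 | l # W' => ?K l W') G H \<Phi>s \<Theta>s
        = (case \<Phi>s of [] => 0 | \<Phi> # \<Phi>s' => spl (%p q. sg ((deg ?BC \<Phi> - 1) * ?d q)
            * ?br (?K (?me \<Phi> H p)) (ctgt \<Phi>) (?h p) \<Phi>s' q) \<Theta>s)
         + (case \<Theta>s of [] => 0 | \<Theta> # \<Theta>s' => ?br (?K (?mr G \<Theta>)) G (ctgt \<Theta>) \<Phi>s \<Theta>s')"
        by (subst brc_fst_letter) (simp add: fst_letter_def split: list.split)
      also have "(case \<Theta>s of [] => 0 | \<Theta> # \<Theta>s' => ?br (?K (?mr G \<Theta>)) G (ctgt \<Theta>) \<Phi>s \<Theta>s') = e2"
      proof (cases \<Theta>s)
        case (Cons \<Theta> \<Theta>s')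
        then have \<Theta>: "is_cochain A B \<Theta>" "csrc \<Theta> = H" "is_path ?AB (ctgt \<Theta>) \<Theta>s'" using \<Theta>s by auto
        have r: "rgt ?BC ?AB G \<Theta> \<in> Arr MM.X" "dom MM.X (rgt ?BC ?AB G \<Theta>) = (G, H)"
          "cod MM.X (rgt ?BC ?AB G \<Theta>) = (G, ctgt \<Theta>)" "deg MM.X (rgt ?BC ?AB G \<Theta>) = cdeg \<Theta>"
          using MM.rgt_Arr[of G \<Theta>] G \<Theta> by auto
        have c: "ctgt (?mr G \<Theta>) = fun_comp A G (ctgt \<Theta>)" "cdeg (?mr G \<Theta>) = cdeg \<Theta>"
          using dg_functor_Arr(3,4)[OF M(1) r(1)] r M(2)[OF G AB.cochain_ctgt[OF \<Theta>(1)]] by auto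
        show ?thesis unfolding Cons list.case e2_def swap
        proof (rule spl_cong)
          fix u v assume uv: "u @ v = us"
          note p = put[OF uv]
          have v: "cval (?mr G \<Theta>) a u = farr G (cval \<Theta> a u)" by (rule M(3)[OF G \<Theta>(1) p(1)])
          have l: "farr G (cval \<Theta> a u) \<in> Arr C" "dom C (farr G (cval \<Theta> a u)) = fobj G (fobj H a)"
            "cod C (farr G (cval \<Theta> a u)) = fobj G (fobj (ctgt \<Theta>) (?e u))"
            using AB.cochain_Hom[OF \<Theta>(1) p(1)] dg_functor_Arr[OF G, of "cval \<Theta> a u"] \<Theta>(2) by (auto simp: Hom_def)
          have "length \<Phi>s + length \<Theta>s' + length v < length \<Phi>s + length \<Theta>s + length us" using Cons uv by auto
          from IH[OF this \<Phi>s \<Theta>(3) p(2), of "%w. \<psi> (farr G (cval \<Theta> a u) # w)"] tail[OF l(1,2)]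
          show "sg ((deg (Coh A C) (?mr G \<Theta>) - 1) * shdeg A v)
              * ?br (%W. brv A C (%w. \<psi> (cval (?mr G \<Theta>) a u # w)) (ctgt (?mr G \<Theta>)) (?e u) W v) G (ctgt \<Theta>) \<Phi>s \<Theta>s'
            = sg ((deg ?AB \<Theta> - 1) * shdeg A v)
              * ?L (%w. \<psi> (farr G (cval \<Theta> a u) # w)) G (ctgt \<Theta>) (?e u) \<Phi>s \<Theta>s' v"
            by (simp add: v c l(3))
        qed
      qed (simp add: e2_def)
      also have "(case \<Phi>s of [] => 0 | \<Phi> # \<Phi>s' => spl (%p q. sg ((deg ?BC \<Phi> - 1) * ?d q)
            * ?br (?K (?me \<Phi> H p)) (ctgt \<Phi>) (?h p) \<Phi>s' q) \<Theta>s) = e1"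
      proof (cases \<Phi>s)
        case (Cons \<Phi> \<Phi>s')
        then have \<Phi>: "is_cochain B C \<Phi>" "csrc \<Phi> = G" "is_path ?BC (ctgt \<Phi>) \<Phi>s'" using \<Phi>s by auto
        show ?thesis unfolding Cons list.case e1_def swap spl_mult_left[symmetric]
        proof (intro spl_cong)
          fix p q u v assume pq': "p @ q = \<Theta>s" and uv': "u @ v = us"
          note pq = pth[OF pq'] and uv = put[OF uv']
          let ?H = "path_end ?AB H p" and ?a = "path_end A a u"
          let ?x = "eps ?BC ?AB \<Phi> H p"
          have r: "?x \<in> Arr MM.X" "dom MM.X ?x = (G, H)" "cod MM.X ?x = (ctgt \<Phi>, ?H)" "deg MM.X ?x = cdeg \<Phi> + ?d p"
            using MM.eps_Arr[OF _ pq(1), of \<Phi>] \<Phi> by auto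
          have hp: "dg_functor A B ?H" using MM.tgt.is_path_Obj[OF pq(1)] by simp
          have c: "ctgt (?me \<Phi> H p) = fun_comp A (ctgt \<Phi>) ?H" "cdeg (?me \<Phi> H p) = cdeg \<Phi> + ?d p"
            "is_cochain A C (?me \<Phi> H p)" "csrc (?me \<Phi> H p) = fun_comp A G H"
            using dg_functor_Arr[OF M(1) r(1)] r M(2)[OF BC.cochain_ctgt[OF \<Phi>(1)] hp] M(2)[OF G H] by auto
          have l: "cval (?me \<Phi> H p) a u \<in> Hom C (fobj G (fobj H a)) (fobj (ctgt \<Phi>) (fobj ?H ?a)) (cdeg \<Phi> + ?d p + shdeg A u)"
            using AC.cochain_Hom[OF c(3) uv(1)] a AB.src.is_path_Obj[OF uv(1)] by (simp add: c)
          let ?k = "%l. ?L (?t l) (ctgt \<Phi>) ?H ?a \<Phi>s' q v"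
          \<comment> \<open>The rest of the word as a function of its first letter. Its additivity
            is the condition for expanding the value of a twisted composite in the next
            step.\<close>
          have k: "?k (add C f g) = ?k f + ?k g"
            if f: "f \<in> Hom C (fobj G (fobj H a)) (fobj (ctgt \<Phi>) (fobj ?H ?a)) n"
              and g: "g \<in> Hom C (fobj G (fobj H a)) (fobj (ctgt \<Phi>) (fobj ?H ?a)) n" for f g n
          proof -
            have "brv B C (%w. \<psi> (add C f g # w)) (ctgt \<Phi>) (fobj ?H ?a) \<Phi>s' x
              = brv B C (%w. \<psi> (f # w) + \<psi> (g # w)) (ctgt \<Phi>) (fobj ?H ?a) \<Phi>s' x" if "is_path B (fobj ?H ?a) x" for x
              using BC.tgt.mlin_add[OF m \<kappa> _ f g, of "[]"] f by (intro BC.brv_cong[OF \<Phi>(3) that]) (auto simp: Hom_def)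
            then have "?k (add C f g) = ?b (%x. brv B C (%w. \<psi> (f # w) + \<psi> (g # w)) (ctgt \<Phi>) (fobj ?H ?a) \<Phi>s' x) ?H ?a q v"
              by (intro AB.brv_cong[OF pq(2) uv(2)])
            then show ?thesis by (simp only: brc_add)
          qed
          have "length \<Phi>s' + length q + length v < length \<Phi>s + length \<Theta>s + length us" using Cons pq' uv' by auto
          from IH[OF this \<Phi>(3) pq(2) uv(2), of "%w. \<psi> (cval (?me \<Phi> H p) a u # w)"] tail[of "cval (?me \<Phi> H p) a u"] l
          have "?br (%W. brv A C (%w. \<psi> (cval (?me \<Phi> H p) a u # w)) (ctgt (?me \<Phi> H p)) ?a W v) (ctgt \<Phi>) ?H \<Phi>s' q = ?k (cval (?me \<Phi> H p) a u)"
            by (simp add: c Hom_def)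
          \<comment> \<open>The first letter is the value of a twisted composite at
            \<open>u\<close>, hence itself a signed sum of values of \<open>\<Phi>\<close> on braced
            words.\<close>
          also have "... = ?b (%s. ?k (cval \<Phi> (fobj H a) s)) H a p u"
            by (rule M(4)[OF \<Phi>(1) pq(1) uv(1)]) (use k \<Phi>(2) in auto)
          finally show "sg ((deg ?BC \<Phi> - 1) * ?d q) * (sg ((deg (Coh A C) (?me \<Phi> H p) - 1) * shdeg A v)
              * ?br (%W. brv A C (%w. \<psi> (cval (?me \<Phi> H p) a u # w)) (ctgt (?me \<Phi> H p)) ?a W v) (ctgt \<Phi>) ?H \<Phi>s' q)
            = sg (?d p * shdeg A v + (deg ?BC \<Phi> - 1) * (?d q + shdeg A v))
              * ?b (%s. ?k (cval \<Phi> (fobj H a) s)) H a p u"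
            by (simp add: c) (auto simp: sg_def)
        qed
      qed (simp add: e1_def)
      finally show ?thesis .
    qed
    finally show ?thesis by (simp add: ac_simps)
  qed
  ultimately show ?case by (simp only:)
qed

text \<open>Both functors are compared on the generators of the triple product. Bare letters reduce
  to composition of functors and values; \<open>\<epsilon>\<close> with a bare outer letter uses
  only additivity of a functor; nested \<open>\<epsilon>\<close> is
  \<open>brv_assoc\<close>.\<close>

lemma twisted_comp_assoc:
  fixes A :: "('k::field, 'a, 'x) dgcat" and B :: "('k, 'b, 'y) dgcat"
    and C :: "('k, 'c, 'f) dgcat" and D :: "('k, 'd, 'g) dgcat"
  assumes "dg_category A" "dg_category B" "dg_category C" "dg_category D"
  defines "S \<equiv> tens (tens (Coh C D) (Coh B C)) (Coh A B)"
  defines "L \<equiv> fun_comp S (twisted_comp A B D)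
      (tens_fun (tens (Coh C D) (Coh B C)) (Coh A B) (Coh B D) (Coh A B) (twisted_comp B C D) (fun_id (Coh A B)))"
    and "R \<equiv> fun_comp S (twisted_comp A C D)
      (fun_comp S (tens_fun (Coh C D) (tens (Coh B C) (Coh A B)) (Coh C D) (Coh A C) (fun_id (Coh C D)) (twisted_comp A B C))
        (assoc_map (Coh C D) (Coh B C) (Coh A B)))"
  shows "dg_functor S (Coh A D) L" "dg_functor S (Coh A D) R" "L = R"
proof -
  interpret AB: dg_pair A B using assms by (simp add: dg_pair_def)
  interpret BC: dg_pair B C using assms by (simp add: dg_pair_def)
  interpret CD: dg_pair C D using assms by (simp add: dg_pair_def)
  interpret AC: dg_pair A C using assms by (simp add: dg_pair_def)
  interpret BD: dg_pair B D using assms by (simp add: dg_pair_def)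
  interpret AD: dg_pair A D using assms by (simp add: dg_pair_def)
  let ?P = "Coh C D" and ?Q = "Coh B C" and ?R = "Coh A B"
  let ?X = "tens ?P ?Q"
    and ?Y = "tens ?Q ?R"
    and ?m1 = "twisted_comp A B C"
    and ?m2 = "twisted_comp A B D"
    and ?m3 = "twisted_comp A C D"
    and ?m4 = "twisted_comp B C D"
  let ?er = "eps ?X ?R"
    and ?eq = "eps ?P ?Q"
    and ?ey = "eps ?P ?Y"
    and ?rq = "rgt ?P ?Q"
  note cats = CD.dg_category_Coh BC.dg_category_Coh AB.dg_category_Coh
  interpret PQ: dg_pair ?P ?Q by (intro dg_pair.intro cats)
  interpret QR: dg_pair ?Q ?R by (intro dg_pair.intro cats)
  interpret XR: dg_pair "?X" ?R by (intro dg_pair.intro cats PQ.dg_category_tens)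
  interpret PT: dg_pair ?P "?Y" by (intro dg_pair.intro cats QR.dg_category_tens)
  note MABC = twisted_comp_props[OF assms(1-3)] and MABD = twisted_comp_props[OF assms(1,2,4)]
    and MACD = twisted_comp_props[OF assms(1,3,4)] and MBCD = twisted_comp_props[OF assms(2-4)]
  note tl = tens_fun_props[OF MBCD(1) dg_functor_fun_id[OF cats(3)]]
    and tr = tens_fun_props[OF dg_functor_fun_id[OF cats(1)] MABC(1)]
  note as = assoc_map_props[OF cats]
  show L: "dg_functor S (Coh A D) L"
    unfolding S_def L_def by (rule dg_functor_comp[OF tl(1) MABD(1)])
  show R: "dg_functor S (Coh A D) R"
    unfolding S_def R_def by (rule dg_functor_comp[OF dg_functor_comp[OF as(1) tr(1)] MACD(1)])
  interpret R: dg_functor "tens ?X ?R" "Coh A D" R using R unfolding S_def .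
  let ?tf = "tens_fun ?P ?Y ?P (Coh A C) (fun_id ?P) ?m1"
  \<comment> \<open>What \<open>R\<close> does after the associativity map. It is applied termwise
    to the signed sum produced by that map.\<close>
  define V where "V = fun_comp (tens ?P ?Y) ?m3 ?tf"
  have V: "dg_functor (tens ?P ?Y) (Coh A D) V"
    unfolding V_def by (rule dg_functor_comp[OF tr(1) MACD(1)])
  interpret V: dg_functor "tens ?P ?Y" "Coh A D" V by (rule V)
  have RV: "farr R l = farr V (farr (assoc_map ?P ?Q ?R) l)" if "l \<in> Arr (tens ?X ?R)" for l
    using that dg_functor_Arr(1)[OF as(1) that] by (simp add: R_def S_def V_def)
  have Vr: "farr V (rgt ?P ?Y F l) = farr ?m3 (rgt ?P (Coh A C) F (farr ?m1 l))"
    if "dg_functor C D F" "l \<in> Arr ?Y" for F l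
    using that PT.rgt_Arr(1)[of F l] by (simp add: V_def tr(4))
  have Ve: "farr V (?ey \<Psi> (G, H) w)
      = farr ?m3 (eps ?P (Coh A C) \<Psi> (fun_comp A G H) (map (farr ?m1) w))"
    if "is_cochain C D \<Psi>" "is_path ?Y (G, H) w" "dg_functor B C G" "dg_functor A B H" for \<Psi> G H w
    using that PT.eps_Arr(1)[of \<Psi> "(G, H)" w] MABC(2)[of G H] by (simp add: V_def tr(3))
  have Lo: "fobj L ((F, G), H) = fun_comp A (fun_comp B F G) H" "fobj R ((F, G), H) = fun_comp A F (fun_comp A G H)"
    "fobj V (F, (G, H)) = fun_comp A F (fun_comp A G H)"
    if o: "dg_functor C D F" "dg_functor B C G" "dg_functor A B H" for F G H
  proof -
    note c = dg_functor_comp[OF o(2,1)] dg_functor_comp[OF o(3,2)]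
    show "fobj L ((F, G), H) = fun_comp A (fun_comp B F G) H"
      using o c by (simp add: L_def S_def XR.tens_ops PQ.tens_ops tl(2) MBCD(2) MABD(2))
    show V: "fobj V (F, (G, H)) = fun_comp A F (fun_comp A G H)"
      using o c by (simp add: V_def PT.tens_ops QR.tens_ops tr(2) MABC(2) MACD(2))
    show "fobj R ((F, G), H) = fun_comp A F (fun_comp A G H)"
      using o c V by (simp add: R_def V_def S_def XR.tens_ops PQ.tens_ops PT.tens_ops QR.tens_ops as(2))
  qed
  \<comment> \<open>On objects the claim is associativity of composing functors, which holds as
    equality of records because composites are undefined outside their source.\<close>
  have oo: "fobj L ((F, G), H) = fobj R ((F, G), H)"
    if o: "dg_functor C D F" "dg_functor B C G" "dg_functor A B H" for F G H
    unfolding Lo[OF o]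
    by (rule dg_functor_eqI[OF dg_functor_comp[OF o(3) dg_functor_comp[OF o(2,1)]] dg_functor_comp[OF dg_functor_comp[OF o(3,2)] o(1)]])
      (use dg_functor_Obj[OF o(3)] dg_functor_Arr(1)[OF o(3)] in auto)
  have La: "farr L (rgt ?X ?R x h) = farr ?m2 (rgt (Coh B D) ?R (fobj ?m4 x) h)"
    if "x \<in> Obj ?X" "h \<in> Arr ?R" for x h
    using that XR.rgt_Arr(1)[OF that] by (simp add: L_def S_def tl(4))
  have Le: "farr L (?er l H hs) = farr ?m2 (eps (Coh B D) ?R (farr ?m4 l) H hs)"
    if "l \<in> Arr ?X" "is_path ?R H hs" for l H hs
  proof -
    have "map (farr (fun_id ?R)) hs = hs" if "is_path ?R H hs" for H
      using that by (induction hs arbitrary: H) auto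
    then show ?thesis
      using that XR.eps_Arr(1)[OF that] AB.src.dg_category_axioms QR.tgt.is_path_Obj[OF that(2)]
      by (simp add: L_def S_def tl(3))
  qed
  have eqI: "farr L l = farr R l"
    if l: "l \<in> Hom (tens ?X ?R) ((F, G), H) ((F', G'), H') n"
      and o: "dg_functor C D F" "dg_functor B C G" "dg_functor A B H" "dg_functor C D F'" "dg_functor B C G'" "dg_functor A B H'"
      and v: "!!a us. is_path A a us ==> AD.rv (farr L l) a us = AD.rv (farr R l) a us" for l F G H F' G' H' n
    using dg_functor.farr_Hom[OF L[unfolded S_def] l] R.farr_Hom[OF l] oo o v by (intro AD.Coh_eqI) auto
  show "L = R"
  proof (rule tens_tens_functor_eqI[OF cats L[unfolded S_def] R[unfolded S_def]])
    show "fobj L ((F, G), H) = fobj R ((F, G), H)" if "F \<in> Obj ?P" "G \<in> Obj ?Q" "H \<in> Obj ?R" for F G H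
      using that oo by simp
    show "farr L (rgt ?X ?R (F, G) \<Theta>) = farr R (rgt ?X ?R (F, G) \<Theta>)"
      if "F \<in> Obj ?P" "G \<in> Obj ?Q" "\<Theta> \<in> Arr ?R" for F G \<Theta>
    proof -
      have o: "dg_functor C D F" "dg_functor B C G" and \<Theta>: "is_cochain A B \<Theta>" using that by auto
      have x: "(F, G) \<in> Obj ?X" using that by (simp add: PQ.tens_ops)
      note r = XR.rgt_Arr[OF x that(3)] and q = QR.rgt_Arr[OF that(2,3)]
      have q': "is_cochain A C (farr ?m1 (rgt ?Q ?R G \<Theta>))"
        using dg_functor_Arr(1)[OF MABC(1) q(1)] by simp
      show ?thesis
      proof (rule eqI[of _ F G "csrc \<Theta>" F G "ctgt \<Theta>"])
        show "rgt ?X ?R (F, G) \<Theta> \<in> Hom (tens ?X ?R) ((F, G), csrc \<Theta>) ((F, G), ctgt \<Theta>) (cdeg \<Theta>)"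
          using r by (simp add: Hom_def)
        fix a us assume p: "is_path A a us"
        have c: "cval \<Theta> a us \<in> Arr B" using AB.cochain_Hom[OF \<Theta> p] by (simp add: Hom_def)
        show "AD.rv (farr L (rgt ?X ?R (F, G) \<Theta>)) a us = AD.rv (farr R (rgt ?X ?R (F, G) \<Theta>)) a us"
          unfolding RV[OF r(1)] La[OF x that(3)] as(3)[OF that] Vr[OF o(1) q(1)] AD.rv_def MBCD(2)[OF o] MACD(3)[OF o(1) q' p]
            MABC(3)[OF o(2) \<Theta> p] MABD(3)[OF dg_functor_comp[OF o(2,1)] \<Theta> p]
          using c by simp
      qed (use o AB.cochain_csrc[OF \<Theta>] AB.cochain_ctgt[OF \<Theta>] in auto)
    qed
    show "farr L (?er (?rq F \<Phi>) H \<Theta>s) = farr R (?er (?rq F \<Phi>) H \<Theta>s)"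
      if "F \<in> Obj ?P" "\<Phi> \<in> Arr ?Q" "is_path ?R H \<Theta>s" for F \<Phi> H \<Theta>s
    proof -
      have o: "dg_functor C D F" and \<Phi>: "is_cochain B C \<Phi>" using that by auto
      note r = PQ.rgt_Arr[OF that(1,2)] and q = QR.eps_Arr[OF that(2,3)]
      note e = XR.eps_Arr[OF r(1) that(3)]
      have H: "dg_functor A B H" "dg_functor A B (path_end ?R H \<Theta>s)"
        using QR.tgt.is_path_Obj[OF that(3)] by auto
      have cat: "dg_functor B C (csrc \<Phi>)" "dg_functor B C (ctgt \<Phi>)"
        using BC.cochain_csrc[OF \<Phi>] BC.cochain_ctgt[OF \<Phi>] by auto
      let ?l = "farr ?m4 (?rq F \<Phi>)"
      have l: "is_cochain B D ?l" "csrc ?l = fun_comp B F (csrc \<Phi>)" "ctgt ?l = fun_comp B F (ctgt \<Phi>)" "cdeg ?l = cdeg \<Phi>"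
        using dg_functor_Arr[OF MBCD(1) r(1)] r MBCD(2)[OF o cat(1)] MBCD(2)[OF o cat(2)] by auto
      have q': "is_cochain A C (farr ?m1 (eps ?Q ?R \<Phi> H \<Theta>s))"
        using dg_functor_Arr(1)[OF MABC(1) q(1)] by simp
      interpret F: dg_functor C D F by (rule o)
      show ?thesis
      proof (rule eqI[of _ F "csrc \<Phi>" H F "ctgt \<Phi>" "path_end ?R H \<Theta>s"])
        show "?er (?rq F \<Phi>) H \<Theta>s \<in> Hom (tens ?X ?R) ((F, csrc \<Phi>), H)
            ((F, ctgt \<Phi>), path_end ?R H \<Theta>s) (cdeg \<Phi> + shdeg ?R \<Theta>s)"
          using e r by (simp add: Hom_def)
        fix a us assume p: "is_path A a us"
        have ob: "fobj H a \<in> Obj B" "fobj (path_end ?R H \<Theta>s) (path_end A a us) \<in> Obj B"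
          using AB.src.is_path_Obj[OF p] H dg_functor_Obj by metis+
        have "AD.rv (farr L (?er (?rq F \<Phi>) H \<Theta>s)) a us
          = brv A B (%w. rho D (cval ?l (fobj H a) w)) H a \<Theta>s us"
          unfolding Le[OF r(1) that(3)] AD.rv_def
          by (rule MABD(4)[OF l(1) that(3) p]) (rule CD.tgt.rho_add)
        also have "... = brv A B (%w. rho D (farr F (cval \<Phi> (fobj H a) w))) H a \<Theta>s us"
          by (rule AB.brv_cong[OF that(3) p]) (simp add: MBCD(3)[OF o \<Phi>])
        also have "... = rho D (farr F (cval (farr ?m1 (eps ?Q ?R \<Phi> H \<Theta>s)) a us))"
          by (rule MABC(4)[OF \<Phi> that(3) p, symmetric])
            (simp add: F.farr_add CD.tgt.rho_add[OF F.farr_Hom F.farr_Hom])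
        also have "... = AD.rv (farr R (?er (?rq F \<Phi>) H \<Theta>s)) a us"
          unfolding RV[OF e(1)] as(4)[OF that] Vr[OF o q(1)] AD.rv_def MACD(3)[OF o q' p] ..
        finally show "AD.rv (farr L (?er (?rq F \<Phi>) H \<Theta>s)) a us
          = AD.rv (farr R (?er (?rq F \<Phi>) H \<Theta>s)) a us" .
      qed (use o cat H in auto)
    qed
    show "farr L (?er (?eq \<Psi> G \<Phi>s) H \<Theta>s) = farr R (?er (?eq \<Psi> G \<Phi>s) H \<Theta>s)"
      if "\<Psi> \<in> Arr ?P" "is_path ?Q G \<Phi>s" "is_path ?R H \<Theta>s" for \<Psi> G \<Phi>s H \<Theta>s
    proof -
      have \<Psi>: "is_cochain C D \<Psi>" using that by auto
      note r = PQ.eps_Arr[OF that(1,2)]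
      note e = XR.eps_Arr[OF r(1) that(3)]
      have GH: "dg_functor B C G" "dg_functor B C (path_end ?Q G \<Phi>s)" "dg_functor A B H" "dg_functor A B (path_end ?R H \<Theta>s)"
        using PQ.tgt.is_path_Obj[OF that(2)] QR.tgt.is_path_Obj[OF that(3)] by auto
      have F: "dg_functor C D (csrc \<Psi>)" "dg_functor C D (ctgt \<Psi>)"
        using CD.cochain_csrc[OF \<Psi>] CD.cochain_ctgt[OF \<Psi>] by auto
      let ?l = "farr ?m4 (?eq \<Psi> G \<Phi>s)"
      have l: "is_cochain B D ?l" using dg_functor_Arr(1)[OF MBCD(1) r(1)] by simp
      show ?thesis
      proof (rule eqI[of _ "csrc \<Psi>" G H "ctgt \<Psi>" "path_end ?Q G \<Phi>s" "path_end ?R H \<Theta>s"])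
        show "?er (?eq \<Psi> G \<Phi>s) H \<Theta>s \<in> Hom (tens ?X ?R) ((csrc \<Psi>, G), H)
            ((ctgt \<Psi>, path_end ?Q G \<Phi>s), path_end ?R H \<Theta>s) (cdeg \<Psi> + shdeg ?Q \<Phi>s + shdeg ?R \<Theta>s)"
          using e r by (simp add: Hom_def)
        fix a us assume p: "is_path A a us"
        let ?Ha = "fobj H a" and ?v = "%w. CD.rv \<Psi> (fobj G (fobj H a)) w"
        have "AD.rv (farr L (?er (?eq \<Psi> G \<Phi>s) H \<Theta>s)) a us
          = brv A B (%w. rho D (cval ?l ?Ha w)) H a \<Theta>s us"
          unfolding Le[OF r(1) that(3)] AD.rv_def
          by (rule MABD(4)[OF l that(3) p]) (rule CD.tgt.rho_add)
        also have "... = brv A B (%w. brv B C ?v G ?Ha \<Phi>s w) H a \<Theta>s us"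
        proof (rule AB.brv_cong[OF that(3) p])
          fix w assume w: "is_path B ?Ha w"
          show "rho D (cval ?l ?Ha w) = brv B C ?v G ?Ha \<Phi>s w"
            unfolding CD.rv_def by (rule MBCD(4)[OF \<Psi> that(2) w]) (rule CD.tgt.rho_add)
        qed
        \<comment> \<open>From here on the brace of \<open>\<Phi>s\<close> and
          \<open>\<Theta>s\<close> has letters in the cochains from \<open>A\<close> to
          \<open>C\<close>, which is the shape produced by \<open>R\<close>.\<close>
        also have "... = brc ?Q ?R (%G \<Theta>. farr ?m1 (rgt ?Q ?R G \<Theta>))
            (%\<Phi> H u. farr ?m1 (eps ?Q ?R \<Phi> H u))
            (%W. brv A C ?v (fun_comp A G H) a W us) G H \<Phi>s \<Theta>s"
          by (rule brv_assoc[OF assms(1-3) kap_1 that(2,3) p CD.cochain_mlin[OF \<Psi>]])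
        also have "... = QR.Br (%args. brv A C ?v (fun_comp A G H) a (map (farr ?m1) args) us) G H \<Phi>s \<Theta>s"
          by (rule brc_map[symmetric])
        also have "... = QR.Br (%args. AD.rv (farr V (?ey \<Psi> (G, H) args)) a us) G H \<Phi>s \<Theta>s"
        proof (rule QR.brc_cong[OF that(2,3)])
          fix w assume w: "is_path ?Y (G, H) w"
          have w': "is_path (Coh A C) (fun_comp A G H) (map (farr ?m1) w)"
            using dg_functor_path(1)[OF MABC(1) w] MABC(2)[OF GH(1,3)] by simp
          have "brv A C (%w. rho D (cval \<Psi> (fobj (fun_comp A G H) a) w)) (fun_comp A G H) a (map (farr ?m1) w) us
            = rho D (cval (farr ?m3 (eps ?P (Coh A C) \<Psi> (fun_comp A G H) (map (farr ?m1) w))) a us)"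
            by (rule MACD(4)[OF \<Psi> w' p, symmetric]) (rule CD.tgt.rho_add)
          then show "brv A C ?v (fun_comp A G H) a (map (farr ?m1) w) us
            = AD.rv (farr V (?ey \<Psi> (G, H) w)) a us"
            using AB.src.is_path_Obj[OF p] by (simp add: Ve[OF \<Psi> w GH(1,3)] AD.rv_def CD.rv_def)
        qed
        \<comment> \<open>The brace operator is the signed sum over \<open>brace_args\<close>;
          additivity of \<open>V\<close> and of evaluation at \<open>us\<close> gathers it into the
          image of the associativity map.\<close>
        also have "... = AD.rv (farr R (?er (?eq \<Psi> G \<Phi>s) H \<Theta>s)) a us"
        proof -
          let ?T = "tens ?P ?Y"
          let ?s = "(csrc \<Psi>, (G, H))" and ?t = "(ctgt \<Psi>, (path_end ?Q G \<Phi>s, path_end ?R H \<Theta>s))"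
          let ?n = "cdeg \<Psi> + shdeg ?Q \<Phi>s + shdeg ?R \<Theta>s"
          let ?L = "map (%(n, args). sscl ?T n (?ey \<Psi> (G, H) args)) (brace_args ?Q ?R G H \<Phi>s \<Theta>s)"
          let ?k = "%f. AD.rv (farr V f) a us"
          note ba = QR.brace_args_path[OF that(2,3)]
          have o: "?s \<in> Obj ?T" "?t \<in> Obj ?T" using F GH by (auto simp: PT.tens_ops QR.tens_ops)
          have k: "?k (add ?T f g) = ?k f + ?k g" if "f \<in> Hom ?T ?s ?t ?n" "g \<in> Hom ?T ?s ?t ?n" for f g
            using V.farr_add[OF that] AD.coh_add(2)[OF V.farr_Hom[OF that(1)] V.farr_Hom[OF that(2)] p] by simp
          have h: "?ey \<Psi> (G, H) w \<in> Hom ?T ?s ?t ?n" if "(n, w) \<in> set (brace_args ?Q ?R G H \<Phi>s \<Theta>s)" for n w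
            using PT.eps_Arr[OF \<open>\<Psi> \<in> Arr ?P\<close> ba(1)[OF that]] ba(2,3)[OF that] by (simp add: Hom_def add.assoc)
          have "QR.Br (%args. ?k (?ey \<Psi> (G, H) args)) G H \<Phi>s \<Theta>s
            = (\<Sum>(n, args)\<leftarrow>brace_args ?Q ?R G H \<Phi>s \<Theta>s. sg n * ?k (?ey \<Psi> (G, H) args))"
            by (rule brace_args_brc[symmetric])
          also have "... = (\<Sum>f\<leftarrow>?L. ?k f)"
            unfolding map_map using V.source.additive_Hom(1)[of ?s ?t ?n ?k, OF k o h]
            by (intro arg_cong[of _ _ sum_list] map_cong HOL.refl) auto
          also have "... = ?k (dsum ?T ?s ?t ?n ?L)"
            by (rule V.source.additive_Hom(2)[of ?s ?t ?n ?k, symmetric]) (use k o h in "auto intro!: V.source.scl_Hom")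
          finally show ?thesis using as(5)[OF that] by (simp add: RV[OF e(1)])
        qed
        finally show "AD.rv (farr L (?er (?eq \<Psi> G \<Phi>s) H \<Theta>s)) a us
          = AD.rv (farr R (?er (?eq \<Psi> G \<Phi>s) H \<Theta>s)) a us" .
      qed (use F GH in auto)
    qed
  qed
qed

theorem theorem1p4:
  shows "(\<forall>(C :: ('k::field, 'c, 'f) dgcat) (D :: ('k, 'd, 'g) dgcat) (E :: ('k, 'e, 'h) dgcat).
            dg_category C \<and> dg_category D \<and> dg_category E \<longrightarrow>
            dg_functor (tens (Coh D E) (Coh C D)) (Coh C E) (twisted_comp C D E))
       \<and> (\<forall>(A :: ('k, 'a, 'x) dgcat) (B :: ('k, 'b, 'y) dgcat)
            (C :: ('k, 'c, 'f) dgcat) (D :: ('k, 'd, 'g) dgcat).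
            dg_category A \<and> dg_category B \<and> dg_category C \<and> dg_category D \<longrightarrow>
            (let S = tens (tens (Coh C D) (Coh B C)) (Coh A B);
                 L = fun_comp S (twisted_comp A B D)
                       (tens_fun (tens (Coh C D) (Coh B C)) (Coh A B) (Coh B D) (Coh A B)
                          (twisted_comp B C D) (fun_id (Coh A B)));
                 R = fun_comp S (twisted_comp A C D)
                       (fun_comp S
                          (tens_fun (Coh C D) (tens (Coh B C) (Coh A B)) (Coh C D) (Coh A C)
                             (fun_id (Coh C D)) (twisted_comp A B C))
                          (assoc_map (Coh C D) (Coh B C) (Coh A B)))
             in dg_functor S (Coh A D) L \<and> dg_functor S (Coh A D) R \<and> L = R))"
  unfolding Let_def
  by (intro conjI allI impI; elim conjE; (rule twisted_comp_props(1) twisted_comp_assoc; assumption))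

end
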